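(* Suppose that $f\colon X_1\times Y_1\to X_{\gamma_X}$ and $g\colon X_1 \times Y_1\to Y_{\delta_Y}$ are continuously differentiable with $$\|\mathrm{D} f(x,y)\|_{\mathcal{B}(X_1\times Y_1,X_{\gamma_X})}\leq L_f,\qquad \|\mathrm{D} g(x,y)\|_{\mathcal{B}(X_1\times Y_1,Y_{\delta_Y})}\leq L_g\qquad((x,y)\in X_1\times Y_1).$$ Then the slow manifold $S_{\epsilon,\zeta}$ is differentiable, i.e. the mapping $$(Y_{S}^{\zeta}\cap Y_1,\|\cdot\|_{Y_1})\to (X_1,\|\cdot\|_{X_1})\times (Y_{F}^{\zeta}\cap Y_1,\|\cdot\|_{Y_{\delta_Y}}),\quad v_0\mapsto (h_{X_1}^{\epsilon,\zeta}(v_0),h_{Y_F^{\zeta}}^{\epsilon,\zeta}(v_0))$$ is (Fréchet) differentiable.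
   Context: **Setting.** $X,Y$ are Banach spaces and $\epsilon>0$ is a parameter. (i) $A\colon X\supset D(A)\to X$ is a closed linear operator generating an exponentially stable $C_0$-semigroup $(e^{tA})_{t\ge0}$ on $X$; $B\colon Y\supset D(B)\to Y$ is a closed linear operator generating a $C_0$-semigroup $(e^{tB})_{t\ge0}$ on $Y$. (ii) $(X_\alpha)_{\alpha\in[-1,\infty)}$ and $(Y_\alpha)_{\alpha\in[-1,\infty)}$ are, up to equivalence of norms for each fixed $\alpha$, the interpolation-extrapolation scales generated by $(X,A)$ and $(Y,B)$ (by $(Y,B-\lambda)$ for some $\lambda\in\rho(B)$ if $0\notin\rho(B)$). The interpolation-extrapolation scale of a densely defined closed operator $S$ on a Banach space $Z$ with $0\in\rho(S)$ is defined, after fixing for each $\theta\in(0,1)$ an exact interpolation functor $(\cdot,\cdot)_\theta$ such that $Z_1$ is dense in $(Z_0,Z_1)_\theta$ whenever $Z_1$ is densely embedded in $Z_0$, by: $Z_k=D(S^k)$ with norm $\|S^kz\|_Z$ for $k\in\mathbb N_0$; $Z_{-1}$ is the completion of $Z$ with respect to $\|S^{-1}z\|_Z$; $Z_{k+\theta}=(Z_k,Z_{k+1})_\theta$ for $k\in\mathbb N_0\cup\{-1\}$, $\theta\in(0,1)$. The operator and its semigroup are extended/restricted to the spaces of the scale and denoted by the same symbols. In particular $X_0=X$, $X_1=D(A)$, $Y_0=Y$, $Y_1=D(B)$. (iii) $\gamma_X\in(0,1]$ if $(e^{tA})_{t\ge0}$ is holomorphic and $\gamma_X=1$ otherwise;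 $\delta_X\in[1-\gamma_X,1]$; $\delta_Y\in(0,1]$ if $(e^{tB})_{t\ge0}$ is holomorphic and $\delta_Y=1$ otherwise. (iv) $f\colon X_{\delta_X}\times Y_{1-\delta_X}\to X$ and $g\colon X_1\times Y_1\to Y_{\delta_Y}$ are continuous, $f(0,0)=0$, $g(0,0)=0$; $f(x,y)\in X_{\gamma_X}$ and $g(x,y)\in Y_{\delta_Y}$ for $(x,y)\in X_1\times Y_1$; $f(u,v)\in C^1([0,t];X_{\delta_X-1})$ whenever $u\in C^1([0,t];X_{\delta_X})$ and $v\in C^1([0,t];Y)\cap C([0,t];Y_{1-\delta_X})$; and there are constants $L_f,L_g>0$ with $\|f(x_1,y_1)-f(x_2,y_2)\|_{X_{\gamma_X}}\le L_f(\|x_1-x_2\|_{X_1}+\|y_1-y_2\|_{Y_1})$, $\|f(u_1,v_1)-f(u_2,v_2)\|_{C^1([0,t];X_{\delta_X-1})}\le L_f(\|u_1-u_2\|_{C^1([0,t];X_{\delta_X})}+\|v_1-v_2\|_{C^1([0,t];Y)})$, $\|g(x_1,y_1)-g(x_2,y_2)\|_{Y_{\delta_Y}}\le L_g(\|x_1-x_2\|_{X_1}+\|y_1-y_2\|_{Y_1})$ for all $x_i\in X_1$, $y_i\in Y_1$, $u_i\in C^1([0,t];X_{\delta_X})$, $v_i\in C^1([0,t];Y)\cap C([0,t];Y_{1-\delta_X})$. (v) $M_A,M_B,C_A,C_B>0$, $\omega_A<0$, $\omega_B\in\mathbb R$ are constants with, for all $t>0$, $\|e^{tA}\|_{\mathcal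 B(X_1)}\le M_Ae^{\omega_At}$, $\|e^{tA}\|_{\mathcal B(X_{\gamma_X},X_1)}\le C_At^{\gamma_X-1}e^{\omega_At}$, $\|e^{tA}\|_{\mathcal B(X_{\delta_X},X_1)}\le C_At^{\delta_X-1}e^{\omega_At}$, $\|e^{tB}\|_{\mathcal B(Y_1)}\le M_Be^{\omega_Bt}$, $\|e^{tB}\|_{\mathcal B(Y_{\delta_Y},Y_1)}\le C_Bt^{\delta_Y-1}e^{\omega_Bt}$. (vi) $\omega_f:=\omega_A+(2C_AL_f)^{1/\gamma_X}(1/\gamma_X)^{(1-\gamma_X)/\gamma_X}$ if $\gamma_X\in(0,1)$; if $\gamma_X=1$, $\omega_f$ is a fixed number $>\omega_A+C_AL_f$. It is assumed that $\omega_f<0$ and $L_f\max\{\|A^{-1}\|_{\mathcal B(X_{\gamma_X},X_1)},\|A^{-1}\|_{\mathcal B(X_{\delta_X-1},X_{\delta_X})}\}<1$. **Splitting of the slow variable space.** For each small $\zeta>0$ there is a splitting $Y=Y_F^\zeta\oplus Y_S^\zeta$ such that: (1) $Y_F^\zeta,Y_S^\zeta$ are closed in $Y$ and the projections $\operatorname{pr}_{Y_F^\zeta},\operatorname{pr}_{Y_S^\zeta}$ commute with $B$ on $Y_1$. (2) $Y_F^\zeta\cap Y_1$ and $Y_S^\zeta\cap Y_1$ are closed subspaces of $Y_1$, endowed with $\|\cdot\|_{Y_1}$. (3) With the convention $f(x,y_F,y_S):=f(x,y_F+y_S)$, $g(x,y_F,y_S):=g(x,y_F+y_S)$: $\|\operatorname{pr}_{Y_S^\zeta}[g(x,y_F,y_S)-g(\tilde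 x,\tilde y_F,\tilde y_S)]\|_{Y_1}\le L_g\zeta^{\delta_Y-1}(\|x-\tilde x\|_{X_1}+\|y_F-\tilde y_F\|_{Y_1}+\|y_S-\tilde y_S\|_{Y_1})$ for $x,\tilde x\in X_1$, $y_F,\tilde y_F\in Y_F^\zeta\cap Y_1$, $y_S,\tilde y_S\in Y_S^\zeta\cap Y_1$. (4) The realization of $B$ in $Y_S^\zeta$, with domain $\{v\in Y_S^\zeta\cap D(B):Bv\in Y_S^\zeta\}$, generates a $C_0$-group on $(Y_S^\zeta,\|\cdot\|_Y)$ which coincides with $e^{tB}$ on $Y_S^\zeta$ for $t\ge0$ (it is also denoted $e^{tB}$ for $t<0$). (5) The realization $B_{Y_F^\zeta}$ of $B$ in $Y_F^\zeta$, with domain $\{v\in Y_F^\zeta\cap D(B):Bv\in Y_F^\zeta\}$, has $0$ in its resolvent set. (6) There are constants $C_B,M_B>0$ such that for all small enough $\zeta>0$ there are constants $0\le N_F^\zeta<N_S^\zeta$ with $\|e^{tB}y_F\|_{Y_1}\le C_Bt^{\delta_Y-1}e^{(N_F^\zeta+\zeta^{-1}\omega_A)t}\|y_F\|_{Y_{\delta_Y}}$ ($t>0$, $y_F\in Y_F^\zeta\cap Y_{\delta_Y}$) and $\|e^{-tB}y_S\|_{Y_1}\le M_Be^{-(N_S^\zeta+\zeta^{-1}\omega_A)t}\|y_S\|_{Y_1}$ ($t\ge0$, $y_S\in Y_S^\zeta\cap Y_1$). (7) (Gap condition) The pair $(\epsilon,\zeta)$ satisfies $$\frac{2^{\gamma_X}L_fC_A\Gamma(\gamma_X)}{\big(2(\epsilon\zeta^{-1}-1)\omega_A+\epsilon(N_S^\zeta+N_F^\zeta)\big)^{\gamma_X}}+\frac{2^{\delta_Y}L_gC_B\Gamma(\delta_Y)}{(N_S^\zeta-N_F^\zeta)^{\delta_Y}}+\frac{2\zeta^{\delta_Y-1}L_gM_B\Gamma(\delta_Y)}{N_S^\zeta-N_F^\zeta}<1,$$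 where $\Gamma$ is the gamma function and the base of the first denominator is understood to be positive. **The maps $h^{\epsilon,\zeta}$.** Let $\eta:=\zeta^{-1}\omega_A+\frac{N_S^\zeta+N_F^\zeta}{2}$ and let $C_\eta$ be the space of all $(u,v_F,v_S)\in C((-\infty,0];X_1\times(Y_F^\zeta\cap Y_1)\times(Y_S^\zeta\cap Y_1))$ with $\sup_{t\le0}e^{-\eta t}(\|u(t)\|_{X_1}+\|v_F(t)\|_{Y_1}+\|v_S(t)\|_{Y_1})<\infty$. For $v_0\in Y_S^\zeta\cap Y_1$ let $(u^{v_0},v_F^{v_0},v_S^{v_0})\in C_\eta$ be the unique fixed point of the operator $\mathscr L_{v_0,\epsilon,\zeta}$ on $C_\eta$ sending $(u,v_F,v_S)$ to the function whose components at $t\le0$ are $\epsilon^{-1}\int_{-\infty}^te^{\epsilon^{-1}(t-s)A}f(u(s),v_F(s),v_S(s))\,ds$, $\int_{-\infty}^te^{(t-s)B}\operatorname{pr}_{Y_F^\zeta}g(u(s),v_F(s),v_S(s))\,ds$, $e^{tB}v_0+\int_0^te^{(t-s)B}\operatorname{pr}_{Y_S^\zeta}g(u(s),v_F(s),v_S(s))\,ds$. Then $h^{\epsilon,\zeta}=(h^{\epsilon,\zeta}_{X_1},h^{\epsilon,\zeta}_{Y_F^\zeta})\colon Y_S^\zeta\cap Y_1\to X_1\times(Y_F^\zeta\cap Y_1)$, $h^{\epsilon,\zeta}(v_0):=(u^{v_0}(0),v_F^{v_0}(0))$. The slow manifold is $S_{\epsilon,\zeta}=\{(h^{\epsilon,\zeta}(v_0),v_0):v_0\in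 Y_S^\zeta\cap Y_1\}$.
   Formalization: Also assumed: the Y_{δ_Y}-norm of pr_{Y_F^ζ}[g(x,y_F,y_S)−g(x̃,ỹ_F,ỹ_S)] is at most L_g(‖x−x̃‖_{X_1}+‖y_F−ỹ_F‖_{Y_1}+‖y_S−ỹ_S‖_{Y_1}); without it the fixed point defining h^{ε,ζ} need not be unique. *)

theory Defs
  imports "HOL-Analysis.Analysis"
begin

section \<open>Normed spaces inside an ambient vector space\<close>

text \<open>
  All spaces of one scale are linear subspaces of a common type, each with its own norm, so that
  the inclusions between them are set inclusions. Scalars are taken from a complete normed
  field extension of the reals (by Gelfand--Mazur the real or the complex field) and act through
  an explicit scalar multiplication.
\<close>

datatype 'v nspace = NSpace (carr: "'v set") (nrm: "'v \<Rightarrow> real")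

definition sub_ns :: "'v nspace \<Rightarrow> 'v set \<Rightarrow> 'v nspace" where
  "sub_ns E S = NSpace (S \<inter> carr E) (nrm E)"

definition prod_ns :: "'v nspace \<Rightarrow> 'w nspace \<Rightarrow> ('v \<times> 'w) nspace" where
  "prod_ns E F = NSpace (carr E \<times> carr F) (\<lambda>(x, y). nrm E x + nrm F y)"

definition prod_scale :: "('k \<Rightarrow> 'v \<Rightarrow> 'v) \<Rightarrow> ('k \<Rightarrow> 'w \<Rightarrow> 'w) \<Rightarrow> 'k \<Rightarrow> 'v \<times> 'w \<Rightarrow> 'v \<times> 'w" where
  "prod_scale sc sc' c = (\<lambda>(x, y). (sc c x, sc' c y))"

definition banach_on :: "('k::real_normed_field \<Rightarrow> 'v::real_vector \<Rightarrow> 'v) \<Rightarrow> 'v nspace \<Rightarrow> bool" where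
  "banach_on sc E \<longleftrightarrow>
     module.subspace sc (carr E) \<and>
     (\<forall>x\<in>carr E. 0 \<le> nrm E x \<and> (nrm E x = 0 \<longleftrightarrow> x = 0)) \<and>
     (\<forall>x\<in>carr E. \<forall>y\<in>carr E. nrm E (x + y) \<le> nrm E x + nrm E y) \<and>
     (\<forall>c. \<forall>x\<in>carr E. nrm E (sc c x) = norm c * nrm E x) \<and>
     (\<forall>s :: nat \<Rightarrow> 'v. (\<forall>n. s n \<in> carr E) \<and>
        (\<forall>e>0. \<exists>N. \<forall>m\<ge>N. \<forall>n\<ge>N. nrm E (s m - s n) < e) \<longrightarrow>
        (\<exists>x\<in>carr E. (\<lambda>n. nrm E (s n - x)) \<longlonglongrightarrow> 0))"

definition embeds :: "'v nspace \<Rightarrow> 'v nspace \<Rightarrow> bool" where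
  "embeds E F \<longleftrightarrow> carr E \<subseteq> carr F \<and> (\<exists>C. \<forall>x\<in>carr E. nrm F x \<le> C * nrm E x)"

definition equiv_ns :: "'v nspace \<Rightarrow> 'v nspace \<Rightarrow> bool" where
  "equiv_ns E F \<longleftrightarrow> embeds E F \<and> embeds F E"

definition dense_in :: "'v::ab_group_add nspace \<Rightarrow> 'v set \<Rightarrow> bool" where
  "dense_in E S \<longleftrightarrow> S \<subseteq> carr E \<and> (\<forall>x\<in>carr E. \<forall>e>0. \<exists>s\<in>S. nrm E (x - s) < e)"

definition closed_in_ns :: "'v::ab_group_add nspace \<Rightarrow> 'v set \<Rightarrow> bool" where
  "closed_in_ns E S \<longleftrightarrow>
     S \<subseteq> carr E \<and> (\<forall>x\<in>carr E. (\<forall>e>0. \<exists>s\<in>S. nrm E (x - s) < e) \<longrightarrow> x \<in> S)"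

section \<open>Operators\<close>

definition linear_between ::
  "('k \<Rightarrow> 'v::ab_group_add \<Rightarrow> 'v) \<Rightarrow> ('k \<Rightarrow> 'w::ab_group_add \<Rightarrow> 'w) \<Rightarrow> 'v set \<Rightarrow> 'w set \<Rightarrow> ('v \<Rightarrow> 'w) \<Rightarrow> bool"
  where
  "linear_between sc sc' S S' T \<longleftrightarrow>
     (\<forall>x\<in>S. T x \<in> S') \<and>
     (\<forall>x\<in>S. \<forall>y\<in>S. T (x + y) = T x + T y) \<and> (\<forall>c. \<forall>x\<in>S. T (sc c x) = sc' c (T x))"

definition opbound :: "'v nspace \<Rightarrow> 'w nspace \<Rightarrow> ('v \<Rightarrow> 'w) \<Rightarrow> real \<Rightarrow> bool" where
  "opbound E F T c \<longleftrightarrow> (\<forall>x\<in>carr E. T x \<in> carr F \<and> nrm F (T x) \<le> c * nrm E x)"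

definition opnorm :: "'v nspace \<Rightarrow> 'w nspace \<Rightarrow> ('v \<Rightarrow> 'w) \<Rightarrow> real" where
  "opnorm E F T = Inf {c. 0 \<le> c \<and> opbound E F T c}"

definition bounded_op ::
  "('k \<Rightarrow> 'v::ab_group_add \<Rightarrow> 'v) \<Rightarrow> ('k \<Rightarrow> 'w::ab_group_add \<Rightarrow> 'w) \<Rightarrow>
   'v nspace \<Rightarrow> 'w nspace \<Rightarrow> ('v \<Rightarrow> 'w) \<Rightarrow> bool" where
  "bounded_op sc sc' E F T \<longleftrightarrow>
     linear_between sc sc' (carr E) (carr F) T \<and> (\<exists>c. opbound E F T c)"

text \<open>Unbounded operators in \<open>E\<close> are given by a domain \<open>D\<close> and a function \<open>S\<close>; only the values
  of \<open>S\<close> on \<open>D\<close> matter.\<close>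

definition closed_op ::
  "('k::real_normed_field \<Rightarrow> 'v::real_vector \<Rightarrow> 'v) \<Rightarrow> 'v nspace \<Rightarrow> 'v set \<Rightarrow> ('v \<Rightarrow> 'v) \<Rightarrow> bool" where
  "closed_op sc E D S \<longleftrightarrow>
     D \<subseteq> carr E \<and> module.subspace sc D \<and> linear_between sc sc D (carr E) S \<and>
     (\<forall>(s :: nat \<Rightarrow> 'v). \<forall>x\<in>carr E. \<forall>y\<in>carr E.
        (\<forall>n. s n \<in> D) \<and> (\<lambda>n. nrm E (s n - x)) \<longlonglongrightarrow> 0 \<and> (\<lambda>n. nrm E (S (s n) - y)) \<longlonglongrightarrow> 0 \<longrightarrow>
        x \<in> D \<and> S x = y)"

definition in_resolvent_set ::
  "('k \<Rightarrow> 'v::ab_group_add \<Rightarrow> 'v) \<Rightarrow> 'v nspace \<Rightarrow> 'v set \<Rightarrow> ('v \<Rightarrow> 'v) \<Rightarrow> 'k \<Rightarrow> bool" where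
  "in_resolvent_set sc E D S l \<longleftrightarrow>
     bij_betw (\<lambda>x. sc l x - S x) D (carr E) \<and>
     (\<exists>c. \<forall>x\<in>D. nrm E x \<le> c * nrm E (sc l x - S x))"

definition realization_dom :: "'v set \<Rightarrow> ('v \<Rightarrow> 'v) \<Rightarrow> 'v set \<Rightarrow> 'v set" where
  "realization_dom D S W = {v \<in> W \<inter> D. S v \<in> W}"

section \<open>Semigroups\<close>

definition C0_semigroup ::
  "('k \<Rightarrow> 'v::real_vector \<Rightarrow> 'v) \<Rightarrow> 'v nspace \<Rightarrow> (real \<Rightarrow> 'v \<Rightarrow> 'v) \<Rightarrow> bool" where
  "C0_semigroup sc E T \<longleftrightarrow>
     (\<forall>t\<ge>0. bounded_op sc sc E E (T t)) \<and>
     (\<forall>x\<in>carr E. T 0 x = x) \<and>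
     (\<forall>s\<ge>0. \<forall>t\<ge>0. \<forall>x\<in>carr E. T (s + t) x = T s (T t x)) \<and>
     (\<forall>x\<in>carr E. ((\<lambda>t. nrm E (T t x - x)) \<longlongrightarrow> 0) (at_right 0))"

definition generates_C0_semigroup ::
  "('k \<Rightarrow> 'v::real_vector \<Rightarrow> 'v) \<Rightarrow> 'v nspace \<Rightarrow> 'v set \<Rightarrow> ('v \<Rightarrow> 'v) \<Rightarrow> (real \<Rightarrow> 'v \<Rightarrow> 'v) \<Rightarrow> bool" where
  "generates_C0_semigroup sc E D S T \<longleftrightarrow>
     C0_semigroup sc E T \<and> D \<subseteq> carr E \<and> S ` D \<subseteq> carr E \<and>
     (\<forall>x\<in>carr E. \<forall>y\<in>carr E.
        ((\<lambda>h. nrm E ((1 / h) *\<^sub>R (T h x - x) - y)) \<longlongrightarrow> 0) (at_right 0) \<longleftrightarrow> x \<in> D \<and> S x = y)"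

definition exponentially_stable :: "'v nspace \<Rightarrow> (real \<Rightarrow> 'v \<Rightarrow> 'v) \<Rightarrow> bool" where
  "exponentially_stable E T \<longleftrightarrow> (\<exists>M w. w < 0 \<and> (\<forall>t\<ge>0. opbound E E (T t) (M * exp (w * t))))"

definition C0_group ::
  "('k \<Rightarrow> 'v::real_vector \<Rightarrow> 'v) \<Rightarrow> 'v nspace \<Rightarrow> (real \<Rightarrow> 'v \<Rightarrow> 'v) \<Rightarrow> bool" where
  "C0_group sc E T \<longleftrightarrow>
     (\<forall>t. bounded_op sc sc E E (T t)) \<and>
     (\<forall>x\<in>carr E. T 0 x = x) \<and>
     (\<forall>s t. \<forall>x\<in>carr E. T (s + t) x = T s (T t x)) \<and>
     (\<forall>x\<in>carr E. ((\<lambda>t. nrm E (T t x - x)) \<longlongrightarrow> 0) (at 0))"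

definition generates_C0_group ::
  "('k \<Rightarrow> 'v::real_vector \<Rightarrow> 'v) \<Rightarrow> 'v nspace \<Rightarrow> 'v set \<Rightarrow> ('v \<Rightarrow> 'v) \<Rightarrow> (real \<Rightarrow> 'v \<Rightarrow> 'v) \<Rightarrow> bool" where
  "generates_C0_group sc E D S T \<longleftrightarrow>
     C0_group sc E T \<and> D \<subseteq> carr E \<and> S ` D \<subseteq> carr E \<and>
     (\<forall>x\<in>carr E. \<forall>y\<in>carr E.
        ((\<lambda>h. nrm E ((1 / h) *\<^sub>R (T h x - x) - y)) \<longlongrightarrow> 0) (at 0) \<longleftrightarrow> x \<in> D \<and> S x = y)"

definition sector :: "real \<Rightarrow> complex set" where
  "sector a = {z. z \<noteq> 0 \<and> \<bar>Arg z\<bar> < a}"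

definition holomorphic_semigroup_complex ::
  "(complex \<Rightarrow> 'v::real_vector \<Rightarrow> 'v) \<Rightarrow> 'v nspace \<Rightarrow> (real \<Rightarrow> 'v \<Rightarrow> 'v) \<Rightarrow> bool" where
  "holomorphic_semigroup_complex cs E T \<longleftrightarrow>
     (\<exists>a TT. 0 < a \<and> a \<le> pi / 2 \<and>
        (\<forall>t>0. \<forall>x\<in>carr E. TT (complex_of_real t) x = T t x) \<and>
        (\<forall>z\<in>sector a. bounded_op cs cs E E (TT z)) \<and>
        (\<forall>z\<in>sector a. \<forall>w\<in>sector a. \<forall>x\<in>carr E. TT (z + w) x = TT z (TT w x)) \<and>
        (\<forall>z\<in>sector a. \<exists>D. bounded_op cs cs E E D \<and>
           (\<forall>e>0. \<exists>d>0. \<forall>w. w \<noteq> 0 \<and> cmod w < d \<longrightarrow>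
              opbound E E (\<lambda>x. cs (1 / w) (TT (z + w) x - TT z x) - D x) e)) \<and>
        (\<forall>b. 0 < b \<and> b < a \<longrightarrow>
           (\<forall>x\<in>carr E. ((\<lambda>z. nrm E (TT z x - x)) \<longlongrightarrow> 0) (at 0 within sector b))))"

text \<open>Over a field containing a root of \<open>-1\<close> (the complex case) this is the usual notion; over
  the reals a semigroup is holomorphic if its complexification is. The norm used on the
  complexification is equivalent to the usual ones, and only its topology matters.\<close>

definition complexification_scale :: "complex \<Rightarrow> 'v \<times> 'v \<Rightarrow> 'v \<times> ('v::real_vector)" where
  "complexification_scale z =
     (\<lambda>(x, y). (Re z *\<^sub>R x - Im z *\<^sub>R y, Re z *\<^sub>R y + Im z *\<^sub>R x))"

definition holomorphic_semigroup ::
  "('k::real_normed_field \<Rightarrow> 'v::real_vector \<Rightarrow> 'v) \<Rightarrow> 'v nspace \<Rightarrow> (real \<Rightarrow> 'v \<Rightarrow> 'v) \<Rightarrow> bool" where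
  "holomorphic_semigroup sc E T \<longleftrightarrow>
     (if \<exists>i::'k. i * i = - 1
      then (\<exists>i::'k. i * i = - 1 \<and>
              holomorphic_semigroup_complex (\<lambda>z. sc (of_real (Re z) + i * of_real (Im z))) E T)
      else holomorphic_semigroup_complex complexification_scale (prod_ns E E)
             (\<lambda>t. map_prod (T t) (T t)))"

section \<open>Interpolation-extrapolation scales\<close>

definition interpolation_couple ::
  "('k::real_normed_field \<Rightarrow> 'v::real_vector \<Rightarrow> 'v) \<Rightarrow> 'v nspace \<Rightarrow> 'v nspace \<Rightarrow> bool" where
  "interpolation_couple sc E0 E1 \<longleftrightarrow>
     banach_on sc E0 \<and> banach_on sc E1 \<and>
     (\<forall>(s :: nat \<Rightarrow> 'v). \<forall>a\<in>carr E0. \<forall>b\<in>carr E1.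
        (\<forall>n. s n \<in> carr E0 \<inter> carr E1) \<and>
        (\<lambda>n. nrm E0 (s n - a)) \<longlonglongrightarrow> 0 \<and> (\<lambda>n. nrm E1 (s n - b)) \<longlonglongrightarrow> 0 \<longrightarrow> a = b)"

definition sum_carr :: "'v::plus nspace \<Rightarrow> 'v nspace \<Rightarrow> 'v set" where
  "sum_carr E0 E1 = {x + y |x y. x \<in> carr E0 \<and> y \<in> carr E1}"

text \<open>Exactness is the bound by the maximum of the two operator norms; functors that are exact
  of exponent \<open>\<theta>\<close> satisfy it.\<close>

definition exact_interpolation_functor ::
  "('k::real_normed_field \<Rightarrow> 'v::real_vector \<Rightarrow> 'v) \<Rightarrow> ('v nspace \<Rightarrow> 'v nspace \<Rightarrow> 'v nspace) \<Rightarrow> bool" where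
  "exact_interpolation_functor sc F \<longleftrightarrow>
     (\<forall>E0 E1. interpolation_couple sc E0 E1 \<longrightarrow>
        banach_on sc (F E0 E1) \<and>
        (\<exists>C. \<forall>x\<in>carr E0 \<inter> carr E1.
           x \<in> carr (F E0 E1) \<and> nrm (F E0 E1) x \<le> C * max (nrm E0 x) (nrm E1 x)) \<and>
        (\<exists>C. \<forall>x\<in>carr (F E0 E1). \<exists>a\<in>carr E0. \<exists>b\<in>carr E1.
           x = a + b \<and> nrm E0 a + nrm E1 b \<le> C * nrm (F E0 E1) x)) \<and>
     (\<forall>E0 E1 G0 G1 T c0 c1.
        interpolation_couple sc E0 E1 \<and> interpolation_couple sc G0 G1 \<and>
        linear_between sc sc (sum_carr E0 E1) (sum_carr G0 G1) T \<and>
        0 \<le> c0 \<and> 0 \<le> c1 \<and> opbound E0 G0 T c0 \<and> opbound E1 G1 T c1 \<longrightarrow>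
        opbound (F E0 E1) (F G0 G1) T (max c0 c1))"

definition density_preserving ::
  "('k::real_normed_field \<Rightarrow> 'v::real_vector \<Rightarrow> 'v) \<Rightarrow> ('v nspace \<Rightarrow> 'v nspace \<Rightarrow> 'v nspace) \<Rightarrow> bool" where
  "density_preserving sc F \<longleftrightarrow>
     (\<forall>E0 E1. banach_on sc E0 \<and> banach_on sc E1 \<and> embeds E1 E0 \<and> dense_in E0 (carr E1) \<longrightarrow>
        dense_in (F E0 E1) (carr E1))"

primrec dom_pow :: "'v nspace \<Rightarrow> 'v set \<Rightarrow> ('v \<Rightarrow> 'v) \<Rightarrow> nat \<Rightarrow> 'v set" where
  "dom_pow Z D S 0 = carr Z"
| "dom_pow Z D S (Suc k) = {z \<in> D. S z \<in> dom_pow Z D S k}"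

text \<open>The completion \<open>E (-1)\<close> is any Banach space inside the ambient type that contains \<open>Z\<close>
  densely and whose norm extends \<open>\<lambda>z. nrm Z (S\<inverse> z)\<close>.\<close>

definition generated_scale ::
  "('k::real_normed_field \<Rightarrow> 'v::real_vector \<Rightarrow> 'v) \<Rightarrow> (real \<Rightarrow> 'v nspace \<Rightarrow> 'v nspace \<Rightarrow> 'v nspace) \<Rightarrow>
   'v nspace \<Rightarrow> 'v set \<Rightarrow> ('v \<Rightarrow> 'v) \<Rightarrow> (real \<Rightarrow> 'v nspace) \<Rightarrow> bool" where
  "generated_scale sc F Z D S E \<longleftrightarrow>
     banach_on sc Z \<and> closed_op sc Z D S \<and> dense_in Z D \<and> in_resolvent_set sc Z D S 0 \<and>
     (\<forall>k::nat. carr (E (real k)) = dom_pow Z D S k \<and>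
        (\<forall>z\<in>dom_pow Z D S k. nrm (E (real k)) z = nrm Z ((S ^^ k) z))) \<and>
     banach_on sc (E (- 1)) \<and> dense_in (E (- 1)) (carr Z) \<and>
     (\<forall>z\<in>carr Z. nrm (E (- 1)) z = nrm Z (the_inv_into D S z)) \<and>
     (\<forall>k::int. \<forall>\<theta>::real. - 1 \<le> k \<and> 0 < \<theta> \<and> \<theta> < 1 \<longrightarrow>
        E (of_int k + \<theta>) = F \<theta> (E (of_int k)) (E (of_int k + 1)))"

definition interp_extrap_scale ::
  "('k::real_normed_field \<Rightarrow> 'v::real_vector \<Rightarrow> 'v) \<Rightarrow>
   'v nspace \<Rightarrow> 'v set \<Rightarrow> ('v \<Rightarrow> 'v) \<Rightarrow> (real \<Rightarrow> 'v nspace) \<Rightarrow> bool" where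
  "interp_extrap_scale sc Z D S X \<longleftrightarrow>
     (\<exists>F E. (\<forall>\<theta>. 0 < \<theta> \<and> \<theta> < 1 \<longrightarrow>
                exact_interpolation_functor sc (F \<theta>) \<and> density_preserving sc (F \<theta>)) \<and>
            generated_scale sc F Z D S E \<and>
            (\<forall>\<alpha>\<ge>-1. banach_on sc (X \<alpha>) \<and> equiv_ns (X \<alpha>) (E \<alpha>)))"

section \<open>Continuity and differentiability\<close>

definition continuous_ns :: "'v::minus nspace \<Rightarrow> 'w::minus nspace \<Rightarrow> ('v \<Rightarrow> 'w) \<Rightarrow> bool" where
  "continuous_ns E G F \<longleftrightarrow>
     (\<forall>x\<in>carr E. F x \<in> carr G) \<and>
     (\<forall>x\<in>carr E. \<forall>e>0. \<exists>d>0. \<forall>y\<in>carr E. nrm E (y - x) < d \<longrightarrow> nrm G (F y - F x) < e)"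

definition continuous_path :: "'v::minus nspace \<Rightarrow> real set \<Rightarrow> (real \<Rightarrow> 'v) \<Rightarrow> bool" where
  "continuous_path E I u \<longleftrightarrow>
     (\<forall>s\<in>I. u s \<in> carr E \<and> ((\<lambda>r. nrm E (u r - u s)) \<longlongrightarrow> 0) (at s within I))"

definition path_deriv ::
  "'v::real_vector nspace \<Rightarrow> real set \<Rightarrow> (real \<Rightarrow> 'v) \<Rightarrow> real \<Rightarrow> 'v \<Rightarrow> bool" where
  "path_deriv E I u s d \<longleftrightarrow>
     d \<in> carr E \<and> ((\<lambda>r. nrm E ((1 / (r - s)) *\<^sub>R (u r - u s) - d)) \<longlongrightarrow> 0) (at s within I)"

definition C1_path :: "'v::real_vector nspace \<Rightarrow> real \<Rightarrow> (real \<Rightarrow> 'v) \<Rightarrow> bool" where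
  "C1_path E t u \<longleftrightarrow>
     (\<forall>s\<in>{0..t}. u s \<in> carr E) \<and>
     (\<exists>u'. continuous_path E {0..t} u' \<and> (\<forall>s\<in>{0..t}. path_deriv E {0..t} u s (u' s)))"

definition C1_norm :: "'v::real_vector nspace \<Rightarrow> real \<Rightarrow> (real \<Rightarrow> 'v) \<Rightarrow> real" where
  "C1_norm E t u =
     (SUP s\<in>{0..t}. nrm E (u s)) + (SUP s\<in>{0..t}. nrm E (THE d. path_deriv E {0..t} u s d))"

definition frechet_deriv_ns ::
  "('k \<Rightarrow> 'v::ab_group_add \<Rightarrow> 'v) \<Rightarrow> ('k \<Rightarrow> 'w::ab_group_add \<Rightarrow> 'w) \<Rightarrow>
   'v nspace \<Rightarrow> 'w nspace \<Rightarrow> ('v \<Rightarrow> 'w) \<Rightarrow> 'v \<Rightarrow> ('v \<Rightarrow> 'w) \<Rightarrow> bool" where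
  "frechet_deriv_ns sc sc' E G F x D \<longleftrightarrow>
     bounded_op sc sc' E G D \<and>
     (\<forall>e>0. \<exists>d>0. \<forall>h\<in>carr E. nrm E h < d \<longrightarrow> nrm G (F (x + h) - F x - D h) \<le> e * nrm E h)"

definition frechet_differentiable_ns ::
  "('k \<Rightarrow> 'v::ab_group_add \<Rightarrow> 'v) \<Rightarrow> ('k \<Rightarrow> 'w::ab_group_add \<Rightarrow> 'w) \<Rightarrow>
   'v nspace \<Rightarrow> 'w nspace \<Rightarrow> ('v \<Rightarrow> 'w) \<Rightarrow> bool" where
  "frechet_differentiable_ns sc sc' E G F \<longleftrightarrow>
     (\<forall>x\<in>carr E. F x \<in> carr G) \<and> (\<forall>x\<in>carr E. \<exists>D. frechet_deriv_ns sc sc' E G F x D)"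

definition C1_bounded_ns ::
  "('k \<Rightarrow> 'v::ab_group_add \<Rightarrow> 'v) \<Rightarrow> ('k \<Rightarrow> 'w::ab_group_add \<Rightarrow> 'w) \<Rightarrow>
   'v nspace \<Rightarrow> 'w nspace \<Rightarrow> ('v \<Rightarrow> 'w) \<Rightarrow> real \<Rightarrow> bool" where
  "C1_bounded_ns sc sc' E G F L \<longleftrightarrow>
     (\<forall>x\<in>carr E. F x \<in> carr G) \<and>
     (\<exists>DF. (\<forall>x\<in>carr E. frechet_deriv_ns sc sc' E G F x (DF x)) \<and>
           (\<forall>x\<in>carr E. \<forall>e>0. \<exists>d>0. \<forall>y\<in>carr E. nrm E (y - x) < d \<longrightarrow>
              opbound E G (\<lambda>h. DF y h - DF x h) e) \<and>
           (\<forall>x\<in>carr E. opbound E G (DF x) L))"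

section \<open>The fast-slow system\<close>

text \<open>
  \<open>X \<alpha>\<close> and \<open>Y \<alpha>\<close> are the spaces of the two scales, so that the underlying Banach spaces are \<open>X 0\<close>
  and \<open>Y 0\<close> and the domains of the generators are \<open>carr (X 1)\<close> and \<open>carr (Y 1)\<close>. The types \<open>'x\<close>, \<open>'y\<close>
  carry the topologies of the largest spaces \<open>X (-1)\<close>, \<open>Y (-1)\<close>; integrals of functions with values
  in a smaller space are computed there. \<open>A\<close>, \<open>B\<close> and the semigroups \<open>TA\<close>, \<open>TB\<close> stand for their
  extensions to the extrapolation spaces.
\<close>

locale fast_slow_system =
  fixes sX :: "'k::{real_normed_field,banach} \<Rightarrow> 'x::banach \<Rightarrow> 'x"
    and sY :: "'k \<Rightarrow> 'y::banach \<Rightarrow> 'y"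
    and X :: "real \<Rightarrow> 'x nspace" and Y :: "real \<Rightarrow> 'y nspace"
    and A :: "'x \<Rightarrow> 'x" and TA :: "real \<Rightarrow> 'x \<Rightarrow> 'x"
    and B :: "'y \<Rightarrow> 'y" and TB :: "real \<Rightarrow> 'y \<Rightarrow> 'y"
    and f :: "'x \<Rightarrow> 'y \<Rightarrow> 'x" and g :: "'x \<Rightarrow> 'y \<Rightarrow> 'y"
    and \<gamma>\<^sub>X \<delta>\<^sub>X \<delta>\<^sub>Y L\<^sub>f L\<^sub>g M\<^sub>A M\<^sub>B C\<^sub>A C\<^sub>B \<omega>\<^sub>A \<omega>\<^sub>B \<omega>\<^sub>f \<epsilon> :: real
  assumes eps_pos: "\<epsilon> > 0"
    and scalars: "vector_space sX" "vector_space sY"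
      "\<And>r x. sX (of_real r) x = r *\<^sub>R x" "\<And>r y. sY (of_real r) y = r *\<^sub>R y"
    and ambient: "equiv_ns (X (- 1)) (NSpace UNIV norm)" "equiv_ns (Y (- 1)) (NSpace UNIV norm)"
    and A_gen: "closed_op sX (X 0) (carr (X 1)) A"
      "generates_C0_semigroup sX (X 0) (carr (X 1)) A TA" "exponentially_stable (X 0) TA"
    and B_gen: "closed_op sY (Y 0) (carr (Y 1)) B"
      "generates_C0_semigroup sY (Y 0) (carr (Y 1)) B TB"
    and X_scale: "interp_extrap_scale sX (X 0) (carr (X 1)) A X"
    and Y_scale: "\<exists>l. in_resolvent_set sY (Y 0) (carr (Y 1)) B l \<and>
      (in_resolvent_set sY (Y 0) (carr (Y 1)) B 0 \<longrightarrow> l = 0) \<and>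
      interp_extrap_scale sY (Y 0) (carr (Y 1)) (\<lambda>y. B y - sY l y) Y"
    and A_ext: "bounded_op sX sX (X 0) (X (- 1)) A"
      "\<And>t. t \<ge> 0 \<Longrightarrow> bounded_op sX sX (X (- 1)) (X (- 1)) (TA t)"
    and B_ext: "bounded_op sY sY (Y 0) (Y (- 1)) B"
      "\<And>t. t \<ge> 0 \<Longrightarrow> bounded_op sY sY (Y (- 1)) (Y (- 1)) (TB t)"
    and gamma_X: "0 < \<gamma>\<^sub>X" "\<gamma>\<^sub>X \<le> 1" "\<not> holomorphic_semigroup sX (X 0) TA \<Longrightarrow> \<gamma>\<^sub>X = 1"
    and delta_X: "1 - \<gamma>\<^sub>X \<le> \<delta>\<^sub>X" "\<delta>\<^sub>X \<le> 1"
    and delta_Y: "0 < \<delta>\<^sub>Y" "\<delta>\<^sub>Y \<le> 1" "\<not> holomorphic_semigroup sY (Y 0) TB \<Longrightarrow> \<delta>\<^sub>Y = 1"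
    and f_cont: "continuous_ns (prod_ns (X \<delta>\<^sub>X) (Y (1 - \<delta>\<^sub>X))) (X 0) (\<lambda>(x, y). f x y)"
    and g_cont: "continuous_ns (prod_ns (X 1) (Y 1)) (Y \<delta>\<^sub>Y) (\<lambda>(x, y). g x y)"
    and fg_zero: "f 0 0 = 0" "g 0 0 = 0"
    and fg_range: "\<And>x y. x \<in> carr (X 1) \<Longrightarrow> y \<in> carr (Y 1) \<Longrightarrow>
      f x y \<in> carr (X \<gamma>\<^sub>X) \<and> g x y \<in> carr (Y \<delta>\<^sub>Y)"
    and f_C1_path: "\<And>t u v. t > 0 \<Longrightarrow> C1_path (X \<delta>\<^sub>X) t u \<Longrightarrow> C1_path (Y 0) t v \<Longrightarrow>
      continuous_path (Y (1 - \<delta>\<^sub>X)) {0..t} v \<Longrightarrow> C1_path (X (\<delta>\<^sub>X - 1)) t (\<lambda>s. f (u s) (v s))"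
    and Lip_pos: "L\<^sub>f > 0" "L\<^sub>g > 0"
    and f_Lip: "\<And>x1 x2 y1 y2. x1 \<in> carr (X 1) \<Longrightarrow> x2 \<in> carr (X 1) \<Longrightarrow>
      y1 \<in> carr (Y 1) \<Longrightarrow> y2 \<in> carr (Y 1) \<Longrightarrow>
      nrm (X \<gamma>\<^sub>X) (f x1 y1 - f x2 y2) \<le> L\<^sub>f * (nrm (X 1) (x1 - x2) + nrm (Y 1) (y1 - y2))"
    and f_C1_Lip: "\<And>t u1 u2 v1 v2. t > 0 \<Longrightarrow>
      C1_path (X \<delta>\<^sub>X) t u1 \<Longrightarrow> C1_path (X \<delta>\<^sub>X) t u2 \<Longrightarrow>
      C1_path (Y 0) t v1 \<Longrightarrow> continuous_path (Y (1 - \<delta>\<^sub>X)) {0..t} v1 \<Longrightarrow>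
      C1_path (Y 0) t v2 \<Longrightarrow> continuous_path (Y (1 - \<delta>\<^sub>X)) {0..t} v2 \<Longrightarrow>
      C1_norm (X (\<delta>\<^sub>X - 1)) t (\<lambda>s. f (u1 s) (v1 s) - f (u2 s) (v2 s))
        \<le> L\<^sub>f * (C1_norm (X \<delta>\<^sub>X) t (\<lambda>s. u1 s - u2 s) + C1_norm (Y 0) t (\<lambda>s. v1 s - v2 s))"
    and g_Lip: "\<And>x1 x2 y1 y2. x1 \<in> carr (X 1) \<Longrightarrow> x2 \<in> carr (X 1) \<Longrightarrow>
      y1 \<in> carr (Y 1) \<Longrightarrow> y2 \<in> carr (Y 1) \<Longrightarrow>
      nrm (Y \<delta>\<^sub>Y) (g x1 y1 - g x2 y2) \<le> L\<^sub>g * (nrm (X 1) (x1 - x2) + nrm (Y 1) (y1 - y2))"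
    and const_pos: "M\<^sub>A > 0" "M\<^sub>B > 0" "C\<^sub>A > 0" "C\<^sub>B > 0" "\<omega>\<^sub>A < 0"
    and TA_bounds: "\<And>t. t > 0 \<Longrightarrow> opbound (X 1) (X 1) (TA t) (M\<^sub>A * exp (\<omega>\<^sub>A * t))"
      "\<And>t. t > 0 \<Longrightarrow> opbound (X \<gamma>\<^sub>X) (X 1) (TA t) (C\<^sub>A * t powr (\<gamma>\<^sub>X - 1) * exp (\<omega>\<^sub>A * t))"
      "\<And>t. t > 0 \<Longrightarrow> opbound (X \<delta>\<^sub>X) (X 1) (TA t) (C\<^sub>A * t powr (\<delta>\<^sub>X - 1) * exp (\<omega>\<^sub>A * t))"
    and TB_bounds: "\<And>t. t > 0 \<Longrightarrow> opbound (Y 1) (Y 1) (TB t) (M\<^sub>B * exp (\<omega>\<^sub>B * t))"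
      "\<And>t. t > 0 \<Longrightarrow> opbound (Y \<delta>\<^sub>Y) (Y 1) (TB t) (C\<^sub>B * t powr (\<delta>\<^sub>Y - 1) * exp (\<omega>\<^sub>B * t))"
    and omega_f: "\<gamma>\<^sub>X < 1 \<Longrightarrow>
        \<omega>\<^sub>f = \<omega>\<^sub>A + (2 * C\<^sub>A * L\<^sub>f) powr (1 / \<gamma>\<^sub>X) * (1 / \<gamma>\<^sub>X) powr ((1 - \<gamma>\<^sub>X) / \<gamma>\<^sub>X)"
      "\<gamma>\<^sub>X = 1 \<Longrightarrow> \<omega>\<^sub>f > \<omega>\<^sub>A + C\<^sub>A * L\<^sub>f"
      "\<omega>\<^sub>f < 0"
    and A_inv_small: "L\<^sub>f * max (opnorm (X \<gamma>\<^sub>X) (X 1) (the_inv_into (carr (X 0)) A))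
        (opnorm (X (\<delta>\<^sub>X - 1)) (X \<delta>\<^sub>X) (the_inv_into (carr (X 0)) A)) < 1"

section \<open>The splitting of the slow variable space\<close>

definition proj_along :: "'v::plus set \<Rightarrow> 'v set \<Rightarrow> 'v \<Rightarrow> 'v" where
  "proj_along F S y = (THE a. a \<in> F \<and> (\<exists>b\<in>S. y = a + b))"

text \<open>The group \<open>GB z\<close> extends \<open>TB\<close> to negative times on \<open>YS z\<close> only. The constants \<open>C\<^sub>S\<close>, \<open>M\<^sub>S\<close> in the dichotomy estimates are not required
  to coincide with \<open>C\<^sub>B\<close>, \<open>M\<^sub>B\<close>.\<close>

locale slow_manifold_setting =
  fast_slow_system sX sY X Y A TA B TB f g \<gamma>\<^sub>X \<delta>\<^sub>X \<delta>\<^sub>Y L\<^sub>f L\<^sub>g M\<^sub>A M\<^sub>B C\<^sub>A C\<^sub>B \<omega>\<^sub>A \<omega>\<^sub>B \<omega>\<^sub>f \<epsilon>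
  for sX :: "'k::{real_normed_field,banach} \<Rightarrow> 'x::banach \<Rightarrow> 'x"
    and sY :: "'k \<Rightarrow> 'y::banach \<Rightarrow> 'y"
    and X Y A TA B TB f g \<gamma>\<^sub>X \<delta>\<^sub>X \<delta>\<^sub>Y L\<^sub>f L\<^sub>g M\<^sub>A M\<^sub>B C\<^sub>A C\<^sub>B \<omega>\<^sub>A \<omega>\<^sub>B \<omega>\<^sub>f \<epsilon> +
  fixes \<zeta>\<^sub>0 :: real and YF YS :: "real \<Rightarrow> 'y set" and GB :: "real \<Rightarrow> real \<Rightarrow> 'y \<Rightarrow> 'y"
    and N\<^sub>F N\<^sub>S :: "real \<Rightarrow> real" and C\<^sub>S M\<^sub>S :: real and \<zeta> :: real
  assumes direct_sum: "\<And>z. 0 < z \<Longrightarrow> z < \<zeta>\<^sub>0 \<Longrightarrow>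
      module.subspace sY (YF z) \<and> module.subspace sY (YS z) \<and> YF z \<inter> YS z = {0} \<and>
      carr (Y 0) = {a + b |a b. a \<in> YF z \<and> b \<in> YS z}"
    and closed: "\<And>z. 0 < z \<Longrightarrow> z < \<zeta>\<^sub>0 \<Longrightarrow>
      closed_in_ns (Y 0) (YF z) \<and> closed_in_ns (Y 0) (YS z)"
    and proj_commute: "\<And>z y. 0 < z \<Longrightarrow> z < \<zeta>\<^sub>0 \<Longrightarrow> y \<in> carr (Y 1) \<Longrightarrow>
      proj_along (YF z) (YS z) y \<in> carr (Y 1) \<and> proj_along (YS z) (YF z) y \<in> carr (Y 1) \<and>
      B (proj_along (YF z) (YS z) y) = proj_along (YF z) (YS z) (B y) \<and>
      B (proj_along (YS z) (YF z) y) = proj_along (YS z) (YF z) (B y)"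
    and closed_Y1: "\<And>z. 0 < z \<Longrightarrow> z < \<zeta>\<^sub>0 \<Longrightarrow>
      closed_in_ns (Y 1) (YF z \<inter> carr (Y 1)) \<and> closed_in_ns (Y 1) (YS z \<inter> carr (Y 1))"
    and g_slow_Lip: "\<And>z x1 x2 a1 a2 b1 b2. 0 < z \<Longrightarrow> z < \<zeta>\<^sub>0 \<Longrightarrow>
      x1 \<in> carr (X 1) \<Longrightarrow> x2 \<in> carr (X 1) \<Longrightarrow>
      a1 \<in> YF z \<inter> carr (Y 1) \<Longrightarrow> a2 \<in> YF z \<inter> carr (Y 1) \<Longrightarrow>
      b1 \<in> YS z \<inter> carr (Y 1) \<Longrightarrow> b2 \<in> YS z \<inter> carr (Y 1) \<Longrightarrow>
      proj_along (YS z) (YF z) (g x1 (a1 + b1) - g x2 (a2 + b2)) \<in> carr (Y 1) \<and>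
      nrm (Y 1) (proj_along (YS z) (YF z) (g x1 (a1 + b1) - g x2 (a2 + b2)))
        \<le> L\<^sub>g * z powr (\<delta>\<^sub>Y - 1) *
            (nrm (X 1) (x1 - x2) + nrm (Y 1) (a1 - a2) + nrm (Y 1) (b1 - b2))"
    and slow_group: "\<And>z. 0 < z \<Longrightarrow> z < \<zeta>\<^sub>0 \<Longrightarrow>
      generates_C0_group sY (sub_ns (Y 0) (YS z)) (realization_dom (carr (Y 1)) B (YS z)) B (GB z)"
      "\<And>z t y. 0 < z \<Longrightarrow> z < \<zeta>\<^sub>0 \<Longrightarrow> t \<ge> 0 \<Longrightarrow> y \<in> YS z \<Longrightarrow> GB z t y = TB t y"
    and fast_resolvent: "\<And>z. 0 < z \<Longrightarrow> z < \<zeta>\<^sub>0 \<Longrightarrow>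
      in_resolvent_set sY (sub_ns (Y 0) (YF z)) (realization_dom (carr (Y 1)) B (YF z)) B 0"
    and dichotomy_const: "C\<^sub>S > 0" "M\<^sub>S > 0"
      "\<And>z. 0 < z \<Longrightarrow> z < \<zeta>\<^sub>0 \<Longrightarrow> 0 \<le> N\<^sub>F z \<and> N\<^sub>F z < N\<^sub>S z"
    and fast_bound: "\<And>z t. 0 < z \<Longrightarrow> z < \<zeta>\<^sub>0 \<Longrightarrow> t > 0 \<Longrightarrow>
      opbound (sub_ns (Y \<delta>\<^sub>Y) (YF z)) (Y 1) (TB t)
        (C\<^sub>S * t powr (\<delta>\<^sub>Y - 1) * exp ((N\<^sub>F z + \<omega>\<^sub>A / z) * t))"
    and slow_bound: "\<And>z t. 0 < z \<Longrightarrow> z < \<zeta>\<^sub>0 \<Longrightarrow> t \<ge> 0 \<Longrightarrow>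
      opbound (sub_ns (Y 1) (YS z)) (Y 1) (GB z (- t)) (M\<^sub>S * exp (- (N\<^sub>S z + \<omega>\<^sub>A / z) * t))"
    and zeta: "0 < \<zeta>" "\<zeta> < \<zeta>\<^sub>0"
    and gap_base: "2 * (\<epsilon> / \<zeta> - 1) * \<omega>\<^sub>A + \<epsilon> * (N\<^sub>S \<zeta> + N\<^sub>F \<zeta>) > 0"
    and gap: "2 powr \<gamma>\<^sub>X * L\<^sub>f * C\<^sub>A * Gamma \<gamma>\<^sub>X /
          (2 * (\<epsilon> / \<zeta> - 1) * \<omega>\<^sub>A + \<epsilon> * (N\<^sub>S \<zeta> + N\<^sub>F \<zeta>)) powr \<gamma>\<^sub>X
        + 2 powr \<delta>\<^sub>Y * L\<^sub>g * C\<^sub>S * Gamma \<delta>\<^sub>Y / (N\<^sub>S \<zeta> - N\<^sub>F \<zeta>) powr \<delta>\<^sub>Y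
        + 2 * \<zeta> powr (\<delta>\<^sub>Y - 1) * L\<^sub>g * M\<^sub>S * Gamma \<delta>\<^sub>Y / (N\<^sub>S \<zeta> - N\<^sub>F \<zeta>) < 1"

section \<open>The slow manifold\<close>

definition eta :: "real \<Rightarrow> real \<Rightarrow> real \<Rightarrow> real \<Rightarrow> real" where
  "eta w nF nS z = w / z + (nS + nF) / 2"

type_synonym ('x, 'y) triple_path = "(real \<Rightarrow> 'x) \<times> (real \<Rightarrow> 'y) \<times> (real \<Rightarrow> 'y)"

definition C_eta ::
  "'x::ab_group_add nspace \<Rightarrow> 'y::ab_group_add nspace \<Rightarrow> 'y set \<Rightarrow> 'y set \<Rightarrow> real \<Rightarrow> ('x, 'y) triple_path set"
  where
  "C_eta X1 Y1 F S \<eta> = {(u, vF, vS).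
     continuous_path X1 {..0} u \<and>
     continuous_path (sub_ns Y1 F) {..0} vF \<and> continuous_path (sub_ns Y1 S) {..0} vS \<and>
     bdd_above ((\<lambda>t. exp (- \<eta> * t) * (nrm X1 (u t) + nrm Y1 (vF t) + nrm Y1 (vS t))) ` {..0})}"

text \<open>In the slow component \<open>t \<le> 0\<close>, so the integral from \<open>0\<close> to \<open>t\<close> is minus the one over \<open>{t..0}\<close>.\<close>

definition lyapunov_perron ::
  "(real \<Rightarrow> 'x::banach \<Rightarrow> 'x) \<Rightarrow> (real \<Rightarrow> 'y::banach \<Rightarrow> 'y) \<Rightarrow> (real \<Rightarrow> 'y \<Rightarrow> 'y) \<Rightarrow>
   ('x \<Rightarrow> 'y \<Rightarrow> 'x) \<Rightarrow> ('x \<Rightarrow> 'y \<Rightarrow> 'y) \<Rightarrow> 'y set \<Rightarrow> 'y set \<Rightarrow> real \<Rightarrow> 'y \<Rightarrow>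
   ('x, 'y) triple_path \<Rightarrow> ('x, 'y) triple_path" where
  "lyapunov_perron TA TB GB f g F S \<epsilon> v0 = (\<lambda>(u, vF, vS).
     (\<lambda>t. (1 / \<epsilon>) *\<^sub>R integral {..t} (\<lambda>s. TA ((t - s) / \<epsilon>) (f (u s) (vF s + vS s))),
      \<lambda>t. integral {..t} (\<lambda>s. TB (t - s) (proj_along F S (g (u s) (vF s + vS s)))),
      \<lambda>t. GB t v0 - integral {t..0} (\<lambda>s. GB (t - s) (proj_along S F (g (u s) (vF s + vS s))))))"

definition lp_fixed_point ::
  "(real \<Rightarrow> 'x::banach \<Rightarrow> 'x) \<Rightarrow> (real \<Rightarrow> 'y::banach \<Rightarrow> 'y) \<Rightarrow> (real \<Rightarrow> 'y \<Rightarrow> 'y) \<Rightarrow>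
   ('x \<Rightarrow> 'y \<Rightarrow> 'x) \<Rightarrow> ('x \<Rightarrow> 'y \<Rightarrow> 'y) \<Rightarrow> 'y set \<Rightarrow> 'y set \<Rightarrow> real \<Rightarrow> 'y \<Rightarrow>
   ('x, 'y) triple_path \<Rightarrow> bool" where
  "lp_fixed_point TA TB GB f g F S \<epsilon> v0 = (\<lambda>(u, vF, vS).
     (case lyapunov_perron TA TB GB f g F S \<epsilon> v0 (u, vF, vS) of (u', vF', vS') \<Rightarrow>
        \<forall>t\<le>0. u' t = u t \<and> vF' t = vF t \<and> vS' t = vS t))"

text \<open>Paths are only determined on \<open>{..0}\<close>; hence the description operator is applied to the value
  at \<open>0\<close> of the unique fixed point.\<close>

definition slow_map ::
  "'x::banach nspace \<Rightarrow> 'y::banach nspace \<Rightarrow> (real \<Rightarrow> 'x \<Rightarrow> 'x) \<Rightarrow> (real \<Rightarrow> 'y \<Rightarrow> 'y) \<Rightarrow> (real \<Rightarrow> 'y \<Rightarrow> 'y) \<Rightarrow>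
   ('x \<Rightarrow> 'y \<Rightarrow> 'x) \<Rightarrow> ('x \<Rightarrow> 'y \<Rightarrow> 'y) \<Rightarrow> 'y set \<Rightarrow> 'y set \<Rightarrow> real \<Rightarrow> real \<Rightarrow> 'y \<Rightarrow> 'x \<times> 'y" where
  "slow_map X1 Y1 TA TB GB f g F S \<epsilon> \<eta> v0 =
     (THE p. \<exists>u vF vS. (u, vF, vS) \<in> C_eta X1 Y1 F S \<eta> \<and>
        lp_fixed_point TA TB GB f g F S \<epsilon> v0 (u, vF, vS) \<and> p = (u 0, vF 0))"

end

theory Submission imports Defs begin

text \<open>
  Write a path on \<open>{..0}\<close> as a triple \<open>\<phi> = (u, v\<^sub>F, v\<^sub>S)\<close>. The path whose value at \<open>0\<close> defines the slow
  manifold solves \<open>\<phi> t = p v t + K (G \<circ> \<phi>) t\<close>, where \<open>p v\<close> is the backward orbit of \<open>v\<close> under the slow group,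
  \<open>G z = (f, P\<^sub>F g, P\<^sub>S g)\<close> is evaluated pointwise, and \<open>K\<close> convolves the three components with the
  semigroups and the group. With the components of \<open>G\<close> weighted by their Lipschitz constants, \<open>G\<close>
  becomes 1-Lipschitz. The operator \<open>K\<close> is bounded by \<open>rate \<mu>\<close> on the paths of size \<open>exp (\<mu> * t)\<close>, the
  kernels of the first two components leading to gamma integrals; the gap condition gives
  \<open>rate \<eta> < 1\<close>. This makes the equation uniquely solvable.

  Superposition with \<open>G\<close> need not be differentiable on the space with weight \<open>\<eta>\<close>, since for \<open>\<eta> < 0\<close> the
  paths may be unbounded and the derivative of \<open>G\<close> is not assumed to be uniformly continuous. It
  becomes differentiable when the target carries a slightly weaker norm. As \<open>rate\<close> is continuous and
  the gap condition is strict, there is \<open>\<eta>\<^sub>1 < \<eta>\<close> with \<open>rate \<eta>\<^sub>1 < 1\<close>. For the solution \<open>\<phi>\<close> at \<open>v\<close> the linearized equation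
  \<open>\<omega> t = p h t + K (DG \<phi> \<cdot> \<omega>) t\<close> is solved in the weight \<open>\<eta>\<close> by a bounded linear function of \<open>h\<close>. The solutions
  at \<open>v + h\<close> and \<open>v\<close> differ by \<open>\<psi> = O(h)\<close> in the weight \<open>\<eta>\<close>, and the Taylor remainder of \<open>G\<close> along \<open>\<phi>\<close> at
  \<open>\<psi>\<close> is \<open>o(h)\<close> in the weight \<open>\<eta>\<^sub>1\<close>: on compact time intervals by uniformity of the derivative on
  the compact image of \<open>\<phi>\<close>, and near \<open>-\<infinity>\<close> because of the factor \<open>exp ((\<eta> - \<eta>\<^sub>1) * t)\<close> gained. The equation
  for \<open>\<psi> - \<omega>\<close> and the contraction in the weight \<open>\<eta>\<^sub>1\<close> then give \<open>\<psi> 0 - \<omega> 0 = o(h)\<close>. This part is carried out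
  for an abstract equation, in the theorem \<open>frechet_differentiable\<close>.

  Three facts are needed to apply it. Since \<open>X 1\<close> and \<open>Y 1\<close> are only subspaces of the types in
  which integrals are formed, the convolutions have to be shown to take values in them and to be
  continuous there (\<open>integral_path_Ioi\<close>, \<open>convolution\<close>, \<open>backward_convolution\<close>). The semigroup of \<open>B\<close> has to
  leave the fast subspace invariant: the projections are bounded by the open mapping argument
  (\<open>projections_bounded\<close>), and they commute with the semigroup because they commute with its generator
  (\<open>commuting_operator\<close>). Finally \<open>G\<close> has to be differentiable into the weighted product, so the slow
  projection has to be bounded from \<open>Y \<delta>\<^sub>Y\<close> to \<open>Y 1\<close> (\<open>PS_smoothing\<close>): followed
  by the group at time \<open>-1\<close> it is bounded on \<open>Y \<delta>\<^sub>Y\<close> by interpolation, and the semigroup at time \<open>1\<close>,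
  which undoes the group, maps \<open>Y \<delta>\<^sub>Y\<close> to \<open>Y 1\<close>.
\<close>

section \<open>Normed subspaces and paths in them\<close>

text \<open>
  A normed space \<open>E\<close> inside a real vector space: \<open>nrm E\<close> is a norm on \<open>carr E\<close>, and the scalar
  multiplication \<open>sc\<close> extends the real one. Outside \<open>carr E\<close> nothing is known about \<open>nrm E\<close>, so
  each rule below carries membership premises.
\<close>

locale normed_space_on =
  fixes sc :: "'k::real_normed_field \<Rightarrow> 'v::real_vector \<Rightarrow> 'v" and E :: "'v nspace"
  assumes scalars: "vector_space sc"
    and scale_of_real: "\<And>r x. sc (of_real r) x = r *\<^sub>R x"
    and carr_subspace: "module.subspace sc (carr E)"
    and nrm_nonneg: "\<And>x. x \<in> carr E \<Longrightarrow> 0 \<le> nrm E x"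
    and nrm_eq_0: "\<And>x. x \<in> carr E \<Longrightarrow> nrm E x = 0 \<longleftrightarrow> x = 0"
    and nrm_triangle: "\<And>x y. x \<in> carr E \<Longrightarrow> y \<in> carr E \<Longrightarrow> nrm E (x + y) \<le> nrm E x + nrm E y"
    and nrm_scale: "\<And>c x. x \<in> carr E \<Longrightarrow> nrm E (sc c x) = norm c * nrm E x"
begin

lemma module_sc: "module sc"
  using scalars by (simp add: vector_space_def module_def)

lemma zero_in [simp]: "0 \<in> carr E"
  using carr_subspace module.subspace_0[OF module_sc] by blast
lemma add_in [simp, intro]: "x \<in> carr E \<Longrightarrow> y \<in> carr E \<Longrightarrow> x + y \<in> carr E"
  using carr_subspace module.subspace_add[OF module_sc] by blast
lemma scale_in [simp, intro]: "x \<in> carr E \<Longrightarrow> sc c x \<in> carr E"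
  using carr_subspace module.subspace_scale[OF module_sc] by blast
lemma scaleR_in [simp, intro]: "x \<in> carr E \<Longrightarrow> r *\<^sub>R x \<in> carr E"
  using scale_in[of x "of_real r"] by (simp add: scale_of_real)
lemma minus_in [simp, intro]: "x \<in> carr E \<Longrightarrow> - x \<in> carr E"
  using scaleR_in[of x "-1"] by simp
lemma diff_in [simp, intro]: "x \<in> carr E \<Longrightarrow> y \<in> carr E \<Longrightarrow> x - y \<in> carr E"
  using add_in[of x "- y"] by auto
lemma sum_in [simp, intro]: "(\<And>i. i \<in> I \<Longrightarrow> x i \<in> carr E) \<Longrightarrow> sum x I \<in> carr E"
  by (induction I rule: infinite_finite_induct) auto

lemma nrm_0 [simp]: "nrm E 0 = 0"
  using nrm_eq_0[of 0] by simp
lemma nrm_scaleR: "x \<in> carr E \<Longrightarrow> nrm E (r *\<^sub>R x) = \<bar>r\<bar> * nrm E x"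
  using nrm_scale[of x "of_real r"] by (simp add: scale_of_real)
lemma nrm_minus: "x \<in> carr E \<Longrightarrow> nrm E (- x) = nrm E x"
  using nrm_scaleR[of x "-1"] by simp
lemma nrm_commute: "x \<in> carr E \<Longrightarrow> y \<in> carr E \<Longrightarrow> nrm E (x - y) = nrm E (y - x)"
  using nrm_minus[of "x - y"] diff_in[of x y] by simp
lemma nrm_triangle_diff: "x \<in> carr E \<Longrightarrow> y \<in> carr E \<Longrightarrow> nrm E (x - y) \<le> nrm E x + nrm E y"
  using nrm_triangle[of x "- y"] nrm_minus[of y] by auto
lemma nrm_triangle_mid:
  "x \<in> carr E \<Longrightarrow> y \<in> carr E \<Longrightarrow> z \<in> carr E \<Longrightarrow> nrm E (x - z) \<le> nrm E (x - y) + nrm E (y - z)"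
  using nrm_triangle[of "x - y" "y - z"] by auto
lemma nrm_triangle_sub: "x \<in> carr E \<Longrightarrow> y \<in> carr E \<Longrightarrow> nrm E x \<le> nrm E y + nrm E (x - y)"
  using nrm_triangle[of "y" "x - y"] by auto
lemma nrm_diff_abs: "x \<in> carr E \<Longrightarrow> y \<in> carr E \<Longrightarrow> \<bar>nrm E x - nrm E y\<bar> \<le> nrm E (x - y)"
  using nrm_triangle_sub[of x y] nrm_triangle_sub[of y x] nrm_commute[of x y] by auto
lemma nrm_sum: "(\<And>i. i \<in> I \<Longrightarrow> x i \<in> carr E) \<Longrightarrow> nrm E (sum x I) \<le> (\<Sum>i\<in>I. nrm E (x i))"
proof (induction I rule: infinite_finite_induct)
  case (insert i I)
  then show ?case using nrm_triangle[of "x i" "sum x I"] by fastforce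
qed auto

subsection \<open>Paths\<close>

lemma continuous_path_iff:
  "continuous_path E I u \<longleftrightarrow> (\<forall>s\<in>I. u s \<in> carr E) \<and>
    (\<forall>s\<in>I. \<forall>e>0. \<exists>d>0. \<forall>r\<in>I. \<bar>r - s\<bar> < d \<longrightarrow> nrm E (u r - u s) < e)"
proof -
  have "((\<lambda>r. nrm E (u r - u s)) \<longlongrightarrow> 0) (at s within I) \<longleftrightarrow>
      (\<forall>e>0. \<exists>d>0. \<forall>r\<in>I. \<bar>r - s\<bar> < d \<longrightarrow> nrm E (u r - u s) < e)"
    if u: "\<forall>s\<in>I. u s \<in> carr E" and s: "s \<in> I" for s
  proof -
    have abs: "\<bar>nrm E (u r - u s)\<bar> = nrm E (u r - u s)" if "r \<in> I" for r
      using nrm_nonneg[of "u r - u s"] diff_in[of "u r" "u s"] u s that by simp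
    have "(\<forall>r\<in>I. r \<noteq> s \<and> \<bar>r - s\<bar> < d \<longrightarrow> \<bar>nrm E (u r - u s)\<bar> < e) \<longleftrightarrow>
        (\<forall>r\<in>I. \<bar>r - s\<bar> < d \<longrightarrow> nrm E (u r - u s) < e)" if "e > 0" for d e
    proof (intro ball_cong refl)
      fix r assume "r \<in> I"
      then show "(r \<noteq> s \<and> \<bar>r - s\<bar> < d \<longrightarrow> \<bar>nrm E (u r - u s)\<bar> < e) \<longleftrightarrow>
          (\<bar>r - s\<bar> < d \<longrightarrow> nrm E (u r - u s) < e)"
        using abs \<open>e > 0\<close> by (cases "r = s") simp_all
    qed
    note * = this
    have "((\<lambda>r. nrm E (u r - u s)) \<longlongrightarrow> 0) (at s within I) \<longleftrightarrow>
      (\<forall>e>0. \<exists>d>0. \<forall>r\<in>I. r \<noteq> s \<and> \<bar>r - s\<bar> < d \<longrightarrow> \<bar>nrm E (u r - u s)\<bar> < e)"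
      unfolding tendsto_iff eventually_at dist_real_def by simp
    then show ?thesis using * by (simp cong: imp_cong)
  qed
  then show ?thesis unfolding continuous_path_def by blast
qed

lemma continuous_pathD: "continuous_path E I u \<Longrightarrow> s \<in> I \<Longrightarrow> u s \<in> carr E"
  by (simp add: continuous_path_def)

lemma continuous_pathI:
  assumes "\<And>s. s \<in> I \<Longrightarrow> u s \<in> carr E"
    and "\<And>s e. s \<in> I \<Longrightarrow> e > 0 \<Longrightarrow> \<exists>d>0. \<forall>r\<in>I. \<bar>r - s\<bar> < d \<longrightarrow> nrm E (u r - u s) < e"
  shows "continuous_path E I u"
  using assms by (simp add: continuous_path_iff)

lemma continuous_path_eps:
  assumes "continuous_path E I u" "s \<in> I" "e > 0"
  obtains d where "d > 0" "\<And>r. r \<in> I \<Longrightarrow> \<bar>r - s\<bar> < d \<Longrightarrow> nrm E (u r - u s) < e"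
  using assms unfolding continuous_path_iff by meson

lemma continuous_path_lim:
  "continuous_path E I u \<Longrightarrow> s \<in> I \<Longrightarrow> ((\<lambda>r. nrm E (u r - u s)) \<longlongrightarrow> 0) (at s within I)"
  by (simp add: continuous_path_def)

lemma continuous_path_subset: "continuous_path E I u \<Longrightarrow> J \<subseteq> I \<Longrightarrow> continuous_path E J u"
  unfolding continuous_path_def by (meson subsetD tendsto_within_subset)

lemma continuous_path_cong:
  assumes "\<And>s. s \<in> I \<Longrightarrow> u s = v s"
  shows "continuous_path E I u \<longleftrightarrow> continuous_path E I v"
  using assms unfolding continuous_path_iff by (simp cong: ball_cong)

lemma continuous_path_dominated:
  assumes "\<And>s. s \<in> I \<Longrightarrow> u s \<in> carr E"
    and "\<And>s. s \<in> I \<Longrightarrow> (m s \<longlongrightarrow> (0::real)) (at s within I)"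
    and "\<And>s r. s \<in> I \<Longrightarrow> r \<in> I \<Longrightarrow> r \<noteq> s \<Longrightarrow> nrm E (u r - u s) \<le> m s r"
  shows "continuous_path E I u"
proof -
  have "((\<lambda>r. nrm E (u r - u s)) \<longlongrightarrow> 0) (at s within I)" if s: "s \<in> I" for s
  proof (rule tendsto_sandwich[OF _ _ tendsto_const assms(2)[OF s]])
    show "\<forall>\<^sub>F r in at s within I. 0 \<le> nrm E (u r - u s)"
      unfolding eventually_at by (rule exI[of _ 1]) (use assms(1) s in \<open>auto intro!: nrm_nonneg\<close>)
    show "\<forall>\<^sub>F r in at s within I. nrm E (u r - u s) \<le> m s r"
      unfolding eventually_at by (rule exI[of _ 1]) (use assms(3) s in auto)
  qed
  then show ?thesis using assms(1) by (simp add: continuous_path_def)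
qed

lemma continuous_path_const: "x \<in> carr E \<Longrightarrow> continuous_path E I (\<lambda>s. x)"
  unfolding continuous_path_def by simp

lemma continuous_path_diff:
  assumes "continuous_path E I u" "continuous_path E I v"
  shows "continuous_path E I (\<lambda>s. u s - v s)"
proof (rule continuous_path_dominated)
  fix s assume s: "s \<in> I"
  show "u s - v s \<in> carr E" using assms s continuous_pathD by blast
  show "((\<lambda>r. nrm E (u r - u s) + nrm E (v r - v s)) \<longlongrightarrow> 0) (at s within I)"
    using tendsto_add[OF continuous_path_lim[OF assms(1) s] continuous_path_lim[OF assms(2) s]] by simp
  fix r assume r: "r \<in> I"
  have "u r - v r - (u s - v s) = (u r - u s) - (v r - v s)" by simp
  then show "nrm E (u r - v r - (u s - v s)) \<le> nrm E (u r - u s) + nrm E (v r - v s)"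
    using nrm_triangle_diff[of "u r - u s" "v r - v s"] assms s r continuous_pathD by (metis diff_in)
qed

lemma continuous_path_scale:
  assumes u: "continuous_path E I u"
  shows "continuous_path E I (\<lambda>s. sc c (u s))"
proof (rule continuous_path_dominated)
  fix s assume s: "s \<in> I"
  show "sc c (u s) \<in> carr E" using u s continuous_pathD by blast
  show "((\<lambda>r. norm c * nrm E (u r - u s)) \<longlongrightarrow> 0) (at s within I)"
    using tendsto_mult_left[OF continuous_path_lim[OF u s], of "norm c"] by simp
  fix r assume r: "r \<in> I"
  have "sc c (u r) - sc c (u s) = sc c (u r - u s)"
    by (simp add: module.scale_right_diff_distrib[OF module_sc])
  then show "nrm E (sc c (u r) - sc c (u s)) \<le> norm c * nrm E (u r - u s)"
    using nrm_scale[of "u r - u s" c] continuous_pathD[OF u s] continuous_pathD[OF u r] by simp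
qed

lemma continuous_path_scaleR:
  "continuous_path E I u \<Longrightarrow> continuous_path E I (\<lambda>s. r *\<^sub>R u s)"
  using continuous_path_scale[of I u "of_real r"] by (simp add: scale_of_real)

lemma continuous_path_add:
  assumes "continuous_path E I u" "continuous_path E I v"
  shows "continuous_path E I (\<lambda>s. u s + v s)"
  using continuous_path_diff[OF assms(1) continuous_path_scaleR[OF assms(2), of "-1"]] by simp

lemma continuous_path_compose:
  assumes u: "continuous_path E I u" and h: "continuous_on J h" "h ` J \<subseteq> I"
  shows "continuous_path E J (\<lambda>s. u (h s))"
proof (rule continuous_pathI)
  fix s assume s: "s \<in> J"
  then show "u (h s) \<in> carr E" using h continuous_pathD[OF u] by auto
  fix e :: real assume "e > 0"
  have hs: "h s \<in> I" using h s by auto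
  obtain d where d: "d > 0" "\<And>r. r \<in> I \<Longrightarrow> \<bar>r - h s\<bar> < d \<Longrightarrow> nrm E (u r - u (h s)) < e"
    using continuous_path_eps[OF u hs \<open>e > 0\<close>] by metis
  obtain d' where "d' > 0" "\<And>r. r \<in> J \<Longrightarrow> \<bar>r - s\<bar> < d' \<Longrightarrow> \<bar>h r - h s\<bar> < d"
    using h(1) s d(1) unfolding continuous_on_iff dist_real_def by meson
  then show "\<exists>d>0. \<forall>r\<in>J. \<bar>r - s\<bar> < d \<longrightarrow> nrm E (u (h r) - u (h s)) < e"
    using d(2) h(2) by (metis image_subset_iff)
qed

lemma continuous_on_nrm:
  assumes u: "continuous_path E I u"
  shows "continuous_on I (\<lambda>s. nrm E (u s))"
  unfolding continuous_on_def
proof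
  fix s assume s: "s \<in> I"
  have "((\<lambda>r. nrm E (u r) - nrm E (u s)) \<longlongrightarrow> 0) (at s within I)"
  proof (rule Lim_null_comparison[OF _ continuous_path_lim[OF u s]])
    show "\<forall>\<^sub>F r in at s within I. norm (nrm E (u r) - nrm E (u s)) \<le> nrm E (u r - u s)"
      unfolding eventually_at by (rule exI[of _ 1]) (use u s nrm_diff_abs continuous_pathD in auto)
  qed
  then show "((\<lambda>s. nrm E (u s)) \<longlongrightarrow> nrm E (u s)) (at s within I)" by (simp add: LIM_zero_iff)
qed

lemma continuous_path_uniform:
  assumes u: "continuous_path E I u" and "compact I" "e > 0"
  obtains d where "d > 0" "\<And>r s. r \<in> I \<Longrightarrow> s \<in> I \<Longrightarrow> \<bar>r - s\<bar> < d \<Longrightarrow> nrm E (u r - u s) < e"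
proof -
  have "\<exists>d>0. \<forall>r\<in>I. \<bar>r - s\<bar> < d \<longrightarrow> nrm E (u r - u s) < e / 2" if "s \<in> I" for s
    using conjunct2[OF u[unfolded continuous_path_iff]] that half_gt_zero[OF \<open>e > 0\<close>] by blast
  then obtain d where d: "\<And>s. s \<in> I \<Longrightarrow> d s > 0"
    "\<And>s r. s \<in> I \<Longrightarrow> r \<in> I \<Longrightarrow> \<bar>r - s\<bar> < d s \<Longrightarrow> nrm E (u r - u s) < e / 2" by metis
  have cover: "I \<subseteq> \<Union>((\<lambda>s. ball s (d s)) ` I)"
    using d(1) centre_in_ball by blast
  have opn: "open G" if "G \<in> (\<lambda>s. ball s (d s)) ` I" for G
    using that by auto
  obtain k where k: "k > 0" "\<And>x. x \<in> I \<Longrightarrow> \<exists>G\<in>(\<lambda>s. ball s (d s)) ` I. ball x k \<subseteq> G"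
    using Heine_Borel_lemma[OF \<open>compact I\<close> cover opn] by metis
  have "nrm E (u r - u s) < e" if r: "r \<in> I" and s: "s \<in> I" and rs: "\<bar>r - s\<bar> < k" for r s
  proof -
    obtain y where y: "y \<in> I" "ball s k \<subseteq> ball y (d y)" using k(2)[OF s] by auto
    have "s \<in> ball y (d y)" "r \<in> ball y (d y)"
      using y(2) k(1) rs by (auto simp: subset_iff dist_real_def abs_minus_commute)
    then have "nrm E (u r - u y) < e / 2" "nrm E (u s - u y) < e / 2"
      using d(2) y(1) r s by (auto simp: dist_real_def abs_minus_commute)
    moreover have "u r \<in> carr E" "u s \<in> carr E" "u y \<in> carr E"
      using continuous_pathD[OF u] r s y by auto
    ultimately show ?thesis
      using nrm_triangle_mid[of "u r" "u y" "u s"] nrm_commute[of "u s" "u y"] by auto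
  qed
  with k(1) that show thesis by blast
qed

end

text \<open>
  The locale form of \<open>banach_on\<close>, with the vector space axioms for the scalar multiplication
  added.
\<close>

locale banach_space_on = normed_space_on sc E
  for sc :: "'k::real_normed_field \<Rightarrow> 'v::real_vector \<Rightarrow> 'v" and E +
  assumes complete: "\<And>s :: nat \<Rightarrow> 'v. (\<And>n. s n \<in> carr E) \<Longrightarrow>
     (\<And>e. e > 0 \<Longrightarrow> \<exists>N. \<forall>m\<ge>N. \<forall>n\<ge>N. nrm E (s m - s n) < e) \<Longrightarrow>
     \<exists>x\<in>carr E. (\<lambda>n. nrm E (s n - x)) \<longlonglongrightarrow> 0"

lemma banach_space_onI:
  assumes "vector_space sc" "\<And>r x. sc (of_real r) x = r *\<^sub>R x" "banach_on sc E"
  shows "banach_space_on sc E"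
  using assms unfolding banach_on_def
  by unfold_locales (simp_all add: vector_space_def)

lemma (in banach_space_on) banach_on: "banach_on sc E"
  using carr_subspace nrm_nonneg nrm_eq_0 nrm_triangle nrm_scale complete
  unfolding banach_on_def by metis

section \<open>Integrals with values in a smaller space\<close>

text \<open>
  The error of the equidistant left Riemann sum of a continuous function whose oscillation on
  intervals of the mesh size is at most \<open>e\<close>.
\<close>

lemma riemann_sums_error:
  fixes g :: "real \<Rightarrow> 'b::banach"
  assumes g: "continuous_on {a..b} g" and ab: "a \<le> b" and n: "n > 0"
    and osc: "\<And>r s. r \<in> {a..b} \<Longrightarrow> s \<in> {a..b} \<Longrightarrow> \<bar>r - s\<bar> \<le> (b - a) / real n \<Longrightarrow> norm (g r - g s) \<le> e"
  shows "norm (integral {a..b} g - (\<Sum>i<n. ((b - a) / real n) *\<^sub>R g (a + real i * ((b - a) / real n)))) \<le> (b - a) * e"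
proof -
  define h where "h = (b - a) / real n"
  have h: "h \<ge> 0" "real n * h = b - a" using ab n by (auto simp: h_def)
  have le: "a + real i * h \<le> b" if "i \<le> n" for i
  proof -
    have "real i * h \<le> real n * h" using that h by (intro mult_right_mono) auto
    then show ?thesis using h by simp
  qed
  have "norm (integral {a..a + real i * h} g - (\<Sum>j<i. h *\<^sub>R g (a + real j * h))) \<le> real i * h * e"
    if "i \<le> n" for i using that
  proof (induction i)
    case (Suc i)
    let ?l = "a + real i * h" and ?u = "a + real (Suc i) * h"
    have lu: "?l \<le> ?u" "?u \<le> b" "a \<le> ?l" "?u - ?l = h"
      using le[OF Suc.prems] h by (auto simp: algebra_simps)
    have "{?l..?u} \<subseteq> {a..b}" using lu(2,3) by (simp only: atLeastatMost_subset_iff) simp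
    then have c: "continuous_on {?l..?u} g" by (rule continuous_on_subset[OF g])
    have "integral {a..?l} g + integral {?l..?u} g = integral {a..?u} g"
    proof (intro Henstock_Kurzweil_Integration.integral_combine integrable_continuous_interval
        continuous_on_subset[OF g])
      show "{a..?u} \<subseteq> {a..b}" using lu(2) by (simp only: atLeastatMost_subset_iff) simp
    qed (use lu in simp_all)
    moreover have "norm (integral {?l..?u} g - h *\<^sub>R g ?l) \<le> h * e"
    proof -
      have "integral {?l..?u} (\<lambda>s. g s - g ?l) = integral {?l..?u} g - h *\<^sub>R g ?l"
        using lu c by (subst integral_diff) (simp_all add: integrable_continuous_interval)
      moreover have "norm (integral {?l..?u} (\<lambda>s. g s - g ?l)) \<le> e * (?u - ?l)"
      proof (rule integral_bound)
        show "norm (g t - g ?l) \<le> e" if "t \<in> {?l..?u}" for t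
        proof (rule osc)
          show "t \<in> {a..b}" "?l \<in> {a..b}" "\<bar>t - ?l\<bar> \<le> (b - a) / real n"
            using that lu unfolding atLeastAtMost_iff h_def[symmetric] by linarith+
        qed
      qed (use lu in \<open>simp_all only: continuous_intros c\<close>)
      ultimately show ?thesis using lu by (simp add: mult.commute)
    qed
    moreover have "norm (integral {a..?l} g - (\<Sum>j<i. h *\<^sub>R g (a + real j * h))) \<le> real i * h * e"
      using Suc by simp
    ultimately have "norm ((integral {a..?l} g - (\<Sum>j<i. h *\<^sub>R g (a + real j * h))) +
        (integral {?l..?u} g - h *\<^sub>R g ?l)) \<le> real i * h * e + h * e"
      by (intro norm_triangle_mono)
    moreover have "(integral {a..?l} g - (\<Sum>j<i. h *\<^sub>R g (a + real j * h))) +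
        (integral {?l..?u} g - h *\<^sub>R g ?l) = integral {a..?u} g - (\<Sum>j<Suc i. h *\<^sub>R g (a + real j * h))"
      using \<open>integral {a..?l} g + integral {?l..?u} g = integral {a..?u} g\<close> by (simp add: algebra_simps)
    ultimately show ?case by (simp add: algebra_simps)
  qed (use h in auto)
  from this[of n] show ?thesis using h by (simp add: h_def)
qed

lemma riemann_sums_tendsto:
  fixes g :: "real \<Rightarrow> 'b::banach"
  assumes g: "continuous_on {a..b} g" and ab: "a \<le> b"
  shows "(\<lambda>n. \<Sum>i<n. ((b - a) / real n) *\<^sub>R g (a + real i * ((b - a) / real n))) \<longlonglongrightarrow> integral {a..b} g"
proof (rule metric_LIMSEQ_I)
  fix e :: real assume "e > 0"
  define e' where "e' = e / (2 * (b - a + 1))"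
  have e': "e' > 0" "(b - a) * e' < e"
  proof -
    show "e' > 0" using \<open>e > 0\<close> ab by (simp add: e'_def)
    have "(b - a) * e' \<le> (b - a + 1) * e'" using \<open>e' > 0\<close> by (simp add: algebra_simps)
    also have "\<dots> = e / 2" using ab by (simp add: e'_def divide_simps)
    finally show "(b - a) * e' < e" using \<open>e > 0\<close> by simp
  qed
  obtain d where d: "d > 0" "\<And>r s. r \<in> {a..b} \<Longrightarrow> s \<in> {a..b} \<Longrightarrow> \<bar>r - s\<bar> < d \<Longrightarrow> norm (g r - g s) < e'"
    using compact_uniformly_continuous[OF g compact_Icc] e'(1)
    unfolding uniformly_continuous_on_def dist_norm by (metis abs_minus_commute real_norm_def)
  obtain N :: nat where N: "N > 0" "(b - a) / d < real N"
    by (metis gr0I of_nat_0_less_iff order_le_less_trans order_less_le_trans reals_Archimedean2 of_nat_0 ab d(1) diff_ge_0_iff_ge divide_nonneg_pos)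
  have "dist (\<Sum>i<n. ((b - a) / real n) *\<^sub>R g (a + real i * ((b - a) / real n))) (integral {a..b} g) < e"
    if "n \<ge> N" for n
  proof -
    have n: "n > 0" "(b - a) / real n < d"
    proof -
      show "n > 0" using N that by simp
      have "(b - a) / d < real n" using N(2) that by linarith
      then show "(b - a) / real n < d" using d(1) \<open>n > 0\<close> by (simp add: field_simps)
    qed
    have "norm (integral {a..b} g - (\<Sum>i<n. ((b - a) / real n) *\<^sub>R g (a + real i * ((b - a) / real n)))) \<le> (b - a) * e'"
      using riemann_sums_error[OF g ab n(1), of e'] d(2) n(2) by (meson less_eq_real_def order_le_less_trans)
    then show ?thesis using e'(2) by (simp add: dist_norm norm_minus_commute)
  qed
  then show "\<exists>N. \<forall>n\<ge>N. dist (\<Sum>i<n. ((b - a) / real n) *\<^sub>R g (a + real i * ((b - a) / real n))) (integral {a..b} g) < e"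
    by blast
qed

text \<open>
  A Banach space continuously embedded in the ambient Banach space of the type. Integrals of
  \<open>E\<close>-valued functions are integrals in the ambient space; they have to be shown to lie in \<open>E\<close>.
\<close>

locale embedded_banach_space = banach_space_on sc E
  for sc :: "'k::real_normed_field \<Rightarrow> 'v::banach \<Rightarrow> 'v" and E +
  fixes emb :: real
  assumes embedding: "\<And>x. x \<in> carr E \<Longrightarrow> norm x \<le> emb * nrm E x" and emb_pos: "emb > 0"
begin

lemma continuous_on_path:
  assumes u: "continuous_path E I u"
  shows "continuous_on I u"
  unfolding continuous_on_def
proof
  fix s assume s: "s \<in> I"
  have "((\<lambda>r. u r - u s) \<longlongrightarrow> 0) (at s within I)"
  proof (rule Lim_null_comparison)
    show "((\<lambda>r. emb * nrm E (u r - u s)) \<longlongrightarrow> 0) (at s within I)"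
      using tendsto_mult_left[OF continuous_path_lim[OF u s], of emb] by simp
    show "\<forall>\<^sub>F r in at s within I. norm (u r - u s) \<le> emb * nrm E (u r - u s)"
      unfolding eventually_at by (rule exI[of _ 1]) (use u s continuous_pathD in \<open>auto intro!: embedding\<close>)
  qed
  then show "(u \<longlongrightarrow> u s) (at s within I)" by (simp add: LIM_zero_iff)
qed

lemma limit_unique:
  assumes "(\<lambda>n. nrm E (s n - x)) \<longlonglongrightarrow> 0" "\<And>n. s n \<in> carr E" "x \<in> carr E" "s \<longlonglongrightarrow> y"
  shows "x = y"
proof -
  have "(\<lambda>n. s n - x) \<longlonglongrightarrow> 0"
  proof (rule Lim_null_comparison)
    show "(\<lambda>n. emb * nrm E (s n - x)) \<longlonglongrightarrow> 0" using tendsto_mult_left[OF assms(1), of emb] by simp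
    show "\<forall>\<^sub>F n in sequentially. norm (s n - x) \<le> emb * nrm E (s n - x)"
      using embedding[OF diff_in[OF assms(2,3)]] by simp
  qed
  then show ?thesis using assms(4) LIMSEQ_unique by (metis Lim_null)
qed

lemma nrm_lim:
  assumes "(\<lambda>n. nrm E (s n - x)) \<longlonglongrightarrow> 0" "\<And>n. s n \<in> carr E" "x \<in> carr E"
  shows "(\<lambda>n. nrm E (s n)) \<longlonglongrightarrow> nrm E x"
proof -
  have "(\<lambda>n. nrm E (s n) - nrm E x) \<longlonglongrightarrow> 0"
    by (rule Lim_null_comparison[OF _ assms(1)]) (use assms nrm_diff_abs in auto)
  then show ?thesis by (simp add: LIM_zero_iff)
qed

text \<open>
  The Riemann sums \<open>S n\<close> are Cauchy in \<open>E\<close>, and their limit in \<open>E\<close> agrees with the ambient limit,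
  which is the integral.
\<close>

lemma integral_path_Icc:
  assumes w: "continuous_path E {a..b} w" and ab: "a \<le> b"
  shows "integral {a..b} w \<in> carr E"
    and "nrm E (integral {a..b} w) \<le> integral {a..b} (\<lambda>s. nrm E (w s))"
proof -
  define t where "t n i = a + real i * ((b - a) / real n)" for n i
  define S where "S n = (\<Sum>i<n. ((b - a) / real n) *\<^sub>R w (t n i))" for n
  have tin: "t n i \<in> {a..b}" if "i < n" for n i
  proof -
    have "real i * ((b - a) / real n) \<le> real n * ((b - a) / real n)"
      using that ab by (intro mult_right_mono) auto
    then show ?thesis using ab that by (auto simp: t_def)
  qed
  have wt: "w (t n i) \<in> carr E" if "i < n" for n i
    using continuous_pathD[OF w tin[OF that]] .
  have Sin: "S n \<in> carr E" for n unfolding S_def using wt by auto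
  \<comment> \<open>comparing \<open>S m\<close> and \<open>S n\<close> with \<open>S (n * m)\<close>, whose partition is a common refinement\<close>
  have refine: "nrm E (S (n * m) - S n) \<le> (b - a) * e"
    if osc: "\<And>r s. r \<in> {a..b} \<Longrightarrow> s \<in> {a..b} \<Longrightarrow> \<bar>r - s\<bar> < d \<Longrightarrow> nrm E (w r - w s) < e"
      and n: "n > 0" "m > 0" "(b - a) / real n < d" for n m d e
  proof -
    let ?k = "(b - a) / real (n * m)"
    have k: "?k \<ge> 0" using ab by simp
    have "S (n * m) = (\<Sum>i<n. \<Sum>l = i * m..<i * m + m. ?k *\<^sub>R w (t (n * m) l))"
      unfolding S_def by (rule sum.nat_group[symmetric])
    moreover have "S n = (\<Sum>i<n. \<Sum>l = i * m..<i * m + m. ?k *\<^sub>R w (t n i))"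
      unfolding S_def using n by (simp add: sum_constant_scaleR)
    ultimately have "S (n * m) - S n = (\<Sum>i<n. \<Sum>l = i * m..<i * m + m. ?k *\<^sub>R (w (t (n * m) l) - w (t n i)))"
      by (simp add: sum_subtractf scaleR_diff_right)
    moreover have "nrm E \<dots> \<le> (\<Sum>i<n. \<Sum>l = i * m..<i * m + m. ?k * e)"
    proof -
      have *: "w (t (n * m) l) - w (t n i) \<in> carr E \<and> nrm E (w (t (n * m) l) - w (t n i)) \<le> e"
        if il: "i < n" "l \<in> {i * m..<i * m + m}" for i l
      proof -
        have "l < n * m"
        proof -
          have "Suc i * m \<le> n * m" using il by (intro mult_le_mono1) simp
          then show ?thesis using il(2) by auto
        qed
        have e1: "t (n * m) l - t n i = (real l - real i * real m) * ?k"
          using n by (simp add: t_def field_simps)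
        have "0 \<le> real l - real i * real m" "real l - real i * real m < real m"
          using il(2) by (auto simp flip: of_nat_mult of_nat_add)
        then have "0 \<le> t (n * m) l - t n i" "t (n * m) l - t n i \<le> real m * ?k"
          unfolding e1 using k by (simp_all only: mult_nonneg_nonneg mult_right_mono less_imp_le)
        moreover have "real m * ?k = (b - a) / real n" using n by simp
        ultimately have "\<bar>t (n * m) l - t n i\<bar> < d" using n by linarith
        then show ?thesis using osc[of "t (n*m) l" "t n i"] tin \<open>l < n * m\<close> il wt by (meson diff_in less_imp_le)
      qed
      have "nrm E (\<Sum>i<n. \<Sum>l = i * m..<i * m + m. ?k *\<^sub>R (w (t (n * m) l) - w (t n i)))
        \<le> (\<Sum>i<n. nrm E (\<Sum>l = i * m..<i * m + m. ?k *\<^sub>R (w (t (n * m) l) - w (t n i))))"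
        by (rule nrm_sum) (use * in auto)
      also have "\<dots> \<le> (\<Sum>i<n. \<Sum>l = i * m..<i * m + m. nrm E (?k *\<^sub>R (w (t (n * m) l) - w (t n i))))"
        by (intro sum_mono nrm_sum) (use * in auto)
      also have "\<dots> \<le> (\<Sum>i<n. \<Sum>l = i * m..<i * m + m. ?k * e)"
      proof (intro sum_mono)
        fix i l assume "i \<in> {..<n}" "l \<in> {i * m..<i * m + m}"
        then have "w (t (n * m) l) - w (t n i) \<in> carr E" "nrm E (w (t (n * m) l) - w (t n i)) \<le> e"
          using * by auto
        then show "nrm E (?k *\<^sub>R (w (t (n * m) l) - w (t n i))) \<le> ?k * e"
          using k by (simp only: nrm_scaleR abs_of_nonneg mult_left_mono)
      qed
      finally show ?thesis .
    qed
    moreover have "(\<Sum>i<n. \<Sum>l = i * m..<i * m + m. ?k * e) = (b - a) * e" using n by simp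
    ultimately show ?thesis by simp
  qed
  have cauchy: "\<exists>N. \<forall>m\<ge>N. \<forall>n\<ge>N. nrm E (S m - S n) < e" if "e > 0" for e
  proof -
    define e' where "e' = e / (4 * (b - a + 1))"
    have e'0: "e' > 0" using \<open>e > 0\<close> ab by (simp add: e'_def)
    have "(b - a) * e' \<le> (b - a + 1) * e'" using e'0 by (simp add: algebra_simps)
    also have "\<dots> = e / 4" using ab by (simp add: e'_def divide_simps)
    finally have e'1: "2 * ((b - a) * e') < e" using \<open>e > 0\<close> by simp
    obtain d where d: "d > 0" "\<And>r s. r \<in> {a..b} \<Longrightarrow> s \<in> {a..b} \<Longrightarrow> \<bar>r - s\<bar> < d \<Longrightarrow> nrm E (w r - w s) < e'"
      using continuous_path_uniform[OF w compact_Icc e'0] by metis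
    obtain N :: nat where N: "(b - a) / d < real N" using reals_Archimedean2 by blast
    have big: "n > 0 \<and> (b - a) / real n < d" if "n \<ge> N" for n
    proof -
      have "(b - a) / d < real n" using N that by linarith
      moreover have "0 \<le> (b - a) / d" using ab d by simp
      ultimately have "n > 0" by (metis gr0I of_nat_0 leD)
      then show ?thesis using \<open>(b - a) / d < real n\<close> d(1) by (simp add: field_simps)
    qed
    have "nrm E (S m - S n) < e" if "m \<ge> N" "n \<ge> N" for m n
    proof -
      have "nrm E (S (n * m) - S n) \<le> (b - a) * e'" "nrm E (S (m * n) - S m) \<le> (b - a) * e'"
        using refine[OF d(2)] big that by blast+
      then have "nrm E (S m - S n) \<le> 2 * ((b - a) * e')"
        using nrm_triangle_mid[OF Sin[of m] Sin[of "n * m"] Sin[of n]]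
          nrm_commute[OF Sin[of m] Sin[of "n * m"]] by (simp only: mult.commute[of m n])
      then show ?thesis using e'1 by simp
    qed
    then show ?thesis by blast
  qed
  obtain x where x: "x \<in> carr E" "(\<lambda>n. nrm E (S n - x)) \<longlonglongrightarrow> 0"
    using complete[of S, OF Sin cauchy] by blast
  have "S \<longlonglongrightarrow> integral {a..b} w"
    unfolding S_def t_def by (rule riemann_sums_tendsto[OF continuous_on_path[OF w] ab])
  then have xi: "x = integral {a..b} w" using limit_unique[OF x(2) Sin x(1)] by simp
  then show "integral {a..b} w \<in> carr E" using x by simp
  have "(\<lambda>n. nrm E (S n)) \<longlonglongrightarrow> nrm E x" by (rule nrm_lim[OF x(2) Sin x(1)])
  moreover have "(\<lambda>n. \<Sum>i<n. ((b - a) / real n) *\<^sub>R nrm E (w (t n i))) \<longlonglongrightarrow> integral {a..b} (\<lambda>s. nrm E (w s))"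
    unfolding t_def by (rule riemann_sums_tendsto[OF continuous_on_nrm[OF w] ab])
  moreover have "nrm E (S n) \<le> (\<Sum>i<n. ((b - a) / real n) *\<^sub>R nrm E (w (t n i)))" for n
  proof -
    have "nrm E (S n) \<le> (\<Sum>i<n. nrm E (((b - a) / real n) *\<^sub>R w (t n i)))"
      unfolding S_def by (rule nrm_sum) (use wt in auto)
    also have "\<dots> = (\<Sum>i<n. ((b - a) / real n) *\<^sub>R nrm E (w (t n i)))"
      using wt ab by (intro sum.cong) (auto simp: nrm_scaleR)
    finally show ?thesis .
  qed
  ultimately show "nrm E (integral {a..b} w) \<le> integral {a..b} (\<lambda>s. nrm E (w s))"
    unfolding xi by (meson LIMSEQ_le)
qed

end

section \<open>Dominated improper integrals\<close>

text \<open>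
  A function that can be squeezed between integrable functions up to an error of small integral is
  integrable. For vector values the squeezing is expressed by an integrable bound on the distance.
\<close>

lemma integrable_on_cbox_approx:
  fixes f :: "'n::euclidean_space \<Rightarrow> 'b::banach"
  assumes approx: "\<And>e. e > 0 \<Longrightarrow> \<exists>g h. g integrable_on cbox a b \<and> h integrable_on cbox a b \<and>
     (\<forall>x\<in>cbox a b. norm (f x - g x) \<le> h x) \<and> integral (cbox a b) h < e"
  shows "f integrable_on cbox a b"
  unfolding integrable_Cauchy
proof (intro allI impI)
  fix e :: real assume "e > 0"
  then have e8: "e / 8 > 0" by simp
  obtain g h where g: "g integrable_on cbox a b" and h: "h integrable_on cbox a b"
    and fg: "\<And>x. x \<in> cbox a b \<Longrightarrow> norm (f x - g x) \<le> h x" and small: "integral (cbox a b) h < e / 8"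
    using approx[OF e8] by metis
  obtain \<gamma>1 where \<gamma>1: "gauge \<gamma>1" "\<And>D. D tagged_division_of (cbox a b) \<Longrightarrow> \<gamma>1 fine D \<Longrightarrow>
      norm ((\<Sum>(x,K)\<in>D. measure lborel K *\<^sub>R g x) - integral (cbox a b) g) < e / 8"
    using integrable_integral[OF g] e8 unfolding has_integral by metis
  obtain \<gamma>2 where \<gamma>2: "gauge \<gamma>2" "\<And>D. D tagged_division_of (cbox a b) \<Longrightarrow> \<gamma>2 fine D \<Longrightarrow>
      norm ((\<Sum>(x,K)\<in>D. measure lborel K *\<^sub>R h x) - integral (cbox a b) h) < e / 8"
    using integrable_integral[OF h] e8 unfolding has_integral by metis
  have close: "norm ((\<Sum>(x,K)\<in>D. measure lborel K *\<^sub>R f x) - integral (cbox a b) g) < 3 * e / 8"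
    if D: "D tagged_division_of (cbox a b)" "(\<lambda>x. \<gamma>1 x \<inter> \<gamma>2 x) fine D" for D
  proof -
    have fine: "\<gamma>1 fine D" "\<gamma>2 fine D" using D(2) by (auto simp: fine_Int)
    have "norm ((\<Sum>(x,K)\<in>D. measure lborel K *\<^sub>R f x) - (\<Sum>(x,K)\<in>D. measure lborel K *\<^sub>R g x))
        = norm (\<Sum>(x,K)\<in>D. measure lborel K *\<^sub>R (f x - g x))"
      by (simp add: sum_subtractf[symmetric] scaleR_diff_right case_prod_unfold)
    also have "\<dots> \<le> (\<Sum>(x,K)\<in>D. measure lborel K *\<^sub>R h x)"
    proof (rule sum_norm_le, clarify)
      fix x K assume "(x, K) \<in> D"
      then have "x \<in> cbox a b" using D(1) by (metis tagged_division_ofD(2,3) subsetD)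
      then show "norm (measure lborel K *\<^sub>R (f x - g x)) \<le> measure lborel K *\<^sub>R h x"
        using fg by (simp add: mult_left_mono)
    qed
    also have "\<dots> < 2 * (e / 8)"
      using \<gamma>2(2)[OF D(1) fine(2)] small unfolding real_norm_def by linarith
    finally have "norm ((\<Sum>(x,K)\<in>D. measure lborel K *\<^sub>R f x) - (\<Sum>(x,K)\<in>D. measure lborel K *\<^sub>R g x)) < 2 * (e / 8)" .
    note norm_triangle_lt[OF add_strict_mono[OF this \<gamma>1(2)[OF D(1) fine(1)]]]
    then show ?thesis by simp
  qed
  have fin: "norm ((\<Sum>(x,K)\<in>D1. measure lborel K *\<^sub>R f x) - (\<Sum>(x,K)\<in>D2. measure lborel K *\<^sub>R f x)) < e"
    if "D1 tagged_division_of (cbox a b)" "(\<lambda>x. \<gamma>1 x \<inter> \<gamma>2 x) fine D1"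
      "D2 tagged_division_of (cbox a b)" "(\<lambda>x. \<gamma>1 x \<inter> \<gamma>2 x) fine D2" for D1 D2
  proof -
    have "norm ((\<Sum>(x,K)\<in>D1. measure lborel K *\<^sub>R f x) - (\<Sum>(x,K)\<in>D2. measure lborel K *\<^sub>R f x)) < 3 * e / 8 + 3 * e / 8"
      by (rule norm_diff_triangle_less[OF close[OF that(1,2)] close[OF that(3,4), unfolded norm_minus_commute[of _ "integral (cbox a b) g"]]])
    then show ?thesis using \<open>e > 0\<close> by simp
  qed
  then show "\<exists>\<gamma>. gauge \<gamma> \<and> (\<forall>D1 D2. D1 tagged_division_of (cbox a b) \<and> \<gamma> fine D1 \<and>
            D2 tagged_division_of (cbox a b) \<and> \<gamma> fine D2 \<longrightarrow>
            norm ((\<Sum>(x,K)\<in>D1. measure lborel K *\<^sub>R f x) - (\<Sum>(x,K)\<in>D2. measure lborel K *\<^sub>R f x)) < e)"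
    by (intro exI[of _ "\<lambda>x. \<gamma>1 x \<inter> \<gamma>2 x"] conjI gauge_Int[OF \<gamma>1(1) \<gamma>2(1)] allI impI) (simp only: fin)
qed

text \<open>
  Integrability of the limit is part of the conclusion. The functions take values in an arbitrary
  Banach space, and no measurability of \<open>f\<close> is assumed.
\<close>

lemma dominated_limit_integrable:
  fixes f :: "'n::euclidean_space \<Rightarrow> 'b::banach"
  assumes F: "\<And>n::nat. F n integrable_on S" and h: "\<And>n. h n integrable_on S"
    and le: "\<And>n x. x \<in> S \<Longrightarrow> norm (f x - F n x) \<le> h n x"
    and lim: "(\<lambda>n. integral S (h n)) \<longlonglongrightarrow> 0"
    and g: "g integrable_on S" and dom: "\<And>x. x \<in> S \<Longrightarrow> norm (f x) \<le> g x"
  shows "f integrable_on S" and "(\<lambda>n. integral S (F n)) \<longlonglongrightarrow> integral S f"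
proof -
  show f: "f integrable_on S"
  proof (rule integrable_on_all_intervals_integrable_bound[OF _ dom g])
    fix a b :: 'n
    show "(\<lambda>x. if x \<in> S then f x else 0) integrable_on cbox a b"
    proof (rule integrable_on_cbox_approx)
      fix e :: real assume "e > 0"
      then obtain n where n: "\<bar>integral S (h n)\<bar> < e"
        using LIMSEQ_D[OF lim] by force
      let ?h = "\<lambda>x. if x \<in> S then h n x else 0" and ?F = "\<lambda>x. if x \<in> S then F n x else 0"
      have nn: "0 \<le> ?h x" for x using order_trans[OF norm_ge_zero le[of x n]] by simp
      have "integral (cbox a b) ?h \<le> integral UNIV ?h"
        using nn h[of n] by (intro integral_subset_le integrable_altD(1)) (auto simp: integrable_restrict_UNIV)
      then have "integral (cbox a b) ?h < e" using n by (simp add: integral_restrict_UNIV)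
      then show "\<exists>g h. g integrable_on cbox a b \<and> h integrable_on cbox a b \<and>
         (\<forall>x\<in>cbox a b. norm ((if x \<in> S then f x else 0) - g x) \<le> h x) \<and> integral (cbox a b) h < e"
        using integrable_altD(1)[OF F[of n]] integrable_altD(1)[OF h[of n]] le
        by (intro exI[of _ ?F] exI[of _ ?h]) auto
    qed
  qed
  have "(\<lambda>n. integral S (F n) - integral S f) \<longlonglongrightarrow> 0"
  proof (rule Lim_null_comparison[OF _ lim], rule always_eventually, rule allI)
    fix n
    have "norm (integral S (\<lambda>x. f x - F n x)) \<le> integral S (h n)"
      by (intro integral_norm_bound_integral integrable_diff f F h le)
    then show "norm (integral S (F n) - integral S f) \<le> integral S (h n)"
      by (simp add: integral_diff f F norm_minus_commute)
  qed
  then show "(\<lambda>n. integral S (F n)) \<longlonglongrightarrow> integral S f" by (simp add: LIM_zero_iff)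
qed

lemma has_integral_affine_UNIV:
  fixes f :: "real \<Rightarrow> 'b::real_normed_vector"
  assumes f: "(f has_integral z) UNIV" and m: "m \<noteq> 0"
  shows "((\<lambda>x. f (m * x + c)) has_integral (1 / \<bar>m\<bar>) *\<^sub>R z) UNIV"
proof -
  have nb: "\<not> (\<exists>a b. (UNIV :: real set) = cbox a b)"
    by (metis bounded_cbox not_bounded_UNIV)
  have "\<exists>B>0. \<forall>a b. ball 0 B \<subseteq> cbox a b \<longrightarrow>
      (\<exists>y. ((\<lambda>x. if x \<in> UNIV then f (m * x + c) else 0) has_integral y) (cbox a b) \<and>
        norm (y - (1 / \<bar>m\<bar>) *\<^sub>R z) < e)" if "e > 0" for e
  proof -
    have "e * \<bar>m\<bar> > 0" using that m by simp
    then obtain B where B: "B > 0" "\<And>a b. ball 0 B \<subseteq> cbox a b \<Longrightarrow>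
        \<exists>y. (f has_integral y) (cbox a b) \<and> norm (y - z) < e * \<bar>m\<bar>"
      using has_integral_altD[OF f nb, of "e * \<bar>m\<bar>"] by (auto simp del: subset_iff)
    define B' where "B' = (B + \<bar>c\<bar>) / \<bar>m\<bar>"
    have "\<exists>y. ((\<lambda>x. f (m * x + c)) has_integral y) (cbox a b) \<and> norm (y - (1 / \<bar>m\<bar>) *\<^sub>R z) < e"
      if ab: "ball 0 B' \<subseteq> cbox a b" for a b
    proof -
      have img: "\<exists>u v. (\<lambda>x. m * x + c) ` cbox a b = cbox u v"
        using interval_image_affinity_interval[of m c a b] by simp
      then obtain u v where uv: "(\<lambda>x. m * x + c) ` cbox a b = cbox u v" by blast
      have "ball 0 B \<subseteq> cbox u v"
      proof
        fix y :: real assume "y \<in> ball 0 B"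
        then have "\<bar>y - c\<bar> < B + \<bar>c\<bar>" by auto
        then have "(y - c) / m \<in> ball 0 B'"
          using m by (auto simp: B'_def divide_strict_right_mono)
        then have "(y - c) / m \<in> cbox a b" using ab by blast
        then have "m * ((y - c) / m) + c \<in> cbox u v" unfolding uv[symmetric] by blast
        then show "y \<in> cbox u v" using m by simp
      qed
      then obtain y where y: "(f has_integral y) (cbox u v)" "norm (y - z) < e * \<bar>m\<bar>"
        using B(2) by metis
      have pre: "(\<lambda>x. (1 / m) *\<^sub>R x + -((1 / m) *\<^sub>R c)) ` cbox u v = cbox a b"
        unfolding uv[symmetric] image_image using m by (simp add: field_simps)
      have "((\<lambda>x. f (m * x + c)) has_integral (1 / \<bar>m\<bar>) *\<^sub>R y) (cbox a b)"
        using has_integral_affinity[OF y(1) m, of c] unfolding pre by simp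
      moreover have "norm ((1 / \<bar>m\<bar>) *\<^sub>R y - (1 / \<bar>m\<bar>) *\<^sub>R z) < e"
      proof -
        have "norm ((1 / \<bar>m\<bar>) *\<^sub>R y - (1 / \<bar>m\<bar>) *\<^sub>R z) = norm (y - z) / \<bar>m\<bar>"
          by (simp add: scaleR_diff_right[symmetric])
        moreover have "norm (y - z) / \<bar>m\<bar> < e" using y(2) m by (simp add: pos_divide_less_eq)
        ultimately show ?thesis by simp
      qed
      ultimately show ?thesis by blast
    qed
    moreover have "B' > 0" using B(1) m by (simp add: B'_def)
    ultimately show ?thesis by auto
  qed
  then show ?thesis by (subst has_integral_alt) (use nb in auto)
qed

lemma has_integral_reflect_halfline:
  fixes k :: "real \<Rightarrow> 'b::banach"
  assumes k: "(k has_integral z) {0<..}"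
  shows "((\<lambda>s. k (t - s)) has_integral z) {..t}"
proof -
  have "((\<lambda>r. if r \<in> {0<..} then k r else 0) has_integral z) UNIV" using k unfolding has_integral_restrict_UNIV .
  from has_integral_affine_UNIV[OF this, of "-1" t]
  have "((\<lambda>s. if s \<in> {..<t} then k (t - s) else 0) has_integral z) UNIV"
    by (simp add: if_distrib cong: if_cong)
  then have "((\<lambda>s. k (t - s)) has_integral z) {..<t}" unfolding has_integral_restrict_UNIV .
  moreover have "negligible {s \<in> {..<t} - {..t}. k (t - s) \<noteq> 0}" "negligible {s \<in> {..t} - {..<t}. k (t - s) \<noteq> 0}"
    by (rule negligible_subset[of "{t}"]; auto)+
  ultimately show ?thesis using has_integral_spike_set_eq[of "{..<t}" "{..t}" "\<lambda>s. k (t - s)"] by simp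
qed

context embedded_banach_space begin

text \<open>
  The improper integral over \<open>{0<..}\<close> of a function with a possible singularity at \<open>0\<close>: the
  integrals over the compact intervals \<open>K n\<close> converge in \<open>E\<close> because those of the scalar bound \<open>b\<close>
  do.
\<close>

lemma integral_path_Ioi:
  assumes w: "continuous_path E {0<..} w" and b: "b integrable_on {0<..}"
    and wb: "\<And>r. r > 0 \<Longrightarrow> nrm E (w r) \<le> b r"
  shows "w integrable_on {0<..}" and "integral {0<..} w \<in> carr E"
    and "nrm E (integral {0<..} w) \<le> integral {0<..} b"
proof -
  define K where "K n = {1 / real (Suc n)..real (Suc n)}" for n
  have Ksub: "K n \<subseteq> {0<..}" for n
  proof
    fix r assume "r \<in> K n"
    then have "1 / real (Suc n) \<le> r" by (simp add: K_def)
    moreover have "0 < 1 / real (Suc n)" by simp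
    ultimately show "r \<in> {0<..}" by (simp only: greaterThan_iff order_less_le_trans)
  qed
  have Kmono: "K m \<subseteq> K n" if "m \<le> n" for m n
  proof -
    have "1 / real (Suc n) \<le> 1 / real (Suc m)" using that by (intro divide_left_mono) auto
    then show ?thesis using that by (auto simp: K_def)
  qed
  have wK: "continuous_path E (K n) w" for n by (rule continuous_path_subset[OF w Ksub])
  have win: "w r \<in> carr E" if "r > 0" for r using continuous_pathD[OF w] that by simp
  have bpos: "0 \<le> b r" if "r > 0" for r
    using nrm_nonneg[OF win[OF that]] wb[OF that] by simp
  define F where "F n r = (if r \<in> K n then w r else 0)" for n r
  define bK where "bK n r = (if r \<in> K n then b r else 0)" for n r
  define h where "h n r = emb * (b r - bK n r)" for n r
  have bint: "b integrable_on {c..d}" if "c > 0" for c d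
    by (rule integrable_on_subinterval[OF b]) (use that in auto)
  have bKint: "(bK n has_integral integral (K n) b) {0<..}" for n
    unfolding bK_def has_integral_restrict[OF Ksub] using bint[of "1 / real (Suc n)"] by (auto simp: K_def)
  have Fint: "(F n has_integral integral (K n) w) {0<..}" for n
    unfolding F_def has_integral_restrict[OF Ksub] using continuous_on_path[OF wK]
    by (auto simp: K_def intro: integrable_integral integrable_continuous_interval)
  have bKlim: "(\<lambda>n. integral {0<..} (bK n)) \<longlonglongrightarrow> integral {0<..} b"
  proof (rule conjunct2[OF monotone_convergence_increasing])
    show "bK n integrable_on {0<..}" for n using bKint by blast
    show "bK n r \<le> bK (Suc n) r" if "r \<in> {0<..}" for n r
      using Kmono[of n "Suc n"] bpos that by (auto simp: bK_def)
    show "(\<lambda>n. bK n r) \<longlonglongrightarrow> b r" if "r \<in> {0<..}" for r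
    proof (rule tendsto_eventually)
      have r: "r > 0" using that by simp
      obtain N :: nat where N: "r + 1 / r < real N" using reals_Archimedean2 by blast
      have "r \<in> K n" if "n \<ge> N" for n
      proof -
        have "r + 1 / r < real (Suc n)" using N that by simp
        moreover have "0 < 1 / r" using r by simp
        ultimately have "r < real (Suc n)" "1 / r < real (Suc n)" using r by linarith+
        then show ?thesis using r by (simp add: K_def field_simps)
      qed
      then show "\<forall>\<^sub>F n in sequentially. bK n r = b r"
        unfolding eventually_sequentially bK_def by auto
    qed
    have "integral {0<..} (bK n) \<in> {0..integral {0<..} b}" for n
    proof -
      have "0 \<le> integral {0<..} (bK n)"
        using bKint bpos by (intro integral_nonneg) (auto simp: bK_def)
      moreover have "integral {0<..} (bK n) \<le> integral {0<..} b"
        using bKint bpos b by (intro integral_le) (auto simp: bK_def)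
      ultimately show ?thesis by simp
    qed
    then show "bounded (range (\<lambda>n. integral {0<..} (bK n)))"
      by (intro bounded_subset[OF bounded_closed_interval[of 0 "integral {0<..} b"]]) auto
  qed
  then have lim: "(\<lambda>n. integral (K n) b) \<longlonglongrightarrow> integral {0<..} b"
    by (simp add: integral_unique[OF bKint])
  have hint: "(h n has_integral emb * (integral {0<..} b - integral (K n) b)) {0<..}" for n
    unfolding h_def using has_integral_diff[OF integrable_integral[OF b] bKint[of n]] by (rule has_integral_mult_right)
  have hlim: "(\<lambda>n. integral {0<..} (h n)) \<longlonglongrightarrow> 0"
  proof -
    have "(\<lambda>n. emb * (integral {0<..} b - integral (K n) b)) \<longlonglongrightarrow> emb * (integral {0<..} b - integral {0<..} b)"
      by (intro tendsto_intros lim)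
    then show ?thesis by (simp add: integral_unique[OF hint])
  qed
  have dom: "norm (w r) \<le> emb * b r" if "r \<in> {0<..}" for r
    using order_trans[OF embedding[OF win] mult_left_mono[OF wb]] emb_pos that by simp
  have le: "norm (w r - F n r) \<le> h n r" if "r \<in> {0<..}" for n r
    using dom[OF that] by (simp add: F_def h_def bK_def)
  have eb: "(\<lambda>r. emb * b r) integrable_on {0<..}" using b by (rule integrable_on_mult_right)
  note dl = dominated_limit_integrable[where f = w and F = F and h = h and S = "{0<..}", OF _ _ le hlim eb dom]
  show w_int: "w integrable_on {0<..}"
    by (rule dl(1)) (use Fint hint in blast)+
  have wlim: "(\<lambda>n. integral (K n) w) \<longlonglongrightarrow> integral {0<..} w"
  proof -
    have "(\<lambda>n. integral {0<..} (F n)) \<longlonglongrightarrow> integral {0<..} w"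
      by (rule dl(2)) (use Fint hint in blast)+
    then show ?thesis by (simp add: integral_unique[OF Fint])
  qed
  have Kin: "integral (K n) w \<in> carr E" for n
    unfolding K_def by (rule integral_path_Icc(1)) (use wK[of n] in \<open>auto simp: K_def field_simps\<close>)
  have piece: "nrm E (integral {c..d} w) \<le> integral {c..d} b \<and> integral {c..d} w \<in> carr E" if "0 < c" "c \<le> d" for c d
  proof -
    have p: "continuous_path E {c..d} w" by (rule continuous_path_subset[OF w]) (use that in auto)
    have "nrm E (integral {c..d} w) \<le> integral {c..d} (\<lambda>s. nrm E (w s))"
      by (rule integral_path_Icc(2)[OF p that(2)])
    also have "\<dots> \<le> integral {c..d} b"
      using that by (intro integral_le integrable_continuous_interval continuous_on_nrm p bint wb) auto
    finally show ?thesis using integral_path_Icc(1)[OF p that(2)] by simp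
  qed
  have diff: "nrm E (integral (K n) w - integral (K m) w) \<le> integral (K n) b - integral (K m) b"
    if mn: "m \<le> n" for m n
  proof -
    let ?a = "1 / real (Suc n)" and ?b = "1 / real (Suc m)" and ?c = "real (Suc m)" and ?d = "real (Suc n)"
    have o: "0 < ?a" "?a \<le> ?b" "?b \<le> ?c" "?c \<le> ?d"
      using mn by (auto simp: field_simps)
    have split: "integral {?a..?d} g = integral {?a..?b} g + integral {?b..?c} g + integral {?c..?d} g"
      if g: "g integrable_on {?a..?d}" for g :: "real \<Rightarrow> 'z::banach"
    proof -
      have "integral {?a..?b} g + integral {?b..?d} g = integral {?a..?d} g"
        by (rule Henstock_Kurzweil_Integration.integral_combine) (use o g in linarith)+
      moreover have "integral {?b..?c} g + integral {?c..?d} g = integral {?b..?d} g"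
        by (rule Henstock_Kurzweil_Integration.integral_combine)
          (use o in \<open>auto intro!: integrable_on_subinterval[OF g]\<close>)
      ultimately show ?thesis by (simp add: add.assoc)
    qed
    have cw: "continuous_on {?a..?d} w" using continuous_on_path[OF wK[of n]] by (simp add: K_def)
    have "integral (K n) w - integral (K m) w = integral {?a..?b} w + integral {?c..?d} w"
      unfolding K_def using split[OF integrable_continuous_interval[OF cw]] by simp
    moreover have "integral (K n) b - integral (K m) b = integral {?a..?b} b + integral {?c..?d} b"
      unfolding K_def using split[OF bint[OF o(1)]] by simp
    moreover have "nrm E (integral {?a..?b} w + integral {?c..?d} w) \<le> integral {?a..?b} b + integral {?c..?d} b"
      using nrm_triangle[of "integral {?a..?b} w" "integral {?c..?d} w"] piece[of ?a ?b] piece[of ?c ?d] o by linarith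
    ultimately show ?thesis by simp
  qed
  have "\<exists>N. \<forall>m\<ge>N. \<forall>n\<ge>N. nrm E (integral (K m) w - integral (K n) w) < e" if e: "e > 0" for e
  proof -
    obtain N where N: "\<And>m n. m \<ge> N \<Longrightarrow> n \<ge> N \<Longrightarrow> norm (integral (K m) b - integral (K n) b) < e"
      using LIMSEQ_imp_Cauchy[OF lim] e unfolding Cauchy_iff by blast
    have "nrm E (integral (K m) w - integral (K n) w) < e" if "m \<ge> N" "n \<ge> N" for m n
      using N[OF that] diff[of n m] diff[of m n] nrm_commute[OF Kin[of n] Kin[of m]]
      by (cases "n \<le> m") auto
    then show ?thesis by blast
  qed
  then obtain x where x: "x \<in> carr E" "(\<lambda>n. nrm E (integral (K n) w - x)) \<longlonglongrightarrow> 0"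
    using complete[of "\<lambda>n. integral (K n) w", OF Kin] by blast
  have xi: "x = integral {0<..} w" by (rule limit_unique[OF x(2) Kin x(1) wlim])
  then show "integral {0<..} w \<in> carr E" using x by simp
  have "nrm E (integral (K n) w) \<le> integral (K n) b" for n
    using piece[of "1 / real (Suc n)" "real (Suc n)"] by (simp add: K_def field_simps)
  then show "nrm E (integral {0<..} w) \<le> integral {0<..} b"
    unfolding xi[symmetric] using LIMSEQ_le[OF nrm_lim[OF x(2) Kin x(1)] lim] by blast
qed

end

section \<open>Convolution with a family of operators\<close>

text \<open>
  A strongly continuous family \<open>S r\<close>, \<open>r \<in> J\<close>, of bounded operators from \<open>V\<close> to \<open>E\<close> with norm at
  most \<open>\<kappa> r\<close>. For a smoothing semigroup \<open>J = {0<..}\<close>, and \<open>\<kappa>\<close> may be singular at \<open>0\<close>; for the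
  backward group \<open>J = {0..}\<close>.
\<close>

locale operator_family = E: embedded_banach_space sc E emb + V: normed_space_on sc V
  for sc :: "'k::real_normed_field \<Rightarrow> 'v::banach \<Rightarrow> 'v" and E emb V +
  fixes S :: "real \<Rightarrow> 'v \<Rightarrow> 'v" and J :: "real set" and \<kappa> :: "real \<Rightarrow> real"
  assumes op_linear: "\<And>r. r \<in> J \<Longrightarrow> linear_between sc sc (carr V) (carr E) (S r)"
    and op_bound: "\<And>r. r \<in> J \<Longrightarrow> opbound V E (S r) (\<kappa> r)"
    and orbit: "\<And>x. x \<in> carr V \<Longrightarrow> continuous_path E J (\<lambda>r. S r x)"
    and \<kappa>_cont: "continuous_on J \<kappa>" and \<kappa>_nonneg: "\<And>r. r \<in> J \<Longrightarrow> 0 \<le> \<kappa> r"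
    and scale_bounded: "\<And>c. bounded_linear (sc c)"
begin

lemma S_in: "r \<in> J \<Longrightarrow> x \<in> carr V \<Longrightarrow> S r x \<in> carr E"
  using op_linear by (simp add: linear_between_def)
lemma S_bound: "r \<in> J \<Longrightarrow> x \<in> carr V \<Longrightarrow> nrm E (S r x) \<le> \<kappa> r * nrm V x"
  using op_bound by (simp add: opbound_def)
lemma S_add: "r \<in> J \<Longrightarrow> x \<in> carr V \<Longrightarrow> y \<in> carr V \<Longrightarrow> S r (x + y) = S r x + S r y"
  using op_linear by (simp add: linear_between_def)
lemma S_scale: "r \<in> J \<Longrightarrow> x \<in> carr V \<Longrightarrow> S r (sc c x) = sc c (S r x)"
  using op_linear by (simp add: linear_between_def)
lemma S_diff: "r \<in> J \<Longrightarrow> x \<in> carr V \<Longrightarrow> y \<in> carr V \<Longrightarrow> S r (x - y) = S r x - S r y"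
  using S_add[of r x "- y"] S_scale[of r y "of_real (-1)"] V.minus_in[of y]
  unfolding V.scale_of_real by simp

lemma path_apply:
  assumes p: "continuous_path V I p" and IJ: "I \<subseteq> J"
  shows "continuous_path E I (\<lambda>r. S r (p r))"
proof (rule E.continuous_path_dominated)
  fix s assume s: "s \<in> I"
  have ps: "p s \<in> carr V" using V.continuous_pathD[OF p s] .
  show "S s (p s) \<in> carr E" using S_in ps s IJ by auto
  have \<kappa>s: "(\<kappa> \<longlongrightarrow> \<kappa> s) (at s within I)"
    using continuous_on_subset[OF \<kappa>_cont IJ] s by (simp add: continuous_on_def)
  have orb: "continuous_path E I (\<lambda>r. S r (p s))"
    by (rule E.continuous_path_subset[OF orbit[OF ps] IJ])
  have "((\<lambda>r. \<kappa> r * nrm V (p r - p s) + nrm E (S r (p s) - S s (p s))) \<longlongrightarrow> \<kappa> s * 0 + 0) (at s within I)"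
    by (intro tendsto_intros \<kappa>s V.continuous_path_lim[OF p s] E.continuous_path_lim[OF orb s])
  then show "((\<lambda>r. \<kappa> r * nrm V (p r - p s) + nrm E (S r (p s) - S s (p s))) \<longlongrightarrow> 0) (at s within I)"
    by simp
  fix r assume r: "r \<in> I"
  have pr: "p r \<in> carr V" using V.continuous_pathD[OF p r] .
  have rJ: "r \<in> J" "s \<in> J" using r s IJ by auto
  have "S r (p r) - S s (p s) = S r (p r - p s) + (S r (p s) - S s (p s))"
    using S_diff[OF rJ(1) pr ps] by simp
  moreover have "nrm E (S r (p r - p s) + (S r (p s) - S s (p s))) \<le> \<kappa> r * nrm V (p r - p s) + nrm E (S r (p s) - S s (p s))"
    using E.nrm_triangle[of "S r (p r - p s)" "S r (p s) - S s (p s)"] S_bound[OF rJ(1), of "p r - p s"]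
      S_in[OF rJ(1), of "p r - p s"] S_in[OF rJ(1) ps] S_in[OF rJ(2) ps] pr ps by (smt (verit) E.diff_in V.diff_in)
  ultimately show "nrm E (S r (p r) - S s (p s)) \<le> \<kappa> r * nrm V (p r - p s) + nrm E (S r (p s) - S s (p s))"
    by (simp only:)
qed

text \<open>
  The convolution of an operator family with a path of size \<open>exp (\<eta> * s)\<close> has the same exponential
  size. After the substitution \<open>s = t - r\<close> the singularity of the kernel stays at \<open>r = 0\<close>, so that
  continuity in \<open>t\<close> follows by dominated convergence.
\<close>

lemma convolution:
  assumes J: "J = {0<..}" and w: "continuous_path V {..0} w"
    and wb: "\<And>s. s \<le> 0 \<Longrightarrow> nrm V (w s) \<le> c * exp (\<eta> * s)"
    and k: "((\<lambda>r. \<kappa> r * exp (- \<eta> * r)) has_integral k) {0<..}"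
  shows "t \<le> 0 \<Longrightarrow> (\<lambda>s. S (t - s) (w s)) integrable_on {..t}"
    and "t \<le> 0 \<Longrightarrow> integral {..t} (\<lambda>s. S (t - s) (w s)) \<in> carr E"
    and "t \<le> 0 \<Longrightarrow> nrm E (integral {..t} (\<lambda>s. S (t - s) (w s))) \<le> c * k * exp (\<eta> * t)"
    and "continuous_path E {..0} (\<lambda>t. integral {..t} (\<lambda>s. S (t - s) (w s)))"
proof -
  let ?I = "\<lambda>t. integral {..t} (\<lambda>s. S (t - s) (w s))"
  let ?k = "\<lambda>t r. S r (w (t - r))"
  have wsh: "continuous_path V {0<..} (\<lambda>r. w (t - r))" if "t \<le> 0" for t
    by (rule V.continuous_path_compose[OF w]) (use that in \<open>auto intro!: continuous_intros\<close>)
  have kp: "continuous_path E {0<..} (?k t)" if "t \<le> 0" for t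
    by (rule path_apply[OF wsh[OF that]]) (simp add: J)
  have bint: "((\<lambda>r. \<kappa> r * (c * exp (\<eta> * (t - r)))) has_integral c * k * exp (\<eta> * t)) {0<..}" for t
    using has_integral_mult_right[OF k, of "c * exp (\<eta> * t)"]
    by (simp add: algebra_simps exp_diff exp_minus exp_add[symmetric] divide_inverse)
  have kb: "nrm E (?k t r) \<le> \<kappa> r * (c * exp (\<eta> * (t - r)))" if "t \<le> 0" "r > 0" for t r
  proof -
    have "nrm E (?k t r) \<le> \<kappa> r * nrm V (w (t - r))"
      using S_bound V.continuous_pathD[OF w] that J by auto
    also have "\<dots> \<le> \<kappa> r * (c * exp (\<eta> * (t - r)))"
      using wb[of "t - r"] that \<kappa>_nonneg J by (intro mult_left_mono) auto
    finally show ?thesis .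
  qed
  have res: "(?k t has_integral integral {0<..} (?k t)) {0<..}" "integral {0<..} (?k t) \<in> carr E"
    "nrm E (integral {0<..} (?k t)) \<le> c * k * exp (\<eta> * t)" if "t \<le> 0" for t
    using E.integral_path_Ioi[OF kp[OF that] has_integral_integrable[OF bint] kb[OF that]] integral_unique[OF bint[of t]]
    by (auto simp: integrable_integral)
  have sub: "((\<lambda>s. S (t - s) (w s)) has_integral integral {0<..} (?k t)) {..t}" if "t \<le> 0" for t
    using has_integral_reflect_halfline[OF res(1)[OF that], of t] by simp
  have I_eq: "?I t = integral {0<..} (?k t)" if "t \<le> 0" for t using integral_unique[OF sub[OF that]] .
  show "(\<lambda>s. S (t - s) (w s)) integrable_on {..t}" if "t \<le> 0" using sub[OF that] by blast
  show "?I t \<in> carr E" if "t \<le> 0" using res(2)[OF that] I_eq[OF that] by simp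
  show "nrm E (?I t) \<le> c * k * exp (\<eta> * t)" if "t \<le> 0" using res(3)[OF that] I_eq[OF that] by simp
  \<comment> \<open>sequential continuity; \<open>D\<close> bounds the exponential weight along the sequence and provides the dominating function\<close>
  have "((\<lambda>r. nrm E (integral {0<..} (?k r) - integral {0<..} (?k t))) \<longlongrightarrow> 0) (at t within {..0})" if t: "t \<le> 0" for t
    unfolding tendsto_at_iff_sequentially comp_def
  proof (intro allI impI)
    fix X assume X: "\<forall>i. X i \<in> {..0} - {t}" and Xt: "X \<longlonglongrightarrow> t"
    have X0: "X n \<le> 0" for n using X by auto
    have "(\<lambda>n. exp (\<eta> * X n)) \<longlonglongrightarrow> exp (\<eta> * t)" by (intro tendsto_intros Xt)
    then obtain D where D: "\<And>n. exp (\<eta> * X n) \<le> D"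
      by (metis BseqE convergentI Bseq_eq_bounded abs_exp_cancel convergent_imp_Bseq real_norm_def)
    define \<phi> where "\<phi> n r = \<kappa> r * nrm V (w (X n - r) - w (t - r))" for n r
    have win: "w (t - r) \<in> carr V" if "t \<le> 0" "r > 0" for t r using V.continuous_pathD[OF w] that by auto
    have c0: "0 \<le> c"
    proof -
      have "0 \<le> nrm V (w 0)" using V.continuous_pathD[OF w] V.nrm_nonneg by simp
      then show ?thesis using wb[of 0] by simp
    qed
    have \<phi>b: "\<bar>\<phi> n r\<bar> \<le> (\<kappa> r * exp (- \<eta> * r)) * (c * (D + exp (\<eta> * t)))" if r: "r \<in> {0<..}" for n r
    proof -
      have r0: "r > 0" using r by simp
      have "nrm V (w (X n - r) - w (t - r)) \<le> c * exp (\<eta> * (X n - r)) + c * exp (\<eta> * (t - r))"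
        using V.nrm_triangle_diff[OF win[OF X0[of n] r0] win[OF t r0]] wb[of "X n - r"] wb[of "t - r"] X0[of n] t r0 by linarith
      also have "\<dots> = exp (- \<eta> * r) * (c * (exp (\<eta> * X n) + exp (\<eta> * t)))"
        by (simp add: algebra_simps exp_diff exp_minus divide_inverse)
      also have "\<dots> \<le> exp (- \<eta> * r) * (c * (D + exp (\<eta> * t)))"
        using D c0 by (intro mult_left_mono) auto
      finally have "nrm V (w (X n - r) - w (t - r)) \<le> exp (- \<eta> * r) * (c * (D + exp (\<eta> * t)))" .
      moreover have "0 \<le> nrm V (w (X n - r) - w (t - r))"
        using win[OF X0 r0] win[OF t r0] V.nrm_nonneg by blast
      moreover have "0 \<le> \<kappa> r" using \<kappa>_nonneg r J by simp
      ultimately show ?thesis unfolding \<phi>_def by (simp add: abs_mult mult.assoc mult_left_mono)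
    qed
    have dom: "(\<lambda>r. (\<kappa> r * exp (- \<eta> * r)) * (c * (D + exp (\<eta> * t)))) integrable_on {0<..}"
      using has_integral_mult_left[OF k] by blast
    have \<phi>int: "\<phi> n integrable_on {0<..}" for n
    proof (rule measurable_bounded_by_integrable_imp_integrable_real[OF _ dom \<phi>b])
      have "continuous_on {0<..} (\<phi> n)" unfolding \<phi>_def
        using \<kappa>_cont J by (intro continuous_intros V.continuous_on_nrm V.continuous_path_diff wsh X0 t) auto
      then show "\<phi> n \<in> borel_measurable (lebesgue_on {0<..})"
        by (intro continuous_imp_measurable_on_sets_lebesgue) auto
    qed auto
    have "(\<lambda>n. integral {0<..} (\<phi> n)) \<longlonglongrightarrow> integral {0 :: real<..} (\<lambda>r. 0 :: real)"
    proof (rule Equivalence_Lebesgue_Henstock_Integration.dominated_convergence(2)[where f = \<phi> and g = "\<lambda>r. 0" and S = "{0<..}", OF \<phi>int dom])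
      show "norm (\<phi> n r) \<le> (\<kappa> r * exp (- \<eta> * r)) * (c * (D + exp (\<eta> * t)))" if "r \<in> {0<..}" for n r
        using \<phi>b[OF that] by simp
      show "(\<lambda>n. \<phi> n r) \<longlonglongrightarrow> 0" if r: "r \<in> {0<..}" for r
      proof -
        have "continuous_path V {..0} (\<lambda>t. w (t - r))"
          by (rule V.continuous_path_compose[OF w]) (use r in \<open>auto intro!: continuous_intros\<close>)
        then have "((\<lambda>y. nrm V (w (y - r) - w (t - r))) \<longlongrightarrow> 0) (at t within {..0})"
          using V.continuous_path_lim[where s = t] t by auto
        then have "(\<lambda>n. nrm V (w (X n - r) - w (t - r))) \<longlonglongrightarrow> 0"
          using X Xt unfolding tendsto_at_iff_sequentially comp_def by blast
        then show ?thesis unfolding \<phi>_def using tendsto_mult_left[of _ 0 sequentially "\<kappa> r"] by fastforce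
      qed
    qed
    then have \<phi>lim: "(\<lambda>n. integral {0<..} (\<phi> n)) \<longlonglongrightarrow> 0" by simp
    have "nrm E (integral {0<..} (?k (X n)) - integral {0<..} (?k t)) \<le> integral {0<..} (\<phi> n)" for n
    proof -
      have "integral {0<..} (?k (X n)) - integral {0<..} (?k t) = integral {0<..} (\<lambda>r. ?k (X n) r - ?k t r)"
        using res(1)[OF X0] res(1)[OF t] by (subst integral_diff) auto
      moreover have "nrm E (integral {0<..} (\<lambda>r. ?k (X n) r - ?k t r)) \<le> integral {0<..} (\<phi> n)"
      proof (rule E.integral_path_Ioi(3)[OF E.continuous_path_diff[OF kp[OF X0] kp[OF t]] \<phi>int])
        fix r :: real assume r: "r > 0"
        then show "nrm E (?k (X n) r - ?k t r) \<le> \<phi> n r"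
          using S_bound[of r "w (X n - r) - w (t - r)"] S_diff[of r "w (X n - r)" "w (t - r)"]
            win[OF X0 r] win[OF t r] J unfolding \<phi>_def by auto
      qed
      ultimately show ?thesis by simp
    qed
    then show "(\<lambda>n. nrm E (integral {0<..} (?k (X n)) - integral {0<..} (?k t))) \<longlonglongrightarrow> 0"
      using E.nrm_nonneg res(2)[OF X0] res(2)[OF t]
      by (intro tendsto_sandwich[OF _ _ tendsto_const \<phi>lim]) (auto intro!: always_eventually)
  qed
  then have "continuous_path E {..0} (\<lambda>t. integral {0<..} (?k t))"
    using res(2) by (simp add: continuous_path_def)
  then show "continuous_path E {..0} ?I"
    using E.continuous_path_cong[of "{..0}" ?I "\<lambda>t. integral {0<..} (?k t)"] I_eq by auto
qed

text \<open>
  The analogue for integrals over \<open>{t..0}\<close>, with an exponential kernel. The condition \<open>\<omega> + \<eta> < 0\<close>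
  makes the integral over the long interval of the order of its value at the end point \<open>t\<close>.
\<close>

lemma backward_convolution:
  assumes J: "J = {0..}" and \<kappa>: "\<And>r. r \<ge> 0 \<Longrightarrow> \<kappa> r = M * exp (\<omega> * r)" and \<eta>: "\<omega> + \<eta> < 0"
    and w: "continuous_path V {..0} w"
    and wb: "\<And>s. s \<le> 0 \<Longrightarrow> nrm V (w s) \<le> c * exp (\<eta> * s)"
  shows "t \<le> 0 \<Longrightarrow> (\<lambda>s. S (s - t) (w s)) integrable_on {t..0}"
    and "t \<le> 0 \<Longrightarrow> integral {t..0} (\<lambda>s. S (s - t) (w s)) \<in> carr E"
    and "t \<le> 0 \<Longrightarrow> nrm E (integral {t..0} (\<lambda>s. S (s - t) (w s))) \<le> c * (M / (- (\<omega> + \<eta>))) * exp (\<eta> * t)"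
    and "continuous_path E {..0} (\<lambda>t. integral {t..0} (\<lambda>s. S (s - t) (w s)))"
proof -
  let ?J = "\<lambda>t. integral {t..0} (\<lambda>s. S (s - t) (w s))"
  have win: "w s \<in> carr V" if "s \<le> 0" for s using V.continuous_pathD[OF w] that by auto
  have c0: "0 \<le> c" using V.nrm_nonneg[OF win[of 0]] wb[of 0] by simp
  have M0: "0 \<le> M" using \<kappa>[of 0] \<kappa>_nonneg[of 0] J by simp
  have kp': "continuous_path E {0..-t} (\<lambda>r. S r (w (t' + r)))" if "t \<le> 0" "t' \<le> t" for t t'
    by (rule path_apply, rule V.continuous_path_compose[OF w])
      (use that J in \<open>auto intro!: continuous_intros\<close>)
  have kp: "continuous_path E {t..0} (\<lambda>s. S (s - t) (w s))" if "t \<le> 0" for t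
    using E.continuous_path_compose[OF kp'[OF that order_refl], of "{t..0}" "\<lambda>s. s - t"]
    by (simp add: continuous_on_diff image_subset_iff)
  show "(\<lambda>s. S (s - t) (w s)) integrable_on {t..0}" if "t \<le> 0"
    using E.continuous_on_path[OF kp[OF that]] by (rule integrable_continuous_interval)
  show Jin: "?J t \<in> carr E" if "t \<le> 0" for t using E.integral_path_Icc(1)[OF kp[OF that] that] .
  show "nrm E (?J t) \<le> c * (M / (- (\<omega> + \<eta>))) * exp (\<eta> * t)" if t: "t \<le> 0"
  proof -
    let ?g = "\<lambda>s. M * c * exp (- \<omega> * t) * exp ((\<omega> + \<eta>) * s)"
    have gint: "(?g has_integral M * c * exp (- \<omega> * t) * (exp ((\<omega> + \<eta>) * 0) / (\<omega> + \<eta>) - exp ((\<omega> + \<eta>) * t) / (\<omega> + \<eta>))) {t..0}"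
    proof (rule has_integral_mult_right, rule fundamental_theorem_of_calculus[OF t])
      show "((\<lambda>s. exp ((\<omega> + \<eta>) * s) / (\<omega> + \<eta>)) has_vector_derivative exp ((\<omega> + \<eta>) * s)) (at s within {t..0})" for s
        using \<eta> by (auto intro!: derivative_eq_intros simp: has_real_derivative_iff_has_vector_derivative[symmetric])
    qed
    have "nrm E (?J t) \<le> integral {t..0} (\<lambda>s. nrm E (S (s - t) (w s)))"
      by (rule E.integral_path_Icc(2)[OF kp[OF t] t])
    also have "\<dots> \<le> integral {t..0} ?g"
    proof (rule integral_le)
      show "(\<lambda>s. nrm E (S (s - t) (w s))) integrable_on {t..0}"
        by (intro integrable_continuous_interval E.continuous_on_nrm kp t)
      show "?g integrable_on {t..0}" using gint by blast
      fix s assume s: "s \<in> {t..0}"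
      have "nrm E (S (s - t) (w s)) \<le> \<kappa> (s - t) * nrm V (w s)"
        using S_bound win s J by auto
      also have "\<dots> \<le> M * exp (\<omega> * (s - t)) * (c * exp (\<eta> * s))"
        using \<kappa>[of "s - t"] wb[of s] s M0 by (simp add: mult_left_mono)
      also have "\<dots> = ?g s"
        by (simp add: exp_add[symmetric] algebra_simps)
      finally show "nrm E (S (s - t) (w s)) \<le> ?g s" .
    qed
    also have "\<dots> = M * c * exp (- \<omega> * t) * (exp ((\<omega> + \<eta>) * 0) / (\<omega> + \<eta>) - exp ((\<omega> + \<eta>) * t) / (\<omega> + \<eta>))"
      by (rule integral_unique[OF gint])
    also have "\<dots> = M * c / (- (\<omega> + \<eta>)) * (exp (\<eta> * t) - exp (- \<omega> * t))"
    proof -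
      have "exp (- \<omega> * t) * exp ((\<omega> + \<eta>) * t) = exp (\<eta> * t)"
        by (simp add: exp_add[symmetric] algebra_simps)
      then show ?thesis using \<eta> by (simp add: field_simps)
    qed
    also have "\<dots> \<le> M * c / (- (\<omega> + \<eta>)) * exp (\<eta> * t)"
      using M0 c0 \<eta> by (intro mult_left_mono) (auto intro!: divide_nonneg_neg simp: divide_le_0_iff mult_nonneg_nonneg)
    finally show ?thesis by (simp add: mult.commute)
  qed
  have shift: "?J t = integral {0..-t} (\<lambda>r. S r (w (t + r)))" for t
    using integral_shift_real_ivl[of t t 0 "\<lambda>s. S (s - t) (w s)"] by (simp add: add.commute)
  \<comment> \<open>shifting both integrals to start at \<open>0\<close>, the increment splits into one integral of the increment of \<open>w\<close> and one over the excess interval\<close>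
  have est: "nrm E (?J t1 - ?J t2) \<le> Mk * (- a) * d + Mk * Bw * (t2 - t1)"
    if ord: "a \<le> t1" "t1 \<le> t2" "t2 \<le> 0" and Mk: "\<And>r. r \<in> {0..-a} \<Longrightarrow> \<kappa> r \<le> Mk" "Mk \<ge> 0"
      and Bw: "\<And>s. s \<in> {a..0} \<Longrightarrow> nrm V (w s) \<le> Bw" and d: "d \<ge> 0"
      "\<And>s. a \<le> s \<Longrightarrow> s + (t2 - t1) \<le> 0 \<Longrightarrow> nrm V (w s - w (s + (t2 - t1))) \<le> d"
    for t1 t2 a Mk Bw d
  proof -
    let ?A = "\<lambda>r. S r (w (t1 + r))" and ?B = "\<lambda>r. S r (w (t2 + r))"
    have pA: "continuous_path E {0..-t1} ?A" "continuous_path E {0..-t2} ?A" "continuous_path E {0..-t2} ?B"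
      using kp'[of t1 t1] kp'[of t2 t1] kp'[of t2 t2] ord by auto
    have pA': "continuous_path E {-t2..-t1} ?A"
      by (rule E.continuous_path_subset[OF pA(1)]) (use ord in auto)
    have "integral {0..-t2} ?A + integral {-t2..-t1} ?A = integral {0..-t1} ?A"
      by (rule Henstock_Kurzweil_Integration.integral_combine)
        (use ord in \<open>auto intro!: integrable_continuous_interval E.continuous_on_path pA\<close>)
    moreover have "integral {0..-t2} ?A - integral {0..-t2} ?B = integral {0..-t2} (\<lambda>r. ?A r - ?B r)"
      by (subst integral_diff) (auto intro!: integrable_continuous_interval E.continuous_on_path pA)
    ultimately have eq: "?J t1 - ?J t2 = integral {0..-t2} (\<lambda>r. ?A r - ?B r) + integral {-t2..-t1} ?A"
      unfolding shift by (simp add: algebra_simps)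
    have p1: "continuous_path E {0..-t2} (\<lambda>r. ?A r - ?B r)" by (rule E.continuous_path_diff[OF pA(2,3)])
    have t2: "0 \<le> - t2" "- t2 \<le> - t1" using ord by auto
    have i1: "nrm E (integral {0..-t2} (\<lambda>r. ?A r - ?B r)) \<le> integral {0..-t2} (\<lambda>r. Mk * d)"
    proof (rule order_trans[OF E.integral_path_Icc(2)[OF p1 t2(1)]], rule integral_le)
      show "(\<lambda>r. nrm E (?A r - ?B r)) integrable_on {0..-t2}"
        by (intro integrable_continuous_interval E.continuous_on_nrm p1)
      fix r assume r: "r \<in> {0..-t2}"
      then have le: "t1 + r \<le> 0" "t2 + r \<le> 0" "r \<in> J" "r \<in> {0..-a}" "a \<le> t1 + r" using ord J by auto
      have "?A r - ?B r = S r (w (t1 + r) - w (t2 + r))" using S_diff win le by auto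
      then have "nrm E (?A r - ?B r) \<le> \<kappa> r * nrm V (w (t1 + r) - w (t2 + r))"
        using S_bound win le by auto
      also have "\<dots> \<le> Mk * d"
        using Mk le d(2)[of "t1 + r"] V.nrm_nonneg[OF V.diff_in[OF win[OF le(1)] win[OF le(2)]]]
        by (intro mult_mono) (auto simp: algebra_simps)
      finally show "nrm E (?A r - ?B r) \<le> Mk * d" .
    qed auto
    have i2: "nrm E (integral {-t2..-t1} ?A) \<le> integral {-t2..-t1} (\<lambda>r. Mk * Bw)"
    proof (rule order_trans[OF E.integral_path_Icc(2)[OF pA' t2(2)]], rule integral_le)
      show "(\<lambda>r. nrm E (?A r)) integrable_on {-t2..-t1}"
        by (intro integrable_continuous_interval E.continuous_on_nrm pA')
      fix r assume r: "r \<in> {-t2..-t1}"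
      then have le: "t1 + r \<le> 0" "r \<in> J" "r \<in> {0..-a}" "a \<le> t1 + r" using ord J by auto
      have "nrm E (?A r) \<le> \<kappa> r * nrm V (w (t1 + r))" using S_bound win le by auto
      also have "\<dots> \<le> Mk * Bw"
        using Mk le Bw[of "t1 + r"] V.nrm_nonneg[OF win[OF le(1)]] by (intro mult_mono) auto
      finally show "nrm E (?A r) \<le> Mk * Bw" .
    qed auto
    have "nrm E (?J t1 - ?J t2) \<le> Mk * d * (- t2) + Mk * Bw * (t2 - t1)"
    proof -
      have "integral {0..-t2} (\<lambda>r. Mk * d) = Mk * d * (- t2)"
        "integral {-t2..-t1} (\<lambda>r. Mk * Bw) = Mk * Bw * (t2 - t1)"
        using t2 by (simp_all add: mult.commute)
      then show ?thesis unfolding eq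
        using E.nrm_triangle[OF E.integral_path_Icc(1)[OF p1 t2(1)] E.integral_path_Icc(1)[OF pA' t2(2)]] i1 i2
        by linarith
    qed
    also have "Mk * d * (- t2) \<le> Mk * (- a) * d"
      using mult_left_mono[of "- t2" "- a" "Mk * d"] Mk(2) d(1) ord by (simp add: algebra_simps)
    finally show ?thesis by simp
  qed
  show "continuous_path E {..0} ?J"
  proof (rule E.continuous_pathI)
    show "?J t \<in> carr E" if "t \<in> {..0}" for t using Jin that by simp
    fix t e :: real assume t: "t \<in> {..0}" and e: "e > 0"
    define a where "a = t - 1"
    have a: "a < 0" using t by (simp add: a_def)
    have "compact (\<kappa> ` {0..-a})"
      by (rule compact_continuous_image[OF continuous_on_subset[OF \<kappa>_cont]]) (auto simp: J)
    then obtain Mk where Mk: "Mk > 0" "\<And>r. r \<in> {0..-a} \<Longrightarrow> \<kappa> r \<le> Mk"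
      using bounded_pos[THEN iffD1, OF compact_imp_bounded] by (metis abs_le_D1 imageI real_norm_def)
    have wa: "continuous_path V {a..0} w" by (rule V.continuous_path_subset[OF w]) auto
    have "compact ((\<lambda>s. nrm V (w s)) ` {a..0})"
      by (rule compact_continuous_image[OF V.continuous_on_nrm[OF wa]]) auto
    then obtain Bw where Bw: "Bw > 0" "\<And>s. s \<in> {a..0} \<Longrightarrow> nrm V (w s) \<le> Bw"
      using bounded_pos[THEN iffD1, OF compact_imp_bounded] by (metis abs_le_D1 imageI real_norm_def)
    define d where "d = e / (4 * Mk * (- a))"
    have "4 * Mk * (- a) > 0" using Mk(1) a by (intro mult_pos_pos) auto
    with e have "d > 0" unfolding d_def by (rule divide_pos_pos)
    moreover have "Mk * (- a) * d = e / 4" using Mk(1) a by (simp add: d_def)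
    ultimately have d: "d > 0" "Mk * (- a) * d = e / 4" .
    obtain m where m: "m > 0" "\<And>r s. r \<in> {a..0} \<Longrightarrow> s \<in> {a..0} \<Longrightarrow> \<bar>r - s\<bar> < m \<Longrightarrow> nrm V (w r - w s) < d"
      using V.continuous_path_uniform[OF wa compact_Icc d(1)] by metis
    define m' where "m' = min (min 1 m) (e / (4 * Mk * Bw))"
    have "e / (4 * Mk * Bw) > 0" using e Mk Bw by simp
    then have m'0: "m' > 0" "m' \<le> 1" "m' \<le> m" "m' \<le> e / (4 * Mk * Bw)" using m(1) by (auto simp: m'_def)
    have key: "nrm E (?J t1 - ?J t2) < e" if "a \<le> t1" "t1 \<le> t2" "t2 \<le> 0" "t2 - t1 < m'" for t1 t2
    proof -
      have "nrm E (?J t1 - ?J t2) \<le> Mk * (- a) * d + Mk * Bw * (t2 - t1)"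
      proof (rule est)
        show "nrm V (w s - w (s + (t2 - t1))) \<le> d" if s: "a \<le> s" "s + (t2 - t1) \<le> 0" for s
          using m(2)[of s "s + (t2 - t1)"] s \<open>t1 \<le> t2\<close> \<open>t2 - t1 < m'\<close> m'0(3) by auto
      qed (use that Mk Bw d in auto)
      also have "Mk * Bw * (t2 - t1) \<le> Mk * Bw * (e / (4 * Mk * Bw))"
        using that m'0(4) Mk Bw by (intro mult_left_mono) auto
      also have "\<dots> = e / 4" using Mk Bw by simp
      finally show ?thesis using d(2) e by simp
    qed
    have "nrm E (?J r - ?J t) < e" if r: "r \<in> {..0}" "\<bar>r - t\<bar> < m'" for r
    proof -
      have "a \<le> r" "a \<le> t" using r m'0(2) by (auto simp: a_def)
      then show ?thesis
        using key[of r t] key[of t r] r t E.nrm_commute[OF Jin[of r] Jin[of t]] by (cases "r \<le> t") auto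
    qed
    then show "\<exists>d>0. \<forall>r\<in>{..0}. \<bar>r - t\<bar> < d \<longrightarrow> nrm E (?J r - ?J t) < e" using m'0(1) by blast
  qed
qed

end

section \<open>An abstract Lyapunov-Perron equation\<close>

text \<open>
  The equation \<open>\<phi> t = p v t + K (G \<circ> \<phi>) t\<close> for paths in \<open>Z\<close> on \<open>{..0}\<close>, with parameter \<open>v\<close> in \<open>U\<close>.
  \<open>K\<close> is linear on exponentially bounded paths and, for both weights \<open>\<eta>\<^sub>1 < \<eta>\<close>, bounded with
  constant \<open>q < 1\<close>; \<open>G\<close> is 1-Lipschitz and continuously differentiable. As \<open>t \<le> 0\<close>, the norm with
  weight \<open>\<eta>\<^sub>1\<close> is weaker than the one with weight \<open>\<eta>\<close>.
\<close>

locale lyapunov_perron_equation =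
  Z: banach_space_on scZ Z + W: normed_space_on scW W + U: normed_space_on scU U
  for scZ :: "'k::real_normed_field \<Rightarrow> 'z::real_vector \<Rightarrow> 'z" and Z
    and scW :: "'k \<Rightarrow> 'w::real_vector \<Rightarrow> 'w" and W
    and scU :: "'k \<Rightarrow> 'u::real_vector \<Rightarrow> 'u" and U +
  fixes K :: "(real \<Rightarrow> 'w) \<Rightarrow> real \<Rightarrow> 'z" and p :: "'u \<Rightarrow> real \<Rightarrow> 'z"
    and G :: "'z \<Rightarrow> 'w" and DG :: "'z \<Rightarrow> 'z \<Rightarrow> 'w" and \<eta> \<eta>\<^sub>1 q M :: real
  assumes q: "0 \<le> q" "q < 1" and weights: "\<eta>\<^sub>1 < \<eta>" and M: "0 \<le> M"
    and K_path: "\<And>\<mu> w c. \<mu> \<in> {\<eta>\<^sub>1, \<eta>} \<Longrightarrow> continuous_path W {..0} w \<Longrightarrow>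
      (\<And>s. s \<le> 0 \<Longrightarrow> nrm W (w s) \<le> c * exp (\<mu> * s)) \<Longrightarrow> continuous_path Z {..0} (K w)"
    and K_bound: "\<And>\<mu> w c t. \<mu> \<in> {\<eta>\<^sub>1, \<eta>} \<Longrightarrow> continuous_path W {..0} w \<Longrightarrow>
      (\<And>s. s \<le> 0 \<Longrightarrow> nrm W (w s) \<le> c * exp (\<mu> * s)) \<Longrightarrow> t \<le> 0 \<Longrightarrow>
      nrm Z (K w t) \<le> q * c * exp (\<mu> * t)"
    and K_add: "\<And>w w' c c' t. continuous_path W {..0} w \<Longrightarrow> continuous_path W {..0} w' \<Longrightarrow>
      (\<And>s. s \<le> 0 \<Longrightarrow> nrm W (w s) \<le> c * exp (\<eta>\<^sub>1 * s)) \<Longrightarrow>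
      (\<And>s. s \<le> 0 \<Longrightarrow> nrm W (w' s) \<le> c' * exp (\<eta>\<^sub>1 * s)) \<Longrightarrow> t \<le> 0 \<Longrightarrow>
      K (\<lambda>s. w s + w' s) t = K w t + K w' t"
    and K_scale: "\<And>w c a t. continuous_path W {..0} w \<Longrightarrow>
      (\<And>s. s \<le> 0 \<Longrightarrow> nrm W (w s) \<le> c * exp (\<eta>\<^sub>1 * s)) \<Longrightarrow> t \<le> 0 \<Longrightarrow>
      K (\<lambda>s. scW a (w s)) t = scZ a (K w t)"
    and K_cong: "\<And>w w' t. (\<And>s. s \<le> 0 \<Longrightarrow> w s = w' s) \<Longrightarrow> t \<le> 0 \<Longrightarrow> K w t = K w' t"
    and p_path: "\<And>v. v \<in> carr U \<Longrightarrow> continuous_path Z {..0} (p v)"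
    and p_bound: "\<And>v t. v \<in> carr U \<Longrightarrow> t \<le> 0 \<Longrightarrow> nrm Z (p v t) \<le> M * nrm U v * exp (\<eta> * t)"
    and p_add: "\<And>v v' t. v \<in> carr U \<Longrightarrow> v' \<in> carr U \<Longrightarrow> t \<le> 0 \<Longrightarrow> p (v + v') t = p v t + p v' t"
    and p_scale: "\<And>a v t. v \<in> carr U \<Longrightarrow> t \<le> 0 \<Longrightarrow> p (scU a v) t = scZ a (p v t)"
    and G_in: "\<And>z. z \<in> carr Z \<Longrightarrow> G z \<in> carr W" and G_0: "G 0 = 0"
    and G_Lip: "\<And>z z'. z \<in> carr Z \<Longrightarrow> z' \<in> carr Z \<Longrightarrow> nrm W (G z - G z') \<le> nrm Z (z - z')"
    and DG: "\<And>z. z \<in> carr Z \<Longrightarrow> frechet_deriv_ns scZ scW Z W G z (DG z)"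
    and DG_cont: "\<And>z e. z \<in> carr Z \<Longrightarrow> e > 0 \<Longrightarrow> \<exists>d>0. \<forall>z'\<in>carr Z. nrm Z (z' - z) < d \<longrightarrow>
      opbound Z W (\<lambda>h. DG z' h - DG z h) e"
begin

lemma weight_le: "c \<ge> 0 \<Longrightarrow> s \<le> 0 \<Longrightarrow> c * exp (\<eta> * s) \<le> c * exp (\<eta>\<^sub>1 * s)"
  using weights by (intro mult_left_mono) (auto simp: mult_right_mono_neg)

lemma W_path_bound_nonneg:
  assumes "continuous_path W {..0} w" "\<And>s. s \<le> 0 \<Longrightarrow> nrm W (w s) \<le> c * exp (\<mu> * s)"
  shows "0 \<le> c"
  using assms(2)[of 0] W.nrm_nonneg[OF W.continuous_pathD[OF assms(1), of 0]] by simp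

lemma W_path_bound_weaken:
  assumes w: "continuous_path W {..0} w" and b: "\<And>s. s \<le> 0 \<Longrightarrow> nrm W (w s) \<le> c * exp (\<mu> * s)"
    and \<mu>: "\<mu> \<in> {\<eta>\<^sub>1, \<eta>}" and s: "s \<le> 0"
  shows "nrm W (w s) \<le> c * exp (\<eta>\<^sub>1 * s)"
  using order_trans[OF b[OF s]] weight_le[OF W_path_bound_nonneg[OF w b] s] b[OF s] \<mu> by auto

lemma K_diff:
  assumes w: "continuous_path W {..0} w" "continuous_path W {..0} w'" and \<mu>: "\<mu> \<in> {\<eta>\<^sub>1, \<eta>}"
    and b: "\<And>s. s \<le> 0 \<Longrightarrow> nrm W (w s) \<le> c * exp (\<mu> * s)" "\<And>s. s \<le> 0 \<Longrightarrow> nrm W (w' s) \<le> c' * exp (\<mu> * s)"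
    and t: "t \<le> 0"
  shows "K (\<lambda>s. w s - w' s) t = K w t - K w' t"
proof -
  have b1: "nrm W (w s) \<le> c * exp (\<eta>\<^sub>1 * s)" if "s \<le> 0" for s
    by (rule W_path_bound_weaken[OF w(1) b(1) \<mu> that])
  have b2: "nrm W (w' s) \<le> c' * exp (\<eta>\<^sub>1 * s)" if "s \<le> 0" for s
    by (rule W_path_bound_weaken[OF w(2) b(2) \<mu> that])
  have m: "scW (of_real (-1)) x = - x" "scZ (of_real (-1)) y = - y" for x y
    unfolding W.scale_of_real Z.scale_of_real by simp_all
  have n: "continuous_path W {..0} (\<lambda>s. - w' s)" using W.continuous_path_scale[OF w(2), of "of_real (-1)"] unfolding m .
  have "nrm W (- w' s) \<le> c' * exp (\<eta>\<^sub>1 * s)" if "s \<le> 0" for s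
    using b2[OF that] W.nrm_minus[OF W.continuous_pathD[OF w(2)]] that by simp
  then show ?thesis
    using K_add[OF w(1) n b1 _ t, of c'] K_scale[OF w(2) b2 t, of "of_real (-1)"] unfolding m by simp
qed

text \<open>
  The contraction estimate. In the weight \<open>\<eta>\<close> it gives uniqueness and Lipschitz dependence on the
  inhomogeneity \<open>r\<close>, in the weight \<open>\<eta>\<^sub>1\<close> the smallness of the remainder of the derivative. The
  assumption \<open>bdd\<close> makes the supremum \<open>m'\<close> of the weighted norm finite, so that
  \<open>m' \<le> c + q * (m' + d)\<close> can be solved for it.
\<close>

lemma a_priori:
  assumes \<mu>: "\<mu> \<in> {\<eta>\<^sub>1, \<eta>}" and \<phi>: "continuous_path Z {..0} \<phi>"
    and bdd: "\<And>t. t \<le> 0 \<Longrightarrow> nrm Z (\<phi> t) \<le> m * exp (\<mu> * t)"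
    and eq: "\<And>t. t \<le> 0 \<Longrightarrow> \<phi> t = r t + K w t"
    and r: "\<And>t. t \<le> 0 \<Longrightarrow> r t \<in> carr Z" "\<And>t. t \<le> 0 \<Longrightarrow> nrm Z (r t) \<le> c * exp (\<mu> * t)"
    and w: "continuous_path W {..0} w"
    and wb: "\<And>t. t \<le> 0 \<Longrightarrow> nrm W (w t) \<le> nrm Z (\<phi> t) + d * exp (\<mu> * t)"
    and t: "t \<le> 0"
  shows "nrm Z (\<phi> t) \<le> (c + q * d) / (1 - q) * exp (\<mu> * t)"
proof -
  define f where "f t = nrm Z (\<phi> t) * exp (- \<mu> * t)" for t
  have fe: "nrm Z (\<phi> t) = f t * exp (\<mu> * t)" for t by (simp add: f_def exp_minus)
  have le_iff: "f t \<le> x \<longleftrightarrow> nrm Z (\<phi> t) \<le> x * exp (\<mu> * t)" for t x unfolding fe by simp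
  have ba: "bdd_above (f ` {..0})"
    by (rule bdd_aboveI2[of _ _ m]) (use bdd in \<open>auto simp: le_iff\<close>)
  define m' where "m' = (SUP t\<in>{..0}. f t)"
  have fm: "f t \<le> m'" if "t \<le> 0" for t unfolding m'_def by (rule cSUP_upper[OF _ ba]) (use that in auto)
  have wm: "nrm W (w t) \<le> (m' + d) * exp (\<mu> * t)" if "t \<le> 0" for t
    using wb[OF that] fm[OF that] unfolding le_iff by (simp add: algebra_simps)
  have step: "f t \<le> c + q * (m' + d)" if "t \<le> 0" for t
  proof -
    have "nrm Z (\<phi> t) \<le> nrm Z (r t) + nrm Z (K w t)"
      unfolding eq[OF that] using Z.nrm_triangle[OF r(1)[OF that] Z.continuous_pathD[OF K_path[OF \<mu> w wm]]] that by simp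
    also have "\<dots> \<le> c * exp (\<mu> * t) + q * (m' + d) * exp (\<mu> * t)"
      by (intro add_mono r(2) that K_bound[OF \<mu> w wm])
    finally show ?thesis unfolding le_iff by (simp add: algebra_simps)
  qed
  have "(SUP t\<in>{..0}. f t) \<le> c + q * (m' + d)" by (rule cSUP_least) (use step in auto)
  then have "m' \<le> c + q * (m' + d)" by (simp only: m'_def)
  then have "m' \<le> (c + q * d) / (1 - q)" using q by (simp add: field_simps)
  then show ?thesis using fm[OF t] unfolding le_iff[symmetric] by simp
qed

text \<open>
  The time-dependent nonlinearities for which the equation is solved: \<open>G\<close> itself, and its
  linearization along a path.
\<close>

definition nemytskii :: "(real \<Rightarrow> 'z \<Rightarrow> 'w) \<Rightarrow> bool" where
  "nemytskii N \<longleftrightarrow> (\<forall>s\<le>0. \<forall>z\<in>carr Z. N s z \<in> carr W) \<and>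
     (\<forall>s\<le>0. \<forall>z\<in>carr Z. \<forall>z'\<in>carr Z. nrm W (N s z - N s z') \<le> nrm Z (z - z')) \<and>
     (\<forall>s\<le>0. N s 0 = 0) \<and>
     (\<forall>u. continuous_path Z {..0} u \<longrightarrow> continuous_path W {..0} (\<lambda>s. N s (u s)))"

text \<open>
  \<open>\<phi>\<close> is a solution in the space with weight \<open>\<eta>\<close>, for nonlinearity \<open>N\<close> and inhomogeneity \<open>r\<close>.
\<close>

definition solves :: "(real \<Rightarrow> 'z \<Rightarrow> 'w) \<Rightarrow> (real \<Rightarrow> 'z) \<Rightarrow> (real \<Rightarrow> 'z) \<Rightarrow> bool" where
  "solves N r \<phi> \<longleftrightarrow> continuous_path Z {..0} \<phi> \<and> (\<exists>c. \<forall>t\<le>0. nrm Z (\<phi> t) \<le> c * exp (\<eta> * t)) \<and>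
     (\<forall>t\<le>0. \<phi> t = r t + K (\<lambda>s. N s (\<phi> s)) t)"

lemma nemytskiiD:
  assumes "nemytskii N"
  shows "s \<le> 0 \<Longrightarrow> z \<in> carr Z \<Longrightarrow> N s z \<in> carr W"
    and "s \<le> 0 \<Longrightarrow> z \<in> carr Z \<Longrightarrow> z' \<in> carr Z \<Longrightarrow> nrm W (N s z - N s z') \<le> nrm Z (z - z')"
    and "continuous_path Z {..0} u \<Longrightarrow> continuous_path W {..0} (\<lambda>s. N s (u s))"
    and "s \<le> 0 \<Longrightarrow> z \<in> carr Z \<Longrightarrow> nrm W (N s z) \<le> nrm Z z"
proof -
  show 2: "s \<le> 0 \<Longrightarrow> z \<in> carr Z \<Longrightarrow> z' \<in> carr Z \<Longrightarrow> nrm W (N s z - N s z') \<le> nrm Z (z - z')" for z'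
    using assms by (simp add: nemytskii_def)
  show "s \<le> 0 \<Longrightarrow> z \<in> carr Z \<Longrightarrow> nrm W (N s z) \<le> nrm Z z"
    using 2[of 0] assms by (simp add: nemytskii_def)
qed (use assms in \<open>simp_all add: nemytskii_def\<close>)

lemma solves_diff_bound:
  assumes N: "nemytskii N" and \<phi>: "solves N r \<phi>" and \<psi>: "solves N r' \<psi>"
    and r: "\<And>t. t \<le> 0 \<Longrightarrow> r t - r' t \<in> carr Z" "\<And>t. t \<le> 0 \<Longrightarrow> nrm Z (r t - r' t) \<le> c * exp (\<eta> * t)"
    and t: "t \<le> 0"
  shows "nrm Z (\<phi> t - \<psi> t) \<le> c / (1 - q) * exp (\<eta> * t)"
proof -
  have p: "continuous_path Z {..0} \<phi>" "continuous_path Z {..0} \<psi>" using \<phi> \<psi> by (simp_all add: solves_def)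
  have in\<phi>: "\<phi> s \<in> carr Z" "\<psi> s \<in> carr Z" if "s \<le> 0" for s using p Z.continuous_pathD that by auto
  obtain a b where ab: "\<And>t. t \<le> 0 \<Longrightarrow> nrm Z (\<phi> t) \<le> a * exp (\<eta> * t)" "\<And>t. t \<le> 0 \<Longrightarrow> nrm Z (\<psi> t) \<le> b * exp (\<eta> * t)"
    using \<phi> \<psi> unfolding solves_def by blast
  let ?w = "\<lambda>s. N s (\<phi> s) - N s (\<psi> s)"
  have Np: "continuous_path W {..0} (\<lambda>s. N s (\<phi> s))" "continuous_path W {..0} (\<lambda>s. N s (\<psi> s))"
    using nemytskiiD(3)[OF N] p by auto
  have Nb: "nrm W (N s (\<phi> s)) \<le> a * exp (\<eta> * s)" "nrm W (N s (\<psi> s)) \<le> b * exp (\<eta> * s)" if "s \<le> 0" for s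
    using order_trans[OF nemytskiiD(4)[OF N that] ab(1)[OF that]] order_trans[OF nemytskiiD(4)[OF N that] ab(2)[OF that]]
      in\<phi>[OF that] by auto
  have "nrm Z (\<phi> t - \<psi> t) \<le> (c + q * 0) / (1 - q) * exp (\<eta> * t)"
  proof (rule a_priori[where r = "\<lambda>t. r t - r' t" and w = ?w and m = "a + b" and \<phi> = "\<lambda>t. \<phi> t - \<psi> t"])
    show "continuous_path Z {..0} (\<lambda>t. \<phi> t - \<psi> t)" "continuous_path W {..0} ?w"
      using p Np by (auto intro: Z.continuous_path_diff W.continuous_path_diff)
    show "\<phi> t - \<psi> t = r t - r' t + K ?w t" if "t \<le> 0" for t
      using K_diff[OF Np _ Nb that] \<phi> \<psi> that by (simp add: solves_def)
    show "nrm Z (\<phi> t - \<psi> t) \<le> (a + b) * exp (\<eta> * t)" if "t \<le> 0" for t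
      using Z.nrm_triangle_diff[OF in\<phi>[OF that]] ab[OF that] by (simp add: algebra_simps)
    show "nrm W (?w s) \<le> nrm Z (\<phi> s - \<psi> s) + 0 * exp (\<eta> * s)" if "s \<le> 0" for s
      using nemytskiiD(2)[OF N that in\<phi>[OF that]] by simp
  qed (use r t in auto)
  then show ?thesis by simp
qed

lemma solves_unique:
  assumes N: "nemytskii N" and \<phi>: "solves N r \<phi>" and \<psi>: "solves N r \<psi>" and t: "t \<le> 0"
  shows "\<phi> t = \<psi> t"
proof -
  have "continuous_path Z {..0} \<phi>" "continuous_path Z {..0} \<psi>" using \<phi> \<psi> by (simp_all add: solves_def)
  then have in\<phi>: "\<phi> t \<in> carr Z" "\<psi> t \<in> carr Z" using t Z.continuous_pathD by auto
  have "nrm Z (\<phi> t - \<psi> t) \<le> 0 / (1 - q) * exp (\<eta> * t)"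
    by (rule solves_diff_bound[OF N \<phi> \<psi> _ _ t]) auto
  then show ?thesis
    using Z.nrm_nonneg[OF Z.diff_in[OF in\<phi>]] Z.nrm_eq_0[OF Z.diff_in[OF in\<phi>]] by simp
qed

text \<open>
  Picard iteration in the ball of radius \<open>c / (1 - q)\<close>. The limit is taken pointwise in \<open>Z\<close>; the
  weighted rate \<open>q ^ n\<close> makes the convergence locally uniform, which gives continuity of the
  limit.
\<close>

lemma solution_exists:
  assumes N: "nemytskii N" and r: "continuous_path Z {..0} r"
    and rb: "\<And>t. t \<le> 0 \<Longrightarrow> nrm Z (r t) \<le> c * exp (\<eta> * t)"
  obtains \<phi> where "solves N r \<phi>" "\<And>t. t \<le> 0 \<Longrightarrow> nrm Z (\<phi> t) \<le> c / (1 - q) * exp (\<eta> * t)"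
proof -
  define C where "C = c / (1 - q)"
  have C: "c + q * C = C" using q by (simp add: C_def field_simps)
  have rin: "r t \<in> carr Z" if "t \<le> 0" for t using Z.continuous_pathD[OF r] that by auto
  have c0: "0 \<le> c" using rb[of 0] Z.nrm_nonneg[OF rin, of 0] by simp
  have C0: "0 \<le> C" using c0 q by (simp add: C_def)
  define \<phi> where "\<phi> n = ((\<lambda>u t. r t + K (\<lambda>s. N s (u s)) t) ^^ n) (\<lambda>t. 0)" for n
  have \<phi>Suc: "\<phi> (Suc n) = (\<lambda>t. r t + K (\<lambda>s. N s (\<phi> n s)) t)" for n by (simp add: \<phi>_def)
  have \<phi>0: "\<phi> 0 = (\<lambda>t. 0)" by (simp add: \<phi>_def)
  have Nb: "nrm W (N s (u s)) \<le> C * exp (\<eta> * s)" "N s (u s) \<in> carr W"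
    if "continuous_path Z {..0} u" "\<And>t. t \<le> 0 \<Longrightarrow> nrm Z (u t) \<le> C * exp (\<eta> * t)" "s \<le> 0" for u s
    using order_trans[OF nemytskiiD(4)[OF N that(3)] that(2)[OF that(3)]] nemytskiiD(1)[OF N that(3)]
      Z.continuous_pathD[OF that(1)] that(3) by auto
  have inv: "continuous_path Z {..0} (\<phi> n) \<and> (\<forall>t\<le>0. nrm Z (\<phi> n t) \<le> C * exp (\<eta> * t))" for n
  proof (induction n)
    case 0
    then show ?case using C0 by (simp add: \<phi>0 Z.continuous_path_const)
  next
    case (Suc n)
    note b = Nb(1)[of "\<phi> n"] and Np = nemytskiiD(3)[OF N, of "\<phi> n"]
    have Kp: "continuous_path Z {..0} (K (\<lambda>s. N s (\<phi> n s)))"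
      by (rule K_path[where \<mu> = \<eta> and c = C]) (use Suc b Np in auto)
    have "nrm Z (r t + K (\<lambda>s. N s (\<phi> n s)) t) \<le> C * exp (\<eta> * t)" if t: "t \<le> 0" for t
    proof -
      have "nrm Z (K (\<lambda>s. N s (\<phi> n s)) t) \<le> q * C * exp (\<eta> * t)"
        by (rule K_bound) (use Suc b Np t in auto)
      then have "nrm Z (r t + K (\<lambda>s. N s (\<phi> n s)) t) \<le> (c + q * C) * exp (\<eta> * t)"
        using Z.nrm_triangle[OF rin[OF t] Z.continuous_pathD[OF Kp], of t] rb[OF t] t by (simp add: algebra_simps)
      then show ?thesis by (simp only: C)
    qed
    then show ?case unfolding \<phi>Suc using Z.continuous_path_add[OF r Kp] by simp
  qed
  then have \<phi>p: "continuous_path Z {..0} (\<phi> n)" and \<phi>b: "t \<le> 0 \<Longrightarrow> nrm Z (\<phi> n t) \<le> C * exp (\<eta> * t)" for n t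
    by auto
  have \<phi>in: "\<phi> n t \<in> carr Z" if "t \<le> 0" for n t using Z.continuous_pathD[OF \<phi>p] that by auto
  have contr: "nrm Z (K (\<lambda>s. N s (u s)) t - K (\<lambda>s. N s (u' s)) t) \<le> q * d * exp (\<eta> * t)"
    if u: "continuous_path Z {..0} u" "\<And>t. t \<le> 0 \<Longrightarrow> nrm Z (u t) \<le> C * exp (\<eta> * t)"
      "continuous_path Z {..0} u'" "\<And>t. t \<le> 0 \<Longrightarrow> nrm Z (u' t) \<le> C * exp (\<eta> * t)"
      and d: "\<And>t. t \<le> 0 \<Longrightarrow> nrm Z (u t - u' t) \<le> d * exp (\<eta> * t)" and t: "t \<le> 0" for u u' d t
  proof -
    have Np: "continuous_path W {..0} (\<lambda>s. N s (u s))" "continuous_path W {..0} (\<lambda>s. N s (u' s))"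
      using nemytskiiD(3)[OF N] u by auto
    have "K (\<lambda>s. N s (u s) - N s (u' s)) t = K (\<lambda>s. N s (u s)) t - K (\<lambda>s. N s (u' s)) t"
      by (rule K_diff[OF Np _ Nb(1)[OF u(1,2)] Nb(1)[OF u(3,4)] t]) auto
    moreover have "nrm Z (K (\<lambda>s. N s (u s) - N s (u' s)) t) \<le> q * d * exp (\<eta> * t)"
    proof (rule K_bound[OF _ W.continuous_path_diff[OF Np] _ t])
      show "nrm W (N s (u s) - N s (u' s)) \<le> d * exp (\<eta> * s)" if "s \<le> 0" for s
        using order_trans[OF nemytskiiD(2)[OF N that] d[OF that]] Z.continuous_pathD[OF u(1)] Z.continuous_pathD[OF u(3)] that
        by auto
    qed simp
    ultimately show ?thesis by simp
  qed
  have cauchy: "nrm Z (\<phi> (n + k) t - \<phi> n t) \<le> q ^ n * C * exp (\<eta> * t)" if "t \<le> 0" for n k t using that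
  proof (induction n arbitrary: t)
    case 0
    then show ?case using \<phi>b by (simp add: \<phi>0)
  next
    case (Suc n)
    have "nrm Z (K (\<lambda>s. N s (\<phi> (n + k) s)) t - K (\<lambda>s. N s (\<phi> n s)) t) \<le> q * (q ^ n * C) * exp (\<eta> * t)"
      by (rule contr) (use \<phi>p \<phi>b Suc in auto)
    then show ?case by (simp add: \<phi>Suc mult.assoc)
  qed
  have qlim: "(\<lambda>n. q ^ n * x) \<longlonglongrightarrow> 0" for x
    using tendsto_mult_right[OF LIMSEQ_power_zero[of q], of x] q by simp
  have "\<exists>x\<in>carr Z. (\<lambda>n. nrm Z (\<phi> n t - x)) \<longlonglongrightarrow> 0" if t: "t \<le> 0" for t
  proof (rule Z.complete[OF \<phi>in[OF t]])
    fix e :: real assume "e > 0"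
    then obtain n0 where n0: "\<bar>q ^ n0 * (2 * (C * exp (\<eta> * t)))\<bar> < e"
      using LIMSEQ_D[OF qlim] by force
    have "nrm Z (\<phi> m t - \<phi> n t) < e" if "m \<ge> n0" "n \<ge> n0" for m n
    proof -
      have "nrm Z (\<phi> m t - \<phi> n t) \<le> nrm Z (\<phi> m t - \<phi> n0 t) + nrm Z (\<phi> n0 t - \<phi> n t)"
        by (rule Z.nrm_triangle_mid) (use \<phi>in t in auto)
      moreover have "nrm Z (\<phi> m t - \<phi> n0 t) \<le> q ^ n0 * C * exp (\<eta> * t)"
        "nrm Z (\<phi> n0 t - \<phi> n t) \<le> q ^ n0 * C * exp (\<eta> * t)"
        using cauchy[OF t, of n0 "m - n0"] cauchy[OF t, of n0 "n - n0"] that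
          Z.nrm_commute[OF \<phi>in[OF t] \<phi>in[OF t]] by auto
      ultimately show ?thesis using n0 by linarith
    qed
    then show "\<exists>N. \<forall>m\<ge>N. \<forall>n\<ge>N. nrm Z (\<phi> m t - \<phi> n t) < e" by blast
  qed
  then obtain \<Phi> where \<Phi>in: "\<And>t. t \<le> 0 \<Longrightarrow> \<Phi> t \<in> carr Z"
    and \<Phi>lim: "\<And>t. t \<le> 0 \<Longrightarrow> (\<lambda>n. nrm Z (\<phi> n t - \<Phi> t)) \<longlonglongrightarrow> 0" by metis
  have close: "nrm Z (\<Phi> t - \<phi> n t) \<le> q ^ n * C * exp (\<eta> * t)" if t: "t \<le> 0" for n t
  proof (rule LIMSEQ_le_const)
    have "(\<lambda>k. nrm Z (\<phi> (n + k) t - \<Phi> t)) \<longlonglongrightarrow> 0"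
      using LIMSEQ_ignore_initial_segment[OF \<Phi>lim[OF t], of n] by (simp add: add.commute)
    from tendsto_add[OF this tendsto_const[of "q ^ n * C * exp (\<eta> * t)"]]
    show "(\<lambda>k. nrm Z (\<phi> (n + k) t - \<Phi> t) + q ^ n * C * exp (\<eta> * t)) \<longlonglongrightarrow> q ^ n * C * exp (\<eta> * t)" by simp
    have "nrm Z (\<Phi> t - \<phi> n t) \<le> nrm Z (\<phi> (n + k) t - \<Phi> t) + q ^ n * C * exp (\<eta> * t)" for k
      using Z.nrm_triangle_mid[OF \<Phi>in[OF t] \<phi>in[OF t, of "n + k"] \<phi>in[OF t, of n]]
        Z.nrm_commute[OF \<Phi>in[OF t] \<phi>in[OF t, of "n + k"]] cauchy[OF t, of n k] by linarith
    then show "\<exists>N. \<forall>k\<ge>N. nrm Z (\<Phi> t - \<phi> n t) \<le> nrm Z (\<phi> (n + k) t - \<Phi> t) + q ^ n * C * exp (\<eta> * t)" by blast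
  qed
  have \<Phi>b: "nrm Z (\<Phi> t) \<le> C * exp (\<eta> * t)" if "t \<le> 0" for t using close[OF that, of 0] by (simp add: \<phi>0)
  have \<Phi>p: "continuous_path Z {..0} \<Phi>"
  proof (rule Z.continuous_pathI)
    show "\<Phi> s \<in> carr Z" if "s \<in> {..0}" for s using \<Phi>in that by simp
    fix s e :: real assume s: "s \<in> {..0}" and e: "e > 0"
    let ?x = "C * exp (\<eta> * s) + C * (exp (\<eta> * s) * exp \<bar>\<eta>\<bar>)"
    obtain n where n: "\<bar>q ^ n * ?x\<bar> < e / 2" using LIMSEQ_D[OF qlim, of "e / 2"] e by force
    obtain d where d: "d > 0" "\<And>r. r \<in> {..0} \<Longrightarrow> \<bar>r - s\<bar> < d \<Longrightarrow> nrm Z (\<phi> n r - \<phi> n s) < e / 2"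
      using Z.continuous_path_eps[OF \<phi>p s, of "e / 2"] e by (metis half_gt_zero)
    have "nrm Z (\<Phi> r - \<Phi> s) < e" if r: "r \<in> {..0}" "\<bar>r - s\<bar> < min d 1" for r
    proof -
      have rs: "r \<le> 0" "s \<le> 0" using r s by auto
      have "nrm Z (\<Phi> r - \<Phi> s) \<le> nrm Z (\<Phi> r - \<phi> n r) + (nrm Z (\<phi> n r - \<phi> n s) + nrm Z (\<Phi> s - \<phi> n s))"
        using Z.nrm_triangle_mid[OF \<Phi>in[OF rs(1)] \<phi>in[OF rs(1), of n] \<Phi>in[OF rs(2)]]
          Z.nrm_triangle_mid[OF \<phi>in[OF rs(1), of n] \<phi>in[OF rs(2), of n] \<Phi>in[OF rs(2)]]
          Z.nrm_commute[OF \<Phi>in[OF rs(2)] \<phi>in[OF rs(2), of n]] by linarith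
      moreover have "nrm Z (\<Phi> r - \<phi> n r) \<le> q ^ n * (C * (exp (\<eta> * s) * exp \<bar>\<eta>\<bar>))"
      proof -
        have "\<eta> * r \<le> \<eta> * s + \<bar>\<eta>\<bar>"
        proof -
          have "\<eta> * (r - s) \<le> \<bar>\<eta>\<bar> * \<bar>r - s\<bar>" by (metis abs_ge_self abs_mult)
          also have "\<dots> \<le> \<bar>\<eta>\<bar> * 1" using r by (intro mult_left_mono) auto
          finally show ?thesis by (simp add: algebra_simps)
        qed
        then have "exp (\<eta> * r) \<le> exp (\<eta> * s) * exp \<bar>\<eta>\<bar>" by (simp add: exp_add[symmetric])
        then have "q ^ n * C * exp (\<eta> * r) \<le> q ^ n * C * (exp (\<eta> * s) * exp \<bar>\<eta>\<bar>)"
          using C0 q by (intro mult_left_mono) auto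
        then show ?thesis using close[OF rs(1), of n] by (simp add: mult.assoc)
      qed
      moreover have "nrm Z (\<Phi> s - \<phi> n s) \<le> q ^ n * (C * exp (\<eta> * s))" using close[OF rs(2), of n] by (simp add: mult.assoc)
      moreover have "q ^ n * (C * exp (\<eta> * s)) + q ^ n * (C * (exp (\<eta> * s) * exp \<bar>\<eta>\<bar>)) < e / 2"
        using n unfolding distrib_left by (rule order_le_less_trans[OF abs_ge_self])
      ultimately show ?thesis using d(2)[of r] r by simp
    qed
    then show "\<exists>d>0. \<forall>r\<in>{..0}. \<bar>r - s\<bar> < d \<longrightarrow> nrm Z (\<Phi> r - \<Phi> s) < e"
      using d(1) by (intro exI[of _ "min d 1"]) auto
  qed
  have eq: "\<Phi> t = r t + K (\<lambda>s. N s (\<Phi> s)) t" if t: "t \<le> 0" for t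
  proof -
    have Kp: "continuous_path Z {..0} (K (\<lambda>s. N s (\<Phi> s)))"
      by (rule K_path[OF _ nemytskiiD(3)[OF N \<Phi>p] Nb(1)[OF \<Phi>p \<Phi>b]]) auto
    have Kin: "r t + K (\<lambda>s. N s (\<Phi> s)) t \<in> carr Z" using Z.continuous_pathD[OF Kp] t rin by auto
    have "nrm Z (\<Phi> t - (r t + K (\<lambda>s. N s (\<Phi> s)) t)) \<le> q ^ n * (2 * (C * exp (\<eta> * t)))" for n
    proof -
      have "nrm Z (K (\<lambda>s. N s (\<Phi> s)) t - K (\<lambda>s. N s (\<phi> n s)) t) \<le> q * (q ^ n * C) * exp (\<eta> * t)"
        by (rule contr) (use \<Phi>p \<Phi>b \<phi>p \<phi>b close t in auto)
      then have "nrm Z (r t + K (\<lambda>s. N s (\<Phi> s)) t - \<phi> (Suc n) t) \<le> q * (q ^ n * C * exp (\<eta> * t))"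
        by (simp add: \<phi>Suc mult.assoc)
      moreover have "nrm Z (\<Phi> t - \<phi> (Suc n) t) \<le> q * (q ^ n * C * exp (\<eta> * t))"
        using close[OF t, of "Suc n"] by (simp add: mult.assoc)
      moreover have "q * (q ^ n * C * exp (\<eta> * t)) \<le> 1 * (q ^ n * C * exp (\<eta> * t))"
        using q C0 by (intro mult_right_mono) auto
      ultimately show ?thesis
        using Z.nrm_triangle_mid[OF \<Phi>in[OF t] \<phi>in[OF t, of "Suc n"] Kin] Z.nrm_commute[OF \<phi>in[OF t, of "Suc n"] Kin] by linarith
    qed
    then have "nrm Z (\<Phi> t - (r t + K (\<lambda>s. N s (\<Phi> s)) t)) \<le> 0"
      by (intro LIMSEQ_le_const[OF qlim]) blast
    then show ?thesis
      using Z.nrm_nonneg[OF Z.diff_in[OF \<Phi>in[OF t] Kin]] Z.nrm_eq_0[OF Z.diff_in[OF \<Phi>in[OF t] Kin]] by simp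
  qed
  have "solves N r \<Phi>" unfolding solves_def using \<Phi>p \<Phi>b eq by blast
  then show thesis by (rule that) (use \<Phi>b in \<open>simp add: C_def\<close>)
qed

subsection \<open>The nonlinearity and its linearization\<close>

lemma DG_linear: "z \<in> carr Z \<Longrightarrow> linear_between scZ scW (carr Z) (carr W) (DG z)"
  using DG by (simp add: frechet_deriv_ns_def bounded_op_def)
lemma DG_in: "z \<in> carr Z \<Longrightarrow> h \<in> carr Z \<Longrightarrow> DG z h \<in> carr W"
  using DG_linear by (simp add: linear_between_def)
lemma DG_add: "z \<in> carr Z \<Longrightarrow> h \<in> carr Z \<Longrightarrow> k \<in> carr Z \<Longrightarrow> DG z (h + k) = DG z h + DG z k"
  using DG_linear by (simp add: linear_between_def)
lemma DG_scale: "z \<in> carr Z \<Longrightarrow> h \<in> carr Z \<Longrightarrow> DG z (scZ a h) = scW a (DG z h)"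
  using DG_linear by (simp add: linear_between_def)
lemma DG_scaleR: "z \<in> carr Z \<Longrightarrow> h \<in> carr Z \<Longrightarrow> DG z (a *\<^sub>R h) = a *\<^sub>R DG z h"
  using DG_scale[of z h "of_real a"] by (simp add: Z.scale_of_real W.scale_of_real)
lemma DG_diff: "z \<in> carr Z \<Longrightarrow> h \<in> carr Z \<Longrightarrow> k \<in> carr Z \<Longrightarrow> DG z (h - k) = DG z h - DG z k"
  using DG_add[of z h "- k"] DG_scaleR[of z k "-1"] by simp

lemma DG_eps:
  assumes "z \<in> carr Z" "e > 0"
  obtains d where "d > 0" "\<And>h. h \<in> carr Z \<Longrightarrow> nrm Z h < d \<Longrightarrow> nrm W (G (z + h) - G z - DG z h) \<le> e * nrm Z h"
  using DG[OF assms(1)] assms(2) unfolding frechet_deriv_ns_def by meson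

lemma DG_bound:
  assumes z: "z \<in> carr Z" and h: "h \<in> carr Z"
  shows "nrm W (DG z h) \<le> nrm Z h"
proof (rule field_le_epsilon)
  fix e' :: real assume e': "e' > 0"
  have h0: "0 \<le> nrm Z h" using h by (rule Z.nrm_nonneg)
  define e where "e = e' / (nrm Z h + 1)"
  have e: "e > 0" "e * nrm Z h \<le> e'" using e' h0 by (auto simp: e_def field_simps)
  obtain d where d: "d > 0" "\<And>k. k \<in> carr Z \<Longrightarrow> nrm Z k < d \<Longrightarrow> nrm W (G (z + k) - G z - DG z k) \<le> e * nrm Z k"
    using DG_eps[OF z e(1)] by metis
  define \<tau> where "\<tau> = d / (nrm Z h + 1)"
  have \<tau>: "\<tau> > 0" "\<tau> * nrm Z h < d" using d(1) h0 by (auto simp: \<tau>_def field_simps)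
  have k: "\<tau> *\<^sub>R h \<in> carr Z" "nrm Z (\<tau> *\<^sub>R h) = \<tau> * nrm Z h" using h \<tau> by (auto simp: Z.nrm_scaleR)
  have zk: "z + \<tau> *\<^sub>R h \<in> carr Z" using z k by simp
  have "nrm W (DG z (\<tau> *\<^sub>R h)) \<le> nrm W (G (z + \<tau> *\<^sub>R h) - G z) + nrm W (G (z + \<tau> *\<^sub>R h) - G z - DG z (\<tau> *\<^sub>R h))"
    using W.nrm_triangle_diff[of "G (z + \<tau> *\<^sub>R h) - G z" "G (z + \<tau> *\<^sub>R h) - G z - DG z (\<tau> *\<^sub>R h)"]
      G_in[OF zk] G_in[OF z] DG_in[OF z k(1)] by simp
  also have "\<dots> \<le> \<tau> * nrm Z h + e * (\<tau> * nrm Z h)"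
    using G_Lip[OF zk z] d(2)[OF k(1)] k(2) \<tau>(2) by (intro add_mono) auto
  also have "\<dots> = \<tau> * (nrm Z h + e * nrm Z h)" by (simp add: algebra_simps)
  also have "\<dots> \<le> \<tau> * (nrm Z h + e')" using e \<tau> by (intro mult_left_mono) auto
  finally have "\<tau> * nrm W (DG z h) \<le> \<tau> * (nrm Z h + e')"
    using DG_scaleR[OF z h, of \<tau>] W.nrm_scaleR[OF DG_in[OF z h], of \<tau>] \<tau>(1) by simp
  then show "nrm W (DG z h) \<le> nrm Z h + e'" using \<tau>(1) by simp
qed

lemma nemytskii_G: "nemytskii (\<lambda>s. G)"
  unfolding nemytskii_def
proof (intro conjI allI impI ballI)
  fix u assume u: "continuous_path Z {..0} u"
  show "continuous_path W {..0} (\<lambda>s. G (u s))"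
  proof (rule W.continuous_path_dominated[where m = "\<lambda>s r. nrm Z (u r - u s)"])
    show "((\<lambda>r. nrm Z (u r - u s)) \<longlongrightarrow> 0) (at s within {..0})" if "s \<in> {..0}" for s
      by (rule Z.continuous_path_lim[OF u that])
  qed (use Z.continuous_pathD[OF u] G_in G_Lip in auto)
qed (use G_in G_Lip G_0 in auto)

lemma nemytskii_DG:
  assumes \<phi>: "continuous_path Z {..0} \<phi>"
  shows "nemytskii (\<lambda>s. DG (\<phi> s))"
proof -
  have in\<phi>: "\<phi> s \<in> carr Z" if "s \<le> 0" for s using Z.continuous_pathD[OF \<phi>] that by simp
  have "continuous_path W {..0} (\<lambda>s. DG (\<phi> s) (u s))" if u: "continuous_path Z {..0} u" for u
  proof (rule W.continuous_pathI)
    have inu: "u s \<in> carr Z" if "s \<le> 0" for s using Z.continuous_pathD[OF u] that by simp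
    show "DG (\<phi> s) (u s) \<in> carr W" if "s \<in> {..0}" for s using DG_in in\<phi> inu that by simp
    fix s e :: real assume s: "s \<in> {..0}" and e: "e > 0"
    have s0: "s \<le> 0" using s by simp
    have n0: "0 \<le> nrm Z (u s)" using inu[OF s0] by (rule Z.nrm_nonneg)
    define e' where "e' = e / (2 * (nrm Z (u s) + 1))"
    have e': "e' > 0" "e' * nrm Z (u s) < e / 2"
    proof -
      show "e' > 0" using e n0 by (simp add: e'_def)
      have "e' * (nrm Z (u s) + 1) = e / 2" using n0 by (simp add: e'_def divide_simps)
      then show "e' * nrm Z (u s) < e / 2" using \<open>e' > 0\<close> by (simp add: algebra_simps)
    qed
    obtain d1 where d1: "d1 > 0" "\<And>z'. z' \<in> carr Z \<Longrightarrow> nrm Z (z' - \<phi> s) < d1 \<Longrightarrow> opbound Z W (\<lambda>h. DG z' h - DG (\<phi> s) h) e'"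
      using DG_cont[OF in\<phi>[OF s0] e'(1)] by blast
    obtain d2 where d2: "d2 > 0" "\<And>r. r \<in> {..0} \<Longrightarrow> \<bar>r - s\<bar> < d2 \<Longrightarrow> nrm Z (\<phi> r - \<phi> s) < d1"
      using Z.continuous_path_eps[OF \<phi> s d1(1)] by metis
    obtain d3 where d3: "d3 > 0" "\<And>r. r \<in> {..0} \<Longrightarrow> \<bar>r - s\<bar> < d3 \<Longrightarrow> nrm Z (u r - u s) < e / 2"
      using Z.continuous_path_eps[OF u s half_gt_zero[OF e]] by metis
    have "nrm W (DG (\<phi> r) (u r) - DG (\<phi> s) (u s)) < e" if r: "r \<in> {..0}" "\<bar>r - s\<bar> < min d2 d3" for r
    proof -
      have r0: "r \<le> 0" using r by simp
      have eq: "DG (\<phi> r) (u r) - DG (\<phi> s) (u s) = DG (\<phi> r) (u r - u s) + (DG (\<phi> r) (u s) - DG (\<phi> s) (u s))"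
        using DG_diff[OF in\<phi>[OF r0] inu[OF r0] inu[OF s0]] by simp
      have "nrm W (DG (\<phi> r) (u r - u s) + (DG (\<phi> r) (u s) - DG (\<phi> s) (u s)))
          \<le> nrm W (DG (\<phi> r) (u r - u s)) + nrm W (DG (\<phi> r) (u s) - DG (\<phi> s) (u s))"
        by (rule W.nrm_triangle) (use DG_in in\<phi> inu r0 s0 in auto)
      moreover have "nrm W (DG (\<phi> r) (u r - u s)) \<le> nrm Z (u r - u s)"
        by (rule DG_bound) (use in\<phi> inu r0 s0 in auto)
      moreover have "nrm W (DG (\<phi> r) (u s) - DG (\<phi> s) (u s)) \<le> e' * nrm Z (u s)"
        using d1(2)[OF in\<phi>[OF r0] d2(2)] r inu[OF s0] by (simp add: opbound_def)
      moreover have "nrm Z (u r - u s) < e / 2" using d3(2)[OF r(1)] r(2) by simp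
      ultimately show ?thesis unfolding eq using e'(2) by linarith
    qed
    then show "\<exists>d>0. \<forall>r\<in>{..0}. \<bar>r - s\<bar> < d \<longrightarrow> nrm W (DG (\<phi> r) (u r) - DG (\<phi> s) (u s)) < e"
      using d2(1) d3(1) by (intro exI[of _ "min d2 d3"]) auto
  qed
  moreover have "DG z 0 = 0" if "z \<in> carr Z" for z using DG_diff[OF that, of 0 0] by simp
  moreover have "nrm W (DG z h - DG z k) \<le> nrm Z (h - k)" if "z \<in> carr Z" "h \<in> carr Z" "k \<in> carr Z" for z h k
    using DG_bound[OF that(1), of "h - k"] DG_diff[OF that] that by simp
  ultimately show ?thesis
    unfolding nemytskii_def using in\<phi> DG_in by simp
qed

text \<open>
  A continuously differentiable map is differentiable uniformly near each point. The mean value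
  inequality behind this is obtained by bisection on \<open>[0, 1]\<close> (Bolzano's lemma) for the additive
  property \<open>P\<close>.
\<close>

lemma taylor_local:
  assumes z0: "z0 \<in> carr Z" and e: "e > 0"
  obtains d where "d > 0" "\<And>z k. z \<in> carr Z \<Longrightarrow> k \<in> carr Z \<Longrightarrow> nrm Z (z - z0) < d \<Longrightarrow> nrm Z k < d \<Longrightarrow>
    nrm W (G (z + k) - G z - DG z k) \<le> e * nrm Z k"
proof -
  have e4: "e / 4 > 0" using e by simp
  obtain d where d: "d > 0" "\<And>z'. z' \<in> carr Z \<Longrightarrow> nrm Z (z' - z0) < d \<Longrightarrow> opbound Z W (\<lambda>h. DG z' h - DG z0 h) (e / 4)"
    using DG_cont[OF z0 e4] by blast
  have near: "nrm W (DG z' h - DG z0 h) \<le> e / 4 * nrm Z h" if "z' \<in> carr Z" "nrm Z (z' - z0) < d" "h \<in> carr Z" for z' h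
    using d(2)[OF that(1,2)] that(3) by (simp add: opbound_def)
  have "nrm W (G (z + k) - G z - DG z k) \<le> e * nrm Z k"
    if z: "z \<in> carr Z" and k: "k \<in> carr Z" and zd: "nrm Z (z - z0) < d / 2" and kd: "nrm Z k < d / 2" for z k
  proof -
    define P where "P a b \<longleftrightarrow> nrm W (G (z + b *\<^sub>R k) - G (z + a *\<^sub>R k) - (b - a) *\<^sub>R DG z0 k) \<le> e / 2 * (b - a) * nrm Z k" for a b
    have in1: "z + a *\<^sub>R k \<in> carr Z" "G (z + a *\<^sub>R k) \<in> carr W" "DG z0 k \<in> carr W" for a
      using z k z0 G_in DG_in by auto
    have "P 0 1"
    proof (rule Bolzano)
      show "P a c" if "P a b" "P b c" for a b c
      proof -
        have "G (z + c *\<^sub>R k) - G (z + a *\<^sub>R k) - (c - a) *\<^sub>R DG z0 k =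
          (G (z + c *\<^sub>R k) - G (z + b *\<^sub>R k) - (c - b) *\<^sub>R DG z0 k) + (G (z + b *\<^sub>R k) - G (z + a *\<^sub>R k) - (b - a) *\<^sub>R DG z0 k)"
          by (simp add: algebra_simps)
        moreover have "nrm W \<dots> \<le> e / 2 * (c - b) * nrm Z k + e / 2 * (b - a) * nrm Z k"
          by (rule order_trans[OF W.nrm_triangle]) (use that in1 in \<open>auto simp: P_def intro: add_mono\<close>)
        moreover have "e / 2 * (c - b) * nrm Z k + e / 2 * (b - a) * nrm Z k = e / 2 * (c - a) * nrm Z k"
          by (simp add: field_simps)
        ultimately show ?thesis unfolding P_def by (simp only:)
      qed
      fix x :: real assume x: "0 \<le> x" "x \<le> 1"
      let ?zx = "z + x *\<^sub>R k"
      have zx: "?zx \<in> carr Z" by (rule in1)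
      have "nrm Z (?zx - z0) \<le> nrm Z (z - z0) + \<bar>x\<bar> * nrm Z k"
        using Z.nrm_triangle[of "z - z0" "x *\<^sub>R k"] z z0 k by (simp add: Z.nrm_scaleR algebra_simps)
      moreover have "\<bar>x\<bar> * nrm Z k \<le> 1 * nrm Z k" using x Z.nrm_nonneg[OF k] by (intro mult_right_mono) auto
      ultimately have zxd: "nrm Z (?zx - z0) < d" using zd kd by simp
      obtain d' where d': "d' > 0" "\<And>h. h \<in> carr Z \<Longrightarrow> nrm Z h < d' \<Longrightarrow> nrm W (G (?zx + h) - G ?zx - DG ?zx h) \<le> e / 4 * nrm Z h"
        using DG_eps[OF zx e4] by metis
      have small: "nrm W (G (z + (x + \<tau>) *\<^sub>R k) - G ?zx - \<tau> *\<^sub>R DG z0 k) \<le> e / 2 * \<bar>\<tau>\<bar> * nrm Z k"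
        if "\<bar>\<tau>\<bar> < d' / (nrm Z k + 1)" for \<tau>
      proof -
        have "\<bar>\<tau>\<bar> * (nrm Z k + 1) < d'" using that Z.nrm_nonneg[OF k] by (simp add: pos_less_divide_eq)
        then have \<tau>d: "\<bar>\<tau>\<bar> * nrm Z k < d'" by (simp add: algebra_simps)
        have \<tau>k: "\<tau> *\<^sub>R k \<in> carr Z" "nrm Z (\<tau> *\<^sub>R k) = \<bar>\<tau>\<bar> * nrm Z k" using k by (auto simp: Z.nrm_scaleR)
        have "G (z + (x + \<tau>) *\<^sub>R k) - G ?zx - \<tau> *\<^sub>R DG z0 k =
            (G (?zx + \<tau> *\<^sub>R k) - G ?zx - DG ?zx (\<tau> *\<^sub>R k)) + (DG ?zx (\<tau> *\<^sub>R k) - DG z0 (\<tau> *\<^sub>R k))"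
          using DG_scaleR[OF z0 k] by (simp add: algebra_simps)
        moreover have "nrm W \<dots> \<le> e / 4 * (\<bar>\<tau>\<bar> * nrm Z k) + e / 4 * (\<bar>\<tau>\<bar> * nrm Z k)"
        proof (rule order_trans[OF W.nrm_triangle add_mono])
          show "nrm W (G (?zx + \<tau> *\<^sub>R k) - G ?zx - DG ?zx (\<tau> *\<^sub>R k)) \<le> e / 4 * (\<bar>\<tau>\<bar> * nrm Z k)"
            using d'(2)[OF \<tau>k(1)] \<tau>k(2) \<tau>d by simp
          show "nrm W (DG ?zx (\<tau> *\<^sub>R k) - DG z0 (\<tau> *\<^sub>R k)) \<le> e / 4 * (\<bar>\<tau>\<bar> * nrm Z k)"
            using near[OF zx zxd \<tau>k(1)] \<tau>k(2) by simp
        qed (use G_in[OF Z.add_in[OF zx \<tau>k(1)]] G_in[OF zx] DG_in[OF zx \<tau>k(1)] DG_in[OF z0 \<tau>k(1)] in auto)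
        moreover have "e / 4 * (\<bar>\<tau>\<bar> * nrm Z k) + e / 4 * (\<bar>\<tau>\<bar> * nrm Z k) = e / 2 * \<bar>\<tau>\<bar> * nrm Z k" by simp
        ultimately show ?thesis by (simp only:)
      qed
      have "P a b" if "a \<le> x \<and> x \<le> b \<and> b - a < d' / (nrm Z k + 1)" for a b
      proof -
        have b: "nrm W (G (z + b *\<^sub>R k) - G ?zx - (b - x) *\<^sub>R DG z0 k) \<le> e / 2 * (b - x) * nrm Z k"
          using small[of "b - x"] that by simp
        have a: "nrm W (G (z + a *\<^sub>R k) - G ?zx - (a - x) *\<^sub>R DG z0 k) \<le> e / 2 * (x - a) * nrm Z k"
          using small[of "a - x"] that by simp
        have "G (z + b *\<^sub>R k) - G (z + a *\<^sub>R k) - (b - a) *\<^sub>R DG z0 k =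
          (G (z + b *\<^sub>R k) - G ?zx - (b - x) *\<^sub>R DG z0 k) - (G (z + a *\<^sub>R k) - G ?zx - (a - x) *\<^sub>R DG z0 k)"
          by (simp add: algebra_simps)
        moreover have "nrm W \<dots> \<le> e / 2 * (b - x) * nrm Z k + e / 2 * (x - a) * nrm Z k"
          by (rule order_trans[OF W.nrm_triangle_diff add_mono[OF b a]]) (use in1 in auto)
        moreover have "e / 2 * (b - x) * nrm Z k + e / 2 * (x - a) * nrm Z k = e / 2 * (b - a) * nrm Z k"
          by (simp add: field_simps)
        ultimately show ?thesis unfolding P_def by (simp only:)
      qed
      moreover have "d' / (nrm Z k + 1) > 0" using d' Z.nrm_nonneg[OF k] by simp
      ultimately show "\<exists>\<delta>>0. \<forall>a b. a \<le> x \<and> x \<le> b \<and> b - a < \<delta> \<longrightarrow> P a b" by blast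
    qed simp
    then have 1: "nrm W (G (z + k) - G z - DG z0 k) \<le> e / 2 * nrm Z k" by (simp add: P_def)
    have 2: "nrm W (DG z k - DG z0 k) \<le> e / 4 * nrm Z k"
      using near[OF z _ k] zd d(1) by simp
    have "G (z + k) - G z - DG z k = (G (z + k) - G z - DG z0 k) - (DG z k - DG z0 k)" by simp
    moreover have "nrm W \<dots> \<le> e / 2 * nrm Z k + e / 4 * nrm Z k"
      by (rule order_trans[OF W.nrm_triangle_diff add_mono[OF 1 2]])
        (use G_in[OF Z.add_in[OF z k]] G_in[OF z] DG_in[OF z k] DG_in[OF z0 k] in auto)
    moreover have "0 \<le> e * nrm Z k" using e Z.nrm_nonneg[OF k] by simp
    ultimately show ?thesis by simp
  qed
  then show thesis using d(1) that[of "d / 2"] by simp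
qed

text \<open>
  Compactness of \<open>[-T, 0]\<close>, again in the form of Bolzano's lemma, makes the radius uniform along
  the path.
\<close>

lemma taylor_on_path:
  assumes \<phi>: "continuous_path Z {..0} \<phi>" and e: "e > 0" and T: "T \<ge> 0"
  obtains d where "d > 0" "\<And>s k. - T \<le> s \<Longrightarrow> s \<le> 0 \<Longrightarrow> k \<in> carr Z \<Longrightarrow> nrm Z k < d \<Longrightarrow>
    nrm W (G (\<phi> s + k) - G (\<phi> s) - DG (\<phi> s) k) \<le> e * nrm Z k"
proof -
  define P where "P a b \<longleftrightarrow> (\<exists>d>0. \<forall>s k. a \<le> s \<and> s \<le> b \<and> s \<le> 0 \<and> k \<in> carr Z \<and> nrm Z k < d \<longrightarrow>
    nrm W (G (\<phi> s + k) - G (\<phi> s) - DG (\<phi> s) k) \<le> e * nrm Z k)" for a b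
  have "P (- T) 0"
  proof (rule Bolzano)
    show "P a c" if P: "P a b" "P b c" for a b c
    proof -
      obtain d1 d2 where "d1 > 0" "d2 > 0" and
        d1: "\<forall>s k. a \<le> s \<and> s \<le> b \<and> s \<le> 0 \<and> k \<in> carr Z \<and> nrm Z k < d1 \<longrightarrow>
          nrm W (G (\<phi> s + k) - G (\<phi> s) - DG (\<phi> s) k) \<le> e * nrm Z k" and
        d2: "\<forall>s k. b \<le> s \<and> s \<le> c \<and> s \<le> 0 \<and> k \<in> carr Z \<and> nrm Z k < d2 \<longrightarrow>
          nrm W (G (\<phi> s + k) - G (\<phi> s) - DG (\<phi> s) k) \<le> e * nrm Z k"
        using P unfolding P_def by blast
      then show ?thesis unfolding P_def
        by (intro exI[of _ "min d1 d2"] conjI allI impI) (simp, metis linear min_less_iff_conj)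
    qed
    fix x :: real assume x: "- T \<le> x" "x \<le> 0"
    then have \<phi>x: "\<phi> x \<in> carr Z" using Z.continuous_pathD[OF \<phi>] by simp
    obtain d where d: "d > 0" "\<And>z k. z \<in> carr Z \<Longrightarrow> k \<in> carr Z \<Longrightarrow> nrm Z (z - \<phi> x) < d \<Longrightarrow> nrm Z k < d \<Longrightarrow>
      nrm W (G (z + k) - G z - DG z k) \<le> e * nrm Z k"
      using taylor_local[OF \<phi>x e] by metis
    obtain \<delta> where \<delta>: "\<delta> > 0" "\<And>r. r \<in> {..0} \<Longrightarrow> \<bar>r - x\<bar> < \<delta> \<Longrightarrow> nrm Z (\<phi> r - \<phi> x) < d"
      using Z.continuous_path_eps[OF \<phi> _ d(1), of x] x by auto
    have "P a b" if "a \<le> x \<and> x \<le> b \<and> b - a < \<delta>" for a b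
      unfolding P_def
    proof (intro exI[of _ d] conjI allI impI d(1))
      fix s k assume s: "a \<le> s \<and> s \<le> b \<and> s \<le> 0 \<and> k \<in> carr Z \<and> nrm Z k < d"
      then have "\<bar>s - x\<bar> < \<delta>" using that by auto
      then show "nrm W (G (\<phi> s + k) - G (\<phi> s) - DG (\<phi> s) k) \<le> e * nrm Z k"
        using s \<delta>(2)[of s] Z.continuous_pathD[OF \<phi>, of s] by (intro d(2)) auto
    qed
    then show "\<exists>d>0. \<forall>a b. a \<le> x \<and> x \<le> b \<and> b - a < d \<longrightarrow> P a b" using \<delta>(1) by blast
  qed (use T in simp)
  then obtain d where d: "d > 0" "\<forall>s k. - T \<le> s \<and> s \<le> 0 \<and> s \<le> 0 \<and> k \<in> carr Z \<and> nrm Z k < d \<longrightarrow>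
      nrm W (G (\<phi> s + k) - G (\<phi> s) - DG (\<phi> s) k) \<le> e * nrm Z k"
    unfolding P_def by blast
  show thesis by (rule that[OF d(1)]) (use d(2) in blast)
qed

text \<open>
  The Taylor remainder along \<open>\<phi>\<close> at a path \<open>\<psi>\<close> of size \<open>a\<close> in the weight \<open>\<eta>\<close> is \<open>o(a)\<close> in the
  weight \<open>\<eta>\<^sub>1\<close>. The weaker weight is needed for \<open>s\<close> near \<open>-\<infinity>\<close>, where only the Lipschitz bound
  \<open>2 * nrm Z (\<psi> s)\<close> is available.
\<close>

lemma taylor_weighted:
  assumes \<phi>: "continuous_path Z {..0} \<phi>" and e: "e > 0" and C: "C \<ge> 0"
  obtains d where "d > 0" "\<And>\<psi> a s. (\<And>s. s \<le> 0 \<Longrightarrow> \<psi> s \<in> carr Z) \<Longrightarrow>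
    (\<And>s. s \<le> 0 \<Longrightarrow> nrm Z (\<psi> s) \<le> C * a * exp (\<eta> * s)) \<Longrightarrow> 0 \<le> a \<Longrightarrow> a < d \<Longrightarrow> s \<le> 0 \<Longrightarrow>
    nrm W (G (\<phi> s + \<psi> s) - G (\<phi> s) - DG (\<phi> s) (\<psi> s)) \<le> e * a * exp (\<eta>\<^sub>1 * s)"
proof -
  have in\<phi>: "\<phi> s \<in> carr Z" if "s \<le> 0" for s using Z.continuous_pathD[OF \<phi>] that by simp
  \<comment> \<open>beyond \<open>-T\<close> the gain \<open>exp ((\<eta> - \<eta>\<^sub>1) * s)\<close> makes the Lipschitz bound small; \<open>T\<close> is found from \<open>1 + x \<le> exp x\<close>\<close>
  define T where "T = 2 * C / e / (\<eta> - \<eta>\<^sub>1)"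
  have T: "T \<ge> 0" using C e weights by (simp add: T_def)
  have far: "2 * C * exp ((\<eta> - \<eta>\<^sub>1) * s) \<le> e" if "s \<le> - T" for s
  proof -
    have "(\<eta> - \<eta>\<^sub>1) * s \<le> (\<eta> - \<eta>\<^sub>1) * (- T)" using that weights by (intro mult_left_mono) auto
    also have "\<dots> = - (2 * C / e)" using weights by (simp add: T_def)
    finally have "2 * C / e \<le> exp (- ((\<eta> - \<eta>\<^sub>1) * s))"
      using exp_ge_add_one_self[of "- ((\<eta> - \<eta>\<^sub>1) * s)"] by linarith
    then have "2 * C \<le> e * exp (- ((\<eta> - \<eta>\<^sub>1) * s))" using e by (simp add: pos_divide_le_eq mult.commute)
    then have "2 * C \<le> e / exp ((\<eta> - \<eta>\<^sub>1) * s)" by (simp only: exp_minus divide_inverse)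
    then show ?thesis by (simp only: pos_le_divide_eq[OF exp_gt_zero])
  qed
  define e' where "e' = e / (C + 1)"
  have e': "e' > 0" "e' * C \<le> e" using e C by (auto simp: e'_def field_simps)
  obtain d where d: "d > 0" "\<And>s k. - T \<le> s \<Longrightarrow> s \<le> 0 \<Longrightarrow> k \<in> carr Z \<Longrightarrow> nrm Z k < d \<Longrightarrow>
    nrm W (G (\<phi> s + k) - G (\<phi> s) - DG (\<phi> s) k) \<le> e' * nrm Z k"
    using taylor_on_path[OF \<phi> e'(1) T] by metis
  \<comment> \<open>\<open>exp (\<bar>\<eta>\<bar> * T)\<close> bounds the weight on \<open>[-T, 0]\<close> for either sign of \<open>\<eta>\<close>\<close>
  define d0 where "d0 = d / ((C + 1) * exp (\<bar>\<eta>\<bar> * T))"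
  have d0: "d0 > 0" using d C by (simp add: d0_def)
  show thesis
  proof (rule that[OF d0])
    fix \<psi> :: "real \<Rightarrow> 'z" and a s :: real
    assume \<psi>: "\<And>s. s \<le> 0 \<Longrightarrow> \<psi> s \<in> carr Z" and \<psi>b: "\<And>s. s \<le> 0 \<Longrightarrow> nrm Z (\<psi> s) \<le> C * a * exp (\<eta> * s)"
      and a: "0 \<le> a" "a < d0" and s: "s \<le> 0"
    have Ca: "0 \<le> C * a" using C a by simp
    show "nrm W (G (\<phi> s + \<psi> s) - G (\<phi> s) - DG (\<phi> s) (\<psi> s)) \<le> e * a * exp (\<eta>\<^sub>1 * s)"
    proof (cases "s \<le> - T")
      case True
      have "nrm W (G (\<phi> s + \<psi> s) - G (\<phi> s) - DG (\<phi> s) (\<psi> s)) \<le> nrm W (G (\<phi> s + \<psi> s) - G (\<phi> s)) + nrm W (DG (\<phi> s) (\<psi> s))"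
        by (rule W.nrm_triangle_diff) (use G_in DG_in in\<phi>[OF s] \<psi>[OF s] in auto)
      also have "\<dots> \<le> nrm Z (\<psi> s) + nrm Z (\<psi> s)"
        using G_Lip[of "\<phi> s + \<psi> s" "\<phi> s"] DG_bound in\<phi>[OF s] \<psi>[OF s] by (intro add_mono) auto
      also have "\<dots> \<le> 2 * C * a * exp (\<eta> * s)" using \<psi>b[OF s] by simp
      also have "\<dots> = (2 * C * exp ((\<eta> - \<eta>\<^sub>1) * s)) * (a * exp (\<eta>\<^sub>1 * s))"
        by (simp add: left_diff_distrib exp_diff)
      also have "\<dots> \<le> e * (a * exp (\<eta>\<^sub>1 * s))" using far[OF True] a by (intro mult_right_mono) auto
      finally show ?thesis by (simp add: mult.assoc)
    next
      case False
      have "nrm Z (\<psi> s) < d"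
      proof -
        have "\<eta> * s \<le> \<bar>\<eta>\<bar> * T"
        proof -
          have "\<eta> * s \<le> \<bar>\<eta>\<bar> * \<bar>s\<bar>" by (metis abs_ge_self abs_mult)
          also have "\<dots> \<le> \<bar>\<eta>\<bar> * T" using False s by (intro mult_left_mono) auto
          finally show ?thesis .
        qed
        then have "C * a * exp (\<eta> * s) \<le> (C + 1) * a * exp (\<bar>\<eta>\<bar> * T)"
          using C a by (intro mult_mono) auto
        also have "\<dots> < (C + 1) * d0 * exp (\<bar>\<eta>\<bar> * T)"
          using C a by (intro mult_strict_right_mono mult_strict_left_mono) auto
        also have "\<dots> = d" using C by (simp add: d0_def)
        finally show ?thesis using \<psi>b[OF s] by simp
      qed
      then have "nrm W (G (\<phi> s + \<psi> s) - G (\<phi> s) - DG (\<phi> s) (\<psi> s)) \<le> e' * nrm Z (\<psi> s)"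
        using False s \<psi> by (intro d(2)) auto
      also have "\<dots> \<le> e' * (C * a * exp (\<eta> * s))" using \<psi>b[OF s] e' by (intro mult_left_mono) auto
      also have "\<dots> \<le> e' * (C * a * exp (\<eta>\<^sub>1 * s))"
        by (rule mult_left_mono[OF weight_le[OF Ca s] less_imp_le[OF e'(1)]])
      also have "\<dots> = (e' * C) * (a * exp (\<eta>\<^sub>1 * s))" by simp
      also have "\<dots> \<le> e * (a * exp (\<eta>\<^sub>1 * s))" using e' a by (intro mult_right_mono) auto
      finally show ?thesis by (simp add: mult.assoc)
    qed
  qed
qed

subsection \<open>Dependence on the parameter\<close>

lemma fixed_point_exists: "v \<in> carr U \<Longrightarrow> \<exists>\<phi>. solves (\<lambda>s. G) (p v) \<phi>"
  by (rule solution_exists[OF nemytskii_G p_path p_bound]) auto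

text \<open>
  The derivative at \<open>v\<close> in direction \<open>h\<close> is the value at \<open>0\<close> of the solution \<open>\<omega> h\<close> of the equation
  linearized along the solution at \<open>v\<close>.
\<close>

theorem frechet_differentiable:
  assumes \<Phi>: "\<And>v. v \<in> carr U \<Longrightarrow> \<exists>\<phi>. solves (\<lambda>s. G) (p v) \<phi> \<and> \<Phi> v = \<phi> 0" and v: "v \<in> carr U"
  shows "\<exists>D. frechet_deriv_ns scU scZ U Z \<Phi> v D"
proof -
  obtain \<phi> where sol: "\<And>v. v \<in> carr U \<Longrightarrow> solves (\<lambda>s. G) (p v) (\<phi> v)" and \<Phi>\<phi>: "\<And>v. v \<in> carr U \<Longrightarrow> \<Phi> v = \<phi> v 0"
    using \<Phi> by metis
  have \<phi>p: "continuous_path Z {..0} (\<phi> v)" if "v \<in> carr U" for v using sol[OF that] by (simp add: solves_def)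
  have \<phi>in: "\<phi> v s \<in> carr Z" if "v \<in> carr U" "s \<le> 0" for v s using Z.continuous_pathD[OF \<phi>p] that by auto
  have \<phi>eq: "\<phi> v t = p v t + K (\<lambda>s. G (\<phi> v s)) t" if "v \<in> carr U" "t \<le> 0" for v t
    using sol that by (simp add: solves_def)
  define C where "C = M / (1 - q)"
  have C: "0 \<le> C" using M q by (simp add: C_def)
  let ?L = "\<lambda>s. DG (\<phi> v s)"
  note L = nemytskii_DG[OF \<phi>p[OF v]]
  have "\<exists>\<omega>. solves ?L (p h) \<omega> \<and> (\<forall>t\<le>0. nrm Z (\<omega> t) \<le> C * nrm U h * exp (\<eta> * t))" if h: "h \<in> carr U" for h
    using solution_exists[OF L p_path[OF h] p_bound[OF h]] by (simp add: C_def) metis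
  then obtain \<omega> where \<omega>: "\<And>h. h \<in> carr U \<Longrightarrow> solves ?L (p h) (\<omega> h)"
    and \<omega>b: "\<And>h t. h \<in> carr U \<Longrightarrow> t \<le> 0 \<Longrightarrow> nrm Z (\<omega> h t) \<le> C * nrm U h * exp (\<eta> * t)"
    by metis
  have \<omega>p: "continuous_path Z {..0} (\<omega> h)" if "h \<in> carr U" for h using \<omega>[OF that] by (simp add: solves_def)
  have \<omega>in: "\<omega> h s \<in> carr Z" if "h \<in> carr U" "s \<le> 0" for h s using Z.continuous_pathD[OF \<omega>p] that by auto
  have \<omega>eq: "\<omega> h t = p h t + K (\<lambda>s. ?L s (\<omega> h s)) t" if "h \<in> carr U" "t \<le> 0" for h t
    using \<omega> that by (simp add: solves_def)
  have Lp: "continuous_path W {..0} (\<lambda>s. ?L s (\<omega> h s))" if "h \<in> carr U" for h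
    by (rule nemytskiiD(3)[OF L \<omega>p[OF that]])
  have Lb: "nrm W (?L s (\<omega> h s)) \<le> C * nrm U h * exp (\<eta> * s)" if "h \<in> carr U" "s \<le> 0" for h s
    using order_trans[OF DG_bound \<omega>b] \<phi>in[OF v] \<omega>in that by simp
  have Lb1: "nrm W (?L s (\<omega> h s)) \<le> C * nrm U h * exp (\<eta>\<^sub>1 * s)" if "h \<in> carr U" "s \<le> 0" for h s
    by (rule W_path_bound_weaken[OF Lp Lb]) (use that in auto)
  \<comment> \<open>linearity in \<open>h\<close> follows from uniqueness\<close>
  have add: "\<omega> (h + k) t = \<omega> h t + \<omega> k t" if hk: "h \<in> carr U" "k \<in> carr U" and t: "t \<le> 0" for h k t
  proof (rule solves_unique[OF L \<omega>[OF U.add_in[OF hk]] _ t])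
    have Kadd: "K (\<lambda>s. ?L s (\<omega> h s + \<omega> k s)) t = K (\<lambda>s. ?L s (\<omega> h s)) t + K (\<lambda>s. ?L s (\<omega> k s)) t" if t: "t \<le> 0" for t
    proof -
      have "K (\<lambda>s. ?L s (\<omega> h s + \<omega> k s)) t = K (\<lambda>s. ?L s (\<omega> h s) + ?L s (\<omega> k s)) t"
        by (rule K_cong[OF _ t]) (use DG_add \<phi>in[OF v] \<omega>in hk in simp)
      then show ?thesis using K_add[OF Lp[OF hk(1)] Lp[OF hk(2)] Lb1[OF hk(1)] Lb1[OF hk(2)] t] by simp
    qed
    show "solves ?L (p (h + k)) (\<lambda>t. \<omega> h t + \<omega> k t)"
      unfolding solves_def
    proof (intro conjI allI impI)
      show "continuous_path Z {..0} (\<lambda>t. \<omega> h t + \<omega> k t)" by (rule Z.continuous_path_add[OF \<omega>p[OF hk(1)] \<omega>p[OF hk(2)]])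
      show "\<exists>c. \<forall>t\<le>0. nrm Z (\<omega> h t + \<omega> k t) \<le> c * exp (\<eta> * t)"
      proof (intro exI[of _ "C * nrm U h + C * nrm U k"] allI impI)
        fix t :: real assume "t \<le> 0"
        then show "nrm Z (\<omega> h t + \<omega> k t) \<le> (C * nrm U h + C * nrm U k) * exp (\<eta> * t)"
          using Z.nrm_triangle[OF \<omega>in[OF hk(1)] \<omega>in[OF hk(2)], of t t] \<omega>b[OF hk(1), of t] \<omega>b[OF hk(2), of t]
          by (simp add: distrib_right)
      qed
      fix t :: real assume "t \<le> 0"
      then show "\<omega> h t + \<omega> k t = p (h + k) t + K (\<lambda>s. ?L s (\<omega> h s + \<omega> k s)) t"
        using \<omega>eq[OF hk(1), of t] \<omega>eq[OF hk(2), of t] p_add[OF hk, of t] Kadd[of t] by simp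
    qed
  qed
  have scale: "\<omega> (scU a h) t = scZ a (\<omega> h t)" if h: "h \<in> carr U" and t: "t \<le> 0" for a h t
  proof (rule solves_unique[OF L \<omega>[OF U.scale_in[OF h]] _ t])
    have Kscale: "K (\<lambda>s. ?L s (scZ a (\<omega> h s))) t = scZ a (K (\<lambda>s. ?L s (\<omega> h s)) t)" if t: "t \<le> 0" for t
    proof -
      have "K (\<lambda>s. ?L s (scZ a (\<omega> h s))) t = K (\<lambda>s. scW a (?L s (\<omega> h s))) t"
        by (rule K_cong[OF _ t]) (use DG_scale \<phi>in[OF v] \<omega>in h in simp)
      then show ?thesis using K_scale[OF Lp[OF h] Lb1[OF h] t] by simp
    qed
    show "solves ?L (p (scU a h)) (\<lambda>t. scZ a (\<omega> h t))"
      unfolding solves_def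
    proof (intro conjI allI impI)
      show "continuous_path Z {..0} (\<lambda>t. scZ a (\<omega> h t))" by (rule Z.continuous_path_scale[OF \<omega>p[OF h]])
      show "\<exists>c. \<forall>t\<le>0. nrm Z (scZ a (\<omega> h t)) \<le> c * exp (\<eta> * t)"
      proof (intro exI[of _ "norm a * (C * nrm U h)"] allI impI)
        fix t :: real assume t: "t \<le> 0"
        show "nrm Z (scZ a (\<omega> h t)) \<le> norm a * (C * nrm U h) * exp (\<eta> * t)"
          using Z.nrm_scale[OF \<omega>in[OF h t]] mult_left_mono[OF \<omega>b[OF h t] norm_ge_zero[of a]] by (simp add: mult.assoc)
      qed
      fix t :: real assume t: "t \<le> 0"
      show "scZ a (\<omega> h t) = p (scU a h) t + K (\<lambda>s. ?L s (scZ a (\<omega> h s))) t"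
        using \<omega>eq[OF h t] p_scale[OF h t] Kscale[OF t] module.scale_right_distrib[OF Z.module_sc] by simp
    qed
  qed
  define D where "D h = \<omega> h 0" for h
  have "bounded_op scU scZ U Z D"
    unfolding bounded_op_def linear_between_def opbound_def D_def
    using add scale \<omega>in \<omega>b[of _ 0] by (auto intro!: exI[of _ C])
  moreover have "\<exists>d>0. \<forall>h\<in>carr U. nrm U h < d \<longrightarrow> nrm Z (\<Phi> (v + h) - \<Phi> v - D h) \<le> e * nrm U h" if e: "e > 0" for e
  proof -
    \<comment> \<open>\<open>e'\<close> compensates the factor \<open>1 / (1 - q)\<close> of the a priori bound\<close>
    define e' where "e' = e * (1 - q)"
    have e': "e' > 0" using e q by (simp add: e'_def)
    obtain d where d: "d > 0" "\<And>\<psi> a s. (\<And>s. s \<le> 0 \<Longrightarrow> \<psi> s \<in> carr Z) \<Longrightarrow>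
      (\<And>s. s \<le> 0 \<Longrightarrow> nrm Z (\<psi> s) \<le> C * a * exp (\<eta> * s)) \<Longrightarrow> 0 \<le> a \<Longrightarrow> a < d \<Longrightarrow> s \<le> 0 \<Longrightarrow>
      nrm W (G (\<phi> v s + \<psi> s) - G (\<phi> v s) - DG (\<phi> v s) (\<psi> s)) \<le> e' * a * exp (\<eta>\<^sub>1 * s)"
      using taylor_weighted[OF \<phi>p[OF v] e' C] by metis
    have "nrm Z (\<Phi> (v + h) - \<Phi> v - D h) \<le> e * nrm U h" if h: "h \<in> carr U" and hd: "nrm U h < d" for h
    proof -
      have vh: "v + h \<in> carr U" using v h by simp
      have h0: "0 \<le> nrm U h" using h by (rule U.nrm_nonneg)
      define \<psi> where "\<psi> s = \<phi> (v + h) s - \<phi> v s" for s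
      have \<psi>in: "\<psi> s \<in> carr Z" if "s \<le> 0" for s using \<phi>in v vh that by (simp add: \<psi>_def)
      have \<psi>b: "nrm Z (\<psi> s) \<le> C * nrm U h * exp (\<eta> * s)" if s: "s \<le> 0" for s
      proof -
        have pd: "p (v + h) t - p v t = p h t" if "t \<le> 0" for t using p_add[OF v h that] by simp
        have "nrm Z (\<phi> (v + h) s - \<phi> v s) \<le> (M * nrm U h) / (1 - q) * exp (\<eta> * s)"
          by (rule solves_diff_bound[OF nemytskii_G sol[OF vh] sol[OF v] _ _ s])
            (use pd p_bound[OF h] Z.continuous_pathD[OF p_path[OF h]] in auto)
        then show ?thesis by (simp add: \<psi>_def C_def)
      qed
      have \<psi>p: "continuous_path Z {..0} \<psi>" unfolding \<psi>_def by (rule Z.continuous_path_diff[OF \<phi>p[OF vh] \<phi>p[OF v]])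
      let ?\<rho> = "\<lambda>s. \<psi> s - \<omega> h s"
      let ?w = "\<lambda>s. (G (\<phi> (v + h) s) - G (\<phi> v s)) - ?L s (\<omega> h s)"
      have Gp: "continuous_path W {..0} (\<lambda>s. G (\<phi> u s))" if "u \<in> carr U" for u
        by (rule nemytskiiD(3)[OF nemytskii_G \<phi>p[OF that]])
      have Gd: "continuous_path W {..0} (\<lambda>s. G (\<phi> (v + h) s) - G (\<phi> v s))"
        by (rule W.continuous_path_diff[OF Gp[OF vh] Gp[OF v]])
      have Gdb: "nrm W (G (\<phi> (v + h) s) - G (\<phi> v s)) \<le> C * nrm U h * exp (\<eta> * s)" if "s \<le> 0" for s
        using order_trans[OF G_Lip \<psi>b[OF that, unfolded \<psi>_def]] \<phi>in v vh that by simp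
      have Kd: "K (\<lambda>s. G (\<phi> (v + h) s) - G (\<phi> v s)) t = K (\<lambda>s. G (\<phi> (v + h) s)) t - K (\<lambda>s. G (\<phi> v s)) t" if t: "t \<le> 0" for t
      proof -
        have bd: "\<exists>c. \<forall>s\<le>0. nrm W (G (\<phi> u s)) \<le> c * exp (\<eta> * s)" if u: "u \<in> carr U" for u
        proof -
          obtain c where "\<And>s. s \<le> 0 \<Longrightarrow> nrm Z (\<phi> u s) \<le> c * exp (\<eta> * s)"
            using sol[OF u] unfolding solves_def by blast
          then show ?thesis
            by (intro exI[of _ c] allI impI order_trans[OF nemytskiiD(4)[OF nemytskii_G _ \<phi>in[OF u]]])
        qed
        obtain c c' where c: "\<forall>s\<le>0. nrm W (G (\<phi> (v + h) s)) \<le> c * exp (\<eta> * s)"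
          and c': "\<forall>s\<le>0. nrm W (G (\<phi> v s)) \<le> c' * exp (\<eta> * s)" using bd[OF vh] bd[OF v] by metis
        show ?thesis by (rule K_diff[OF Gp[OF vh] Gp[OF v] _ _ _ t, of \<eta> c c']) (use c c' in auto)
      qed
      have "nrm Z (?\<rho> 0) \<le> (0 + q * (e' * nrm U h)) / (1 - q) * exp (\<eta>\<^sub>1 * 0)"
      proof (rule a_priori[where r = "\<lambda>t. 0" and w = ?w and m = "C * nrm U h + C * nrm U h" and \<phi> = ?\<rho> and \<mu> = \<eta>\<^sub>1])
        show "continuous_path Z {..0} ?\<rho>" by (rule Z.continuous_path_diff[OF \<psi>p \<omega>p[OF h]])
        show "continuous_path W {..0} ?w" by (rule W.continuous_path_diff[OF Gd Lp[OF h]])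
        show "nrm Z (?\<rho> t) \<le> (C * nrm U h + C * nrm U h) * exp (\<eta>\<^sub>1 * t)" if t: "t \<le> 0" for t
          using Z.nrm_triangle_diff[OF \<psi>in[OF t] \<omega>in[OF h t]] \<psi>b[OF t] \<omega>b[OF h t]
            weight_le[OF mult_nonneg_nonneg[OF C h0] t] by (simp add: distrib_right)
        show "?\<rho> t = 0 + K ?w t" if t: "t \<le> 0" for t
        proof -
          have "K ?w t = K (\<lambda>s. G (\<phi> (v + h) s) - G (\<phi> v s)) t - K (\<lambda>s. ?L s (\<omega> h s)) t"
            by (rule K_diff[OF Gd Lp[OF h] _ Gdb Lb[OF h] t]) auto
          then show ?thesis
            using Kd[OF t] \<phi>eq[OF vh t] \<phi>eq[OF v t] \<omega>eq[OF h t] p_add[OF v h t] by (simp add: \<psi>_def)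
        qed
        \<comment> \<open>the forcing of \<open>\<psi> - \<omega> h\<close> is the Taylor remainder plus the linearization applied to \<open>\<psi> - \<omega> h\<close> itself\<close>
        show "nrm W (?w s) \<le> nrm Z (?\<rho> s) + e' * nrm U h * exp (\<eta>\<^sub>1 * s)" if s: "s \<le> 0" for s
        proof -
          have vs: "\<phi> v s + \<psi> s = \<phi> (v + h) s" by (simp add: \<psi>_def)
          have "?w s = (G (\<phi> v s + \<psi> s) - G (\<phi> v s) - DG (\<phi> v s) (\<psi> s)) + DG (\<phi> v s) (\<psi> s - \<omega> h s)"
            unfolding vs DG_diff[OF \<phi>in[OF v s] \<psi>in[OF s] \<omega>in[OF h s]] by simp
          moreover have "nrm W \<dots> \<le> e' * nrm U h * exp (\<eta>\<^sub>1 * s) + nrm Z (\<psi> s - \<omega> h s)"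
          proof (rule order_trans[OF W.nrm_triangle add_mono])
            show "nrm W (G (\<phi> v s + \<psi> s) - G (\<phi> v s) - DG (\<phi> v s) (\<psi> s)) \<le> e' * nrm U h * exp (\<eta>\<^sub>1 * s)"
              by (rule d(2)[OF \<psi>in \<psi>b h0 hd s])
            show "nrm W (DG (\<phi> v s) (\<psi> s - \<omega> h s)) \<le> nrm Z (\<psi> s - \<omega> h s)"
              by (rule DG_bound[OF \<phi>in[OF v s] Z.diff_in[OF \<psi>in[OF s] \<omega>in[OF h s]]])
          qed (use G_in DG_in \<phi>in[OF v s] \<phi>in[OF vh s] \<psi>in[OF s] \<omega>in[OF h s] vs in auto)
          ultimately show ?thesis by (simp only: add.commute)
        qed
      qed auto
      also have "\<dots> = q * (e * nrm U h)" using q by (simp add: e'_def)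
      also have "\<dots> \<le> 1 * (e * nrm U h)" using q e h0 by (intro mult_right_mono) auto
      finally show ?thesis using \<Phi>\<phi>[OF v] \<Phi>\<phi>[OF vh] by (simp add: \<psi>_def D_def)
    qed
    then show ?thesis using d(1) by blast
  qed
  ultimately show ?thesis unfolding frechet_deriv_ns_def by blast
qed

end

section \<open>Subspaces and products\<close>

lemma carr_sub_ns [simp]: "carr (sub_ns E S) = S \<inter> carr E" and nrm_sub_ns [simp]: "nrm (sub_ns E S) = nrm E"
  by (simp_all add: sub_ns_def)
lemma carr_prod_ns [simp]: "carr (prod_ns E F) = carr E \<times> carr F"
  and nrm_prod_ns [simp]: "nrm (prod_ns E F) (x, y) = nrm E x + nrm F y"
  by (simp_all add: prod_ns_def)

lemma (in normed_space_on) normed_sub_ns: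
  assumes "module.subspace sc S"
  shows "normed_space_on sc (sub_ns E S)"
proof (rule normed_space_on.intro)
  show "module.subspace sc (carr (sub_ns E S))"
    using module.subspace_inter[OF module_sc assms carr_subspace] by simp
qed (use scalars scale_of_real nrm_nonneg nrm_eq_0 nrm_triangle nrm_scale in auto)

lemma (in banach_space_on) banach_sub_ns:
  assumes S: "module.subspace sc S" and cl: "closed_in_ns E (S \<inter> carr E)"
  shows "banach_space_on sc (sub_ns E S)"
proof -
  interpret sub: normed_space_on sc "sub_ns E S" by (rule normed_sub_ns[OF S])
  show ?thesis
  proof
    fix s :: "nat \<Rightarrow> 'v"
    assume s: "\<And>n. s n \<in> carr (sub_ns E S)"
      and cau: "\<And>e. e > 0 \<Longrightarrow> \<exists>N. \<forall>m\<ge>N. \<forall>n\<ge>N. nrm (sub_ns E S) (s m - s n) < e"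
    then obtain x where x: "x \<in> carr E" "(\<lambda>n. nrm E (s n - x)) \<longlonglongrightarrow> 0"
      using complete[of s] by auto
    have "\<exists>y\<in>S \<inter> carr E. nrm E (x - y) < e" if e: "e > 0" for e
    proof -
      obtain n where "\<bar>nrm E (s n - x)\<bar> < e" using LIMSEQ_D[OF x(2) e] by force
      then show ?thesis using nrm_commute[OF x(1), of "s n"] s[of n] by (intro bexI[of _ "s n"]) auto
    qed
    then have "x \<in> S \<inter> carr E" using cl x(1) unfolding closed_in_ns_def by blast
    then show "\<exists>x\<in>carr (sub_ns E S). (\<lambda>n. nrm (sub_ns E S) (s n - x)) \<longlonglongrightarrow> 0" using x(2) by auto
  qed
qed

lemma vector_space_prod_scale:
  assumes "vector_space sc" "vector_space sc'"
  shows "vector_space (prod_scale sc sc')"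
  using assms unfolding vector_space_def prod_scale_def by (auto simp: algebra_simps)

lemma prod_scale_of_real:
  assumes "\<And>r x. sc (of_real r) x = r *\<^sub>R x" "\<And>r x. sc' (of_real r) x = r *\<^sub>R x"
  shows "prod_scale sc sc' (of_real r) z = r *\<^sub>R z"
  by (cases z) (simp add: prod_scale_def assms)

lemma subspace_prod_scale:
  assumes "vector_space sc" "vector_space sc'" "module.subspace sc S" "module.subspace sc' S'"
  shows "module.subspace (prod_scale sc sc') (S \<times> S')"
proof -
  have m: "module sc" "module sc'" "module (prod_scale sc sc')"
    using assms(1,2) vector_space_prod_scale[OF assms(1,2)] by (simp_all add: vector_space_def module_def)
  show ?thesis
    using assms(3,4) unfolding module.subspace_def[OF m(1)] module.subspace_def[OF m(2)] module.subspace_def[OF m(3)]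
    by (auto simp: prod_scale_def zero_prod_def)
qed

lemma normed_prod_ns:
  assumes "normed_space_on sc E" "normed_space_on sc' F"
  shows "normed_space_on (prod_scale sc sc') (prod_ns E F)"
proof -
  interpret E: normed_space_on sc E by fact
  interpret F: normed_space_on sc' F by fact
  show ?thesis
  proof (rule normed_space_on.intro)
    show "vector_space (prod_scale sc sc')" by (rule vector_space_prod_scale[OF E.scalars F.scalars])
    show "prod_scale sc sc' (of_real r) x = r *\<^sub>R x" for r x
      by (rule prod_scale_of_real) (simp_all add: E.scale_of_real F.scale_of_real)
    show "module.subspace (prod_scale sc sc') (carr (prod_ns E F))"
      using subspace_prod_scale[OF E.scalars F.scalars E.carr_subspace F.carr_subspace] by simp
    show "0 \<le> nrm (prod_ns E F) x" if "x \<in> carr (prod_ns E F)" for x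
      using that E.nrm_nonneg F.nrm_nonneg by (cases x) auto
    show "(nrm (prod_ns E F) x = 0) = (x = 0)" if "x \<in> carr (prod_ns E F)" for x
      using that E.nrm_nonneg F.nrm_nonneg E.nrm_eq_0 F.nrm_eq_0
      by (cases x) (auto simp: zero_prod_def add_nonneg_eq_0_iff)
    show "nrm (prod_ns E F) (x + y) \<le> nrm (prod_ns E F) x + nrm (prod_ns E F) y"
      if "x \<in> carr (prod_ns E F)" "y \<in> carr (prod_ns E F)" for x y
      using that E.nrm_triangle[of "fst x" "fst y"] F.nrm_triangle[of "snd x" "snd y"] by (cases x; cases y) auto
    show "nrm (prod_ns E F) (prod_scale sc sc' c x) = norm c * nrm (prod_ns E F) x"
      if "x \<in> carr (prod_ns E F)" for c x
      using that by (cases x) (auto simp: prod_scale_def E.nrm_scale F.nrm_scale distrib_left)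
  qed
qed

lemma banach_prod_ns:
  assumes "banach_space_on sc E" "banach_space_on sc' F"
  shows "banach_space_on (prod_scale sc sc') (prod_ns E F)"
proof -
  interpret E: banach_space_on sc E by fact
  interpret F: banach_space_on sc' F by fact
  interpret P: normed_space_on "prod_scale sc sc'" "prod_ns E F"
    by (rule normed_prod_ns) unfold_locales
  show ?thesis
  proof
    fix s :: "nat \<Rightarrow> 'b \<times> 'c"
    assume s: "\<And>n. s n \<in> carr (prod_ns E F)"
      and cau: "\<And>e. e > 0 \<Longrightarrow> \<exists>N. \<forall>m\<ge>N. \<forall>n\<ge>N. nrm (prod_ns E F) (s m - s n) < e"
    have sin: "fst (s n) \<in> carr E" "snd (s n) \<in> carr F" for n using s[of n] by auto
    have nn: "nrm (prod_ns E F) (s m - s n) = nrm E (fst (s m) - fst (s n)) + nrm F (snd (s m) - snd (s n))" for m n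
      by (cases "s m"; cases "s n") simp
    have pos: "0 \<le> nrm E (fst (s m) - fst (s n))" "0 \<le> nrm F (snd (s m) - snd (s n))" for m n
      using sin by (auto intro: E.nrm_nonneg F.nrm_nonneg)
    have "\<exists>x\<in>carr E. (\<lambda>n. nrm E (fst (s n) - x)) \<longlonglongrightarrow> 0"
    proof (rule E.complete[OF sin(1)])
      fix e :: real assume "e > 0"
      from cau[OF this] obtain N where N: "\<forall>m\<ge>N. \<forall>n\<ge>N. nrm (prod_ns E F) (s m - s n) < e" ..
      show "\<exists>N. \<forall>m\<ge>N. \<forall>n\<ge>N. nrm E (fst (s m) - fst (s n)) < e"
        using N pos unfolding nn by (smt (verit))
    qed
    moreover have "\<exists>x\<in>carr F. (\<lambda>n. nrm F (snd (s n) - x)) \<longlonglongrightarrow> 0"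
    proof (rule F.complete[OF sin(2)])
      fix e :: real assume "e > 0"
      from cau[OF this] obtain N where N: "\<forall>m\<ge>N. \<forall>n\<ge>N. nrm (prod_ns E F) (s m - s n) < e" ..
      show "\<exists>N. \<forall>m\<ge>N. \<forall>n\<ge>N. nrm F (snd (s m) - snd (s n)) < e"
        using N pos unfolding nn by (smt (verit))
    qed
    ultimately obtain x y where xy: "x \<in> carr E" "(\<lambda>n. nrm E (fst (s n) - x)) \<longlonglongrightarrow> 0"
      "y \<in> carr F" "(\<lambda>n. nrm F (snd (s n) - y)) \<longlonglongrightarrow> 0" by blast
    have "nrm (prod_ns E F) (s n - (x, y)) = nrm E (fst (s n) - x) + nrm F (snd (s n) - y)" for n
      by (cases "s n") simp
    then have "(\<lambda>n. nrm (prod_ns E F) (s n - (x, y))) \<longlonglongrightarrow> 0"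
      using tendsto_add[OF xy(2,4)] by simp
    then show "\<exists>x\<in>carr (prod_ns E F). (\<lambda>n. nrm (prod_ns E F) (s n - x)) \<longlonglongrightarrow> 0"
      using xy(1,3) by (intro bexI[of _ "(x, y)"]) auto
  qed
qed

section \<open>Complementary closed subspaces\<close>

text \<open>Baire's theorem in terms of \<open>nrm E\<close>: one of the covering sets \<open>V n\<close> is dense in a ball.\<close>

lemma (in banach_space_on) baire:
  assumes cover: "carr E \<subseteq> (\<Union>n::nat. V n)" and V: "\<And>n. V n \<subseteq> carr E"
  obtains n y0 r where "r > 0" "y0 \<in> carr E"
    "\<And>y e. y \<in> carr E \<Longrightarrow> nrm E (y - y0) < r \<Longrightarrow> e > 0 \<Longrightarrow> \<exists>v\<in>V n. nrm E (y - v) < e"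
proof -
  define d where "d x y = (if x \<in> carr E \<and> y \<in> carr E then nrm E (x - y) else 0)" for x y
  interpret Metric_space "carr E" d
  proof
    show "0 \<le> d x y" for x y by (auto simp: d_def intro: nrm_nonneg)
    show "d x y = d y x" for x y by (auto simp: d_def intro: nrm_commute)
    show "d x y = 0 \<longleftrightarrow> x = y" if "x \<in> carr E" "y \<in> carr E" for x y
      using that nrm_eq_0[of "x - y"] by (auto simp: d_def)
    show "d x z \<le> d x y + d y z" if "x \<in> carr E" "y \<in> carr E" "z \<in> carr E" for x y z
      using that nrm_triangle_mid by (simp add: d_def)
  qed
  have mc: "mcomplete"
    unfolding mcomplete_def
  proof (intro allI impI)
    fix \<sigma> assume \<sigma>: "MCauchy \<sigma>"
    then have s: "\<sigma> n \<in> carr E" for n by (auto simp: MCauchy_def)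
    have "\<exists>x\<in>carr E. (\<lambda>n. nrm E (\<sigma> n - x)) \<longlonglongrightarrow> 0"
    proof (rule complete[OF s])
      fix e :: real assume "e > 0"
      then show "\<exists>N. \<forall>m\<ge>N. \<forall>n\<ge>N. nrm E (\<sigma> m - \<sigma> n) < e"
        using \<sigma> s unfolding MCauchy_def d_def by simp
    qed
    then obtain x where x: "x \<in> carr E" "(\<lambda>n. nrm E (\<sigma> n - x)) \<longlonglongrightarrow> 0" by blast
    have "limitin mtopology \<sigma> x sequentially"
      unfolding limitin_metric
    proof (intro conjI allI impI x(1))
      fix e :: real assume "e > 0"
      from tendstoD[OF x(2) this] show "\<forall>\<^sub>F n in sequentially. \<sigma> n \<in> carr E \<and> d (\<sigma> n) x < e"
        by (rule eventually_mono) (use s x in \<open>auto simp: d_def dist_real_def\<close>)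
    qed
    then show "\<exists>x. limitin mtopology \<sigma> x sequentially" by blast
  qed
  have "\<exists>n. mtopology interior_of (mtopology closure_of (V n)) \<noteq> {}"
  proof (rule ccontr)
    assume "\<not> ?thesis"
    then have "mtopology interior_of \<Union>(range (\<lambda>n. mtopology closure_of (V n))) = {}"
      by (intro metric_Baire_category_alt[OF mc]) auto
    moreover have "\<Union>(range (\<lambda>n. mtopology closure_of (V n))) = carr E"
    proof
      show "\<Union>(range (\<lambda>n. mtopology closure_of (V n))) \<subseteq> carr E"
        using closure_of_subset_topspace[of mtopology] by auto
      show "carr E \<subseteq> \<Union>(range (\<lambda>n. mtopology closure_of (V n)))"
      proof -
        have "V n \<subseteq> mtopology closure_of (V n)" for n
          using closure_of_subset[of "V n" mtopology] V by simp
        then have "(\<Union>n. V n) \<subseteq> (\<Union>n. mtopology closure_of (V n))" by (rule UN_mono[OF subset_refl])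
        with cover show ?thesis by (rule order_trans)
      qed
    qed
    ultimately have "carr E = {}" using interior_of_topspace[of mtopology] by simp
    then show False using zero_in by blast
  qed
  then obtain n y0 where y0: "y0 \<in> mtopology interior_of (mtopology closure_of (V n))" by blast
  then obtain r where r: "r > 0" "mball y0 r \<subseteq> mtopology closure_of (V n)"
    using openin_interior_of[of mtopology] interior_of_subset[of mtopology]
    unfolding openin_mtopology by (meson subset_trans)
  have y0E: "y0 \<in> carr E" using y0 interior_of_subset_topspace[of mtopology] by auto
  show thesis
  proof (rule that[OF r(1) y0E])
    fix y e :: "'v" and e' :: real assume y: "y \<in> carr E" "nrm E (y - y0) < r" "e' > 0"
    then have "y \<in> mball y0 r" using y0E nrm_commute[of y y0] by (simp add: d_def)
    then have "y \<in> mtopology closure_of (V n)" using r(2) by blast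
    then obtain v where "v \<in> V n" "v \<in> mball y e'" using y(3) unfolding metric_closure_of by auto
    then show "\<exists>v\<in>V n. nrm E (y - v) < e'" by (auto simp: d_def)
  qed
qed

lemma proj_along_eq:
  assumes m: "module sc" and F: "module.subspace sc F" and S: "module.subspace sc S"
    and FS: "F \<inter> S = {0::'v::real_vector}" and a: "a \<in> F" and b: "b \<in> S"
  shows "proj_along F S (a + b) = a"
  unfolding proj_along_def
proof (rule the_equality)
  show "a \<in> F \<and> (\<exists>b'\<in>S. a + b = a + b')" using a b by blast
  fix a' assume "a' \<in> F \<and> (\<exists>b'\<in>S. a + b = a' + b')"
  then obtain b' where a': "a' \<in> F" "b' \<in> S" "a + b = a' + b'" by blast
  then have "a' - a = b - b'" by (simp add: algebra_simps)
  moreover have "a' - a \<in> F" "b - b' \<in> S"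
    using module.subspace_diff[OF m] F S a b a' by blast+
  ultimately have "a' - a \<in> F \<inter> S" by simp
  then show "a' = a" using FS by simp
qed

text \<open>
  A Banach space that is the algebraic direct sum of \<open>F\<close> and \<open>S\<close>, with projections \<open>P\<close> onto \<open>F\<close>
  and \<open>Q\<close> onto \<open>S\<close>. Closedness of the subspaces is assumed only where it is needed.
\<close>

locale complemented_space = banach_space_on sc E
  for sc :: "'k::real_normed_field \<Rightarrow> 'v::real_vector \<Rightarrow> 'v" and E +
  fixes F S :: "'v set"
  assumes subspace_F: "module.subspace sc F" and subspace_S: "module.subspace sc S"
    and disjoint: "F \<inter> S = {0}" and direct_sum: "carr E = {a + b |a b. a \<in> F \<and> b \<in> S}"
begin

abbreviation "P \<equiv> proj_along F S"
abbreviation "Q \<equiv> proj_along S F"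

lemma F_sub: "F \<subseteq> carr E"
proof
  fix a assume "a \<in> F"
  moreover have "0 \<in> S" using module.subspace_0[OF module_sc subspace_S] .
  ultimately show "a \<in> carr E" unfolding direct_sum by force
qed

lemma P_sum: "a \<in> F \<Longrightarrow> b \<in> S \<Longrightarrow> P (a + b) = a"
  by (rule proj_along_eq[OF module_sc subspace_F subspace_S disjoint])

lemma Q_sum: "a \<in> F \<Longrightarrow> b \<in> S \<Longrightarrow> Q (a + b) = b"
  using proj_along_eq[OF module_sc subspace_S subspace_F, of b a] disjoint by (simp add: Int_commute add.commute)

lemma decompose:
  assumes "y \<in> carr E"
  shows "P y \<in> F" "Q y \<in> S" "P y + Q y = y"
  using assms P_sum Q_sum unfolding direct_sum by auto

lemma Q_in_S: "b \<in> S \<Longrightarrow> Q b = b" and Q_in_F: "a \<in> F \<Longrightarrow> Q a = 0"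
  using Q_sum[of 0 b] Q_sum[of a 0]
    module.subspace_0[OF module_sc subspace_S] module.subspace_0[OF module_sc subspace_F] by simp_all

lemma
  assumes y: "y \<in> carr E" "y' \<in> carr E"
  shows P_add: "P (y + y') = P y + P y'" and Q_add: "Q (y + y') = Q y + Q y'"
proof -
  have "y + y' = (P y + P y') + (Q y + Q y')" using decompose(3)[OF y(1)] decompose(3)[OF y(2)] by (simp add: algebra_simps)
  moreover have "P y + P y' \<in> F" "Q y + Q y' \<in> S"
    using module.subspace_add[OF module_sc subspace_F decompose(1)[OF y(1)] decompose(1)[OF y(2)]]
      module.subspace_add[OF module_sc subspace_S decompose(2)[OF y(1)] decompose(2)[OF y(2)]] by simp_all
  ultimately show "P (y + y') = P y + P y'" "Q (y + y') = Q y + Q y'"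
    using P_sum[of "P y + P y'" "Q y + Q y'"] Q_sum[of "P y + P y'" "Q y + Q y'"] by simp_all
qed

lemma
  assumes y: "y \<in> carr E"
  shows P_scale: "P (sc c y) = sc c (P y)" and Q_scale: "Q (sc c y) = sc c (Q y)"
proof -
  have "sc c y = sc c (P y) + sc c (Q y)"
    using decompose(3)[OF y] module.scale_right_distrib[OF module_sc, of c "P y" "Q y"] by simp
  moreover have "sc c (P y) \<in> F" "sc c (Q y) \<in> S"
    using module.subspace_scale[OF module_sc subspace_F decompose(1)[OF y]]
      module.subspace_scale[OF module_sc subspace_S decompose(2)[OF y]] by simp_all
  ultimately show "P (sc c y) = sc c (P y)" "Q (sc c y) = sc c (Q y)"
    using P_sum[of "sc c (P y)" "sc c (Q y)"] Q_sum[of "sc c (P y)" "sc c (Q y)"] by simp_all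
qed

lemma P_diff: "y \<in> carr E \<Longrightarrow> y' \<in> carr E \<Longrightarrow> P (y - y') = P y - P y'"
  and Q_diff: "y \<in> carr E \<Longrightarrow> y' \<in> carr E \<Longrightarrow> Q (y - y') = Q y - Q y'"
  using P_add[of y "- y'"] Q_add[of y "- y'"] P_scale[of y' "of_real (-1)"] Q_scale[of y' "of_real (-1)"]
  unfolding scale_of_real by auto

lemma S_sub: "S \<subseteq> carr E"
proof
  fix b assume "b \<in> S"
  moreover have "0 \<in> F" using module.subspace_0[OF module_sc subspace_F] .
  ultimately show "b \<in> carr E" unfolding direct_sum by force
qed

lemma P_in: "y \<in> carr E \<Longrightarrow> P y \<in> carr E" and Q_in: "y \<in> carr E \<Longrightarrow> Q y \<in> carr E"
  using decompose F_sub S_sub by blast+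

text \<open>
  This is the open mapping argument applied to addition \<open>F \<times> S \<rightarrow> E\<close>: by Baire, the vectors whose
  components have norm sum \<open>N\<close> at most \<open>k\<close> are dense in a ball around \<open>0\<close>, and successive
  approximation with halving errors removes the closure.
\<close>

lemma projections_bounded:
  assumes closed: "closed_in_ns E F" "closed_in_ns E S"
  shows "\<exists>c\<ge>0. \<forall>y\<in>carr E. nrm E (Q y) \<le> c * nrm E y"
proof -
  define N where "N y = nrm E (P y) + nrm E (Q y)" for y
  have Nle: "nrm E (P y) \<le> N y" "nrm E (Q y) \<le> N y" "0 \<le> N y" if "y \<in> carr E" for y
    using nrm_nonneg[OF P_in[OF that]] nrm_nonneg[OF Q_in[OF that]] by (auto simp: N_def)
  have Ndiff: "N (y - y') \<le> N y + N y'" if "y \<in> carr E" "y' \<in> carr E" for y y'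
    using nrm_triangle_diff[OF P_in[OF that(1)] P_in[OF that(2)]] nrm_triangle_diff[OF Q_in[OF that(1)] Q_in[OF that(2)]]
    unfolding N_def P_diff[OF that] Q_diff[OF that] by simp
  have Nscale: "N (r *\<^sub>R y) = \<bar>r\<bar> * N y" if "y \<in> carr E" for r y
    using P_scale[OF that, of "of_real r"] Q_scale[OF that, of "of_real r"] P_in[OF that] Q_in[OF that]
    unfolding scale_of_real by (simp add: N_def nrm_scaleR distrib_left)
  obtain n y0 r where r: "r > 0" and y0: "y0 \<in> carr E" and
    dense: "\<And>y e. y \<in> carr E \<Longrightarrow> nrm E (y - y0) < r \<Longrightarrow> e > 0 \<Longrightarrow>
      \<exists>v\<in>{y\<in>carr E. N y \<le> real n}. nrm E (y - v) < e"
  proof (rule baire[of "\<lambda>n. {y\<in>carr E. N y \<le> real n}"])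
    show "carr E \<subseteq> (\<Union>n. {y \<in> carr E. N y \<le> real n})" using real_arch_simple by blast
  qed auto
  define k where "k = 2 * real n"
  have k: "k \<ge> 0" by (simp add: k_def)
  \<comment> \<open>differences of elements of the dense set move the centre of the ball to \<open>0\<close>, at the cost of doubling the bound\<close>
  have dense0: "\<exists>v\<in>carr E. N v \<le> k \<and> nrm E (y - v) < e" if y: "y \<in> carr E" "nrm E y < r" and e: "e > 0" for y e
  proof -
    have e2: "e / 2 > 0" using e by simp
    obtain v v0 where v: "v \<in> carr E" "N v \<le> real n" "nrm E (y + y0 - v) < e / 2"
      and v0: "v0 \<in> carr E" "N v0 \<le> real n" "nrm E (y0 - v0) < e / 2"
      using dense[of "y + y0" "e / 2"] dense[of y0 "e / 2"] y y0 e2 r by auto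
    have eq: "y - (v - v0) = (y + y0 - v) - (y0 - v0)" by simp
    have "nrm E (y - (v - v0)) < e"
      unfolding eq using nrm_triangle_diff[of "y + y0 - v" "y0 - v0"] v v0 y y0 by (smt (verit) add_in diff_in field_sum_of_halves)
    then show ?thesis using Ndiff[OF v(1) v0(1)] v v0 by (intro bexI[of _ "v - v0"]) (auto simp: k_def)
  qed
  have step: "\<exists>v\<in>carr E. N v \<le> k / 2 ^ j \<and> nrm E (y - v) < r / 2 ^ Suc j"
    if y: "y \<in> carr E" "nrm E y < r / 2 ^ j" for y and j :: nat
  proof -
    have "nrm E ((2 ^ j) *\<^sub>R y) < r" using y by (simp add: nrm_scaleR field_simps)
    moreover have "r / 2 > 0" using r by simp
    ultimately obtain v where v: "v \<in> carr E" "N v \<le> k" "nrm E ((2 ^ j) *\<^sub>R y - v) < r / 2"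
      using dense0[of "(2 ^ j) *\<^sub>R y"] y by blast
    let ?v = "(1 / 2 ^ j) *\<^sub>R v"
    have "y - ?v = (1 / 2 ^ j) *\<^sub>R ((2 ^ j) *\<^sub>R y - v)" by (simp add: scaleR_diff_right)
    then have "nrm E (y - ?v) = nrm E ((2 ^ j) *\<^sub>R y - v) / 2 ^ j"
      using y v by (simp add: nrm_scaleR)
    also have "\<dots> < (r / 2) / 2 ^ j" using v(3) by (intro divide_strict_right_mono) auto
    finally have "nrm E (y - ?v) < r / 2 ^ Suc j" by simp
    moreover have "N ?v \<le> k / 2 ^ j" using Nscale[OF v(1), of "1 / 2 ^ j"] v(2) by (simp add: divide_right_mono)
    ultimately show ?thesis using v(1) by blast
  qed
  have small: "nrm E (Q y) \<le> 2 * k" if y: "y \<in> carr E" "nrm E y < r" for y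
  proof -
    \<comment> \<open>\<open>R j\<close> is the error after \<open>j\<close> steps; the components of \<open>y - R m\<close> are Cauchy since \<open>N\<close> of the increments is summable\<close>
    define pick where "pick j x = (SOME v. v \<in> carr E \<and> N v \<le> k / 2 ^ j \<and> nrm E (x - v) < r / 2 ^ Suc j)" for j :: nat and x
    have pick: "pick j x \<in> carr E \<and> N (pick j x) \<le> k / 2 ^ j \<and> nrm E (x - pick j x) < r / 2 ^ Suc j"
      if "x \<in> carr E" "nrm E x < r / 2 ^ j" for j x
      unfolding pick_def by (rule someI_ex) (use step[OF that] in blast)
    define R where "R = rec_nat y (\<lambda>j x. x - pick j x)"
    have R0: "R 0 = y" and RS: "R (Suc j) = R j - pick j (R j)" for j by (simp_all add: R_def)
    have Rin: "R j \<in> carr E \<and> nrm E (R j) < r / 2 ^ j" for j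
    proof (induction j)
      case (Suc j)
      then show ?case using pick[of "R j" j] by (auto simp: RS)
    qed (use y in \<open>simp add: R0\<close>)
    have RE: "R j \<in> carr E" for j using Rin by simp
    have dR: "N (R j - R (Suc j)) \<le> k / 2 ^ j" for j using pick[of "R j" j] Rin[of j] by (simp add: RS)
    have tail: "N (R m - R (m + i)) \<le> 2 * k / 2 ^ m" for m i
    proof -
      have "N (R m - R (m + i)) \<le> (2 * k / 2 ^ m) * (1 - 1 / 2 ^ i)"
      proof (induction i)
        case (Suc i)
        have "R m - R (m + Suc i) = (R m - R (m + i)) - - (R (m + i) - R (Suc (m + i)))" by simp
        also have "N \<dots> \<le> N (R m - R (m + i)) + N (- (R (m + i) - R (Suc (m + i))))"
          by (rule Ndiff) (use RE in auto)
        also have "N (- (R (m + i) - R (Suc (m + i)))) = N (R (m + i) - R (Suc (m + i)))"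
          using Nscale[of "R (m + i) - R (Suc (m + i))" "-1"] RE by simp
        also have "\<dots> \<le> k / 2 ^ (m + i)" by (rule dR)
        finally have "N (R m - R (m + Suc i)) \<le> (2 * k / 2 ^ m) * (1 - 1 / 2 ^ i) + k / 2 ^ (m + i)" using Suc by simp
        also have "\<dots> = (2 * k / 2 ^ m) * (1 - 1 / 2 ^ Suc i)" by (simp add: power_add field_simps)
        finally show ?case .
      qed (use Nscale[of 0 0] k in simp)
      also have "\<dots> \<le> (2 * k / 2 ^ m) * 1" using k by (intro mult_left_mono) auto
      finally show ?thesis by simp
    qed
    have tail': "N (R m - R m') \<le> 2 * k / 2 ^ M" if "m \<ge> M" "m' \<ge> M" for m m' M
    proof -
      have main: "N (R m - R m') \<le> 2 * k / 2 ^ M" if "M \<le> m" "m \<le> m'" for m m'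
      proof -
        have "N (R m - R m') \<le> 2 * k / 2 ^ m" using tail[of m "m' - m"] that by simp
        also have "\<dots> \<le> 2 * k / 2 ^ M" using that k by (intro divide_left_mono) (auto intro: power_increasing)
        finally show ?thesis .
      qed
      have "N (R m - R m') = N (R m' - R m)" using Nscale[of "R m' - R m" "-1"] RE by simp
      then show ?thesis using main[of m m'] main[of m' m] that by (cases "m \<le> m'") auto
    qed
    have lim2: "(\<lambda>M. 2 * k / 2 ^ M) \<longlonglongrightarrow> 0"
      using LIMSEQ_divide_realpow_zero[of 2 "2 * k"] by simp
    have cau: "\<exists>M. \<forall>m\<ge>M. \<forall>m'\<ge>M. N (R m - R m') < e" if e: "e > 0" for e
    proof -
      obtain M where "\<bar>2 * k / 2 ^ M\<bar> < e" using LIMSEQ_D[OF lim2 e] by force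
      then have "2 * k / 2 ^ M < e" by linarith
      then show ?thesis using tail'[of M] by (meson order_le_less_trans)
    qed
    let ?p = "\<lambda>m. P (y - R m)" and ?q = "\<lambda>m. Q (y - R m)"
    have yR: "y - R m \<in> carr E" for m using y RE by simp
    have pd: "?p m - ?p m' = P (R m' - R m)" and qd: "?q m - ?q m' = Q (R m' - R m)" for m m'
      using P_diff[OF yR yR, of m m'] Q_diff[OF yR yR, of m m'] by simp_all
    have "\<exists>x\<in>carr E. (\<lambda>m. nrm E (?p m - x)) \<longlonglongrightarrow> 0"
    proof (rule complete[OF P_in[OF yR]])
      fix e :: real assume "e > 0"
      from cau[OF this] obtain M where M: "\<forall>m\<ge>M. \<forall>m'\<ge>M. N (R m - R m') < e" ..
      show "\<exists>M. \<forall>m\<ge>M. \<forall>m'\<ge>M. nrm E (?p m - ?p m') < e"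
        unfolding pd using M Nle(1)[OF diff_in[OF RE RE]] order_le_less_trans by blast
    qed
    then obtain a where a: "a \<in> carr E" "(\<lambda>m. nrm E (?p m - a)) \<longlonglongrightarrow> 0" by blast
    have "\<exists>x\<in>carr E. (\<lambda>m. nrm E (?q m - x)) \<longlonglongrightarrow> 0"
    proof (rule complete[OF Q_in[OF yR]])
      fix e :: real assume "e > 0"
      from cau[OF this] obtain M where M: "\<forall>m\<ge>M. \<forall>m'\<ge>M. N (R m - R m') < e" ..
      show "\<exists>M. \<forall>m\<ge>M. \<forall>m'\<ge>M. nrm E (?q m - ?q m') < e"
        unfolding qd using M Nle(2)[OF diff_in[OF RE RE]] order_le_less_trans by blast
    qed
    then obtain b where b: "b \<in> carr E" "(\<lambda>m. nrm E (?q m - b)) \<longlonglongrightarrow> 0" by blast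
    have "a \<in> F"
    proof -
      have "\<exists>s\<in>F. nrm E (a - s) < e" if e: "e > 0" for e
      proof -
        obtain m where "\<bar>nrm E (?p m - a)\<bar> < e" using LIMSEQ_D[OF a(2) e] by force
        then show ?thesis using nrm_commute[OF a(1) P_in[OF yR], of m] decompose(1)[OF yR, of m] by (intro bexI[of _ "?p m"]) auto
      qed
      then show ?thesis using closed(1) a(1) unfolding closed_in_ns_def by blast
    qed
    moreover have bS: "b \<in> S"
    proof -
      have "\<exists>s\<in>S. nrm E (b - s) < e" if e: "e > 0" for e
      proof -
        obtain m where "\<bar>nrm E (?q m - b)\<bar> < e" using LIMSEQ_D[OF b(2) e] by force
        then show ?thesis using nrm_commute[OF b(1) Q_in[OF yR], of m] decompose(2)[OF yR, of m] by (intro bexI[of _ "?q m"]) auto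
      qed
      then show ?thesis using closed(2) b(1) unfolding closed_in_ns_def by blast
    qed
    moreover have "a + b = y"
    proof -
      have "nrm E (y - (a + b)) \<le> nrm E (?p m - a) + nrm E (?q m - b) + r / 2 ^ m" for m
      proof -
        have eq: "y - (a + b) = (?p m - a) + ((?q m - b) + R m)"
          using decompose(3)[OF yR[of m]] by (simp add: algebra_simps)
        have "nrm E ((?p m - a) + ((?q m - b) + R m)) \<le> nrm E (?p m - a) + (nrm E (?q m - b) + nrm E (R m))"
          using nrm_triangle[of "?p m - a" "(?q m - b) + R m"] nrm_triangle[of "?q m - b" "R m"]
            P_in[OF yR] Q_in[OF yR] RE a b by (smt (verit) add_in diff_in)
        then show ?thesis unfolding eq using Rin[of m] by linarith
      qed
      moreover have "(\<lambda>m. nrm E (?p m - a) + nrm E (?q m - b) + r / 2 ^ m) \<longlonglongrightarrow> 0 + 0 + 0"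
        by (intro tendsto_add a b) (use LIMSEQ_divide_realpow_zero[of 2 r] in simp)
      ultimately have "nrm E (y - (a + b)) \<le> 0 + 0 + 0" by (intro LIMSEQ_le_const) blast+
      then show ?thesis using nrm_nonneg[of "y - (a + b)"] nrm_eq_0[of "y - (a + b)"] y a b by simp
    qed
    ultimately have "Q y = b" using Q_sum by blast
    moreover have "nrm E b \<le> 2 * k"
    proof -
      have "nrm E b \<le> nrm E (?q m - b) + 2 * k" for m
      proof -
        have "nrm E (?q m) \<le> 2 * k / 2 ^ 0" using order_trans[OF Nle(2)[OF yR[of m]], OF tail'[of 0 0 m, unfolded R0]] by simp
        then show ?thesis using nrm_triangle_sub[OF b(1) Q_in[OF yR[of m]]] nrm_commute[OF b(1) Q_in[OF yR[of m]]] by simp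
      qed
      moreover have "(\<lambda>m. nrm E (?q m - b) + 2 * k) \<longlonglongrightarrow> 0 + 2 * k" by (intro tendsto_add b tendsto_const)
      ultimately have "nrm E b \<le> 0 + 2 * k" by (intro LIMSEQ_le_const) blast+
      then show ?thesis by simp
    qed
    ultimately show ?thesis by simp
  qed
  have "nrm E (Q y) \<le> (4 * k / r) * nrm E y" if y: "y \<in> carr E" for y
  proof (cases "y = 0")
    case True
    then show ?thesis using Q_diff[OF y y] by simp
  next
    case False
    then have ny: "nrm E y > 0" using nrm_nonneg[OF y] nrm_eq_0[OF y] by simp
    let ?t = "r / (2 * nrm E y)"
    have t: "?t > 0" using r ny by simp
    have "nrm E (?t *\<^sub>R y) = r / 2" using t ny y r by (simp add: nrm_scaleR)
    then have "nrm E (Q (?t *\<^sub>R y)) \<le> 2 * k" using small[of "?t *\<^sub>R y"] y r by simp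
    moreover have "Q (?t *\<^sub>R y) = ?t *\<^sub>R Q y" using Q_scale[OF y, of "of_real ?t"] unfolding scale_of_real by simp
    ultimately have "\<bar>?t\<bar> * nrm E (Q y) \<le> 2 * k" by (simp only: nrm_scaleR[OF Q_in[OF y], of ?t])
    then have "?t * nrm E (Q y) \<le> 2 * k" by (simp only: abs_of_pos[OF t])
    then have "nrm E (Q y) * ?t \<le> 2 * k" by (subst mult.commute)
    then have "nrm E (Q y) \<le> 2 * k / ?t" by (subst pos_le_divide_eq[OF t])
    then show ?thesis by (simp add: mult.assoc)
  qed
  moreover have "4 * k / r \<ge> 0" using k r by simp
  ultimately show ?thesis by blast
qed

end

section \<open>Interpolation-extrapolation scales\<close>

lemma (in normed_space_on) embedsD:
  assumes "embeds E F"
  shows "\<exists>C>0. \<forall>x\<in>carr E. x \<in> carr F \<and> nrm F x \<le> C * nrm E x"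
proof -
  obtain C where C: "\<And>x. x \<in> carr E \<Longrightarrow> nrm F x \<le> C * nrm E x" and sub: "carr E \<subseteq> carr F"
    using assms unfolding embeds_def by blast
  have "nrm F x \<le> (\<bar>C\<bar> + 1) * nrm E x" if x: "x \<in> carr E" for x
    by (rule order_trans[OF C[OF x] mult_right_mono[OF _ nrm_nonneg[OF x]]]) simp
  moreover have "\<bar>C\<bar> + 1 > 0" using abs_ge_zero[of C] by linarith
  ultimately show ?thesis using sub by blast
qed

lemma (in normed_space_on) opbound_pos:
  assumes "opbound E F T c"
  shows "opbound E F T (max c 0)"
  unfolding opbound_def
proof
  fix x assume x: "x \<in> carr E"
  then have "T x \<in> carr F" "nrm F (T x) \<le> c * nrm E x" using assms by (auto simp: opbound_def)
  moreover have "c * nrm E x \<le> max c 0 * nrm E x" by (intro mult_right_mono nrm_nonneg x) simp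
  ultimately show "T x \<in> carr F \<and> nrm F (T x) \<le> max c 0 * nrm E x" by linarith
qed

text \<open>Operator bounds survive a change to other norms on both sides.\<close>

lemma opbound_change:
  assumes T: "opbound E F T c" and c: "c \<ge> 0"
    and E: "\<And>x. x \<in> carr E' \<Longrightarrow> x \<in> carr E \<and> nrm E x \<le> a * nrm E' x"
    and F: "\<And>x. x \<in> carr F \<Longrightarrow> x \<in> carr F' \<and> nrm F' x \<le> b * nrm F x" and b: "b \<ge> 0"
  shows "opbound E' F' T (b * c * a)"
  unfolding opbound_def
proof
  fix x assume x: "x \<in> carr E'"
  have Tx: "T x \<in> carr F" "nrm F (T x) \<le> c * nrm E x" using T E[OF x] by (auto simp: opbound_def)
  have "nrm F' (T x) \<le> b * nrm F (T x)" using F[OF Tx(1)] by simp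
  also have "\<dots> \<le> b * (c * nrm E x)" using Tx(2) b by (rule mult_left_mono)
  also have "\<dots> \<le> b * (c * (a * nrm E' x))" using E[OF x] b c by (intro mult_left_mono) auto
  finally show "T x \<in> carr F' \<and> nrm F' (T x) \<le> b * c * a * nrm E' x" using F[OF Tx(1)] by (simp add: mult.assoc)
qed

lemma (in banach_space_on) banach_equivalent:
  assumes F: "normed_space_on sc F" and carr: "carr F = carr E"
    and EF: "\<And>x. x \<in> carr E \<Longrightarrow> nrm E x \<le> a * nrm F x" "\<And>x. x \<in> carr E \<Longrightarrow> nrm F x \<le> b * nrm E x" and a: "a > 0"
  shows "banach_space_on sc F"
proof -
  interpret F: normed_space_on sc F by fact
  show ?thesis
  proof
    fix s :: "nat \<Rightarrow> 'v"
    assume s: "\<And>n. s n \<in> carr F" and cau: "\<And>e. e > 0 \<Longrightarrow> \<exists>N. \<forall>m\<ge>N. \<forall>n\<ge>N. nrm F (s m - s n) < e"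
    have sE: "s n \<in> carr E" for n using s carr by simp
    have "\<exists>x\<in>carr E. (\<lambda>n. nrm E (s n - x)) \<longlonglongrightarrow> 0"
    proof (rule complete[OF sE])
      fix e :: real assume "e > 0"
      then have "e / a > 0" using a by simp
      from cau[OF this] obtain N where N: "\<forall>m\<ge>N. \<forall>n\<ge>N. nrm F (s m - s n) < e / a" ..
      have "nrm E (s m - s n) < e" if "m \<ge> N" "n \<ge> N" for m n
      proof -
        have "nrm E (s m - s n) \<le> a * nrm F (s m - s n)" by (rule EF(1)[OF diff_in[OF sE sE]])
        also have "\<dots> < a * (e / a)" using N that a by (intro mult_strict_left_mono) auto
        finally show ?thesis using a by simp
      qed
      then show "\<exists>N. \<forall>m\<ge>N. \<forall>n\<ge>N. nrm E (s m - s n) < e" by blast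
    qed
    then obtain x where x: "x \<in> carr E" "(\<lambda>n. nrm E (s n - x)) \<longlonglongrightarrow> 0" by blast
    have "(\<lambda>n. nrm F (s n - x)) \<longlonglongrightarrow> 0"
    proof (rule tendsto_sandwich[OF _ _ tendsto_const])
      show "(\<lambda>n. b * nrm E (s n - x)) \<longlonglongrightarrow> 0" using tendsto_mult_left[OF x(2), of b] by simp
    qed (use EF(2) sE x(1) carr in \<open>auto intro!: always_eventually F.nrm_nonneg\<close>)
    then show "\<exists>x\<in>carr F. (\<lambda>n. nrm F (s n - x)) \<longlonglongrightarrow> 0" using x(1) carr by blast
  qed
qed

text \<open>
  An interpolation-extrapolation scale with its witnesses: \<open>E\<close> is the scale generated by \<open>S\<close> with
  the functors \<open>F\<close>, and \<open>X \<alpha>\<close> is \<open>E \<alpha>\<close> with an equivalent norm. The scale \<open>E\<close> only serves to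
  derive facts about \<open>X\<close>.
\<close>

locale extrapolation_scale =
  fixes sc :: "'k::real_normed_field \<Rightarrow> 'v::real_vector \<Rightarrow> 'v" and S :: "'v \<Rightarrow> 'v" and X :: "real \<Rightarrow> 'v nspace"
    and F :: "real \<Rightarrow> 'v nspace \<Rightarrow> 'v nspace \<Rightarrow> 'v nspace" and E :: "real \<Rightarrow> 'v nspace"
  assumes scalars: "vector_space sc" and scale_of_real: "\<And>r x. sc (of_real r) x = r *\<^sub>R x"
    and interp: "\<And>\<theta>. 0 < \<theta> \<Longrightarrow> \<theta> < 1 \<Longrightarrow> exact_interpolation_functor sc (F \<theta>)"
    and generated: "generated_scale sc F (X 0) (carr (X 1)) S E"
    and banach_X: "\<And>\<alpha>. \<alpha> \<ge> -1 \<Longrightarrow> banach_on sc (X \<alpha>)"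
    and equiv: "\<And>\<alpha>. \<alpha> \<ge> -1 \<Longrightarrow> equiv_ns (X \<alpha>) (E \<alpha>)"

lemma extrapolation_scale_exists:
  assumes "vector_space sc" "\<And>r x. sc (of_real r) x = r *\<^sub>R x" "interp_extrap_scale sc (X 0) (carr (X 1)) S X"
  obtains F E where "extrapolation_scale sc S X F E"
proof -
  obtain F E where "\<forall>\<theta>. 0 < \<theta> \<and> \<theta> < 1 \<longrightarrow> exact_interpolation_functor sc (F \<theta>) \<and> density_preserving sc (F \<theta>)"
    "generated_scale sc F (X 0) (carr (X 1)) S E"
    "\<forall>\<alpha>\<ge>-1. banach_on sc (X \<alpha>) \<and> equiv_ns (X \<alpha>) (E \<alpha>)"
    using assms(3) unfolding interp_extrap_scale_def by blast
  then have "extrapolation_scale sc S X F E"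
    by (intro extrapolation_scale.intro) (use assms(1,2) in auto)
  then show thesis by (rule that)
qed

context extrapolation_scale begin

lemma banach: "\<alpha> \<ge> -1 \<Longrightarrow> banach_space_on sc (X \<alpha>)"
  by (rule banach_space_onI[OF scalars scale_of_real banach_X])

sublocale X0: banach_space_on sc "X 0" by (rule banach) simp
sublocale X1: banach_space_on sc "X 1" by (rule banach) simp

lemma S_linear: "linear_between sc sc (carr (X 1)) (carr (X 0)) S"
  using generated by (simp add: generated_scale_def closed_op_def)
lemma S_in: "x \<in> carr (X 1) \<Longrightarrow> S x \<in> carr (X 0)"
  and S_add: "x \<in> carr (X 1) \<Longrightarrow> y \<in> carr (X 1) \<Longrightarrow> S (x + y) = S x + S y"
  and S_scale: "x \<in> carr (X 1) \<Longrightarrow> S (sc c x) = sc c (S x)"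
  using S_linear by (auto simp: linear_between_def)

lemma X1_X0: "x \<in> carr (X 1) \<Longrightarrow> x \<in> carr (X 0)"
  using generated by (auto simp: generated_scale_def closed_op_def)

lemma dense: "x \<in> carr (X 0) \<Longrightarrow> e > 0 \<Longrightarrow> \<exists>y\<in>carr (X 1). nrm (X 0) (x - y) < e"
  using generated by (auto simp: generated_scale_def dense_in_def)

lemma carr_E0: "carr (E 0) = carr (X 0)" and nrm_E0: "z \<in> carr (X 0) \<Longrightarrow> nrm (E 0) z = nrm (X 0) z"
proof -
  have *: "carr (E (real k)) = dom_pow (X 0) (carr (X 1)) S k \<and>
        (\<forall>z\<in>dom_pow (X 0) (carr (X 1)) S k. nrm (E (real k)) z = nrm (X 0) ((S ^^ k) z))" for k
    using generated by (simp add: generated_scale_def)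
  show "carr (E 0) = carr (X 0)" "z \<in> carr (X 0) \<Longrightarrow> nrm (E 0) z = nrm (X 0) z" using *[of 0] by auto
qed

lemma carr_E1: "carr (E 1) = carr (X 1)" and nrm_E1: "z \<in> carr (X 1) \<Longrightarrow> nrm (E 1) z = nrm (X 0) (S z)"
proof -
  have *: "carr (E (real k)) = dom_pow (X 0) (carr (X 1)) S k \<and>
        (\<forall>z\<in>dom_pow (X 0) (carr (X 1)) S k. nrm (E (real k)) z = nrm (X 0) ((S ^^ k) z))" for k
    using generated by (simp add: generated_scale_def)
  show "carr (E 1) = carr (X 1)" "z \<in> carr (X 1) \<Longrightarrow> nrm (E 1) z = nrm (X 0) (S z)" using *[of 1] S_in by auto
qed

lemma norm_X1_le: "\<exists>c>0. \<forall>x\<in>carr (X 1). nrm (X 1) x \<le> c * nrm (X 0) (S x)"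
  and norm_S_le: "\<exists>c>0. \<forall>x\<in>carr (X 1). nrm (X 0) (S x) \<le> c * nrm (X 1) x"
proof -
  have e: "embeds (X 1) (E 1)" "embeds (E 1) (X 1)" using equiv[of 1] by (auto simp: equiv_ns_def)
  show "\<exists>c>0. \<forall>x\<in>carr (X 1). nrm (X 0) (S x) \<le> c * nrm (X 1) x"
    using X1.embedsD[OF e(1)] nrm_E1 by auto
  obtain C where C: "\<And>x. x \<in> carr (X 1) \<Longrightarrow> nrm (X 1) x \<le> C * nrm (X 0) (S x)"
    using e(2) nrm_E1 unfolding embeds_def carr_E1 by auto
  have "nrm (X 1) x \<le> (\<bar>C\<bar> + 1) * nrm (X 0) (S x)" if x: "x \<in> carr (X 1)" for x
    by (rule order_trans[OF C[OF x] mult_right_mono[OF _ X0.nrm_nonneg[OF S_in[OF x]]]]) simp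
  moreover have "\<bar>C\<bar> + 1 > 0" using abs_ge_zero[of C] by linarith
  ultimately show "\<exists>c>0. \<forall>x\<in>carr (X 1). nrm (X 1) x \<le> c * nrm (X 0) (S x)" by blast
qed

lemma resolvent: "bij_betw (\<lambda>x. - S x) (carr (X 1)) (carr (X 0))"
  "\<exists>c. \<forall>x\<in>carr (X 1). nrm (X 0) x \<le> c * nrm (X 0) (S x)"
proof -
  have z: "sc 0 x = 0" for x using scale_of_real[of 0 x] by simp
  have r: "in_resolvent_set sc (X 0) (carr (X 1)) S 0" using generated by (simp add: generated_scale_def)
  then show "bij_betw (\<lambda>x. - S x) (carr (X 1)) (carr (X 0))" by (simp add: in_resolvent_set_def z)
  obtain c where "\<forall>x\<in>carr (X 1). nrm (X 0) x \<le> c * nrm (X 0) (- S x)"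
    using r by (auto simp: in_resolvent_set_def z)
  then show "\<exists>c. \<forall>x\<in>carr (X 1). nrm (X 0) x \<le> c * nrm (X 0) (S x)"
    using X0.nrm_minus[OF S_in] by auto
qed

lemma S_surj: "z \<in> carr (X 0) \<Longrightarrow> \<exists>x\<in>carr (X 1). S x = z"
proof -
  assume "z \<in> carr (X 0)"
  then have "- z \<in> (\<lambda>x. - S x) ` carr (X 1)" using resolvent(1) by (simp add: bij_betw_def)
  then show ?thesis by auto
qed

lemma S_inj: "inj_on S (carr (X 1))"
  using resolvent(1) unfolding bij_betw_def inj_on_def by auto

lemma norm_X0_le: "\<exists>c>0. \<forall>x\<in>carr (X 1). nrm (X 0) x \<le> c * nrm (X 1) x"
proof -
  obtain c where c: "\<And>x. x \<in> carr (X 1) \<Longrightarrow> nrm (X 0) x \<le> c * nrm (X 0) (S x)" using resolvent(2) by blast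
  obtain c' where c': "c' > 0" "\<And>x. x \<in> carr (X 1) \<Longrightarrow> nrm (X 0) (S x) \<le> c' * nrm (X 1) x" using norm_S_le by blast
  have "nrm (X 0) x \<le> (\<bar>c\<bar> + 1) * c' * nrm (X 1) x" if x: "x \<in> carr (X 1)" for x
  proof -
    have "nrm (X 0) x \<le> (\<bar>c\<bar> + 1) * nrm (X 0) (S x)"
      by (rule order_trans[OF c[OF x] mult_right_mono[OF _ X0.nrm_nonneg[OF S_in[OF x]]]]) simp
    also have "\<dots> \<le> (\<bar>c\<bar> + 1) * (c' * nrm (X 1) x)" by (rule mult_left_mono[OF c'(2)[OF x]]) simp
    finally show ?thesis by (simp add: mult.assoc)
  qed
  moreover have "(\<bar>c\<bar> + 1) * c' > 0" using c'(1) abs_ge_zero[of c] by (intro mult_pos_pos) linarith+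
  ultimately show ?thesis by blast
qed

text \<open>\<open>X 0\<close> embeds in \<open>X (-1)\<close> because \<open>S\<inverse>\<close> is bounded on \<open>X 0\<close>.\<close>

lemma norm_extrapolated_le: "\<exists>c>0. \<forall>x\<in>carr (X 0). x \<in> carr (X (-1)) \<and> nrm (X (-1)) x \<le> c * nrm (X 0) x"
proof -
  have "embeds (X 0) (E (-1))"
  proof -
    obtain c where c: "\<And>x. x \<in> carr (X 1) \<Longrightarrow> nrm (X 0) x \<le> c * nrm (X 0) (S x)" using resolvent(2) by blast
    have n: "nrm (E (-1)) z = nrm (X 0) (the_inv_into (carr (X 1)) S z)" if "z \<in> carr (X 0)" for z
      using generated that by (simp add: generated_scale_def)
    have "nrm (E (-1)) z \<le> c * nrm (X 0) z" if z: "z \<in> carr (X 0)" for z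
    proof -
      obtain x where x: "x \<in> carr (X 1)" "S x = z" using S_surj[OF z] by blast
      then show ?thesis using n[OF z] c[OF x(1)] the_inv_into_f_f[OF S_inj x(1)] by simp
    qed
    moreover have "carr (X 0) \<subseteq> carr (E (-1))"
      using generated by (simp add: generated_scale_def dense_in_def)
    ultimately show ?thesis unfolding embeds_def by blast
  qed
  then obtain c where c: "c > 0" "\<And>x. x \<in> carr (X 0) \<Longrightarrow> x \<in> carr (E (-1)) \<and> nrm (E (-1)) x \<le> c * nrm (X 0) x"
    using X0.embedsD by blast
  obtain c' where c': "\<And>x. x \<in> carr (E (-1)) \<Longrightarrow> x \<in> carr (X (-1)) \<and> nrm (X (-1)) x \<le> c' * nrm (E (-1)) x"
    using equiv[of "-1"] unfolding equiv_ns_def embeds_def by (meson order_refl subsetD)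
  have nn: "0 \<le> nrm (E (-1)) x" if "x \<in> carr (E (-1))" for x
    using generated that by (simp add: generated_scale_def banach_on_def)
  have "x \<in> carr (X (-1)) \<and> nrm (X (-1)) x \<le> ((\<bar>c'\<bar> + 1) * c) * nrm (X 0) x" if x: "x \<in> carr (X 0)" for x
  proof -
    have xE: "x \<in> carr (E (-1))" using c(2)[OF x] by simp
    have "nrm (X (-1)) x \<le> c' * nrm (E (-1)) x" using c'[OF xE] by simp
    also have "\<dots> \<le> (\<bar>c'\<bar> + 1) * nrm (E (-1)) x" using nn[OF xE] by (intro mult_right_mono) auto
    also have "\<dots> \<le> (\<bar>c'\<bar> + 1) * (c * nrm (X 0) x)" using c(2)[OF x] by (intro mult_left_mono) auto
    finally show ?thesis using c'[OF xE] by (simp add: mult.assoc)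
  qed
  moreover have "(\<bar>c'\<bar> + 1) * c > 0" using c(1) abs_ge_zero[of c'] by (intro mult_pos_pos) linarith+
  ultimately show ?thesis by blast
qed

lemma banach_E0: "banach_space_on sc (E 0)"
proof (rule X0.banach_equivalent[where a = 1 and b = 1])
  show "normed_space_on sc (E 0)"
    by (rule normed_space_on.intro)
      (use scalars scale_of_real X0.carr_subspace X0.nrm_nonneg X0.nrm_eq_0 X0.nrm_triangle X0.nrm_scale in \<open>auto simp: carr_E0 nrm_E0\<close>)
qed (auto simp: carr_E0 nrm_E0)

lemma banach_E1: "banach_space_on sc (E 1)"
proof -
  obtain a b where "a > 0" and ab: "\<And>x. x \<in> carr (X 1) \<Longrightarrow> nrm (X 1) x \<le> a * nrm (X 0) (S x)"
    "\<And>x. x \<in> carr (X 1) \<Longrightarrow> nrm (X 0) (S x) \<le> b * nrm (X 1) x"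
    using norm_X1_le norm_S_le by blast
  show ?thesis
  proof (rule X1.banach_equivalent[where a = a and b = b])
    have S0: "S x = 0 \<longleftrightarrow> x = 0" if "x \<in> carr (X 1)" for x
    proof -
      have "S 0 = 0" using S_add[of 0 0] by simp
      then show ?thesis using S_inj that by (metis X1.zero_in inj_onD)
    qed
    show "normed_space_on sc (E 1)"
    proof (rule normed_space_on.intro)
      show "module.subspace sc (carr (E 1))" by (simp add: carr_E1 X1.carr_subspace)
      show "0 \<le> nrm (E 1) x" if "x \<in> carr (E 1)" for x
        using that X0.nrm_nonneg S_in by (simp add: carr_E1 nrm_E1)
      show "(nrm (E 1) x = 0) = (x = 0)" if "x \<in> carr (E 1)" for x
        using that X0.nrm_eq_0 S_in S0 by (simp add: carr_E1 nrm_E1)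
      show "nrm (E 1) (x + y) \<le> nrm (E 1) x + nrm (E 1) y" if "x \<in> carr (E 1)" "y \<in> carr (E 1)" for x y
        using that X0.nrm_triangle[OF S_in S_in] S_add by (simp add: carr_E1 nrm_E1)
      show "nrm (E 1) (sc c x) = norm c * nrm (E 1) x" if "x \<in> carr (E 1)" for c x
        using that X0.nrm_scale[OF S_in] S_scale by (simp add: carr_E1 nrm_E1)
    qed (rule scalars scale_of_real)+
  qed (use ab \<open>a > 0\<close> in \<open>auto simp: carr_E1 nrm_E1\<close>)
qed

lemma couple: "interpolation_couple sc (E 0) (E 1)"
  unfolding interpolation_couple_def
proof (intro conjI allI ballI impI)
  show "banach_on sc (E 0)" "banach_on sc (E 1)"
    using banach_space_on.banach_on[OF banach_E0] banach_space_on.banach_on[OF banach_E1] by auto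
  obtain c where c: "\<And>x. x \<in> carr (X 1) \<Longrightarrow> nrm (X 0) x \<le> c * nrm (X 0) (S x)" using resolvent(2) by blast
  fix s :: "nat \<Rightarrow> 'v" and a b
  assume a: "a \<in> carr (E 0)" and b: "b \<in> carr (E 1)"
  assume s: "(\<forall>n. s n \<in> carr (E 0) \<inter> carr (E 1)) \<and> (\<lambda>n. nrm (E 0) (s n - a)) \<longlonglongrightarrow> 0 \<and> (\<lambda>n. nrm (E 1) (s n - b)) \<longlonglongrightarrow> 0"
  have sin: "s n \<in> carr (X 1)" "s n \<in> carr (X 0)" for n using s by (auto simp: carr_E0 carr_E1)
  have ab: "a \<in> carr (X 0)" "b \<in> carr (X 1)" "b \<in> carr (X 0)" using a b X1_X0 by (auto simp: carr_E0 carr_E1)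
  have s0: "(\<lambda>n. nrm (X 0) (s n - a)) \<longlonglongrightarrow> 0" and s1: "(\<lambda>n. nrm (X 0) (S (s n - b))) \<longlonglongrightarrow> 0"
    using s sin ab by (simp_all add: nrm_E0 nrm_E1)
  have "nrm (X 0) (a - b) \<le> nrm (X 0) (s n - a) + c * nrm (X 0) (S (s n - b))" for n
    using X0.nrm_triangle_mid[OF ab(1) sin(2) ab(3), of n] X0.nrm_commute[OF ab(1) sin(2)[of n]]
      c[OF X1.diff_in[OF sin(1)[of n] ab(2)]] by simp
  moreover have "(\<lambda>n. nrm (X 0) (s n - a) + c * nrm (X 0) (S (s n - b))) \<longlonglongrightarrow> 0 + c * 0"
    by (intro tendsto_intros s0 s1)
  ultimately have "nrm (X 0) (a - b) \<le> 0 + c * 0" by (intro LIMSEQ_le_const) blast+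
  then show "a = b" using X0.nrm_nonneg[of "a - b"] X0.nrm_eq_0[of "a - b"] ab by simp
qed

lemma E_interpolated: "0 < \<theta> \<Longrightarrow> \<theta> < 1 \<Longrightarrow> E \<theta> = F \<theta> (E 0) (E 1)"
proof -
  assume \<theta>: "0 < \<theta>" "\<theta> < 1"
  have "\<forall>k::int. \<forall>\<theta>::real. - 1 \<le> k \<and> 0 < \<theta> \<and> \<theta> < 1 \<longrightarrow>
        E (of_int k + \<theta>) = F \<theta> (E (of_int k)) (E (of_int k + 1))"
    using generated by (simp add: generated_scale_def)
  from this[rule_format, of 0 \<theta>] \<theta> show ?thesis by simp
qed

lemma interpolated_sub: "0 < \<theta> \<Longrightarrow> \<theta> \<le> 1 \<Longrightarrow> carr (X \<theta>) \<subseteq> carr (X 0)"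
proof (cases "\<theta> = 1")
  case True
  then show ?thesis using X1_X0 by auto
next
  case False
  assume "0 < \<theta>" "\<theta> \<le> 1"
  then have \<theta>: "0 < \<theta>" "\<theta> < 1" using False by auto
  obtain C where C: "\<forall>x\<in>carr (F \<theta> (E 0) (E 1)). \<exists>a\<in>carr (E 0). \<exists>b\<in>carr (E 1).
      x = a + b \<and> nrm (E 0) a + nrm (E 1) b \<le> C * nrm (F \<theta> (E 0) (E 1)) x"
    using interp[OF \<theta>] couple unfolding exact_interpolation_functor_def by blast
  have "carr (X \<theta>) \<subseteq> carr (E \<theta>)" using equiv[of \<theta>] \<theta> by (auto simp: equiv_ns_def embeds_def)
  moreover have "carr (E \<theta>) \<subseteq> carr (X 0)"
    unfolding E_interpolated[OF \<theta>] using C X1_X0 by (force simp: carr_E0 carr_E1)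
  ultimately show ?thesis by blast
qed

lemma interpolated_embedding:
  assumes "0 < \<theta>" "\<theta> \<le> 1"
  shows "\<exists>c>0. \<forall>x\<in>carr (X 1). x \<in> carr (X \<theta>) \<and> nrm (X \<theta>) x \<le> c * nrm (X 1) x"
proof (cases "\<theta> = 1")
  case True
  then show ?thesis by (intro exI[of _ 1]) auto
next
  case False
  then have \<theta>: "0 < \<theta>" "\<theta> < 1" using assms by auto
  obtain C where C: "\<forall>x\<in>carr (E 0) \<inter> carr (E 1).
      x \<in> carr (F \<theta> (E 0) (E 1)) \<and> nrm (F \<theta> (E 0) (E 1)) x \<le> C * max (nrm (E 0) x) (nrm (E 1) x)"
    using interp[OF \<theta>] couple unfolding exact_interpolation_functor_def by blast
  obtain a b where a: "a > 0" "\<And>x. x \<in> carr (X 1) \<Longrightarrow> nrm (X 0) x \<le> a * nrm (X 1) x"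
    and b: "b > 0" "\<And>x. x \<in> carr (X 1) \<Longrightarrow> nrm (X 0) (S x) \<le> b * nrm (X 1) x"
    using norm_X0_le norm_S_le by blast
  obtain d where d: "\<And>x. x \<in> carr (E \<theta>) \<Longrightarrow> x \<in> carr (X \<theta>) \<and> nrm (X \<theta>) x \<le> d * nrm (E \<theta>) x"
  proof -
    have "embeds (E \<theta>) (X \<theta>)" using equiv[of \<theta>] \<theta> by (simp add: equiv_ns_def)
    then show thesis using that unfolding embeds_def by (meson subsetD)
  qed
  interpret X\<theta>: banach_space_on sc "X \<theta>" by (rule banach) (use \<theta> in simp)
  have Epos: "0 \<le> nrm (E \<theta>) x" if "x \<in> carr (E \<theta>)" for x
    using interp[OF \<theta>] couple that unfolding exact_interpolation_functor_def E_interpolated[OF \<theta>] banach_on_def by blast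
  have "x \<in> carr (X \<theta>) \<and> nrm (X \<theta>) x \<le> ((\<bar>d\<bar> + 1) * ((\<bar>C\<bar> + 1) * (a + b))) * nrm (X 1) x" if x: "x \<in> carr (X 1)" for x
  proof -
    have x1: "0 \<le> nrm (X 1) x" by (rule X1.nrm_nonneg[OF x])
    have xE: "x \<in> carr (E \<theta>)" "nrm (E \<theta>) x \<le> C * max (nrm (X 0) x) (nrm (X 0) (S x))"
      using C x X1_X0[OF x] unfolding E_interpolated[OF \<theta>] by (auto simp: carr_E0 carr_E1 nrm_E0 nrm_E1)
    have m: "0 \<le> max (nrm (X 0) x) (nrm (X 0) (S x))" "max (nrm (X 0) x) (nrm (X 0) (S x)) \<le> (a + b) * nrm (X 1) x"
      using a(2)[OF x] b(2)[OF x] X0.nrm_nonneg[OF X1_X0[OF x]] mult_nonneg_nonneg[OF less_imp_le[OF a(1)] x1]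
        mult_nonneg_nonneg[OF less_imp_le[OF b(1)] x1] by (auto simp: distrib_right)
    have "nrm (E \<theta>) x \<le> (\<bar>C\<bar> + 1) * max (nrm (X 0) x) (nrm (X 0) (S x))"
      by (rule order_trans[OF xE(2) mult_right_mono[OF _ m(1)]]) simp
    also have "\<dots> \<le> (\<bar>C\<bar> + 1) * ((a + b) * nrm (X 1) x)" by (rule mult_left_mono[OF m(2)]) simp
    finally have 1: "nrm (E \<theta>) x \<le> (\<bar>C\<bar> + 1) * ((a + b) * nrm (X 1) x)" .
    have "nrm (X \<theta>) x \<le> (\<bar>d\<bar> + 1) * nrm (E \<theta>) x"
      by (rule order_trans[OF conjunct2[OF d[OF xE(1)]] mult_right_mono[OF _ Epos[OF xE(1)]]]) simp
    also have "\<dots> \<le> (\<bar>d\<bar> + 1) * ((\<bar>C\<bar> + 1) * ((a + b) * nrm (X 1) x))" by (rule mult_left_mono[OF 1]) simp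
    finally show ?thesis using d[OF xE(1)] by (simp add: mult.assoc)
  qed
  moreover have "(\<bar>d\<bar> + 1) * ((\<bar>C\<bar> + 1) * (a + b)) > 0"
    using a(1) b(1) abs_ge_zero[of C] abs_ge_zero[of d] by (intro mult_pos_pos) linarith+
  ultimately show ?thesis by blast
qed

text \<open>
  Interpolation of operators: the functors apply to the exact norms of \<open>E 0\<close> and \<open>E 1\<close>, and
  equivalence of norms carries the bound over to \<open>X \<theta>\<close>.
\<close>

lemma interpolated_operator:
  assumes \<theta>: "0 < \<theta>" "\<theta> \<le> 1" and T: "linear_between sc sc (carr (X 0)) (carr (X 0)) T"
    and T0: "opbound (X 0) (X 0) T c0" and T1: "opbound (X 1) (X 1) T c1"
  shows "\<exists>c\<ge>0. opbound (X \<theta>) (X \<theta>) T c"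
proof (cases "\<theta> = 1")
  case True
  then show ?thesis using X1.opbound_pos[OF T1] by (intro exI[of _ "max c1 0"]) auto
next
  case False
  then have \<theta>': "0 < \<theta>" "\<theta> < 1" using \<theta> by auto
  interpret X\<theta>: banach_space_on sc "X \<theta>" by (rule banach) (use \<theta> in simp)
  obtain a b where a: "a > 0" "\<And>x. x \<in> carr (X 1) \<Longrightarrow> nrm (X 1) x \<le> a * nrm (X 0) (S x)"
    and b: "b > 0" "\<And>x. x \<in> carr (X 1) \<Longrightarrow> nrm (X 0) (S x) \<le> b * nrm (X 1) x"
    using norm_X1_le norm_S_le by blast
  have T0': "opbound (E 0) (E 0) T (max c0 0)"
    using X0.opbound_pos[OF T0] unfolding opbound_def by (simp add: carr_E0 nrm_E0)
  have T1': "opbound (E 1) (E 1) T (b * max c1 0 * a)"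
    by (rule opbound_change[OF X1.opbound_pos[OF T1]]) (use a b in \<open>auto simp: carr_E1 nrm_E1\<close>)
  have sum: "sum_carr (E 0) (E 1) = carr (X 0)"
  proof
    show "sum_carr (E 0) (E 1) \<subseteq> carr (X 0)" using X1_X0 by (auto simp: sum_carr_def carr_E0 carr_E1)
    have "x \<in> sum_carr (E 0) (E 1)" if "x \<in> carr (X 0)" for x
      unfolding sum_carr_def carr_E0 carr_E1 using that X1.zero_in by (metis (mono_tags, lifting) CollectI add.right_neutral)
    then show "carr (X 0) \<subseteq> sum_carr (E 0) (E 1)" by blast
  qed
  have "opbound (F \<theta> (E 0) (E 1)) (F \<theta> (E 0) (E 1)) T (max (max c0 0) (b * max c1 0 * a))"
    using interp[OF \<theta>'] couple T T0' T1' a(1) b(1) unfolding exact_interpolation_functor_def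
    by (metis sum max.cobounded2 mult_nonneg_nonneg less_imp_le)
  then have TE: "opbound (E \<theta>) (E \<theta>) T (max (max c0 0) (b * max c1 0 * a))" by (simp only: E_interpolated[OF \<theta>'])
  have e: "embeds (X \<theta>) (E \<theta>)" "embeds (E \<theta>) (X \<theta>)" using equiv[of \<theta>] \<theta> by (auto simp: equiv_ns_def)
  obtain p where p: "\<And>x. x \<in> carr (X \<theta>) \<Longrightarrow> x \<in> carr (E \<theta>) \<and> nrm (E \<theta>) x \<le> p * nrm (X \<theta>) x"
    using X\<theta>.embedsD[OF e(1)] by blast
  have banachE: "banach_space_on sc (E \<theta>)"
    using interp[OF \<theta>'] couple unfolding exact_interpolation_functor_def E_interpolated[OF \<theta>']
    by (intro banach_space_onI scalars scale_of_real) blast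
  interpret E\<theta>: banach_space_on sc "E \<theta>" by (rule banachE)
  obtain r where r: "r > 0" "\<And>x. x \<in> carr (E \<theta>) \<Longrightarrow> x \<in> carr (X \<theta>) \<and> nrm (X \<theta>) x \<le> r * nrm (E \<theta>) x"
    using E\<theta>.embedsD[OF e(2)] by blast
  have "opbound (X \<theta>) (X \<theta>) T (r * max (max c0 0) (b * max c1 0 * a) * p)"
    by (rule opbound_change[OF TE]) (use p r in auto)
  from X\<theta>.opbound_pos[OF this] show ?thesis by (meson max.cobounded2)
qed

end

section \<open>Semigroups on the domain of the generator\<close>

lemma (in normed_space_on) orbit_continuous:
  assumes T_in: "\<And>t x. t \<ge> 0 \<Longrightarrow> x \<in> carr E \<Longrightarrow> T t x \<in> carr E"
    and T_bound: "\<And>t x. t \<ge> 0 \<Longrightarrow> x \<in> carr E \<Longrightarrow> nrm E (T t x) \<le> M * exp (w * t) * nrm E x" and M: "M \<ge> 0"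
    and T_diff: "\<And>t x y. t \<ge> 0 \<Longrightarrow> x \<in> carr E \<Longrightarrow> y \<in> carr E \<Longrightarrow> T t (x - y) = T t x - T t y"
    and law: "\<And>s t x. s \<ge> 0 \<Longrightarrow> t \<ge> 0 \<Longrightarrow> x \<in> carr E \<Longrightarrow> T (s + t) x = T s (T t x)"
    and right: "((\<lambda>h. nrm E (T h x - x)) \<longlongrightarrow> 0) (at_right 0)" and x: "x \<in> carr E"
  shows "continuous_path E {0..} (\<lambda>t. T t x)"
proof (rule continuous_pathI)
  show "T t x \<in> carr E" if "t \<in> {0..}" for t using T_in x that by simp
  fix s e :: real assume s: "s \<in> {0..}" and e: "e > 0"
  define C where "C = M * exp (\<bar>w\<bar> * (s + 1)) + 1"
  have C: "C > 0" using M by (simp add: C_def add_nonneg_pos)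
  have "e / C > 0" using e C by simp
  then have "\<forall>\<^sub>F h in at_right 0. \<bar>nrm E (T h x - x)\<bar> < e / C"
    using tendstoD[OF right] by (simp add: dist_real_def)
  then obtain d where d: "d > 0" "\<And>h. 0 < h \<Longrightarrow> h < d \<Longrightarrow> nrm E (T h x - x) < e / C"
    unfolding eventually_at_right_field by (metis abs_less_iff)
  have step: "nrm E (T (m + h) x - T m x) < e" if m: "0 \<le> m" "m \<le> s + 1" and h: "0 < h" "h < d" for m h
  proof -
    have Th: "T h x - x \<in> carr E" using T_in[of h x] h x by auto
    have "T (m + h) x - T m x = T m (T h x - x)"
      using law[OF m(1), of h x] T_diff[OF m(1), of "T h x" x] T_in[of h x] h x by simp
    also have "nrm E \<dots> \<le> M * exp (w * m) * nrm E (T h x - x)" by (rule T_bound[OF m(1) Th])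
    also have "\<dots> \<le> C * nrm E (T h x - x)"
    proof (rule mult_right_mono[OF _ nrm_nonneg[OF Th]])
      have "w * m \<le> \<bar>w\<bar> * (s + 1)"
        using m by (metis abs_ge_self abs_mult abs_of_nonneg abs_ge_zero mult_left_mono order_trans)
      then show "M * exp (w * m) \<le> C" unfolding C_def using M by (simp add: mult_left_mono add_increasing2)
    qed
    also have "\<dots> < C * (e / C)" using d(2)[OF h] C by (rule mult_strict_left_mono)
    finally show ?thesis using C by simp
  qed
  have "nrm E (T r x - T s x) < e" if r: "r \<in> {0..}" "\<bar>r - s\<bar> < min d 1" for r
  proof (cases r s rule: linorder_cases)
    case less
    then show ?thesis using step[of r "s - r"] r s nrm_commute[of "T r x" "T s x"] T_in x by auto
  next
    case greater
    then show ?thesis using step[of s "r - s"] r s by auto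
  qed (use e in simp)
  then show "\<exists>d>0. \<forall>r\<in>{0..}. \<bar>r - s\<bar> < d \<longrightarrow> nrm E (T r x - T s x) < e"
    using d(1) by (intro exI[of _ "min d 1"]) auto
qed

lemma (in normed_space_on) continuous_path_Ioi:
  assumes "\<And>r. r > 0 \<Longrightarrow> continuous_path E {r..} u"
  shows "continuous_path E {0<..} u"
proof (rule continuous_pathI)
  show "u s \<in> carr E" if "s \<in> {0<..}" for s using continuous_pathD[OF assms[of s]] that by simp
  fix s e :: real assume s: "s \<in> {0<..}" and e: "e > 0"
  have s2: "s / 2 > 0" "s \<in> {s / 2..}" using s by auto
  obtain d where d: "d > 0" "\<And>r. r \<in> {s / 2..} \<Longrightarrow> \<bar>r - s\<bar> < d \<Longrightarrow> nrm E (u r - u s) < e"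
    using continuous_path_eps[OF assms[OF s2(1)] s2(2) e] by metis
  have "nrm E (u r - u s) < e" if "\<bar>r - s\<bar> < min d (s / 2)" for r
  proof -
    have "s / 2 \<le> r" using that unfolding min_less_iff_conj abs_less_iff by linarith
    then show ?thesis using d(2)[of r] that by simp
  qed
  then show "\<exists>d>0. \<forall>r\<in>{0<..}. \<bar>r - s\<bar> < d \<longrightarrow> nrm E (u r - u s) < e"
    using d(1) s2(1) by (intro exI[of _ "min d (s / 2)"]) auto
qed

text \<open>
  A bounded operator that commutes with \<open>T h\<close> maps the derivative of an orbit at \<open>0\<close> to the
  derivative of the image orbit. It is used for the operators of the semigroup or group
  themselves.
\<close>

lemma (in normed_space_on) difference_quotient_commute:
  assumes lim: "((\<lambda>h. nrm E ((1 / h) *\<^sub>R (T h x - x) - y)) \<longlongrightarrow> 0) F"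
    and Q: "linear_between sc sc (carr E) (carr E) Q" "opbound E E Q c"
    and com: "\<forall>\<^sub>F h in F. T h x \<in> carr E \<and> Q (T h x) = T h (Q x)" and x: "x \<in> carr E" and y: "y \<in> carr E"
  shows "((\<lambda>h. nrm E ((1 / h) *\<^sub>R (T h (Q x) - Q x) - Q y)) \<longlongrightarrow> 0) F"
proof (rule Lim_null_comparison)
  show "((\<lambda>h. c * nrm E ((1 / h) *\<^sub>R (T h x - x) - y)) \<longlongrightarrow> 0) F" using tendsto_mult_left[OF lim, of c] by simp
  have Qs: "Q (a *\<^sub>R z) = a *\<^sub>R Q z" if "z \<in> carr E" for a z
    using Q(1) that unfolding linear_between_def by (metis scale_of_real)
  have Qd: "Q (z - z') = Q z - Q z'" if "z \<in> carr E" "z' \<in> carr E" for z z'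
  proof -
    have "Q (z + (-1) *\<^sub>R z') = Q z + Q ((-1) *\<^sub>R z')"
      using Q(1) that scaleR_in[of z' "-1"] unfolding linear_between_def by blast
    then show ?thesis using Qs[of z' "-1"] that by simp
  qed
  show "\<forall>\<^sub>F h in F. norm (nrm E ((1 / h) *\<^sub>R (T h (Q x) - Q x) - Q y)) \<le> c * nrm E ((1 / h) *\<^sub>R (T h x - x) - y)"
    using com
  proof (rule eventually_mono, elim conjE)
    fix h assume T: "T h x \<in> carr E" and "Q (T h x) = T h (Q x)"
    then have eq: "(1 / h) *\<^sub>R (T h (Q x) - Q x) - Q y = Q ((1 / h) *\<^sub>R (T h x - x) - y)"
      using Qd[OF T x] Qs[of "T h x - x" "1 / h"] Qd[of "(1 / h) *\<^sub>R (T h x - x)" y] x y by simp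
    have "(1 / h) *\<^sub>R (T h x - x) - y \<in> carr E" using T x y by simp
    then have "Q ((1 / h) *\<^sub>R (T h x - x) - y) \<in> carr E"
      "nrm E (Q ((1 / h) *\<^sub>R (T h x - x) - y)) \<le> c * nrm E ((1 / h) *\<^sub>R (T h x - x) - y)"
      using Q(2) by (auto simp: opbound_def)
    then show "norm (nrm E ((1 / h) *\<^sub>R (T h (Q x) - Q x) - Q y)) \<le> c * nrm E ((1 / h) *\<^sub>R (T h x - x) - y)"
      unfolding eq using nrm_nonneg by simp
  qed
qed

text \<open>
  A semigroup on \<open>E0\<close> that restricts to \<open>E1\<close>, where the norm of \<open>E1\<close> is controlled by that of
  \<open>S x\<close> in \<open>E0\<close>. The operator \<open>S\<close> commutes with the semigroup but need not be its generator; it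
  may be a translate of it.
\<close>

locale domain_semigroup = E0: normed_space_on sc E0 + E1: normed_space_on sc E1
  for sc :: "'k::real_normed_field \<Rightarrow> 'v::real_vector \<Rightarrow> 'v" and E0 E1 +
  fixes S :: "'v \<Rightarrow> 'v" and T :: "real \<Rightarrow> 'v \<Rightarrow> 'v" and M w :: real
  assumes sub: "carr E1 \<subseteq> carr E0"
    and C0: "C0_semigroup sc E0 T"
    and S_in: "\<And>x. x \<in> carr E1 \<Longrightarrow> S x \<in> carr E0"
    and S_diff: "\<And>x y. x \<in> carr E1 \<Longrightarrow> y \<in> carr E1 \<Longrightarrow> S (x - y) = S x - S y"
    and graph_norm: "\<exists>c>0. \<forall>x\<in>carr E1. nrm E1 x \<le> c * nrm E0 (S x)"
    and commute: "\<And>x t. x \<in> carr E1 \<Longrightarrow> t \<ge> 0 \<Longrightarrow> S (T t x) = T t (S x)"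
    and T_bound1: "\<And>t. t > 0 \<Longrightarrow> opbound E1 E1 (T t) (M * exp (w * t))"
begin

lemma T_linear: "t \<ge> 0 \<Longrightarrow> linear_between sc sc (carr E0) (carr E0) (T t)"
  using C0 by (simp add: C0_semigroup_def bounded_op_def)
lemma T_in: "t \<ge> 0 \<Longrightarrow> x \<in> carr E0 \<Longrightarrow> T t x \<in> carr E0"
  and T_add: "t \<ge> 0 \<Longrightarrow> x \<in> carr E0 \<Longrightarrow> y \<in> carr E0 \<Longrightarrow> T t (x + y) = T t x + T t y"
  and T_scale: "t \<ge> 0 \<Longrightarrow> x \<in> carr E0 \<Longrightarrow> T t (sc c x) = sc c (T t x)"
  using T_linear by (auto simp: linear_between_def)
lemma T_diff: "t \<ge> 0 \<Longrightarrow> x \<in> carr E0 \<Longrightarrow> y \<in> carr E0 \<Longrightarrow> T t (x - y) = T t x - T t y"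
  using T_add[of t x "- y"] T_scale[of t y "of_real (-1)"] E0.minus_in[of y] unfolding E0.scale_of_real by simp
lemma T_0: "x \<in> carr E0 \<Longrightarrow> T 0 x = x"
  and T_law: "s \<ge> 0 \<Longrightarrow> t \<ge> 0 \<Longrightarrow> x \<in> carr E0 \<Longrightarrow> T (s + t) x = T s (T t x)"
  and T_right: "x \<in> carr E0 \<Longrightarrow> ((\<lambda>h. nrm E0 (T h x - x)) \<longlongrightarrow> 0) (at_right 0)"
  using C0 by (auto simp: C0_semigroup_def)

lemma T_in1: "t \<ge> 0 \<Longrightarrow> x \<in> carr E1 \<Longrightarrow> T t x \<in> carr E1"
proof (cases "t = 0")
  case True
  then show "x \<in> carr E1 \<Longrightarrow> T t x \<in> carr E1" using T_0 sub by auto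
qed (use T_bound1[of t] in \<open>auto simp: opbound_def\<close>)

lemma T_bound1': "t \<ge> 0 \<Longrightarrow> x \<in> carr E1 \<Longrightarrow> nrm E1 (T t x) \<le> max 1 M * exp (w * t) * nrm E1 x"
proof (cases "t = 0")
  case True
  assume x: "x \<in> carr E1"
  have "1 * nrm E1 x \<le> max 1 M * nrm E1 x" by (rule mult_right_mono[OF _ E1.nrm_nonneg[OF x]]) simp
  then show ?thesis using True T_0 sub x by auto
next
  case False
  assume t: "t \<ge> 0" and x: "x \<in> carr E1"
  have "nrm E1 (T t x) \<le> M * exp (w * t) * nrm E1 x" using T_bound1[of t] t x False by (simp add: opbound_def)
  also have "\<dots> \<le> max 1 M * exp (w * t) * nrm E1 x" by (intro mult_right_mono E1.nrm_nonneg x) auto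
  finally show ?thesis .
qed

text \<open>
  Strong continuity in \<open>E1\<close>: the increment of an orbit is controlled in \<open>E1\<close> by that of the orbit
  of \<open>S x\<close> in \<open>E0\<close>.
\<close>

lemma orbit1:
  assumes x: "x \<in> carr E1"
  shows "continuous_path E1 {0..} (\<lambda>t. T t x)"
proof (rule E1.orbit_continuous[where M = "max 1 M" and w = w])
  obtain c where c: "c > 0" "\<And>x. x \<in> carr E1 \<Longrightarrow> nrm E1 x \<le> c * nrm E0 (S x)" using graph_norm by blast
  show "((\<lambda>h. nrm E1 (T h x - x)) \<longlongrightarrow> 0) (at_right 0)"
  proof (rule Lim_null_comparison)
    show "((\<lambda>h. c * nrm E0 (T h (S x) - S x)) \<longlongrightarrow> 0) (at_right 0)"
      using tendsto_mult_left[OF T_right[OF S_in[OF x]], of c] by simp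
    have "norm (nrm E1 (T h x - x)) \<le> c * nrm E0 (T h (S x) - S x)" if "h > 0" for h
    proof -
      have h: "T h x \<in> carr E1" using T_in1 that x by simp
      have "S (T h x - x) = T h (S x) - S x" using S_diff[OF h x] commute[OF x, of h] that by simp
      then show ?thesis using c(2)[OF E1.diff_in[OF h x]] E1.nrm_nonneg[OF E1.diff_in[OF h x]] by simp
    qed
    then show "\<forall>\<^sub>F h in at_right 0. norm (nrm E1 (T h x - x)) \<le> c * nrm E0 (T h (S x) - S x)"
      by (simp add: eventually_at_filter)
  qed
qed (use T_in1 T_bound1' T_diff[OF _ subsetD[OF sub] subsetD[OF sub]] T_law[OF _ _ subsetD[OF sub]] x in auto)

lemma smoothing_orbit:
  assumes x: "x \<in> carr E0" and smooth: "\<And>r. r > 0 \<Longrightarrow> T r x \<in> carr E1"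
  shows "continuous_path E1 {0<..} (\<lambda>t. T t x)"
proof (rule E1.continuous_path_Ioi)
  fix r :: real assume r: "r > 0"
  have "continuous_path E1 {r..} (\<lambda>t. T (t - r) (T r x))"
    by (rule E1.continuous_path_compose[OF orbit1[OF smooth[OF r]]]) (auto intro!: continuous_intros)
  moreover have "T t x = T (t - r) (T r x)" if "t \<in> {r..}" for t
    using T_law[of "t - r" r x] that r x by simp
  ultimately show "continuous_path E1 {r..} (\<lambda>t. T t x)"
    using E1.continuous_path_cong[of "{r..}" "\<lambda>t. T t x" "\<lambda>t. T (t - r) (T r x)"] by blast
qed

text \<open>The growth bound on \<open>E1\<close> is conjugated to one on \<open>E0\<close> by the isomorphism \<open>S\<close>.\<close>

lemma T_bound0:
  assumes surj: "\<And>z. z \<in> carr E0 \<Longrightarrow> \<exists>x\<in>carr E1. S x = z" and Sb: "\<exists>b>0. \<forall>x\<in>carr E1. nrm E0 (S x) \<le> b * nrm E1 x"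
  shows "\<exists>C>0. \<forall>t\<ge>0. \<forall>z\<in>carr E0. nrm E0 (T t z) \<le> C * exp (w * t) * nrm E0 z"
proof -
  obtain c where c: "c > 0" "\<And>x. x \<in> carr E1 \<Longrightarrow> nrm E1 x \<le> c * nrm E0 (S x)" using graph_norm by blast
  obtain b where b: "b > 0" "\<And>x. x \<in> carr E1 \<Longrightarrow> nrm E0 (S x) \<le> b * nrm E1 x" using Sb by blast
  have "nrm E0 (T t z) \<le> (b * max 1 M * c) * exp (w * t) * nrm E0 z" if t: "t \<ge> 0" and z: "z \<in> carr E0" for t z
  proof -
    obtain x where x: "x \<in> carr E1" "S x = z" using surj[OF z] by blast
    have "nrm E0 (T t z) = nrm E0 (S (T t x))" using commute[OF x(1) t] x(2) by simp
    also have "\<dots> \<le> b * nrm E1 (T t x)" by (rule b(2)[OF T_in1[OF t x(1)]])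
    also have "\<dots> \<le> b * (max 1 M * exp (w * t) * nrm E1 x)" using T_bound1'[OF t x(1)] b(1) by (intro mult_left_mono) auto
    also have "\<dots> \<le> b * (max 1 M * exp (w * t) * (c * nrm E0 z))" using c(2)[OF x(1)] x(2) b(1) by (intro mult_left_mono) auto
    finally show ?thesis by (simp add: mult_ac)
  qed
  moreover have "b * max 1 M * c > 0" using b(1) c(1) by (intro mult_pos_pos) auto
  ultimately show ?thesis by blast
qed

end

lemma generator_invariance:
  assumes E: "normed_space_on sc E" and gen: "generates_C0_semigroup sc E D A T"
    and x: "x \<in> D" and t: "t \<ge> 0"
  shows "T t x \<in> D" and "A (T t x) = T t (A x)"
proof -
  interpret normed_space_on sc E by fact
  have C0: "C0_semigroup sc E T" and D: "D \<subseteq> carr E" "A ` D \<subseteq> carr E"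
    and G: "\<And>x y. x \<in> carr E \<Longrightarrow> y \<in> carr E \<Longrightarrow>
        ((\<lambda>h. nrm E ((1 / h) *\<^sub>R (T h x - x) - y)) \<longlongrightarrow> 0) (at_right 0) \<longleftrightarrow> x \<in> D \<and> A x = y"
    using gen by (auto simp: generates_C0_semigroup_def)
  have xE: "x \<in> carr E" "A x \<in> carr E" using x D by auto
  have T: "linear_between sc sc (carr E) (carr E) (T s)" "\<exists>c. opbound E E (T s) c" if "s \<ge> 0" for s
    using C0 that by (auto simp: C0_semigroup_def bounded_op_def)
  have Tin: "T s y \<in> carr E" if "s \<ge> 0" "y \<in> carr E" for s y using T(1)[OF that(1)] that(2) by (simp add: linear_between_def)
  obtain c where c: "opbound E E (T t) c" using T(2)[OF t] by blast
  have "T t (T h x) = T h (T t x)" if "h \<ge> 0" for h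
  proof -
    have "T (t + h) x = T t (T h x)" "T (h + t) x = T h (T t x)"
      using C0 t that xE(1) unfolding C0_semigroup_def by blast+
    then show ?thesis by (simp add: add.commute)
  qed
  then have "\<forall>\<^sub>F h in at_right 0. T h x \<in> carr E \<and> T t (T h x) = T h (T t x)"
    using Tin xE by (auto simp: eventually_at_filter)
  then have "((\<lambda>h. nrm E ((1 / h) *\<^sub>R (T h (T t x) - T t x) - T t (A x))) \<longlongrightarrow> 0) (at_right 0)"
    using difference_quotient_commute[OF _ T(1)[OF t] c _ xE] G[OF xE] x by blast
  then show "T t x \<in> D" "A (T t x) = T t (A x)" using G Tin t xE by auto
qed

lemma group_generator_invariance:
  assumes E: "normed_space_on sc E" and gen: "generates_C0_group sc E D A T" and x: "x \<in> D"
  shows "T t x \<in> D" and "A (T t x) = T t (A x)"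
proof -
  interpret normed_space_on sc E by fact
  have C0: "C0_group sc E T" and D: "D \<subseteq> carr E" "A ` D \<subseteq> carr E"
    and G: "\<And>x y. x \<in> carr E \<Longrightarrow> y \<in> carr E \<Longrightarrow>
        ((\<lambda>h. nrm E ((1 / h) *\<^sub>R (T h x - x) - y)) \<longlongrightarrow> 0) (at 0) \<longleftrightarrow> x \<in> D \<and> A x = y"
    using gen by (auto simp: generates_C0_group_def)
  have xE: "x \<in> carr E" "A x \<in> carr E" using x D by auto
  have T: "linear_between sc sc (carr E) (carr E) (T s)" "\<exists>c. opbound E E (T s) c" for s
    using C0 by (auto simp: C0_group_def bounded_op_def)
  have Tin: "T s y \<in> carr E" if "y \<in> carr E" for s y using T(1)[of s] that by (simp add: linear_between_def)
  obtain c where c: "opbound E E (T t) c" using T(2) by blast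
  have "T t (T h x) = T h (T t x)" for h
  proof -
    have "T (t + h) x = T t (T h x)" "T (h + t) x = T h (T t x)"
      using C0 xE(1) unfolding C0_group_def by blast+
    then show ?thesis by (simp add: add.commute)
  qed
  then have "\<forall>\<^sub>F h in at 0. T h x \<in> carr E \<and> T t (T h x) = T h (T t x)"
    using Tin xE by (auto intro!: always_eventually)
  then have "((\<lambda>h. nrm E ((1 / h) *\<^sub>R (T h (T t x) - T t x) - T t (A x))) \<longlongrightarrow> 0) (at 0)"
    using difference_quotient_commute[OF _ T(1) c _ xE] G[OF xE] x by blast
  then show "T t x \<in> D" "A (T t x) = T t (A x)" using G Tin xE by auto
qed

lemma backward_semigroup:
  assumes "C0_group sc E G"
  shows "C0_semigroup sc E (\<lambda>t. G (- t))"
proof -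
  have "((\<lambda>t. nrm E (G (- t) x - x)) \<longlongrightarrow> 0) (at_right 0)" if "x \<in> carr E" for x
  proof -
    have "((\<lambda>t. nrm E (G t x - x)) \<longlongrightarrow> 0) (at 0)" using assms that by (simp add: C0_group_def)
    moreover have "filterlim uminus (at 0) (at_right (0::real))"
      by (simp add: filterlim_at eventually_at_filter) (auto intro!: tendsto_eq_intros)
    ultimately show ?thesis by (rule filterlim_compose)
  qed
  moreover have "G (- s - t) x = G (- s) (G (- t) x)" if "x \<in> carr E" for s t x
  proof -
    have "G (- s + - t) x = G (- s) (G (- t) x)" using assms that unfolding C0_group_def by blast
    then show ?thesis by simp
  qed
  ultimately show ?thesis using assms unfolding C0_group_def C0_semigroup_def by simp
qed

section \<open>Operators that commute with the generator\<close>

text \<open>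
  A semigroup of growth \<open>C * exp (w * t)\<close> on \<open>E0\<close> with generator \<open>A\<close>, which is bounded from the
  domain \<open>E1\<close> to \<open>E0\<close> and densely defined.
\<close>

locale generated_semigroup = E0: normed_space_on sc E0 + E1: normed_space_on sc E1
  for sc :: "'k::real_normed_field \<Rightarrow> 'v::real_vector \<Rightarrow> 'v" and E0 E1 +
  fixes A :: "'v \<Rightarrow> 'v" and T :: "real \<Rightarrow> 'v \<Rightarrow> 'v" and C w a :: real
  assumes sub: "carr E1 \<subseteq> carr E0" and gen: "generates_C0_semigroup sc E0 (carr E1) A T"
    and A_diff: "\<And>x y. x \<in> carr E1 \<Longrightarrow> y \<in> carr E1 \<Longrightarrow> A (x - y) = A x - A y"
    and A_bound: "\<And>x. x \<in> carr E1 \<Longrightarrow> nrm E0 (A x) \<le> a * nrm E1 x" and a: "a \<ge> 0"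
    and T_bound: "\<And>t z. t \<ge> 0 \<Longrightarrow> z \<in> carr E0 \<Longrightarrow> nrm E0 (T t z) \<le> C * exp (w * t) * nrm E0 z" and C: "C > 0"
    and orbit: "\<And>x. x \<in> carr E1 \<Longrightarrow> continuous_path E1 {0..} (\<lambda>t. T t x)"
    and dense: "\<And>x e. x \<in> carr E0 \<Longrightarrow> e > 0 \<Longrightarrow> \<exists>y\<in>carr E1. nrm E0 (x - y) < e"
begin

lemma C0: "C0_semigroup sc E0 T" and A_in: "x \<in> carr E1 \<Longrightarrow> A x \<in> carr E0"
  using gen by (auto simp: generates_C0_semigroup_def)

lemma T_linear: "t \<ge> 0 \<Longrightarrow> linear_between sc sc (carr E0) (carr E0) (T t)"
  using C0 by (simp add: C0_semigroup_def bounded_op_def)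
lemma T_in: "t \<ge> 0 \<Longrightarrow> x \<in> carr E0 \<Longrightarrow> T t x \<in> carr E0"
  and T_add: "t \<ge> 0 \<Longrightarrow> x \<in> carr E0 \<Longrightarrow> y \<in> carr E0 \<Longrightarrow> T t (x + y) = T t x + T t y"
  and T_scale: "t \<ge> 0 \<Longrightarrow> x \<in> carr E0 \<Longrightarrow> T t (sc c x) = sc c (T t x)"
  using T_linear by (auto simp: linear_between_def)
lemma T_diff: "t \<ge> 0 \<Longrightarrow> x \<in> carr E0 \<Longrightarrow> y \<in> carr E0 \<Longrightarrow> T t (x - y) = T t x - T t y"
  using T_add[of t x "- y"] T_scale[of t y "of_real (-1)"] E0.minus_in[of y] unfolding E0.scale_of_real by simp
lemma T_0: "x \<in> carr E0 \<Longrightarrow> T 0 x = x"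
  and T_law: "s \<ge> 0 \<Longrightarrow> t \<ge> 0 \<Longrightarrow> x \<in> carr E0 \<Longrightarrow> T (s + t) x = T s (T t x)"
  using C0 by (auto simp: C0_semigroup_def)

lemma T_in1: "t \<ge> 0 \<Longrightarrow> x \<in> carr E1 \<Longrightarrow> T t x \<in> carr E1"
  and A_T: "t \<ge> 0 \<Longrightarrow> x \<in> carr E1 \<Longrightarrow> A (T t x) = T t (A x)"
  using generator_invariance[OF E0.normed_space_on_axioms gen] by auto

lemma T_bound_on:
  assumes "0 \<le> t" "t \<le> \<tau>" "z \<in> carr E0"
  shows "nrm E0 (T t z) \<le> C * exp (\<bar>w\<bar> * \<tau>) * nrm E0 z"
proof -
  have "w * t \<le> \<bar>w\<bar> * \<tau>"
    using assms(1,2) by (metis abs_ge_self abs_mult abs_of_nonneg abs_ge_zero mult_left_mono order_trans)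
  then have "C * exp (w * t) * nrm E0 z \<le> C * exp (\<bar>w\<bar> * \<tau>) * nrm E0 z"
    using C E0.nrm_nonneg[OF assms(3)] by (intro mult_right_mono mult_left_mono) auto
  then show ?thesis using T_bound[OF assms(1,3)] by simp
qed

lemma first_order:
  assumes x: "x \<in> carr E1" and e: "e > 0"
  obtains d where "d > 0" "\<And>h. 0 \<le> h \<Longrightarrow> h < d \<Longrightarrow> nrm E0 (T h x - x - h *\<^sub>R A x) \<le> e * h"
proof -
  have xE: "x \<in> carr E0" "A x \<in> carr E0" using x sub A_in by auto
  have "((\<lambda>h. nrm E0 ((1 / h) *\<^sub>R (T h x - x) - A x)) \<longlongrightarrow> 0) (at_right 0)"
    using gen x xE unfolding generates_C0_semigroup_def by blast
  then have "\<forall>\<^sub>F h in at_right 0. \<bar>nrm E0 ((1 / h) *\<^sub>R (T h x - x) - A x)\<bar> < e"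
    using tendstoD[OF _ e] by (fastforce simp: dist_real_def)
  then obtain d where d: "d > 0" "\<And>h. 0 < h \<Longrightarrow> h < d \<Longrightarrow> nrm E0 ((1 / h) *\<^sub>R (T h x - x) - A x) < e"
    unfolding eventually_at_right_field by (metis abs_less_iff)
  show thesis
  proof (rule that[OF d(1)])
    fix h :: real assume h: "0 \<le> h" "h < d"
    show "nrm E0 (T h x - x - h *\<^sub>R A x) \<le> e * h"
    proof (cases "h = 0")
      case True
      then show ?thesis using T_0 xE by simp
    next
      case False
      then have h0: "h > 0" using h by simp
      have in0: "(1 / h) *\<^sub>R (T h x - x) - A x \<in> carr E0" using T_in[of h x] h xE by simp
      have "T h x - x - h *\<^sub>R A x = h *\<^sub>R ((1 / h) *\<^sub>R (T h x - x) - A x)" using h0 by (simp add: scaleR_diff_right)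
      then have "nrm E0 (T h x - x - h *\<^sub>R A x) = h * nrm E0 ((1 / h) *\<^sub>R (T h x - x) - A x)"
        using E0.nrm_scaleR[OF in0, of h] h0 by simp
      also have "\<dots> \<le> h * e" using d(2)[OF h0 h(2)] h0 by (intro mult_left_mono) auto
      finally show ?thesis by (simp add: mult.commute)
    qed
  qed
qed

text \<open>
  Orbits starting in the domain are Lipschitz. Near each time the bound follows from
  \<open>first_order\<close>, with the error \<open>nrm E1 u * h\<close>, which explains the constant \<open>a + 1\<close>; Bolzano's
  lemma adds up the increments.
\<close>

lemma orbit_Lipschitz:
  assumes u: "u \<in> carr E1" and h: "0 \<le> h" "h \<le> \<tau>"
  shows "nrm E0 (T h u - u) \<le> C * exp (\<bar>w\<bar> * \<tau>) * (a + 1) * nrm E1 u * h"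
proof (cases "u = 0")
  case True
  have "T h 0 = 0" using T_diff[OF h(1), of 0 0] by simp
  then show ?thesis using True by simp
next
  case False
  define K where "K = C * exp (\<bar>w\<bar> * \<tau>)"
  have K: "K > 0" using C by (simp add: K_def)
  have uE: "u \<in> carr E0" "A u \<in> carr E0" using u sub A_in by auto
  have nu: "nrm E1 u > 0" using E1.nrm_nonneg[OF u] E1.nrm_eq_0[OF u] False by simp
  obtain d where d: "d > 0" "\<And>h. 0 \<le> h \<Longrightarrow> h < d \<Longrightarrow> nrm E0 (T h u - u - h *\<^sub>R A u) \<le> nrm E1 u * h"
    using first_order[OF u nu] by metis
  have small: "nrm E0 (T k u - u) \<le> (a + 1) * nrm E1 u * k" if k: "0 \<le> k" "k < d" for k
  proof -
    have "T k u - u = (T k u - u - k *\<^sub>R A u) + k *\<^sub>R A u" by simp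
    then have "nrm E0 (T k u - u) \<le> nrm E0 (T k u - u - k *\<^sub>R A u) + nrm E0 (k *\<^sub>R A u)"
      using E0.nrm_triangle[of "T k u - u - k *\<^sub>R A u" "k *\<^sub>R A u"] T_in[OF k(1) uE(1)] uE by simp
    also have "nrm E0 (k *\<^sub>R A u) = k * nrm E0 (A u)" using uE k by (simp add: E0.nrm_scaleR)
    also have "k * nrm E0 (A u) \<le> k * (a * nrm E1 u)" using A_bound[OF u] k by (intro mult_left_mono) auto
    finally show ?thesis using d(2)[OF k] by (simp add: algebra_simps)
  qed
  define R where "R \<alpha> \<beta> \<longleftrightarrow> (0 \<le> \<alpha> \<and> \<beta> \<le> \<tau> \<longrightarrow> nrm E0 (T \<beta> u - T \<alpha> u) \<le> K * (a + 1) * nrm E1 u * (\<beta> - \<alpha>))" for \<alpha> \<beta>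
  have "R 0 h"
  proof (rule Bolzano)
    show "R \<alpha> \<gamma>" if "R \<alpha> \<beta>" "R \<beta> \<gamma>" "\<alpha> \<le> \<beta>" "\<beta> \<le> \<gamma>" for \<alpha> \<beta> \<gamma>
      unfolding R_def
    proof
      assume r: "0 \<le> \<alpha> \<and> \<gamma> \<le> \<tau>"
      have "nrm E0 (T \<gamma> u - T \<alpha> u) \<le> nrm E0 (T \<gamma> u - T \<beta> u) + nrm E0 (T \<beta> u - T \<alpha> u)"
        by (rule E0.nrm_triangle_mid) (use T_in uE r that in auto)
      also have "\<dots> \<le> K * (a + 1) * nrm E1 u * (\<gamma> - \<beta>) + K * (a + 1) * nrm E1 u * (\<beta> - \<alpha>)"
        using that r by (intro add_mono) (auto simp: R_def)
      also have "\<dots> = K * (a + 1) * nrm E1 u * (\<gamma> - \<alpha>)" by (simp add: right_diff_distrib)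
      finally show "nrm E0 (T \<gamma> u - T \<alpha> u) \<le> K * (a + 1) * nrm E1 u * (\<gamma> - \<alpha>)" .
    qed
    fix x :: real
    have "R \<alpha> \<beta>" if ab: "\<alpha> \<le> x \<and> x \<le> \<beta> \<and> \<beta> - \<alpha> < d" for \<alpha> \<beta>
      unfolding R_def
    proof
      assume r: "0 \<le> \<alpha> \<and> \<beta> \<le> \<tau>"
      have k: "0 \<le> \<beta> - \<alpha>" "\<beta> - \<alpha> < d" using ab by auto
      have "T \<beta> u - T \<alpha> u = T \<alpha> (T (\<beta> - \<alpha>) u - u)"
        using T_law[of \<alpha> "\<beta> - \<alpha>" u] T_diff[of \<alpha> "T (\<beta> - \<alpha>) u" u] T_in[OF k(1) uE(1)] uE k r by simp
      also have "nrm E0 \<dots> \<le> K * nrm E0 (T (\<beta> - \<alpha>) u - u)"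
        unfolding K_def using r ab T_in[OF k(1) uE(1)] uE by (intro T_bound_on) auto
      also have "\<dots> \<le> K * ((a + 1) * nrm E1 u * (\<beta> - \<alpha>))"
        using small[OF k] K by (intro mult_left_mono) auto
      finally show "nrm E0 (T \<beta> u - T \<alpha> u) \<le> K * (a + 1) * nrm E1 u * (\<beta> - \<alpha>)" by (simp add: mult.assoc)
    qed
    then show "\<exists>d>0. \<forall>\<alpha> \<beta>. \<alpha> \<le> x \<and> x \<le> \<beta> \<and> \<beta> - \<alpha> < d \<longrightarrow> R \<alpha> \<beta>" using d(1) by blast
  qed (rule h)
  then show ?thesis using h T_0 uE by (simp add: R_def K_def)
qed

text \<open>The first order error at \<open>u\<close> in terms of the one at \<open>v\<close>, uniformly in \<open>h\<close>.\<close>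

lemma first_order_uniform:
  assumes u: "u \<in> carr E1" and v: "v \<in> carr E1" and h: "0 \<le> h" "h \<le> \<tau>"
  shows "nrm E0 (T h u - u - h *\<^sub>R A u) \<le> nrm E0 (T h v - v - h *\<^sub>R A v)
      + (C * exp (\<bar>w\<bar> * \<tau>) + 1) * (a + 1) * nrm E1 (u - v) * h"
proof -
  have in0: "u \<in> carr E0" "v \<in> carr E0" "A u \<in> carr E0" "A v \<in> carr E0" "T h u \<in> carr E0" "T h v \<in> carr E0"
    using u v sub A_in T_in h by auto
  have uv: "u - v \<in> carr E1" using u v by simp
  have n: "0 \<le> nrm E1 (u - v)" using uv by (rule E1.nrm_nonneg)
  have uv0: "T h (u - v) - (u - v) \<in> carr E0" "h *\<^sub>R A (u - v) \<in> carr E0" "T h v - v - h *\<^sub>R A v \<in> carr E0"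
    using in0 uv sub A_in[OF uv] T_diff[OF h(1) in0(1,2)] by auto
  have eq: "T h u - u - h *\<^sub>R A u = (T h v - v - h *\<^sub>R A v) + ((T h (u - v) - (u - v)) - h *\<^sub>R A (u - v))"
    using T_diff[OF h(1) in0(1,2)] A_diff[OF u v] by (simp add: scaleR_diff_right)
  have "nrm E0 (T h u - u - h *\<^sub>R A u) \<le> nrm E0 (T h v - v - h *\<^sub>R A v)
      + (nrm E0 (T h (u - v) - (u - v)) + nrm E0 (h *\<^sub>R A (u - v)))"
    unfolding eq using E0.nrm_triangle[OF uv0(3) E0.diff_in[OF uv0(1,2)]] E0.nrm_triangle_diff[OF uv0(1,2)] by linarith
  also have "nrm E0 (h *\<^sub>R A (u - v)) \<le> (a + 1) * nrm E1 (u - v) * h"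
  proof -
    have "nrm E0 (h *\<^sub>R A (u - v)) = h * nrm E0 (A (u - v))" using E0.nrm_scaleR[OF A_in[OF uv], of h] h by simp
    also have "\<dots> \<le> h * (a * nrm E1 (u - v))" using A_bound[OF uv] h by (intro mult_left_mono) auto
    also have "\<dots> \<le> h * ((a + 1) * nrm E1 (u - v))" using h n by (intro mult_left_mono mult_right_mono) auto
    finally show ?thesis by (simp add: mult_ac)
  qed
  finally show ?thesis using orbit_Lipschitz[OF uv h] by (simp add: algebra_simps)
qed

text \<open>
  An operator that is bounded on \<open>E0\<close> and on the domain \<open>E1\<close>, and commutes with the generator,
  commutes with the semigroup. For \<open>y\<close> in the domain the path \<open>z s = T (t - s) (P (T s y))\<close> joins
  \<open>T t (P y)\<close> to \<open>P (T t y)\<close>, and its derivative vanishes. This is expressed by increments: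
  \<open>nrm E0 (z \<beta> - z \<alpha>) \<le> e * (\<beta> - \<alpha>)\<close> holds for short intervals, hence for \<open>[0, t]\<close>, for each
  \<open>e > 0\<close>. Density of the domain extends the result to \<open>E0\<close>.
\<close>

theorem commuting_operator:
  assumes P: "linear_between sc sc (carr E0) (carr E0) P" "opbound E0 E0 P p" "p \<ge> 0"
    and P1: "opbound E1 E1 P p1" "p1 \<ge> 0" and PA: "\<And>x. x \<in> carr E1 \<Longrightarrow> A (P x) = P (A x)"
    and t: "t \<ge> 0" and y: "y \<in> carr E0"
  shows "T t (P y) = P (T t y)"
proof -
  have Pin: "P x \<in> carr E0" "nrm E0 (P x) \<le> p * nrm E0 x" if "x \<in> carr E0" for x
    using P(2) that by (auto simp: opbound_def)
  have Pin1: "P x \<in> carr E1" "nrm E1 (P x) \<le> p1 * nrm E1 x" if "x \<in> carr E1" for x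
    using P1(1) that by (auto simp: opbound_def)
  have Pscale: "P (r *\<^sub>R x) = r *\<^sub>R P x" if "x \<in> carr E0" for r x
    using P(1) that unfolding linear_between_def by (metis E0.scale_of_real)
  have Pdiff: "P (x - z) = P x - P z" if "x \<in> carr E0" "z \<in> carr E0" for x z
  proof -
    have "P (x + (-1) *\<^sub>R z) = P x + P ((-1) *\<^sub>R z)"
      using P(1) that E0.scaleR_in[of z "-1"] unfolding linear_between_def by blast
    then show ?thesis using Pscale[of z "-1"] that by simp
  qed
  define K where "K = C * exp (\<bar>w\<bar> * t)"
  have K: "K > 0" using C by (simp add: K_def)
  have TK: "nrm E0 (T s z) \<le> K * nrm E0 z" if "0 \<le> s" "s \<le> t" "z \<in> carr E0" for s z
    unfolding K_def by (rule T_bound_on[OF that])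
  have domain: "T t (P y) = P (T t y)" if y: "y \<in> carr E1" for y
  proof -
    have yE: "y \<in> carr E0" "A y \<in> carr E0" using y sub A_in by auto
    define q where "q s = P (T s y)" for s
    have q: "q s \<in> carr E1" "q s \<in> carr E0" "A (q s) = P (T s (A y))" if "s \<ge> 0" for s
      using Pin1(1)[OF T_in1[OF that y]] sub PA[OF T_in1[OF that y]] A_T[OF that y] by (auto simp: q_def)
    define z where "z s = T (t - s) (q s)" for s
    have zin: "z s \<in> carr E0" if "0 \<le> s" "s \<le> t" for s using T_in[of "t - s"] q that by (simp add: z_def)
    \<comment> \<open>the increment of \<open>z\<close> consists of the first order errors at \<open>y\<close> and at \<open>q \<alpha>\<close>; the first order terms cancel by \<open>PA\<close>\<close>
    have increment: "nrm E0 (z \<beta> - z \<alpha>) \<le> K * (p * K * nrm E0 (T h y - y - h *\<^sub>R A y) + nrm E0 (T h (q \<alpha>) - q \<alpha> - h *\<^sub>R A (q \<alpha>)))"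
      if ab: "0 \<le> \<alpha>" "\<alpha> \<le> \<beta>" "\<beta> \<le> t" and h: "h = \<beta> - \<alpha>" for \<alpha> \<beta> h
    proof -
      have h0: "h \<ge> 0" using ab h by simp
      have r1: "T h y - y - h *\<^sub>R A y \<in> carr E0" using T_in h0 yE by simp
      have Tr1: "T \<alpha> (T h y - y - h *\<^sub>R A y) \<in> carr E0" using T_in ab r1 by simp
      have r2: "T h (q \<alpha>) - q \<alpha> - h *\<^sub>R A (q \<alpha>) \<in> carr E0" using T_in[OF h0 q(2)[OF ab(1)]] q(2)[OF ab(1)] A_in[OF q(1)[OF ab(1)]] by simp
      have Tay: "T \<alpha> y \<in> carr E0" "T \<alpha> (A y) \<in> carr E0" "T \<beta> y \<in> carr E0" using T_in ab yE by auto
      have Ts: "T \<alpha> (h *\<^sub>R A y) = h *\<^sub>R T \<alpha> (A y)"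
        using T_scale[OF ab(1) yE(2), of "of_real h"] unfolding E0.scale_of_real .
      have "T \<alpha> (T h y - y - h *\<^sub>R A y) = T \<beta> y - T \<alpha> y - h *\<^sub>R T \<alpha> (A y)"
        using T_diff[OF ab(1), of "T h y - y" "h *\<^sub>R A y"] T_diff[OF ab(1), of "T h y" y] T_in[OF h0 yE(1)] yE
          Ts T_law[OF ab(1) h0 yE(1)] h by simp
      then have "P (T \<alpha> (T h y - y - h *\<^sub>R A y)) = q \<beta> - q \<alpha> - h *\<^sub>R A (q \<alpha>)"
        using Pdiff[of "T \<beta> y - T \<alpha> y" "h *\<^sub>R T \<alpha> (A y)"] Pdiff[of "T \<beta> y" "T \<alpha> y"] Pscale[OF Tay(2), of h] Tay q(3)[OF ab(1)]
        by (simp add: q_def)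
      then have d: "q \<beta> - T h (q \<alpha>) = P (T \<alpha> (T h y - y - h *\<^sub>R A y)) - (T h (q \<alpha>) - q \<alpha> - h *\<^sub>R A (q \<alpha>))" by simp
      have Thq: "T h (q \<alpha>) \<in> carr E0" using T_in[OF h0] q[OF ab(1)] by simp
      have "z \<beta> - z \<alpha> = T (t - \<beta>) (q \<beta> - T h (q \<alpha>))"
        using T_law[of "t - \<beta>" h "q \<alpha>"] T_diff[of "t - \<beta>" "q \<beta>" "T h (q \<alpha>)"] q ab h h0 Thq by (simp add: z_def)
      also have "nrm E0 \<dots> \<le> K * nrm E0 (q \<beta> - T h (q \<alpha>))"
        by (rule TK) (use ab q Thq in auto)
      also have "\<dots> \<le> K * (p * K * nrm E0 (T h y - y - h *\<^sub>R A y) + nrm E0 (T h (q \<alpha>) - q \<alpha> - h *\<^sub>R A (q \<alpha>)))"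
      proof (rule mult_left_mono)
        have "nrm E0 (q \<beta> - T h (q \<alpha>)) \<le> nrm E0 (P (T \<alpha> (T h y - y - h *\<^sub>R A y))) + nrm E0 (T h (q \<alpha>) - q \<alpha> - h *\<^sub>R A (q \<alpha>))"
          unfolding d by (rule E0.nrm_triangle_diff[OF Pin(1)[OF Tr1] r2])
        also have "nrm E0 (P (T \<alpha> (T h y - y - h *\<^sub>R A y))) \<le> p * nrm E0 (T \<alpha> (T h y - y - h *\<^sub>R A y))"
          by (rule Pin(2)[OF Tr1])
        also have "\<dots> \<le> p * (K * nrm E0 (T h y - y - h *\<^sub>R A y))"
          using TK[of \<alpha> "T h y - y - h *\<^sub>R A y"] ab r1 P(3) by (intro mult_left_mono) auto
        finally show "nrm E0 (q \<beta> - T h (q \<alpha>)) \<le> p * K * nrm E0 (T h y - y - h *\<^sub>R A y) + nrm E0 (T h (q \<alpha>) - q \<alpha> - h *\<^sub>R A (q \<alpha>))"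
          by (simp add: mult.assoc)
      qed (use K in simp)
      finally show ?thesis .
    qed
    have "nrm E0 (z t - z 0) \<le> e * t" if e: "e > 0" for e
    proof -
      define R where "R \<alpha> \<beta> \<longleftrightarrow> (0 \<le> \<alpha> \<and> \<beta> \<le> t \<longrightarrow> nrm E0 (z \<beta> - z \<alpha>) \<le> e * (\<beta> - \<alpha>))" for \<alpha> \<beta>
      define L where "L = (K + 1) * (a + 1) * p1 + 1"
      have L: "L > 0" using K a P1(2) by (simp add: L_def add_nonneg_pos)
      define N where "N = K * (p * K + 1 + L)"
      define e' where "e' = e / N"
      have den: "N > 0" unfolding N_def using K P(3) L by (intro mult_pos_pos add_nonneg_pos add_nonneg_nonneg) auto
      have e': "e' > 0" "K * (p * K * e' + e' + L * e') = e"
      proof -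
        show "e' > 0" unfolding e'_def using e den by simp
        have "K * (p * K * e' + e' + L * e') = N * e'" by (simp add: N_def algebra_simps)
        also have "\<dots> = e" using den by (simp add: e'_def)
        finally show "K * (p * K * e' + e' + L * e') = e" .
      qed
      obtain d1 where d1: "d1 > 0" "\<And>h. 0 \<le> h \<Longrightarrow> h < d1 \<Longrightarrow> nrm E0 (T h y - y - h *\<^sub>R A y) \<le> e' * h"
        using first_order[OF y e'(1)] by metis
      have "R 0 t"
      proof (rule Bolzano[OF t])
        show "R \<alpha> \<gamma>" if "R \<alpha> \<beta>" "R \<beta> \<gamma>" "\<alpha> \<le> \<beta>" "\<beta> \<le> \<gamma>" for \<alpha> \<beta> \<gamma>
          unfolding R_def
        proof
          assume r: "0 \<le> \<alpha> \<and> \<gamma> \<le> t"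
          have "nrm E0 (z \<gamma> - z \<alpha>) \<le> nrm E0 (z \<gamma> - z \<beta>) + nrm E0 (z \<beta> - z \<alpha>)"
            by (rule E0.nrm_triangle_mid) (use zin r that in auto)
          also have "\<dots> \<le> e * (\<gamma> - \<beta>) + e * (\<beta> - \<alpha>)" using that r by (intro add_mono) (auto simp: R_def)
          finally show "nrm E0 (z \<gamma> - z \<alpha>) \<le> e * (\<gamma> - \<alpha>)" by (simp add: right_diff_distrib)
        qed
        fix x :: real assume x: "0 \<le> x" "x \<le> t"
        obtain d2 where d2: "d2 > 0" "\<And>h. 0 \<le> h \<Longrightarrow> h < d2 \<Longrightarrow> nrm E0 (T h (q x) - q x - h *\<^sub>R A (q x)) \<le> e' * h"
          using first_order[OF q(1)[OF x(1)] e'(1)] by metis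
        obtain d3 where d3: "d3 > 0" "\<And>r. r \<in> {0..} \<Longrightarrow> \<bar>r - x\<bar> < d3 \<Longrightarrow> nrm E1 (T r y - T x y) < e'"
          using E1.continuous_path_eps[OF orbit[OF y] _ e'(1), of x] x by auto
        have "R \<alpha> \<beta>" if ab: "\<alpha> \<le> x \<and> x \<le> \<beta> \<and> \<beta> - \<alpha> < min d1 (min d2 d3)" for \<alpha> \<beta>
          unfolding R_def
        proof
          assume r: "0 \<le> \<alpha> \<and> \<beta> \<le> t"
          define h where "h = \<beta> - \<alpha>"
          have h: "0 \<le> h" "h < d1" "h < d2" "h \<le> t" using ab r by (auto simp: h_def)
          have a0: "0 \<le> \<alpha>" "\<alpha> \<le> \<beta>" "\<beta> \<le> t" using ab r by auto
          \<comment> \<open>the first order error at \<open>q \<alpha>\<close> is compared with the one at the fixed vector \<open>q x\<close>, as \<open>d2\<close> must not depend on \<open>\<alpha>\<close>\<close>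
          have near: "nrm E1 (q \<alpha> - q x) \<le> p1 * e'"
          proof -
            have in1: "T \<alpha> y \<in> carr E1" "T x y \<in> carr E1" using T_in1 y a0 x by auto
            have "q \<alpha> - q x = P (T \<alpha> y - T x y)" using Pdiff[OF subsetD[OF sub in1(1)] subsetD[OF sub in1(2)]] by (simp add: q_def)
            then have "nrm E1 (q \<alpha> - q x) \<le> p1 * nrm E1 (T \<alpha> y - T x y)" using Pin1(2) in1 by simp
            also have "\<dots> \<le> p1 * e'" using d3(2)[of \<alpha>] a0 ab P1(2) by (intro mult_left_mono) auto
            finally show ?thesis .
          qed
          have "nrm E0 (T h (q \<alpha>) - q \<alpha> - h *\<^sub>R A (q \<alpha>)) \<le> nrm E0 (T h (q x) - q x - h *\<^sub>R A (q x))
              + (K + 1) * (a + 1) * nrm E1 (q \<alpha> - q x) * h"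
            unfolding K_def by (rule first_order_uniform[OF q(1)[OF a0(1)] q(1)[OF x(1)] h(1,4)])
          also have "\<dots> \<le> e' * h + (K + 1) * (a + 1) * (p1 * e') * h"
            using d2(2)[OF h(1,3)] near K a h(1) by (intro add_mono mult_right_mono mult_left_mono) auto
          also have "\<dots> \<le> e' * h + L * e' * h"
          proof -
            have "(K + 1) * (a + 1) * (p1 * e') \<le> L * e'" using e'(1) by (simp add: L_def algebra_simps)
            then show ?thesis using h(1) by (intro add_left_mono mult_right_mono) auto
          qed
          finally have 2: "nrm E0 (T h (q \<alpha>) - q \<alpha> - h *\<^sub>R A (q \<alpha>)) \<le> e' * h + L * e' * h" .
          have "nrm E0 (z \<beta> - z \<alpha>) \<le> K * (p * K * nrm E0 (T h y - y - h *\<^sub>R A y) + nrm E0 (T h (q \<alpha>) - q \<alpha> - h *\<^sub>R A (q \<alpha>)))"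
            by (rule increment[OF a0 h_def])
          also have "\<dots> \<le> K * (p * K * (e' * h) + (e' * h + L * e' * h))"
            using d1(2)[OF h(1,2)] 2 K P(3) by (intro mult_left_mono add_mono) auto
          also have "\<dots> = K * (p * K * e' + e' + L * e') * h" by (simp add: algebra_simps)
          finally show "nrm E0 (z \<beta> - z \<alpha>) \<le> e * (\<beta> - \<alpha>)" unfolding e'(2) h_def .
        qed
        moreover have "min d1 (min d2 d3) > 0" using d1 d2 d3 by simp
        ultimately show "\<exists>d>0. \<forall>\<alpha> \<beta>. \<alpha> \<le> x \<and> x \<le> \<beta> \<and> \<beta> - \<alpha> < d \<longrightarrow> R \<alpha> \<beta>" by blast
      qed
      then show ?thesis using t by (simp add: R_def)
    qed
    then have "nrm E0 (z t - z 0) \<le> 0 + e" if "e > 0" for e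
    proof -
      have "e / (t + 1) * t \<le> e" using that t by (simp add: field_simps)
      moreover have "e / (t + 1) > 0" using that t by simp
      ultimately show ?thesis using \<open>\<And>e. e > 0 \<Longrightarrow> nrm E0 (z t - z 0) \<le> e * t\<close> by fastforce
    qed
    then have "nrm E0 (z t - z 0) \<le> 0" by (rule field_le_epsilon)
    then have "z t = z 0"
      using E0.nrm_nonneg[of "z t - z 0"] E0.nrm_eq_0[of "z t - z 0"] zin[of t] zin[of 0] t by simp
    then show ?thesis using T_0 q(2)[OF t] yE by (simp add: z_def q_def)
  qed
  have Ty: "T t (P y) - P (T t y) \<in> carr E0" using T_in[OF t] Pin y by simp
  have "nrm E0 (T t (P y) - P (T t y)) \<le> 0 + e" if e: "e > 0" for e
  proof -
    have c: "2 * K * p + 1 > 0" using K P(3) by (simp add: add_nonneg_pos)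
    then have "e / (2 * K * p + 1) > 0" using e by simp
    from dense[OF y this] obtain x where x: "x \<in> carr E1" "nrm E0 (y - x) < e / (2 * K * p + 1)" by blast
    have xE: "x \<in> carr E0" "y - x \<in> carr E0" using x sub y by auto
    have "T t (P y) - P (T t y) = T t (P (y - x)) - P (T t (y - x))"
      using domain[OF x(1)] Pdiff[OF y xE(1)] T_diff[OF t y xE(1)] T_diff[OF t Pin(1)[OF y] Pin(1)[OF xE(1)]]
        Pdiff[OF T_in[OF t y] T_in[OF t xE(1)]] by simp
    also have "nrm E0 \<dots> \<le> nrm E0 (T t (P (y - x))) + nrm E0 (P (T t (y - x)))"
      by (rule E0.nrm_triangle_diff) (use T_in[OF t] Pin xE in auto)
    also have "\<dots> \<le> K * (p * nrm E0 (y - x)) + p * (K * nrm E0 (y - x))"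
    proof (rule add_mono)
      show "nrm E0 (T t (P (y - x))) \<le> K * (p * nrm E0 (y - x))"
        using TK[OF t order_refl Pin(1)[OF xE(2)]] mult_left_mono[OF Pin(2)[OF xE(2)] less_imp_le[OF K]] by simp
      show "nrm E0 (P (T t (y - x))) \<le> p * (K * nrm E0 (y - x))"
        using Pin(2)[OF T_in[OF t xE(2)]] mult_left_mono[OF TK[OF t order_refl xE(2)] P(3)] by simp
    qed
    also have "\<dots> \<le> (2 * K * p + 1) * nrm E0 (y - x)" using E0.nrm_nonneg[OF xE(2)] by (simp add: algebra_simps)
    also have "\<dots> \<le> (2 * K * p + 1) * (e / (2 * K * p + 1))" using x(2) c by (intro mult_left_mono) auto
    finally show ?thesis using c by simp
  qed
  then have "nrm E0 (T t (P y) - P (T t y)) \<le> 0" by (rule field_le_epsilon)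
  then show ?thesis using E0.nrm_nonneg[OF Ty] E0.nrm_eq_0[OF Ty] by simp
qed

end

section \<open>Kernel integrals\<close>

lemma has_integral_Gamma_scaled:
  assumes a: "a > (0::real)" and l: "l > 0"
  shows "((\<lambda>r. r powr (a - 1) * exp (- l * r)) has_integral Gamma a / l powr a) {0<..}"
proof -
  let ?g = "\<lambda>t::real. t powr (a - 1) / exp t"
  have "(?g has_integral Gamma a) {0<..}"
    using Gamma_integral_real[OF a] by (subst has_integral_spike_set_eq[of _ "{0..}"]) (auto intro: negligible_subset[of "{0}"])
  then have "((\<lambda>t. if t \<in> {0<..} then ?g t else 0) has_integral Gamma a) UNIV"
    unfolding has_integral_restrict_UNIV .
  from has_integral_affine_UNIV[OF this, of l 0] l
  have "((\<lambda>r. if r \<in> {0<..} then ?g (l * r) else 0) has_integral (1 / l) *\<^sub>R Gamma a) UNIV"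
    by (simp add: zero_less_mult_iff cong: if_cong)
  then have "((\<lambda>r. ?g (l * r)) has_integral (1 / l) *\<^sub>R Gamma a) {0<..}"
    unfolding has_integral_restrict_UNIV .
  from has_integral_mult_right[OF this, of "l powr (1 - a)"]
  have "((\<lambda>r. l powr (1 - a) * ?g (l * r)) has_integral l powr (1 - a) * ((1 / l) *\<^sub>R Gamma a)) {0<..}" .
  moreover have "l powr (1 - a) * ((1 / l) *\<^sub>R Gamma a) = Gamma a / l powr a"
    using l by (simp add: powr_diff)
  moreover have "l powr (1 - a) * ?g (l * r) = r powr (a - 1) * exp (- l * r)" if "r \<in> {0<..}" for r
  proof -
    have "l powr (1 - a) * (l * r) powr (a - 1) = r powr (a - 1)"
      using l that by (simp add: powr_mult powr_add[symmetric] mult.assoc[symmetric])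
    then show ?thesis using l by (simp add: exp_minus divide_inverse mult.assoc[symmetric])
  qed
  ultimately show ?thesis by (metis (no_types, lifting) has_integral_cong)
qed

text \<open>By log-convexity, as \<open>1\<close> lies between \<open>a\<close> and \<open>2\<close> and \<open>Gamma 1 = Gamma 2 = 1\<close>.\<close>

lemma Gamma_ge_1:
  assumes a: "0 < a" "a \<le> (1::real)"
  shows "1 \<le> Gamma a"
proof -
  define u where "u = 1 / (2 - a)"
  have u: "0 \<le> u" "u \<le> 1" using a by (auto simp: u_def)
  have "u * (2 - a) = 1" using a by (simp add: u_def)
  then have eq: "(1 - u) * 2 + u * a = 1" by (simp add: algebra_simps)
  have cv: "(ln \<circ> Gamma) ((1 - u) *\<^sub>R 2 + u *\<^sub>R a) \<le> (1 - u) * (ln \<circ> Gamma) 2 + u * (ln \<circ> Gamma) a"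
    by (rule convex_onD[OF log_convex_Gamma_real u]) (use a in auto)
  moreover have "Gamma (2::real) = 1" using Gamma_fact[of 1, where 'a = real] by (simp add: numeral_2_eq_2)
  ultimately have "0 \<le> u * ln (Gamma a)" using cv unfolding real_scaleR_def eq by simp
  then have "0 \<le> ln (Gamma a)" using a by (simp add: u_def zero_le_divide_iff)
  then show ?thesis using Gamma_real_pos[OF a(1)] by simp
qed

section \<open>Paths and continuously differentiable maps\<close>

lemma continuous_path_sub_ns:
  "continuous_path (sub_ns E S) I u \<longleftrightarrow> continuous_path E I u \<and> (\<forall>s\<in>I. u s \<in> S)"
  by (auto simp: continuous_path_def)

lemma continuous_path_prod_ns:
  fixes sc :: "'k::real_normed_field \<Rightarrow> 'v::real_vector \<Rightarrow> 'v" and sc' :: "'k \<Rightarrow> 'w::real_vector \<Rightarrow> 'w"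
  assumes "normed_space_on sc E" "normed_space_on sc' F"
  shows "continuous_path (prod_ns E F) I u \<longleftrightarrow>
    continuous_path E I (\<lambda>s. fst (u s)) \<and> continuous_path F I (\<lambda>s. snd (u s))"
proof -
  interpret E: normed_space_on sc E by fact
  interpret F: normed_space_on sc' F by fact
  interpret P: normed_space_on "prod_scale sc sc'" "prod_ns E F" by (rule normed_prod_ns[OF assms])
  have nn: "nrm (prod_ns E F) (u r - u s) = nrm E (fst (u r) - fst (u s)) + nrm F (snd (u r) - snd (u s))" for r s
    by (cases "u r"; cases "u s") simp
  have inP: "u s \<in> carr (prod_ns E F) \<longleftrightarrow> fst (u s) \<in> carr E \<and> snd (u s) \<in> carr F" for s
    by (cases "u s") simp
  show ?thesis
  proof (intro iffI conjI)
    assume u: "continuous_path (prod_ns E F) I u"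
    then have uin: "fst (u s) \<in> carr E" "snd (u s) \<in> carr F" if "s \<in> I" for s
      using P.continuous_pathD[OF u that] inP by auto
    have lim: "((\<lambda>r. nrm E (fst (u r) - fst (u s)) + nrm F (snd (u r) - snd (u s))) \<longlongrightarrow> 0) (at s within I)" if "s \<in> I" for s
      using P.continuous_path_lim[OF u that] unfolding nn .
    show "continuous_path E I (\<lambda>s. fst (u s))"
      by (rule E.continuous_path_dominated[OF _ lim]) (use uin F.nrm_nonneg in auto)
    show "continuous_path F I (\<lambda>s. snd (u s))"
      by (rule F.continuous_path_dominated[OF _ lim]) (use uin E.nrm_nonneg in auto)
  next
    assume u: "continuous_path E I (\<lambda>s. fst (u s)) \<and> continuous_path F I (\<lambda>s. snd (u s))"
    show "continuous_path (prod_ns E F) I u"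
      unfolding continuous_path_def nn inP
    proof (intro ballI conjI)
      fix s assume s: "s \<in> I"
      show "fst (u s) \<in> carr E" "snd (u s) \<in> carr F"
        using u s E.continuous_pathD F.continuous_pathD by auto
      show "((\<lambda>r. nrm E (fst (u r) - fst (u s)) + nrm F (snd (u r) - snd (u s))) \<longlongrightarrow> 0) (at s within I)"
        using tendsto_add[OF E.continuous_path_lim[OF conjunct1[OF u] s] F.continuous_path_lim[OF conjunct2[OF u] s]] by simp
    qed
  qed
qed

text \<open>
  The product with the maximum of the norms divided by weights. Dividing by Lipschitz constants
  makes a map with Lipschitz components 1-Lipschitz.
\<close>

definition max_ns :: "real \<Rightarrow> 'u nspace \<Rightarrow> real \<Rightarrow> 'v nspace \<Rightarrow> ('u \<times> 'v) nspace" where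
  "max_ns a E b F = NSpace (carr E \<times> carr F) (\<lambda>(x, y). max (nrm E x / a) (nrm F y / b))"

lemma carr_max_ns [simp]: "carr (max_ns a E b F) = carr E \<times> carr F"
  and nrm_max_ns [simp]: "nrm (max_ns a E b F) (x, y) = max (nrm E x / a) (nrm F y / b)"
  by (simp_all add: max_ns_def)

lemma normed_max_ns:
  assumes "normed_space_on sc E" "normed_space_on sc' F" and ab: "a > 0" "b > 0"
  shows "normed_space_on (prod_scale sc sc') (max_ns a E b F)"
proof -
  interpret E: normed_space_on sc E by fact
  interpret F: normed_space_on sc' F by fact
  interpret P: normed_space_on "prod_scale sc sc'" "prod_ns E F" by (rule normed_prod_ns[OF assms(1,2)])
  show ?thesis
  proof (rule normed_space_on.intro)
    show "module.subspace (prod_scale sc sc') (carr (max_ns a E b F))" using P.carr_subspace by simp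
    show "0 \<le> nrm (max_ns a E b F) x" if "x \<in> carr (max_ns a E b F)" for x
      using that E.nrm_nonneg ab by (cases x) (auto simp: le_max_iff_disj)
    show "(nrm (max_ns a E b F) x = 0) = (x = 0)" if x: "x \<in> carr (max_ns a E b F)" for x
    proof (cases x)
      case (Pair u v)
      then have uv: "u \<in> carr E" "v \<in> carr F" using x by auto
      have "0 \<le> nrm E u / a" "0 \<le> nrm F v / b" using E.nrm_nonneg[OF uv(1)] F.nrm_nonneg[OF uv(2)] ab by auto
      then have "max (nrm E u / a) (nrm F v / b) = 0 \<longleftrightarrow> nrm E u / a = 0 \<and> nrm F v / b = 0" by (auto simp: max_def)
      then show ?thesis using Pair E.nrm_eq_0[OF uv(1)] F.nrm_eq_0[OF uv(2)] ab by (simp add: zero_prod_def)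
    qed
    show "nrm (max_ns a E b F) (x + y) \<le> nrm (max_ns a E b F) x + nrm (max_ns a E b F) y"
      if "x \<in> carr (max_ns a E b F)" "y \<in> carr (max_ns a E b F)" for x y
    proof (cases x; cases y)
      fix u v u' v' assume [simp]: "x = (u, v)" "y = (u', v')"
      have "nrm E (u + u') / a \<le> nrm E u / a + nrm E u' / a" "nrm F (v + v') / b \<le> nrm F v / b + nrm F v' / b"
        using that E.nrm_triangle[of u u'] F.nrm_triangle[of v v'] ab by (auto simp: add_divide_distrib[symmetric] divide_right_mono)
      then show ?thesis by (simp add: max_def)
    qed
    show "nrm (max_ns a E b F) (prod_scale sc sc' c x) = norm c * nrm (max_ns a E b F) x"
      if "x \<in> carr (max_ns a E b F)" for c x
    proof (cases x)
      case (Pair u v)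
      then show ?thesis using that
        by (simp add: prod_scale_def E.nrm_scale F.nrm_scale max_mult_distrib_left)
    qed
  qed (rule P.scalars P.scale_of_real)+
qed

lemma continuous_path_max_ns:
  fixes sc :: "'k::real_normed_field \<Rightarrow> 'v::real_vector \<Rightarrow> 'v" and sc' :: "'k \<Rightarrow> 'w::real_vector \<Rightarrow> 'w"
  assumes "normed_space_on sc E" "normed_space_on sc' F" and ab: "a > 0" "b > 0"
    and u: "continuous_path (max_ns a E b F) I u"
  shows "continuous_path E I (\<lambda>s. fst (u s))" "continuous_path F I (\<lambda>s. snd (u s))"
proof -
  interpret E: normed_space_on sc E by fact
  interpret F: normed_space_on sc' F by fact
  interpret P: normed_space_on "prod_scale sc sc'" "max_ns a E b F" by (rule normed_max_ns[OF assms(1-4)])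
  have nn: "nrm (max_ns a E b F) (u r - u s) = max (nrm E (fst (u r) - fst (u s)) / a) (nrm F (snd (u r) - snd (u s)) / b)" for r s
    by (cases "u r"; cases "u s") simp
  have uin: "fst (u s) \<in> carr E" "snd (u s) \<in> carr F" if "s \<in> I" for s
    using P.continuous_pathD[OF u that] by (cases "u s"; simp)+
  have lim: "((\<lambda>r. c * nrm (max_ns a E b F) (u r - u s)) \<longlongrightarrow> 0) (at s within I)" if "s \<in> I" for s c
    using tendsto_mult_left[OF P.continuous_path_lim[OF u that], of c] by simp
  show "continuous_path E I (\<lambda>s. fst (u s))"
  proof (rule E.continuous_path_dominated[OF _ lim[where c = a]])
    fix s r
    have "nrm E (fst (u r) - fst (u s)) / a \<le> nrm (max_ns a E b F) (u r - u s)" unfolding nn by simp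
    then show "nrm E (fst (u r) - fst (u s)) \<le> a * nrm (max_ns a E b F) (u r - u s)"
      using ab by (simp add: pos_divide_le_eq mult.commute)
  qed (use uin in auto)
  show "continuous_path F I (\<lambda>s. snd (u s))"
  proof (rule F.continuous_path_dominated[OF _ lim[where c = b]])
    fix s r
    have "nrm F (snd (u r) - snd (u s)) / b \<le> nrm (max_ns a E b F) (u r - u s)" unfolding nn by simp
    then show "nrm F (snd (u r) - snd (u s)) \<le> b * nrm (max_ns a E b F) (u r - u s)"
      using ab by (simp add: pos_divide_le_eq mult.commute)
  qed (use uin in auto)
qed

text \<open>
  \<open>F\<close> is continuously differentiable from \<open>E\<close> to \<open>G\<close> with derivative \<open>DF\<close>; continuity of \<open>DF\<close> is
  with respect to the operator norm.
\<close>

definition C1_ns ::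
  "('k \<Rightarrow> 'v::ab_group_add \<Rightarrow> 'v) \<Rightarrow> ('k \<Rightarrow> 'w::ab_group_add \<Rightarrow> 'w) \<Rightarrow> 'v nspace \<Rightarrow> 'w nspace \<Rightarrow>
   ('v \<Rightarrow> 'w) \<Rightarrow> ('v \<Rightarrow> 'v \<Rightarrow> 'w) \<Rightarrow> bool" where
  "C1_ns sc sc' E G F DF \<longleftrightarrow> (\<forall>x\<in>carr E. F x \<in> carr G) \<and>
     (\<forall>x\<in>carr E. frechet_deriv_ns sc sc' E G F x (DF x)) \<and>
     (\<forall>x\<in>carr E. \<forall>e>0. \<exists>d>0. \<forall>y\<in>carr E. nrm E (y - x) < d \<longrightarrow> opbound E G (\<lambda>h. DF y h - DF x h) e)"

lemma linear_between_diff: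
  assumes "normed_space_on sc E" "normed_space_on sc' G" "linear_between sc sc' (carr E) (carr G) T"
    "x \<in> carr E" "y \<in> carr E"
  shows "T (x - y) = T x - T y"
proof -
  interpret E: normed_space_on sc E by fact
  interpret G: normed_space_on sc' G by fact
  have "T (x + sc (of_real (-1)) y) = T x + sc' (of_real (-1)) (T y)"
    using assms(3-5) E.scale_in unfolding linear_between_def by (metis)
  then show ?thesis unfolding E.scale_of_real G.scale_of_real by simp
qed

lemma frechet_deriv_compose_linear:
  assumes E: "normed_space_on sc E" and E': "normed_space_on sc' E'" and G: "normed_space_on sd G" and G': "normed_space_on sd' G'"
    and Fin: "\<And>x. x \<in> carr E \<Longrightarrow> F x \<in> carr G"
    and p: "linear_between sc' sc (carr E') (carr E) p" "opbound E' E p a" "a \<ge> 0"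
    and R: "linear_between sd sd' (carr G) (carr G') R" "opbound G G' R b" "b \<ge> 0"
    and x: "x \<in> carr E'" and fre: "frechet_deriv_ns sc sd E G F (p x) D"
  shows "frechet_deriv_ns sc' sd' E' G' (\<lambda>x. R (F (p x))) x (\<lambda>h. R (D (p h)))"
proof -
  interpret E: normed_space_on sc E by fact
  interpret E': normed_space_on sc' E' by fact
  interpret G: normed_space_on sd G by fact
  interpret G': normed_space_on sd' G' by fact
  have pin: "p x \<in> carr E" "nrm E (p x) \<le> a * nrm E' x" if "x \<in> carr E'" for x
    using p(2) that by (auto simp: opbound_def)
  have Rin: "R x \<in> carr G'" "nrm G' (R x) \<le> b * nrm G x" if "x \<in> carr G" for x
    using R(2) that by (auto simp: opbound_def)
  note Rd = linear_between_diff[OF G G' R(1)] and pd = linear_between_diff[OF E' E p(1)]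
  have padd: "p (x + y) = p x + p y" if "x \<in> carr E'" "y \<in> carr E'" for x y using p(1) that by (simp add: linear_between_def)
  have Dlin: "linear_between sc sd (carr E) (carr G) D" "\<exists>c. opbound E G D c"
    using fre by (auto simp: frechet_deriv_ns_def bounded_op_def)
  have Din: "D h \<in> carr G" if "h \<in> carr E" for h using Dlin(1) that by (simp add: linear_between_def)
  have small: "\<exists>e'>0. b * (e' * a) \<le> e" if e: "e > 0" for e
  proof (intro exI conjI)
    have N: "b * a + 1 > 0" using p(3) R(3) by (simp add: add_nonneg_pos)
    show e': "e / (b * a + 1) > 0" using e N by simp
    have "b * (e / (b * a + 1) * a) = b * a * (e / (b * a + 1))" by simp
    also have "\<dots> \<le> (b * a + 1) * (e / (b * a + 1))" using e' by (intro mult_right_mono) auto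
    also have "\<dots> = e" using N by simp
    finally show "b * (e / (b * a + 1) * a) \<le> e" .
  qed
  have near: "nrm E (p h) < d" if "h \<in> carr E'" "nrm E' h < d / (a + 1)" "d > 0" for h d
  proof -
    have "nrm E (p h) \<le> (a + 1) * nrm E' h" using pin(2)[OF that(1)] E'.nrm_nonneg[OF that(1)] by (simp add: distrib_right)
    also have "\<dots> < (a + 1) * (d / (a + 1))" using that(2) p(3) by (intro mult_strict_left_mono) auto
    finally show ?thesis using p(3) by simp
  qed
  have a1: "d / (a + 1) > 0" if "d > 0" for d using that p(3) by simp
  have lin: "linear_between sc' sd' (carr E') (carr G') (\<lambda>h. R (D (p h)))"
    using p(1) R(1) Dlin(1) unfolding linear_between_def by simp
  have bd: "\<exists>c. opbound E' G' (\<lambda>h. R (D (p h))) c"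
  proof -
    obtain c where c: "opbound E G D c" using Dlin(2) by blast
    from E.opbound_pos[OF this] have c': "opbound E G (D) (max c 0)" .
    have "opbound E' G' (\<lambda>h. R (D (p h))) (b * (max c 0 * a))"
      unfolding opbound_def
    proof (intro ballI conjI)
      fix h assume h: "h \<in> carr E'"
      have 1: "D (p h) \<in> carr G" "nrm G (D (p h)) \<le> max c 0 * nrm E (p h)"
        using c' pin(1)[OF h] by (auto simp: opbound_def)
      show "R (D (p h)) \<in> carr G'" using Rin 1 by simp
      have "nrm G' (R (D (p h))) \<le> b * (max c 0 * (a * nrm E' h))"
        using order_trans[OF Rin(2)[OF 1(1)] mult_left_mono[OF order_trans[OF 1(2) mult_left_mono[OF pin(2)[OF h]]] R(3)]] by simp
      then show "nrm G' (R (D (p h))) \<le> b * (max c 0 * a) * nrm E' h" by (simp add: mult.assoc)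
    qed
    then show ?thesis by blast
  qed
  have diff: "\<exists>d>0. \<forall>h\<in>carr E'. nrm E' h < d \<longrightarrow>
      nrm G' (R (F (p (x + h))) - R (F (p x)) - R (D (p h))) \<le> e * nrm E' h" if e: "e > 0" for e
  proof -
    obtain e' where e': "e' > 0" "b * (e' * a) \<le> e" using small[OF e] by blast
    obtain d where d: "d > 0" "\<And>h. h \<in> carr E \<Longrightarrow> nrm E h < d \<Longrightarrow> nrm G (F (p x + h) - F (p x) - D h) \<le> e' * nrm E h"
      using fre e'(1) unfolding frechet_deriv_ns_def by meson
    have "nrm G' (R (F (p (x + h))) - R (F (p x)) - R (D (p h))) \<le> e * nrm E' h" if h: "h \<in> carr E'" "nrm E' h < d / (a + 1)" for h
    proof -
      have i: "F (p x + p h) \<in> carr G" "F (p x) \<in> carr G" "D (p h) \<in> carr G"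
        using Fin Din pin x h by auto
      have "R (F (p (x + h))) - R (F (p x)) - R (D (p h)) = R (F (p x + p h) - F (p x) - D (p h))"
        using Rd[OF G.diff_in[OF i(1,2)] i(3)] Rd[OF i(1,2)] padd x h by simp
      also have "nrm G' \<dots> \<le> b * nrm G (F (p x + p h) - F (p x) - D (p h))" using Rin(2) i by simp
      also have "\<dots> \<le> b * (e' * nrm E (p h))"
        by (rule mult_left_mono[OF d(2)[OF pin(1)[OF h(1)] near[OF h d(1)]] R(3)])
      also have "\<dots> \<le> b * (e' * (a * nrm E' h))" using pin(2)[OF h(1)] R(3) e' by (intro mult_left_mono) auto
      also have "\<dots> = (b * (e' * a)) * nrm E' h" by simp
      also have "\<dots> \<le> e * nrm E' h" using e' E'.nrm_nonneg[OF h(1)] by (intro mult_right_mono) auto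
      finally show ?thesis .
    qed
    then show ?thesis using a1[OF d(1)] by blast
  qed
  show ?thesis
    unfolding frechet_deriv_ns_def bounded_op_def by (intro conjI allI impI lin bd diff)
qed

lemma C1_ns_compose_linear:
  assumes E: "normed_space_on sc E" and E': "normed_space_on sc' E'" and G: "normed_space_on sd G" and G': "normed_space_on sd' G'"
    and F: "C1_ns sc sd E G F DF"
    and p: "linear_between sc' sc (carr E') (carr E) p" "opbound E' E p a" "a \<ge> 0"
    and R: "linear_between sd sd' (carr G) (carr G') R" "opbound G G' R b" "b \<ge> 0"
  shows "C1_ns sc' sd' E' G' (\<lambda>x. R (F (p x))) (\<lambda>x h. R (DF (p x) (p h)))"
proof -
  interpret E: normed_space_on sc E by fact
  interpret E': normed_space_on sc' E' by fact
  interpret G: normed_space_on sd G by fact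
  interpret G': normed_space_on sd' G' by fact
  have pin: "p x \<in> carr E" "nrm E (p x) \<le> a * nrm E' x" if "x \<in> carr E'" for x
    using p(2) that by (auto simp: opbound_def)
  have Rin: "R x \<in> carr G'" "nrm G' (R x) \<le> b * nrm G x" if "x \<in> carr G" for x
    using R(2) that by (auto simp: opbound_def)
  note Rd = linear_between_diff[OF G G' R(1)] and pd = linear_between_diff[OF E' E p(1)]
  have Fin: "F x \<in> carr G" if "x \<in> carr E" for x using F that by (simp add: C1_ns_def)
  have fre: "frechet_deriv_ns sc sd E G F x (DF x)" if "x \<in> carr E" for x using F that by (simp add: C1_ns_def)
  have Dlin: "linear_between sc sd (carr E) (carr G) (DF x)" if "x \<in> carr E" for x
    using fre[OF that] by (auto simp: frechet_deriv_ns_def bounded_op_def)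
  have Din: "DF x h \<in> carr G" if "x \<in> carr E" "h \<in> carr E" for x h using Dlin[OF that(1)] that(2) by (simp add: linear_between_def)
  have small: "\<exists>e'>0. b * (e' * a) \<le> e" if e: "e > 0" for e
  proof (intro exI conjI)
    have N: "b * a + 1 > 0" using p(3) R(3) by (simp add: add_nonneg_pos)
    show e': "e / (b * a + 1) > 0" using e N by simp
    have "b * (e / (b * a + 1) * a) = b * a * (e / (b * a + 1))" by simp
    also have "\<dots> \<le> (b * a + 1) * (e / (b * a + 1))" using e' by (intro mult_right_mono) auto
    also have "\<dots> = e" using N by simp
    finally show "b * (e / (b * a + 1) * a) \<le> e" .
  qed
  have near: "nrm E (p h) < d" if "h \<in> carr E'" "nrm E' h < d / (a + 1)" "d > 0" for h d
  proof -
    have "nrm E (p h) \<le> (a + 1) * nrm E' h" using pin(2)[OF that(1)] E'.nrm_nonneg[OF that(1)] by (simp add: distrib_right)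
    also have "\<dots> < (a + 1) * (d / (a + 1))" using that(2) p(3) by (intro mult_strict_left_mono) auto
    finally show ?thesis using p(3) by simp
  qed
  have a1: "d / (a + 1) > 0" if "d > 0" for d using that p(3) by simp
  have deriv: "frechet_deriv_ns sc' sd' E' G' (\<lambda>x. R (F (p x))) x (\<lambda>h. R (DF (p x) (p h)))" if x: "x \<in> carr E'" for x
    by (rule frechet_deriv_compose_linear[OF E E' G G' Fin p R x fre[OF pin(1)[OF x]]])
  have cont: "\<exists>d>0. \<forall>y\<in>carr E'. nrm E' (y - x) < d \<longrightarrow>
      opbound E' G' (\<lambda>h. R (DF (p y) (p h)) - R (DF (p x) (p h))) e" if x: "x \<in> carr E'" and e: "e > 0" for x e
  proof -
    obtain e' where e': "e' > 0" "b * (e' * a) \<le> e" using small[OF e] by blast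
    obtain d where d: "d > 0" "\<And>y. y \<in> carr E \<Longrightarrow> nrm E (y - p x) < d \<Longrightarrow> opbound E G (\<lambda>h. DF y h - DF (p x) h) e'"
      using F pin(1)[OF x] e'(1) unfolding C1_ns_def by meson
    have "opbound E' G' (\<lambda>h. R (DF (p y) (p h)) - R (DF (p x) (p h))) e" if y: "y \<in> carr E'" "nrm E' (y - x) < d / (a + 1)" for y
      unfolding opbound_def
    proof (intro ballI conjI)
      fix h assume h: "h \<in> carr E'"
      have "nrm E (p y - p x) < d" using near[OF E'.diff_in[OF y(1) x] y(2) d(1)] pd[OF y(1) x] by simp
      then have 1: "nrm G (DF (p y) (p h) - DF (p x) (p h)) \<le> e' * nrm E (p h)"
        using d(2)[OF pin(1)[OF y(1)]] pin(1)[OF h] by (simp add: opbound_def)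
      have i: "DF (p y) (p h) \<in> carr G" "DF (p x) (p h) \<in> carr G" using Din pin x y h by auto
      then show "R (DF (p y) (p h)) - R (DF (p x) (p h)) \<in> carr G'" using Rin by simp
      have "nrm G' (R (DF (p y) (p h)) - R (DF (p x) (p h))) \<le> b * nrm G (DF (p y) (p h) - DF (p x) (p h))"
        using Rin(2)[OF G.diff_in[OF i]] Rd[OF i] by simp
      also have "\<dots> \<le> b * (e' * nrm E (p h))" by (rule mult_left_mono[OF 1 R(3)])
      also have "\<dots> \<le> b * (e' * (a * nrm E' h))" using pin(2)[OF h] R(3) e' by (intro mult_left_mono) auto
      also have "\<dots> = (b * (e' * a)) * nrm E' h" by simp
      also have "\<dots> \<le> e * nrm E' h" using e' E'.nrm_nonneg[OF h] by (intro mult_right_mono) auto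
      finally show "nrm G' (R (DF (p y) (p h)) - R (DF (p x) (p h))) \<le> e * nrm E' h" .
    qed
    then show ?thesis using a1[OF d(1)] by blast
  qed
  show ?thesis
    unfolding C1_ns_def by (intro conjI ballI allI impI Rin(1) Fin pin(1) deriv cont)
qed

lemma C1_ns_pair:
  assumes E: "normed_space_on sc E" and G: "normed_space_on sd G" and G': "normed_space_on sd' G'" and ab: "a > 0" "b > 0"
    and F: "C1_ns sc sd E G F DF" and H: "C1_ns sc sd' E G' H DH"
  shows "C1_ns sc (prod_scale sd sd') E (max_ns a G b G') (\<lambda>x. (F x, H x)) (\<lambda>x h. (DF x h, DH x h))"
proof -
  interpret E: normed_space_on sc E by fact
  have lt: "max (x / a) (y / b) \<le> e" if "x \<le> a * e" "y \<le> b * e" for x y e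
    using that ab by (simp add: pos_divide_le_eq mult.commute)
  have Fin: "F x \<in> carr G" "H x \<in> carr G'" if "x \<in> carr E" for x using F H that by (auto simp: C1_ns_def)
  have fre: "frechet_deriv_ns sc sd E G F x (DF x)" "frechet_deriv_ns sc sd' E G' H x (DH x)" if "x \<in> carr E" for x
    using F H that by (auto simp: C1_ns_def)
  have lin: "linear_between sc (prod_scale sd sd') (carr E) (carr (max_ns a G b G')) (\<lambda>h. (DF x h, DH x h))" if "x \<in> carr E" for x
    using fre[OF that] unfolding frechet_deriv_ns_def bounded_op_def linear_between_def by (simp add: prod_scale_def)
  have bd: "\<exists>c. opbound E (max_ns a G b G') (\<lambda>h. (DF x h, DH x h)) c" if x: "x \<in> carr E" for x
  proof -
    obtain c c' where c: "opbound E G (DF x) c" "opbound E G' (DH x) c'"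
      using fre[OF x] unfolding frechet_deriv_ns_def bounded_op_def by blast
    have "opbound E (max_ns a G b G') (\<lambda>h. (DF x h, DH x h)) (max c 0 / a + max c' 0 / b)"
      unfolding opbound_def
    proof (intro ballI conjI)
      fix h assume h: "h \<in> carr E"
      have 1: "DF x h \<in> carr G" "nrm G (DF x h) \<le> max c 0 * nrm E h" "DH x h \<in> carr G'" "nrm G' (DH x h) \<le> max c' 0 * nrm E h"
        using E.opbound_pos[OF c(1)] E.opbound_pos[OF c(2)] h by (auto simp: opbound_def)
      then show "(DF x h, DH x h) \<in> carr (max_ns a G b G')" by simp
      have "nrm G (DF x h) / a \<le> (max c 0 / a) * nrm E h" "nrm G' (DH x h) / b \<le> (max c' 0 / b) * nrm E h"
        using 1 ab by (simp_all add: divide_right_mono)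
      moreover have "0 \<le> (max c 0 / a) * nrm E h" "0 \<le> (max c' 0 / b) * nrm E h"
        using ab E.nrm_nonneg[OF h] by simp_all
      ultimately have "nrm G (DF x h) / a \<le> (max c 0 / a + max c' 0 / b) * nrm E h"
        "nrm G' (DH x h) / b \<le> (max c 0 / a + max c' 0 / b) * nrm E h" unfolding distrib_right by linarith+
      then show "nrm (max_ns a G b G') (DF x h, DH x h) \<le> (max c 0 / a + max c' 0 / b) * nrm E h" by simp
    qed
    then show ?thesis by blast
  qed
  have diff: "\<exists>d>0. \<forall>h\<in>carr E. nrm E h < d \<longrightarrow>
      nrm (max_ns a G b G') ((F (x + h), H (x + h)) - (F x, H x) - (DF x h, DH x h)) \<le> e * nrm E h" if x: "x \<in> carr E" and e: "e > 0" for x e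
  proof -
    have e': "a * e > 0" "b * e > 0" using ab e by auto
    obtain d where d: "d > 0" "\<forall>h\<in>carr E. nrm E h < d \<longrightarrow> nrm G (F (x + h) - F x - DF x h) \<le> a * e * nrm E h"
      using fre(1)[OF x] e'(1) unfolding frechet_deriv_ns_def by meson
    obtain d' where d': "d' > 0" "\<forall>h\<in>carr E. nrm E h < d' \<longrightarrow> nrm G' (H (x + h) - H x - DH x h) \<le> b * e * nrm E h"
      using fre(2)[OF x] e'(2) unfolding frechet_deriv_ns_def by meson
    show ?thesis
    proof (intro exI[of _ "min d d'"] conjI ballI impI)
      fix h assume h: "h \<in> carr E" "nrm E h < min d d'"
      then have "nrm G (F (x + h) - F x - DF x h) \<le> a * (e * nrm E h)" "nrm G' (H (x + h) - H x - DH x h) \<le> b * (e * nrm E h)"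
        using d(2) d'(2) by (simp_all add: mult.assoc)
      from lt[OF this] show "nrm (max_ns a G b G') ((F (x + h), H (x + h)) - (F x, H x) - (DF x h, DH x h)) \<le> e * nrm E h" by simp
    qed (use d d' in simp)
  qed
  have cont: "\<exists>d>0. \<forall>y\<in>carr E. nrm E (y - x) < d \<longrightarrow>
      opbound E (max_ns a G b G') (\<lambda>h. (DF y h, DH y h) - (DF x h, DH x h)) e" if x: "x \<in> carr E" and e: "e > 0" for x e
  proof -
    have e': "a * e > 0" "b * e > 0" using ab e by auto
    obtain d where d: "d > 0" "\<forall>y\<in>carr E. nrm E (y - x) < d \<longrightarrow> opbound E G (\<lambda>h. DF y h - DF x h) (a * e)"
      using F x e'(1) unfolding C1_ns_def by meson
    obtain d' where d': "d' > 0" "\<forall>y\<in>carr E. nrm E (y - x) < d' \<longrightarrow> opbound E G' (\<lambda>h. DH y h - DH x h) (b * e)"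
      using H x e'(2) unfolding C1_ns_def by meson
    show ?thesis
    proof (intro exI[of _ "min d d'"] conjI ballI impI)
      fix y assume y: "y \<in> carr E" "nrm E (y - x) < min d d'"
      then have o: "opbound E G (\<lambda>h. DF y h - DF x h) (a * e)" "opbound E G' (\<lambda>h. DH y h - DH x h) (b * e)"
        using d(2) d'(2) by auto
      show "opbound E (max_ns a G b G') (\<lambda>h. (DF y h, DH y h) - (DF x h, DH x h)) e"
        unfolding opbound_def
      proof (intro ballI conjI)
        fix h assume h: "h \<in> carr E"
        have 1: "DF y h - DF x h \<in> carr G" "nrm G (DF y h - DF x h) \<le> a * (e * nrm E h)"
          "DH y h - DH x h \<in> carr G'" "nrm G' (DH y h - DH x h) \<le> b * (e * nrm E h)"
          using o h by (auto simp: opbound_def mult.assoc)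
        then show "(DF y h, DH y h) - (DF x h, DH x h) \<in> carr (max_ns a G b G')" by simp
        show "nrm (max_ns a G b G') ((DF y h, DH y h) - (DF x h, DH x h)) \<le> e * nrm E h" using lt[OF 1(2,4)] by simp
      qed
    qed (use d d' in simp)
  qed
  show ?thesis
    unfolding C1_ns_def frechet_deriv_ns_def bounded_op_def
    using Fin lin bd diff cont by auto
qed

section \<open>The ambient topology\<close>

text \<open>
  If the ambient space is the extrapolation space \<open>X (-1)\<close>, the space \<open>X 1\<close> embeds in it and the
  scalars act boundedly.
\<close>

lemma extrapolation_ambient:
  fixes sc :: "'k::real_normed_field \<Rightarrow> 'v::banach \<Rightarrow> 'v"
  assumes sca: "extrapolation_scale sc S X F E" and amb: "equiv_ns (X (- 1)) (NSpace UNIV norm)"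
  shows "\<exists>c>0. \<forall>x\<in>carr (X 1). norm x \<le> c * nrm (X 1) x"
    and "bounded_linear (sc c)"
proof -
  interpret extrapolation_scale sc S X F E by fact
  interpret Xm: banach_space_on sc "X (-1)" by (rule banach) simp
  obtain a where a: "a > 0" "\<And>x. x \<in> carr (X (-1)) \<Longrightarrow> norm x \<le> a * nrm (X (-1)) x"
    using Xm.embedsD[of "NSpace UNIV norm"] amb by (auto simp: equiv_ns_def)
  obtain b where U: "carr (X (-1)) = UNIV" and b: "\<And>x. nrm (X (-1)) x \<le> b * norm x"
    using amb by (auto simp: equiv_ns_def embeds_def)
  obtain c1 where c1: "c1 > 0" "\<And>x. x \<in> carr (X 1) \<Longrightarrow> nrm (X 0) x \<le> c1 * nrm (X 1) x" using norm_X0_le by blast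
  obtain c2 where c2: "c2 > 0" "\<And>x. x \<in> carr (X 0) \<Longrightarrow> nrm (X (-1)) x \<le> c2 * nrm (X 0) x" using norm_extrapolated_le by blast
  have "norm x \<le> (a * (c2 * c1)) * nrm (X 1) x" if x: "x \<in> carr (X 1)" for x
  proof -
    have "norm x \<le> a * nrm (X (-1)) x" using a(2) U by simp
    also have "\<dots> \<le> a * (c2 * nrm (X 0) x)" using c2(2)[OF X1_X0[OF x]] a(1) by (intro mult_left_mono) auto
    also have "\<dots> \<le> a * (c2 * (c1 * nrm (X 1) x))" using c1(2)[OF x] a(1) c2(1) by (intro mult_left_mono) auto
    finally show ?thesis by (simp add: mult.assoc)
  qed
  then show "\<exists>c>0. \<forall>x\<in>carr (X 1). norm x \<le> c * nrm (X 1) x"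
    using a(1) c1(1) c2(1) by (intro exI[of _ "a * (c2 * c1)"]) auto
  show "bounded_linear (sc c)"
  proof (rule bounded_linear_intro[where K = "a * (norm c * b)"])
    show "sc c (x + y) = sc c x + sc c y" for x y by (rule module.scale_right_distrib[OF Xm.module_sc])
    have "sc c (sc (of_real r) x) = sc (of_real r) (sc c x)" for r x
      using module.scale_scale[OF Xm.module_sc] by (metis mult.commute)
    then show "sc c (r *\<^sub>R x) = r *\<^sub>R sc c x" for r x by (simp only: scale_of_real)
    show "norm (sc c x) \<le> norm x * (a * (norm c * b))" for x
    proof -
      have "norm (sc c x) \<le> a * nrm (X (-1)) (sc c x)" using a(2) U by simp
      also have "nrm (X (-1)) (sc c x) = norm c * nrm (X (-1)) x" using Xm.nrm_scale U by simp
      also have "a * (norm c * nrm (X (-1)) x) \<le> a * (norm c * (b * norm x))"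
        using b a(1) by (intro mult_left_mono) auto
      finally show ?thesis by (simp add: mult_ac)
    qed
  qed
qed

context slow_manifold_setting begin

abbreviation (input) "PF \<equiv> proj_along (YF \<zeta>) (YS \<zeta>)"
abbreviation (input) "PS \<equiv> proj_along (YS \<zeta>) (YF \<zeta>)"
abbreviation (input) "Y1F \<equiv> sub_ns (Y 1) (YF \<zeta>)"
abbreviation (input) "Y1S \<equiv> sub_ns (Y 1) (YS \<zeta>)"
abbreviation (input) "YdF \<equiv> sub_ns (Y \<delta>\<^sub>Y) (YF \<zeta>)"

section \<open>Spaces, semigroups and projections\<close>

lemma X_scale_exists: "\<exists>F E. extrapolation_scale sX A X F E"
  using extrapolation_scale_exists[OF scalars(1,3) X_scale] by metis

text \<open>A number \<open>\<lambda>\<close> for which \<open>Y\<close> is the scale generated by \<open>B - \<lambda>\<close>.\<close>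

definition shift :: 'k where "shift = (SOME l. \<exists>F E. extrapolation_scale sY (\<lambda>y. B y - sY l y) Y F E)"

text \<open>
  The translate \<open>B - \<lambda>\<close> of \<open>B\<close>; it is an isomorphism from \<open>Y 1\<close> to \<open>Y 0\<close> and commutes with the
  semigroup of \<open>B\<close>.
\<close>

definition Bs :: "'y \<Rightarrow> 'y" where "Bs y = B y - sY shift y"

lemma Y_scale_exists: "\<exists>F E. extrapolation_scale sY Bs Y F E"
proof -
  obtain l where "interp_extrap_scale sY (Y 0) (carr (Y 1)) (\<lambda>y. B y - sY l y) Y" using Y_scale by blast
  from extrapolation_scale_exists[OF scalars(2,4) this]
  have "\<exists>l F E. extrapolation_scale sY (\<lambda>y. B y - sY l y) Y F E" by metis
  from someI_ex[OF this] show ?thesis unfolding shift_def[symmetric] Bs_def[abs_def] .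
qed

lemma banach_X: "\<alpha> \<ge> -1 \<Longrightarrow> banach_space_on sX (X \<alpha>)" and banach_Y: "\<alpha> \<ge> -1 \<Longrightarrow> banach_space_on sY (Y \<alpha>)"
  using X_scale_exists Y_scale_exists extrapolation_scale.banach by blast+

lemma X1_X0: "carr (X 1) \<subseteq> carr (X 0)" and Xg_X0: "carr (X \<gamma>\<^sub>X) \<subseteq> carr (X 0)"
  using X_scale_exists extrapolation_scale.X1_X0 extrapolation_scale.interpolated_sub gamma_X(1,2) by blast+
lemma Y1_Y0: "carr (Y 1) \<subseteq> carr (Y 0)" and Yd_Y0: "carr (Y \<delta>\<^sub>Y) \<subseteq> carr (Y 0)"
  using Y_scale_exists extrapolation_scale.X1_X0 extrapolation_scale.interpolated_sub delta_Y(1,2) by blast+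

sublocale X0: banach_space_on sX "X 0" by (rule banach_X) simp
sublocale X1: banach_space_on sX "X 1" by (rule banach_X) simp
sublocale Xg: banach_space_on sX "X \<gamma>\<^sub>X" by (rule banach_X) (use gamma_X in simp)
sublocale Y0: banach_space_on sY "Y 0" by (rule banach_Y) simp
sublocale Y1: banach_space_on sY "Y 1" by (rule banach_Y) simp
sublocale Yd: banach_space_on sY "Y \<delta>\<^sub>Y" by (rule banach_Y) (use delta_Y in simp)

sublocale TA: domain_semigroup sX "X 0" "X 1" A TA M\<^sub>A \<omega>\<^sub>A
proof
  obtain F E where "extrapolation_scale sX A X F E" using X_scale_exists by blast
  then interpret S: extrapolation_scale sX A X F E .
  show "carr (X 1) \<subseteq> carr (X 0)" by (rule X1_X0)
  show "C0_semigroup sX (X 0) TA" using A_gen(2) by (simp add: generates_C0_semigroup_def)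
  show "A x \<in> carr (X 0)" if "x \<in> carr (X 1)" for x by (rule S.S_in[OF that])
  show "A (x - y) = A x - A y" if "x \<in> carr (X 1)" "y \<in> carr (X 1)" for x y
    by (rule linear_between_diff[OF X1.normed_space_on_axioms X0.normed_space_on_axioms S.S_linear that])
  show "\<exists>c>0. \<forall>x\<in>carr (X 1). nrm (X 1) x \<le> c * nrm (X 0) (A x)" by (rule S.norm_X1_le)
  show "A (TA t x) = TA t (A x)" if "x \<in> carr (X 1)" "t \<ge> 0" for x t
    by (rule generator_invariance(2)[OF X0.normed_space_on_axioms A_gen(2) that])
  show "opbound (X 1) (X 1) (TA t) (M\<^sub>A * exp (\<omega>\<^sub>A * t))" if "t > 0" for t by (rule TA_bounds(1)[OF that])
qed

lemma B_linear: "linear_between sY sY (carr (Y 1)) (carr (Y 0)) B"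
  using B_gen(1) by (simp add: closed_op_def)
lemma B_in: "y \<in> carr (Y 1) \<Longrightarrow> B y \<in> carr (Y 0)"
  and B_add: "y \<in> carr (Y 1) \<Longrightarrow> y' \<in> carr (Y 1) \<Longrightarrow> B (y + y') = B y + B y'"
  using B_linear by (auto simp: linear_between_def)
lemma B_diff: "y \<in> carr (Y 1) \<Longrightarrow> y' \<in> carr (Y 1) \<Longrightarrow> B (y - y') = B y - B y'"
  by (rule linear_between_diff[OF Y1.normed_space_on_axioms Y0.normed_space_on_axioms B_linear])

lemma Bs_in: "y \<in> carr (Y 1) \<Longrightarrow> Bs y \<in> carr (Y 0)"
  unfolding Bs_def using B_in Y1_Y0 by (intro Y0.diff_in Y0.scale_in) auto
lemma Bs_diff: "y \<in> carr (Y 1) \<Longrightarrow> y' \<in> carr (Y 1) \<Longrightarrow> Bs (y - y') = Bs y - Bs y'"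
  unfolding Bs_def by (simp add: B_diff module.scale_right_diff_distrib[OF Y0.module_sc])
lemma Bs_graph: "\<exists>c>0. \<forall>x\<in>carr (Y 1). nrm (Y 1) x \<le> c * nrm (Y 0) (Bs x)"
  and Bs_bound: "\<exists>c>0. \<forall>x\<in>carr (Y 1). nrm (Y 0) (Bs x) \<le> c * nrm (Y 1) x"
  and Y1_Y0_bound: "\<exists>c>0. \<forall>x\<in>carr (Y 1). nrm (Y 0) x \<le> c * nrm (Y 1) x"
  and Bs_surj: "z \<in> carr (Y 0) \<Longrightarrow> \<exists>x\<in>carr (Y 1). Bs x = z"
  and Y1_dense: "z \<in> carr (Y 0) \<Longrightarrow> e > 0 \<Longrightarrow> \<exists>y\<in>carr (Y 1). nrm (Y 0) (z - y) < e"
  and Y1_Yd_bound: "\<exists>c>0. \<forall>x\<in>carr (Y 1). x \<in> carr (Y \<delta>\<^sub>Y) \<and> nrm (Y \<delta>\<^sub>Y) x \<le> c * nrm (Y 1) x"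
proof -
  obtain F E where "extrapolation_scale sY Bs Y F E" using Y_scale_exists by blast
  then interpret S: extrapolation_scale sY Bs Y F E .
  show "\<exists>c>0. \<forall>x\<in>carr (Y 1). nrm (Y 1) x \<le> c * nrm (Y 0) (Bs x)" by (rule S.norm_X1_le)
  show "\<exists>c>0. \<forall>x\<in>carr (Y 1). nrm (Y 0) (Bs x) \<le> c * nrm (Y 1) x" by (rule S.norm_S_le)
  show "\<exists>c>0. \<forall>x\<in>carr (Y 1). nrm (Y 0) x \<le> c * nrm (Y 1) x" by (rule S.norm_X0_le)
  show "z \<in> carr (Y 0) \<Longrightarrow> \<exists>x\<in>carr (Y 1). Bs x = z" by (rule S.S_surj)
  show "z \<in> carr (Y 0) \<Longrightarrow> e > 0 \<Longrightarrow> \<exists>y\<in>carr (Y 1). nrm (Y 0) (z - y) < e" by (rule S.dense)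
  show "\<exists>c>0. \<forall>x\<in>carr (Y 1). x \<in> carr (Y \<delta>\<^sub>Y) \<and> nrm (Y \<delta>\<^sub>Y) x \<le> c * nrm (Y 1) x"
    by (rule S.interpolated_embedding[OF delta_Y(1,2)])
qed

lemma TB_linear: "t \<ge> 0 \<Longrightarrow> linear_between sY sY (carr (Y 0)) (carr (Y 0)) (TB t)"
  using B_gen(2) by (simp add: generates_C0_semigroup_def C0_semigroup_def bounded_op_def)

sublocale TB: domain_semigroup sY "Y 0" "Y 1" Bs TB M\<^sub>B \<omega>\<^sub>B
proof
  show "carr (Y 1) \<subseteq> carr (Y 0)" by (rule Y1_Y0)
  show "C0_semigroup sY (Y 0) TB" using B_gen(2) by (simp add: generates_C0_semigroup_def)
  show "Bs (TB t x) = TB t (Bs x)" if x: "x \<in> carr (Y 1)" and t: "t \<ge> 0" for x t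
  proof -
    have x0: "x \<in> carr (Y 0)" using x Y1_Y0 by auto
    have "TB t (Bs x) = TB t (B x) - TB t (sY shift x)"
      unfolding Bs_def
      by (rule linear_between_diff[OF Y0.normed_space_on_axioms Y0.normed_space_on_axioms TB_linear[OF t] B_in[OF x] Y0.scale_in[OF x0]])
    also have "TB t (sY shift x) = sY shift (TB t x)" using TB_linear[OF t] x0 by (simp add: linear_between_def)
    finally show ?thesis
      using generator_invariance(2)[OF Y0.normed_space_on_axioms B_gen(2) x t] by (simp add: Bs_def)
  qed
  show "opbound (Y 1) (Y 1) (TB t) (M\<^sub>B * exp (\<omega>\<^sub>B * t))" if "t > 0" for t by (rule TB_bounds(1)[OF that])
qed (use Bs_in Bs_diff Bs_graph in auto)

sublocale split: complemented_space sY "Y 0" "YF \<zeta>" "YS \<zeta>"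
  by unfold_locales (use direct_sum[OF zeta] in auto)

lemma Q_bounded: "\<exists>c\<ge>0. \<forall>y\<in>carr (Y 0). nrm (Y 0) (PS y) \<le> c * nrm (Y 0) y"
  by (rule split.projections_bounded) (use closed[OF zeta] in auto)

lemma PS_Y1: "y \<in> carr (Y 1) \<Longrightarrow> PS y \<in> carr (Y 1)" and B_PS: "y \<in> carr (Y 1) \<Longrightarrow> B (PS y) = PS (B y)"
  and PF_Y1: "y \<in> carr (Y 1) \<Longrightarrow> PF y \<in> carr (Y 1)"
  using proj_commute[OF zeta] by auto

lemma PS_linear: "linear_between sY sY (carr (Y 0)) (carr (Y 0)) PS"
  unfolding linear_between_def using split.Q_add split.Q_scale split.Q_in by auto

text \<open>By conjugation with \<open>Bs\<close>, which commutes with the slow projection.\<close>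

lemma PS_bounded_Y1: "\<exists>c\<ge>0. opbound (Y 1) (Y 1) PS c"
proof -
  obtain p where p: "p \<ge> 0" "\<And>y. y \<in> carr (Y 0) \<Longrightarrow> nrm (Y 0) (PS y) \<le> p * nrm (Y 0) y" using Q_bounded by blast
  obtain a where a: "a > 0" "\<And>y. y \<in> carr (Y 1) \<Longrightarrow> nrm (Y 1) y \<le> a * nrm (Y 0) (Bs y)" using Bs_graph by blast
  obtain b where b: "b > 0" "\<And>y. y \<in> carr (Y 1) \<Longrightarrow> nrm (Y 0) (Bs y) \<le> b * nrm (Y 1) y" using Bs_bound by blast
  have "nrm (Y 1) (PS y) \<le> (a * (p * b)) * nrm (Y 1) y" if y: "y \<in> carr (Y 1)" for y
  proof -
    have y0: "y \<in> carr (Y 0)" using y Y1_Y0 by auto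
    have "Bs (PS y) = PS (Bs y)"
      unfolding Bs_def using B_PS[OF y] split.Q_diff[OF B_in[OF y] Y0.scale_in[OF y0]] split.Q_scale[OF y0] by simp
    then have "nrm (Y 1) (PS y) \<le> a * nrm (Y 0) (PS (Bs y))" using a(2)[OF PS_Y1[OF y]] by simp
    also have "\<dots> \<le> a * (p * nrm (Y 0) (Bs y))" using p(2)[OF Bs_in[OF y]] a(1) by (intro mult_left_mono) auto
    also have "\<dots> \<le> a * (p * (b * nrm (Y 1) y))" using b(2)[OF y] a(1) p(1) by (intro mult_left_mono) auto
    finally show ?thesis by (simp add: mult.assoc)
  qed
  moreover have "a * (p * b) \<ge> 0" using a(1) b(1) p(1) by simp
  ultimately show ?thesis using PS_Y1 unfolding opbound_def by blast
qed

lemma TB_PS: "t \<ge> 0 \<Longrightarrow> y \<in> carr (Y 0) \<Longrightarrow> TB t (PS y) = PS (TB t y)"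
proof -
  obtain C where C: "C > 0" "\<And>t z. t \<ge> 0 \<Longrightarrow> z \<in> carr (Y 0) \<Longrightarrow> nrm (Y 0) (TB t z) \<le> C * exp (\<omega>\<^sub>B * t) * nrm (Y 0) z"
    using TB.T_bound0[OF Bs_surj Bs_bound] by blast
  obtain b where b: "b > 0" "\<And>y. y \<in> carr (Y 1) \<Longrightarrow> nrm (Y 0) (Bs y) \<le> b * nrm (Y 1) y" using Bs_bound by blast
  obtain c where c: "c > 0" "\<And>y. y \<in> carr (Y 1) \<Longrightarrow> nrm (Y 0) y \<le> c * nrm (Y 1) y" using Y1_Y0_bound by blast
  interpret G: generated_semigroup sY "Y 0" "Y 1" B TB C \<omega>\<^sub>B "b + norm shift * c"
  proof
    show "carr (Y 1) \<subseteq> carr (Y 0)" by (rule Y1_Y0)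
    show "nrm (Y 0) (B y) \<le> (b + norm shift * c) * nrm (Y 1) y" if y: "y \<in> carr (Y 1)" for y
    proof -
      have y0: "y \<in> carr (Y 0)" using y Y1_Y0 by auto
      have "nrm (Y 0) (B y) \<le> nrm (Y 0) (Bs y) + nrm (Y 0) (sY shift y)"
        using Y0.nrm_triangle[OF Bs_in[OF y] Y0.scale_in[OF y0, of shift]] by (simp add: Bs_def)
      also have "\<dots> \<le> b * nrm (Y 1) y + norm shift * (c * nrm (Y 1) y)"
        using b(2)[OF y] c(2)[OF y] Y0.nrm_scale[OF y0] by (intro add_mono) (auto intro: mult_left_mono)
      finally show ?thesis by (simp add: algebra_simps)
    qed
    show "generates_C0_semigroup sY (Y 0) (carr (Y 1)) B TB" by (rule B_gen(2))
    show "\<exists>y\<in>carr (Y 1). nrm (Y 0) (x - y) < e" if "x \<in> carr (Y 0)" "e > 0" for x e by (rule Y1_dense[OF that])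
    show "continuous_path (Y 1) {0..} (\<lambda>t. TB t x)" if "x \<in> carr (Y 1)" for x by (rule TB.orbit1[OF that])
  qed (use B_diff C b c in auto)
  assume t: "t \<ge> 0" and y: "y \<in> carr (Y 0)"
  obtain p where p: "p \<ge> 0" "\<And>y. y \<in> carr (Y 0) \<Longrightarrow> nrm (Y 0) (PS y) \<le> p * nrm (Y 0) y" using Q_bounded by blast
  obtain p1 where p1: "p1 \<ge> 0" "opbound (Y 1) (Y 1) PS p1" using PS_bounded_Y1 by blast
  show "TB t (PS y) = PS (TB t y)"
    by (rule G.commuting_operator[OF PS_linear _ p(1) p1(2,1) B_PS t y]) (use p(2) split.Q_in in \<open>auto simp: opbound_def\<close>)
qed

text \<open>
  For the slow subspace, invariance is contained in the assumption on the group; for the fast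
  subspace it follows since the kernel of the slow projection is invariant.
\<close>

lemma TB_YF:
  assumes t: "t \<ge> 0" and y: "y \<in> YF \<zeta>"
  shows "TB t y \<in> YF \<zeta>"
proof -
  have y0: "y \<in> carr (Y 0)" using y split.F_sub by auto
  have "TB t 0 = 0" using TB.T_diff[OF t, of 0 0] by simp
  then have "PS (TB t y) = 0" using TB_PS[OF t y0] split.Q_in_F[OF y] by simp
  then show ?thesis using split.decompose(1,3)[OF TB.T_in[OF t y0]] by simp
qed

lemma subspace_YF: "module.subspace sY (YF \<zeta>)" and subspace_YS: "module.subspace sY (YS \<zeta>)"
  using direct_sum[OF zeta] by auto

sublocale Y1F: banach_space_on sY Y1F
  by (rule Y1.banach_sub_ns[OF subspace_YF]) (use closed_Y1[OF zeta] in simp)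
sublocale Y1S: banach_space_on sY Y1S
  by (rule Y1.banach_sub_ns[OF subspace_YS]) (use closed_Y1[OF zeta] in simp)
sublocale YdF: normed_space_on sY YdF
  by (rule Yd.normed_sub_ns[OF subspace_YF])
sublocale Y0S: normed_space_on sY "sub_ns (Y 0) (YS \<zeta>)"
  by (rule Y0.normed_sub_ns[OF subspace_YS])

subsection \<open>The group on the slow subspace\<close>

lemma slow_domain: "realization_dom (carr (Y 1)) B (YS \<zeta>) = YS \<zeta> \<inter> carr (Y 1)"
proof -
  have "B y \<in> YS \<zeta>" if y: "y \<in> YS \<zeta>" "y \<in> carr (Y 1)" for y
    using B_PS[OF y(2)] split.Q_in_S[OF y(1)] split.decompose(2)[OF B_in[OF y(2)]] by simp
  then show ?thesis by (auto simp: realization_dom_def)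
qed

lemma GB_group: "generates_C0_group sY (sub_ns (Y 0) (YS \<zeta>)) (YS \<zeta> \<inter> carr (Y 1)) B (GB \<zeta>)"
  using slow_group(1)[OF zeta] unfolding slow_domain .

lemma GB_C0: "C0_group sY (sub_ns (Y 0) (YS \<zeta>)) (GB \<zeta>)"
  using GB_group by (simp add: generates_C0_group_def)

lemma YS_Y0: "YS \<zeta> \<inter> carr (Y 0) = YS \<zeta>" using split.S_sub by auto

lemma GB_linear: "linear_between sY sY (YS \<zeta>) (YS \<zeta>) (GB \<zeta> t)"
  using GB_C0 by (simp add: C0_group_def bounded_op_def YS_Y0)
lemma GB_in: "y \<in> YS \<zeta> \<Longrightarrow> GB \<zeta> t y \<in> YS \<zeta>"
  and GB_add: "y \<in> YS \<zeta> \<Longrightarrow> y' \<in> YS \<zeta> \<Longrightarrow> GB \<zeta> t (y + y') = GB \<zeta> t y + GB \<zeta> t y'"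
  and GB_scale: "y \<in> YS \<zeta> \<Longrightarrow> GB \<zeta> t (sY c y) = sY c (GB \<zeta> t y)"
  using GB_linear by (auto simp: linear_between_def)
lemma GB_0: "y \<in> YS \<zeta> \<Longrightarrow> GB \<zeta> 0 y = y"
  and GB_law: "y \<in> YS \<zeta> \<Longrightarrow> GB \<zeta> (s + t) y = GB \<zeta> s (GB \<zeta> t y)"
  using GB_C0 unfolding C0_group_def carr_sub_ns YS_Y0 by blast+

text \<open>The group run backwards in time.\<close>

sublocale GB: domain_semigroup sY "sub_ns (Y 0) (YS \<zeta>)" Y1S Bs "\<lambda>t. GB \<zeta> (- t)" M\<^sub>S "- (N\<^sub>S \<zeta> + \<omega>\<^sub>A / \<zeta>)"
proof
  show "carr Y1S \<subseteq> carr (sub_ns (Y 0) (YS \<zeta>))" using Y1_Y0 by auto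
  show "C0_semigroup sY (sub_ns (Y 0) (YS \<zeta>)) (\<lambda>t. GB \<zeta> (- t))" by (rule backward_semigroup[OF GB_C0])
  have BS: "B x \<in> YS \<zeta>" if "x \<in> carr Y1S" for x
    using that slow_domain by (auto simp: realization_dom_def)
  have sS: "sY shift x \<in> YS \<zeta>" if "x \<in> YS \<zeta>" for x using module.subspace_scale[OF Y0.module_sc subspace_YS that] .
  show "Bs x \<in> carr (sub_ns (Y 0) (YS \<zeta>))" if "x \<in> carr Y1S" for x
    using BS[OF that] sS[of x] that Bs_in module.subspace_diff[OF Y0.module_sc subspace_YS] by (simp add: Bs_def)
  show "Bs (x - y) = Bs x - Bs y" if "x \<in> carr Y1S" "y \<in> carr Y1S" for x y using Bs_diff that by simp
  show "\<exists>c>0. \<forall>x\<in>carr Y1S. nrm Y1S x \<le> c * nrm (sub_ns (Y 0) (YS \<zeta>)) (Bs x)" using Bs_graph by auto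
  show "Bs (GB \<zeta> (- t) x) = GB \<zeta> (- t) (Bs x)" if x: "x \<in> carr Y1S" for x t
  proof -
    have xS: "x \<in> YS \<zeta>" using x by simp
    have "GB \<zeta> (- t) (Bs x) = GB \<zeta> (- t) (B x) - GB \<zeta> (- t) (sY shift x)"
      unfolding Bs_def
      by (rule linear_between_diff[OF Y0S.normed_space_on_axioms Y0S.normed_space_on_axioms]) (use GB_linear BS[OF x] sS[OF xS] in \<open>simp_all add: YS_Y0\<close>)
    then show ?thesis
      using group_generator_invariance(2)[OF Y0S.normed_space_on_axioms GB_group, of x "- t"] x GB_scale[OF xS] by (simp add: Bs_def)
  qed
  show "opbound Y1S Y1S (GB \<zeta> (- t)) (M\<^sub>S * exp (- (N\<^sub>S \<zeta> + \<omega>\<^sub>A / \<zeta>) * t))" if "t > 0" for t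
    using slow_bound[OF zeta, of t] that GB_in by (auto simp: opbound_def)
qed

text \<open>
  The slow projection gains regularity: \<open>PS y = TB 1 (GB \<zeta> (-1) (PS y))\<close>, where \<open>GB \<zeta> (-1) \<circ> PS\<close>
  is bounded on \<open>Y 0\<close> and on \<open>Y 1\<close>, hence on \<open>Y \<delta>\<^sub>Y\<close>, and \<open>TB 1\<close> maps \<open>Y \<delta>\<^sub>Y\<close> to \<open>Y 1\<close>.
\<close>

lemma PS_smoothing: "\<exists>c\<ge>0. opbound (Y \<delta>\<^sub>Y) Y1S PS c"
proof -
  obtain F E where "extrapolation_scale sY Bs Y F E" using Y_scale_exists by blast
  then interpret S: extrapolation_scale sY Bs Y F E .
  let ?T = "\<lambda>y. GB \<zeta> (- 1) (PS y)"
  have PSS: "PS y \<in> YS \<zeta>" if "y \<in> carr (Y 0)" for y by (rule split.decompose(2)[OF that])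
  obtain p where p: "p \<ge> 0" "\<And>y. y \<in> carr (Y 0) \<Longrightarrow> nrm (Y 0) (PS y) \<le> p * nrm (Y 0) y" using Q_bounded by blast
  obtain p1 where p1: "p1 \<ge> 0" "opbound (Y 1) (Y 1) PS p1" using PS_bounded_Y1 by blast
  have Tlin: "linear_between sY sY (carr (Y 0)) (carr (Y 0)) ?T"
    unfolding linear_between_def using PSS GB_in GB_add GB_scale split.S_sub split.Q_add split.Q_scale by auto
  obtain g where g: "opbound (sub_ns (Y 0) (YS \<zeta>)) (sub_ns (Y 0) (YS \<zeta>)) (GB \<zeta> (-1)) g"
    using GB_C0 unfolding C0_group_def bounded_op_def by blast
  have T0: "opbound (Y 0) (Y 0) ?T (max g 0 * p)"
    unfolding opbound_def
  proof
    fix y assume y: "y \<in> carr (Y 0)"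
    have "GB \<zeta> (- 1) (PS y) \<in> carr (Y 0)" "nrm (Y 0) (GB \<zeta> (- 1) (PS y)) \<le> max g 0 * nrm (Y 0) (PS y)"
      using Y0S.opbound_pos[OF g] PSS[OF y] split.S_sub by (auto simp: opbound_def)
    moreover have "max g 0 * nrm (Y 0) (PS y) \<le> max g 0 * (p * nrm (Y 0) y)" by (rule mult_left_mono[OF p(2)[OF y]]) simp
    ultimately show "?T y \<in> carr (Y 0) \<and> nrm (Y 0) (?T y) \<le> max g 0 * p * nrm (Y 0) y" by (simp add: mult.assoc)
  qed
  have T1: "opbound (Y 1) (Y 1) ?T ((max 1 M\<^sub>S * exp (- (N\<^sub>S \<zeta> + \<omega>\<^sub>A / \<zeta>) * 1)) * p1)"
    unfolding opbound_def
  proof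
    fix y assume y: "y \<in> carr (Y 1)"
    have Py: "PS y \<in> carr Y1S" "nrm (Y 1) (PS y) \<le> p1 * nrm (Y 1) y"
      using p1(2) y PSS Y1_Y0 by (auto simp: opbound_def)
    have "nrm (Y 1) (?T y) \<le> max 1 M\<^sub>S * exp (- (N\<^sub>S \<zeta> + \<omega>\<^sub>A / \<zeta>) * 1) * nrm (Y 1) (PS y)"
      using GB.T_bound1'[OF zero_le_one Py(1)] by simp
    also have "\<dots> \<le> max 1 M\<^sub>S * exp (- (N\<^sub>S \<zeta> + \<omega>\<^sub>A / \<zeta>) * 1) * (p1 * nrm (Y 1) y)"
      by (rule mult_left_mono[OF Py(2)]) simp
    finally show "?T y \<in> carr (Y 1) \<and> nrm (Y 1) (?T y) \<le> (max 1 M\<^sub>S * exp (- (N\<^sub>S \<zeta> + \<omega>\<^sub>A / \<zeta>) * 1)) * p1 * nrm (Y 1) y"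
      using GB.T_in1[OF zero_le_one Py(1)] by (simp add: mult.assoc)
  qed
  obtain c where c: "c \<ge> 0" "opbound (Y \<delta>\<^sub>Y) (Y \<delta>\<^sub>Y) ?T c"
    using S.interpolated_operator[OF delta_Y(1,2) Tlin T0 T1] by blast
  have s: "opbound (Y \<delta>\<^sub>Y) (Y 1) (TB 1) (C\<^sub>B * exp \<omega>\<^sub>B)" using TB_bounds(2)[of 1] by simp
  have "PS y \<in> carr Y1S \<and> nrm Y1S (PS y) \<le> (C\<^sub>B * exp \<omega>\<^sub>B * c) * nrm (Y \<delta>\<^sub>Y) y" if y: "y \<in> carr (Y \<delta>\<^sub>Y)" for y
  proof -
    have y0: "y \<in> carr (Y 0)" using y Yd_Y0 by auto
    have Ty: "?T y \<in> carr (Y \<delta>\<^sub>Y)" "nrm (Y \<delta>\<^sub>Y) (?T y) \<le> c * nrm (Y \<delta>\<^sub>Y) y" using c(2) y by (auto simp: opbound_def)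
    have "TB 1 (?T y) = GB \<zeta> 1 (?T y)" using slow_group(2)[OF zeta zero_le_one GB_in[OF PSS[OF y0], of "-1"]] by simp
    also have "\<dots> = PS y" using GB_law[OF PSS[OF y0], of 1 "-1"] GB_0[OF PSS[OF y0]] by simp
    finally have eq: "TB 1 (?T y) = PS y" .
    have 1: "PS y \<in> carr (Y 1)" "nrm (Y 1) (PS y) \<le> C\<^sub>B * exp \<omega>\<^sub>B * nrm (Y \<delta>\<^sub>Y) (?T y)"
    proof -
      have "TB 1 (?T y) \<in> carr (Y 1) \<and> nrm (Y 1) (TB 1 (?T y)) \<le> C\<^sub>B * exp \<omega>\<^sub>B * nrm (Y \<delta>\<^sub>Y) (?T y)"
        using s Ty(1) unfolding opbound_def by blast
      then show "PS y \<in> carr (Y 1)" "nrm (Y 1) (PS y) \<le> C\<^sub>B * exp \<omega>\<^sub>B * nrm (Y \<delta>\<^sub>Y) (?T y)"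
        unfolding eq by auto
    qed
    have "C\<^sub>B * exp \<omega>\<^sub>B * nrm (Y \<delta>\<^sub>Y) (?T y) \<le> C\<^sub>B * exp \<omega>\<^sub>B * (c * nrm (Y \<delta>\<^sub>Y) y)"
      using Ty(2) const_pos(4) by (intro mult_left_mono) auto
    then show ?thesis using 1 PSS[OF y0] by (simp add: mult.assoc)
  qed
  moreover have "C\<^sub>B * exp \<omega>\<^sub>B * c \<ge> 0" using c(1) const_pos(4) by simp
  ultimately show ?thesis unfolding opbound_def by blast
qed

lemma PF_bounded: "\<exists>c\<ge>0. opbound (Y \<delta>\<^sub>Y) YdF PF c"
proof -
  obtain c where c: "c \<ge> 0" "opbound (Y \<delta>\<^sub>Y) Y1S PS c" using PS_smoothing by blast
  obtain b where b: "b > 0" "\<And>x. x \<in> carr (Y 1) \<Longrightarrow> x \<in> carr (Y \<delta>\<^sub>Y) \<and> nrm (Y \<delta>\<^sub>Y) x \<le> b * nrm (Y 1) x" using Y1_Yd_bound by blast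
  have "PF y \<in> carr YdF \<and> nrm YdF (PF y) \<le> (1 + b * c) * nrm (Y \<delta>\<^sub>Y) y" if y: "y \<in> carr (Y \<delta>\<^sub>Y)" for y
  proof -
    have y0: "y \<in> carr (Y 0)" using y Yd_Y0 by auto
    have 1: "PS y \<in> carr (Y 1)" "nrm (Y 1) (PS y) \<le> c * nrm (Y \<delta>\<^sub>Y) y" using c(2) y by (auto simp: opbound_def)
    have 2: "PS y \<in> carr (Y \<delta>\<^sub>Y)" "nrm (Y \<delta>\<^sub>Y) (PS y) \<le> b * nrm (Y 1) (PS y)" using b(2)[OF 1(1)] by auto
    have "b * nrm (Y 1) (PS y) \<le> b * (c * nrm (Y \<delta>\<^sub>Y) y)" using 1(2) b(1) by (intro mult_left_mono) auto
    moreover have eq: "PF y = y - PS y" using split.decompose(3)[OF y0] by (simp add: algebra_simps)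
    ultimately show ?thesis
      using Yd.nrm_triangle_diff[OF y 2(1)] 2 split.decompose(1)[OF y0] Yd.diff_in[OF y 2(1)] by (simp add: distrib_right mult.assoc)
  qed
  moreover have "1 + b * c \<ge> 0" using b(1) c(1) by simp
  ultimately show ?thesis unfolding opbound_def by blast
qed

end

context slow_manifold_setting begin

section \<open>The three convolution operators\<close>

text \<open>Embedding constants of \<open>X 1\<close> and \<open>Y 1\<close> in the ambient spaces.\<close>

definition embX :: real where "embX = (SOME c. c > 0 \<and> (\<forall>x\<in>carr (X 1). norm x \<le> c * nrm (X 1) x))"
definition embY :: real where "embY = (SOME c. c > 0 \<and> (\<forall>x\<in>carr (Y 1). norm x \<le> c * nrm (Y 1) x))"

lemma embX: "embX > 0" "x \<in> carr (X 1) \<Longrightarrow> norm x \<le> embX * nrm (X 1) x" and bounded_linear_sX: "bounded_linear (sX c)"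
proof -
  obtain F E where sca: "extrapolation_scale sX A X F E" using X_scale_exists by blast
  have "\<exists>c. c > 0 \<and> (\<forall>x\<in>carr (X 1). norm x \<le> c * nrm (X 1) x)"
    using extrapolation_ambient(1)[OF sca ambient(1)] by blast
  from someI_ex[OF this] show "embX > 0" "x \<in> carr (X 1) \<Longrightarrow> norm x \<le> embX * nrm (X 1) x"
    unfolding embX_def[symmetric] by auto
  show "bounded_linear (sX c)" by (rule extrapolation_ambient(2)[OF sca ambient(1)])
qed

lemma embY: "embY > 0" "x \<in> carr (Y 1) \<Longrightarrow> norm x \<le> embY * nrm (Y 1) x" and bounded_linear_sY: "bounded_linear (sY c)"
proof -
  obtain F E where sca: "extrapolation_scale sY Bs Y F E" using Y_scale_exists by blast
  have "\<exists>c. c > 0 \<and> (\<forall>x\<in>carr (Y 1). norm x \<le> c * nrm (Y 1) x)"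
    using extrapolation_ambient(1)[OF sca ambient(2)] by blast
  from someI_ex[OF this] show "embY > 0" "x \<in> carr (Y 1) \<Longrightarrow> norm x \<le> embY * nrm (Y 1) x"
    unfolding embY_def[symmetric] by auto
  show "bounded_linear (sY c)" by (rule extrapolation_ambient(2)[OF sca ambient(2)])
qed

text \<open>
  The bounds on the operators \<open>TA (r / \<epsilon>)\<close> from \<open>X \<gamma>\<^sub>X\<close> to \<open>X 1\<close>, \<open>TB r\<close> from the fast part of
  \<open>Y \<delta>\<^sub>Y\<close> to that of \<open>Y 1\<close>, and \<open>GB \<zeta> (-r)\<close> on the slow part of \<open>Y 1\<close>.
\<close>

definition kerX :: "real \<Rightarrow> real" where
  "kerX r = C\<^sub>A * (r / \<epsilon>) powr (\<gamma>\<^sub>X - 1) * exp (\<omega>\<^sub>A * (r / \<epsilon>))"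
definition kerF :: "real \<Rightarrow> real" where
  "kerF r = C\<^sub>S * r powr (\<delta>\<^sub>Y - 1) * exp ((N\<^sub>F \<zeta> + \<omega>\<^sub>A / \<zeta>) * r)"
definition kerS :: "real \<Rightarrow> real" where
  "kerS r = M\<^sub>S * exp (- (N\<^sub>S \<zeta> + \<omega>\<^sub>A / \<zeta>) * r)"

sublocale convX: operator_family sX "X 1" embX "X \<gamma>\<^sub>X" "\<lambda>r. TA (r / \<epsilon>)" "{0<..}" kerX
proof (intro operator_family.intro embedded_banach_space.intro embedded_banach_space_axioms.intro
    operator_family_axioms.intro)
  show "banach_space_on sX (X 1)" by (rule X1.banach_space_on_axioms)
  show "normed_space_on sX (X \<gamma>\<^sub>X)" by (rule Xg.normed_space_on_axioms)
  have smooth: "TA t x \<in> carr (X 1)" if "t > 0" "x \<in> carr (X \<gamma>\<^sub>X)" for t x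
    using TA_bounds(2)[OF that(1)] that(2) by (auto simp: opbound_def)
  show "norm x \<le> embX * nrm (X 1) x" if "x \<in> carr (X 1)" for x by (rule embX(2)[OF that])
  show "embX > 0" by (rule embX(1))
  show "linear_between sX sX (carr (X \<gamma>\<^sub>X)) (carr (X 1)) (TA (r / \<epsilon>))" if "r \<in> {0<..}" for r
  proof -
    have r: "r / \<epsilon> > 0" using that eps_pos by simp
    then show ?thesis
      unfolding linear_between_def
      using smooth[OF r] TA.T_add[of "r / \<epsilon>"] TA.T_scale[of "r / \<epsilon>"] Xg_X0 by (auto simp: subset_iff)
  qed
  show "opbound (X \<gamma>\<^sub>X) (X 1) (TA (r / \<epsilon>)) (kerX r)" if "r \<in> {0<..}" for r
    unfolding kerX_def by (rule TA_bounds(2)) (use that eps_pos in simp)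
  show "continuous_path (X 1) {0<..} (\<lambda>r. TA (r / \<epsilon>) x)" if x: "x \<in> carr (X \<gamma>\<^sub>X)" for x
  proof (rule X1.continuous_path_compose)
    show "continuous_path (X 1) {0<..} (\<lambda>t. TA t x)"
      by (rule TA.smoothing_orbit) (use x Xg_X0 smooth in auto)
  qed (use eps_pos in \<open>auto intro!: continuous_intros\<close>)
  show "continuous_on {0<..} kerX" unfolding kerX_def using eps_pos by (intro continuous_intros) auto
  show "0 \<le> kerX r" if "r \<in> {0<..}" for r unfolding kerX_def using const_pos(3) by simp
  show "bounded_linear (sX c)" for c by (rule bounded_linear_sX)
qed

sublocale convF: operator_family sY Y1F embY YdF TB "{0<..}" kerF
proof (intro operator_family.intro embedded_banach_space.intro embedded_banach_space_axioms.intro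
    operator_family_axioms.intro)
  show "banach_space_on sY Y1F" by (rule Y1F.banach_space_on_axioms)
  show "normed_space_on sY YdF" by (rule YdF.normed_space_on_axioms)
  have smooth: "TB t x \<in> carr Y1F" if "t > 0" "x \<in> carr YdF" for t x
    using fast_bound[OF zeta that(1)] that TB_YF by (auto simp: opbound_def)
  show "norm x \<le> embY * nrm Y1F x" if "x \<in> carr Y1F" for x using embY(2) that by simp
  show "embY > 0" by (rule embY(1))
  show "linear_between sY sY (carr YdF) (carr Y1F) (TB r)" if "r \<in> {0<..}" for r
  proof -
    have r: "r > 0" using that by simp
    then show ?thesis
      unfolding linear_between_def
      using smooth[OF r] TB.T_add[of r] TB.T_scale[of r] Yd_Y0 by (auto simp: subset_iff)
  qed
  show "opbound YdF Y1F (TB r) (kerF r)" if "r \<in> {0<..}" for r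
    using fast_bound[OF zeta, of r] that smooth by (auto simp: opbound_def kerF_def)
  show "continuous_path Y1F {0<..} (\<lambda>r. TB r x)" if x: "x \<in> carr YdF" for x
    unfolding continuous_path_sub_ns
  proof
    show "continuous_path (Y 1) {0<..} (\<lambda>t. TB t x)"
      by (rule TB.smoothing_orbit) (use x Yd_Y0 smooth in auto)
  qed (use x TB_YF in auto)
  show "continuous_on {0<..} kerF" unfolding kerF_def by (intro continuous_intros) auto
  show "0 \<le> kerF r" if "r \<in> {0<..}" for r unfolding kerF_def using dichotomy_const(1) by simp
  show "bounded_linear (sY c)" for c by (rule bounded_linear_sY)
qed

sublocale convS: operator_family sY Y1S embY Y1S "\<lambda>r. GB \<zeta> (- r)" "{0..}" kerS
proof (intro operator_family.intro embedded_banach_space.intro embedded_banach_space_axioms.intro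
    operator_family_axioms.intro)
  show "banach_space_on sY Y1S" by (rule Y1S.banach_space_on_axioms)
  show "normed_space_on sY Y1S" by (rule Y1S.normed_space_on_axioms)
  show "norm x \<le> embY * nrm Y1S x" if "x \<in> carr Y1S" for x using embY(2) that by simp
  show "embY > 0" by (rule embY(1))
  have inS: "GB \<zeta> (- r) x \<in> carr Y1S" if "r \<ge> 0" "x \<in> carr Y1S" for r x using GB.T_in1[OF that] .
  show "linear_between sY sY (carr Y1S) (carr Y1S) (GB \<zeta> (- r))" if "r \<in> {0..}" for r
    unfolding linear_between_def using inS[of r] that GB_add GB_scale by simp
  show "opbound Y1S Y1S (GB \<zeta> (- r)) (kerS r)" if "r \<in> {0..}" for r
    using slow_bound[OF zeta, of r] that inS[of r] by (auto simp: opbound_def kerS_def)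
  show "continuous_path Y1S {0..} (\<lambda>r. GB \<zeta> (- r) x)" if "x \<in> carr Y1S" for x by (rule GB.orbit1[OF that])
  show "continuous_on {0..} kerS" unfolding kerS_def by (intro continuous_intros)
  show "0 \<le> kerS r" if "r \<in> {0..}" for r unfolding kerS_def using dichotomy_const(2) by simp
  show "bounded_linear (sY c)" for c by (rule bounded_linear_sY)
qed

abbreviation (input) \<eta> :: real where "\<eta> \<equiv> eta \<omega>\<^sub>A (N\<^sub>F \<zeta>) (N\<^sub>S \<zeta>) \<zeta>"

text \<open>
  The weights \<open>\<mu>\<close> for which the three convolutions map paths of size \<open>exp (\<mu> * t)\<close> to paths of the
  same size.
\<close>

definition admissible :: "real \<Rightarrow> bool" where
  "admissible \<mu> \<longleftrightarrow> \<omega>\<^sub>A / \<epsilon> < \<mu> \<and> N\<^sub>F \<zeta> + \<omega>\<^sub>A / \<zeta> < \<mu> \<and> \<mu> < N\<^sub>S \<zeta> + \<omega>\<^sub>A / \<zeta>"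

text \<open>
  The bound on the Lyapunov-Perron operator in the weight \<open>\<mu>\<close>: the sum of the Lipschitz constants
  of the three components, each multiplied by the integral of the corresponding kernel with its
  exponential weight.
\<close>

definition rate :: "real \<Rightarrow> real" where
  "rate \<mu> = L\<^sub>f * (C\<^sub>A * Gamma \<gamma>\<^sub>X / (\<epsilon> * (\<mu> - \<omega>\<^sub>A / \<epsilon>)) powr \<gamma>\<^sub>X)
     + L\<^sub>g * (C\<^sub>S * Gamma \<delta>\<^sub>Y / (\<mu> - (N\<^sub>F \<zeta> + \<omega>\<^sub>A / \<zeta>)) powr \<delta>\<^sub>Y)
     + L\<^sub>g * \<zeta> powr (\<delta>\<^sub>Y - 1) * (M\<^sub>S / (N\<^sub>S \<zeta> + \<omega>\<^sub>A / \<zeta> - \<mu>))"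

lemma dichotomy: "N\<^sub>F \<zeta> < N\<^sub>S \<zeta>" using dichotomy_const(3)[OF zeta] by simp

lemma eta_distances:
  "\<epsilon> * (\<eta> - \<omega>\<^sub>A / \<epsilon>) = (2 * (\<epsilon> / \<zeta> - 1) * \<omega>\<^sub>A + \<epsilon> * (N\<^sub>S \<zeta> + N\<^sub>F \<zeta>)) / 2"
  "\<eta> - (N\<^sub>F \<zeta> + \<omega>\<^sub>A / \<zeta>) = (N\<^sub>S \<zeta> - N\<^sub>F \<zeta>) / 2"
  "N\<^sub>S \<zeta> + \<omega>\<^sub>A / \<zeta> - \<eta> = (N\<^sub>S \<zeta> - N\<^sub>F \<zeta>) / 2"
  using eps_pos zeta by (simp_all add: eta_def field_simps)

lemma admissible_eta: "admissible \<eta>"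
proof -
  have "\<epsilon> * (\<eta> - \<omega>\<^sub>A / \<epsilon>) > 0" using gap_base unfolding eta_distances by simp
  then have "\<eta> - \<omega>\<^sub>A / \<epsilon> > 0" using eps_pos by (simp add: zero_less_mult_iff)
  moreover have "\<eta> - (N\<^sub>F \<zeta> + \<omega>\<^sub>A / \<zeta>) > 0" "N\<^sub>S \<zeta> + \<omega>\<^sub>A / \<zeta> - \<eta> > 0" unfolding eta_distances using dichotomy by auto
  ultimately show ?thesis by (simp add: admissible_def)
qed

text \<open>
  The gap condition. Its third summand contains a factor \<open>Gamma \<delta>\<^sub>Y\<close>, absent from \<open>rate\<close>, which is
  at least \<open>1\<close>.
\<close>

lemma rate_eta: "rate \<eta> < 1"
proof -
  let ?b = "2 * (\<epsilon> / \<zeta> - 1) * \<omega>\<^sub>A + \<epsilon> * (N\<^sub>S \<zeta> + N\<^sub>F \<zeta>)" and ?d = "N\<^sub>S \<zeta> - N\<^sub>F \<zeta>"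
  have d: "?d > 0" using dichotomy by simp
  have half: "(x / 2) powr a = x powr a / 2 powr a" if "x > 0" for x a :: real using that by (simp add: powr_divide)
  have 1: "L\<^sub>f * (C\<^sub>A * Gamma \<gamma>\<^sub>X / (?b / 2) powr \<gamma>\<^sub>X) = 2 powr \<gamma>\<^sub>X * L\<^sub>f * C\<^sub>A * Gamma \<gamma>\<^sub>X / ?b powr \<gamma>\<^sub>X"
    unfolding half[OF gap_base] by simp
  have 2: "L\<^sub>g * (C\<^sub>S * Gamma \<delta>\<^sub>Y / (?d / 2) powr \<delta>\<^sub>Y) = 2 powr \<delta>\<^sub>Y * L\<^sub>g * C\<^sub>S * Gamma \<delta>\<^sub>Y / ?d powr \<delta>\<^sub>Y"
    unfolding half[OF d] by simp
  have "L\<^sub>g * \<zeta> powr (\<delta>\<^sub>Y - 1) * (M\<^sub>S / (?d / 2)) = (2 * \<zeta> powr (\<delta>\<^sub>Y - 1) * L\<^sub>g * M\<^sub>S / ?d) * 1" by simp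
  also have "\<dots> \<le> (2 * \<zeta> powr (\<delta>\<^sub>Y - 1) * L\<^sub>g * M\<^sub>S / ?d) * Gamma \<delta>\<^sub>Y"
    using Gamma_ge_1[OF delta_Y(1,2)] Lip_pos dichotomy_const d by (intro mult_left_mono) auto
  finally have 3: "L\<^sub>g * \<zeta> powr (\<delta>\<^sub>Y - 1) * (M\<^sub>S / (?d / 2)) \<le> 2 * \<zeta> powr (\<delta>\<^sub>Y - 1) * L\<^sub>g * M\<^sub>S * Gamma \<delta>\<^sub>Y / ?d" by simp
  show ?thesis unfolding rate_def eta_distances 1 2 using gap 3 by linarith
qed

lemma rate_nonneg: "admissible \<mu> \<Longrightarrow> 0 \<le> rate \<mu>"
  unfolding rate_def admissible_def
  using Lip_pos const_pos dichotomy_const Gamma_real_pos[OF gamma_X(1)] Gamma_real_pos[OF delta_Y(1)]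
  by (intro add_nonneg_nonneg mult_nonneg_nonneg divide_nonneg_nonneg) auto

lemma smaller_weight: "\<exists>\<mu><\<eta>. admissible \<mu> \<and> rate \<mu> < 1"
proof -
  have a: "\<omega>\<^sub>A / \<epsilon> < \<eta>" "N\<^sub>F \<zeta> + \<omega>\<^sub>A / \<zeta> < \<eta>" "\<eta> < N\<^sub>S \<zeta> + \<omega>\<^sub>A / \<zeta>" using admissible_eta by (auto simp: admissible_def)
  have "(rate \<longlongrightarrow> rate \<eta>) (at_left \<eta>)"
    unfolding rate_def[abs_def] using a eps_pos by (intro tendsto_intros) auto
  then have "\<forall>\<^sub>F \<mu> in at_left \<eta>. rate \<mu> < 1" using rate_eta by (rule order_tendstoD(2))
  moreover have "\<forall>\<^sub>F \<mu> in at_left \<eta>. \<omega>\<^sub>A / \<epsilon> < \<mu>" "\<forall>\<^sub>F \<mu> in at_left \<eta>. N\<^sub>F \<zeta> + \<omega>\<^sub>A / \<zeta> < \<mu>"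
    using a order_tendstoD(1)[OF tendsto_ident_at] by auto
  moreover have "\<forall>\<^sub>F \<mu> in at_left \<eta>. \<mu> < \<eta>" by (simp add: eventually_at_filter)
  ultimately have "\<forall>\<^sub>F \<mu> in at_left \<eta>. \<mu> < \<eta> \<and> admissible \<mu> \<and> rate \<mu> < 1"
    by eventually_elim (use a in \<open>auto simp: admissible_def\<close>)
  then show ?thesis using eventually_happens' [OF trivial_limit_at_left_real] by blast
qed

text \<open>A slightly smaller weight for which the gap estimate persists.\<close>

definition \<eta>\<^sub>1 :: real where "\<eta>\<^sub>1 = (SOME \<mu>. \<mu> < \<eta> \<and> admissible \<mu> \<and> rate \<mu> < 1)"

lemma eta1: "\<eta>\<^sub>1 < \<eta>" "admissible \<eta>\<^sub>1" "rate \<eta>\<^sub>1 < 1"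
proof -
  have "\<exists>\<mu>. \<mu> < \<eta> \<and> admissible \<mu> \<and> rate \<mu> < 1" using smaller_weight by blast
  from someI_ex[OF this] show "\<eta>\<^sub>1 < \<eta>" "admissible \<eta>\<^sub>1" "rate \<eta>\<^sub>1 < 1" unfolding \<eta>\<^sub>1_def[symmetric] by auto
qed

lemma kerX_integral:
  assumes "admissible \<mu>"
  shows "((\<lambda>r. kerX r * exp (- \<mu> * r)) has_integral
    \<epsilon> * (C\<^sub>A * Gamma \<gamma>\<^sub>X / (\<epsilon> * (\<mu> - \<omega>\<^sub>A / \<epsilon>)) powr \<gamma>\<^sub>X)) {0<..}"
proof -
  have l: "\<mu> - \<omega>\<^sub>A / \<epsilon> > 0" using assms by (simp add: admissible_def)
  have gamma: "((\<lambda>r. C\<^sub>A * \<epsilon> powr (1 - \<gamma>\<^sub>X) * (r powr (\<gamma>\<^sub>X - 1) * exp (- (\<mu> - \<omega>\<^sub>A / \<epsilon>) * r))) has_integral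
      C\<^sub>A * \<epsilon> powr (1 - \<gamma>\<^sub>X) * (Gamma \<gamma>\<^sub>X / (\<mu> - \<omega>\<^sub>A / \<epsilon>) powr \<gamma>\<^sub>X)) {0<..}"
    by (rule has_integral_mult_right[OF has_integral_Gamma_scaled[OF gamma_X(1) l]])
  have ker: "C\<^sub>A * \<epsilon> powr (1 - \<gamma>\<^sub>X) * (r powr (\<gamma>\<^sub>X - 1) * exp (- (\<mu> - \<omega>\<^sub>A / \<epsilon>) * r)) = kerX r * exp (- \<mu> * r)"
    if "r \<in> {0<..}" for r
  proof -
    have "(r / \<epsilon>) powr (\<gamma>\<^sub>X - 1) = r powr (\<gamma>\<^sub>X - 1) * \<epsilon> powr (1 - \<gamma>\<^sub>X)"
    proof -
      have "(r / \<epsilon>) powr (\<gamma>\<^sub>X - 1) = r powr (\<gamma>\<^sub>X - 1) / \<epsilon> powr (\<gamma>\<^sub>X - 1)"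
        using that eps_pos by (simp add: powr_divide)
      moreover have "\<epsilon> powr (1 - \<gamma>\<^sub>X) = inverse (\<epsilon> powr (\<gamma>\<^sub>X - 1))"
        using powr_minus[of \<epsilon> "\<gamma>\<^sub>X - 1"] by simp
      ultimately show ?thesis by (simp only: divide_inverse)
    qed
    moreover have "exp (- (\<mu> - \<omega>\<^sub>A / \<epsilon>) * r) = exp (\<omega>\<^sub>A * (r / \<epsilon>)) * exp (- \<mu> * r)"
      by (simp add: exp_add[symmetric] algebra_simps)
    ultimately show ?thesis by (simp add: kerX_def)
  qed
  have val: "C\<^sub>A * \<epsilon> powr (1 - \<gamma>\<^sub>X) * (Gamma \<gamma>\<^sub>X / (\<mu> - \<omega>\<^sub>A / \<epsilon>) powr \<gamma>\<^sub>X)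
      = \<epsilon> * (C\<^sub>A * Gamma \<gamma>\<^sub>X / (\<epsilon> * (\<mu> - \<omega>\<^sub>A / \<epsilon>)) powr \<gamma>\<^sub>X)"
  proof -
    have a: "(\<epsilon> * (\<mu> - \<omega>\<^sub>A / \<epsilon>)) powr \<gamma>\<^sub>X = \<epsilon> powr \<gamma>\<^sub>X * (\<mu> - \<omega>\<^sub>A / \<epsilon>) powr \<gamma>\<^sub>X"
      by (rule powr_mult)
    have b: "\<epsilon> powr (1 - \<gamma>\<^sub>X) = \<epsilon> / \<epsilon> powr \<gamma>\<^sub>X" using eps_pos by (simp add: powr_diff)
    show ?thesis unfolding a b by (simp add: mult_ac)
  qed
  show ?thesis by (rule has_integral_eq[OF ker gamma[unfolded val]])
qed

lemma kerF_integral: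
  assumes "admissible \<mu>"
  shows "((\<lambda>r. kerF r * exp (- \<mu> * r)) has_integral
    C\<^sub>S * Gamma \<delta>\<^sub>Y / (\<mu> - (N\<^sub>F \<zeta> + \<omega>\<^sub>A / \<zeta>)) powr \<delta>\<^sub>Y) {0<..}"
proof -
  have l: "\<mu> - (N\<^sub>F \<zeta> + \<omega>\<^sub>A / \<zeta>) > 0" using assms by (simp add: admissible_def)
  have "((\<lambda>r. C\<^sub>S * (r powr (\<delta>\<^sub>Y - 1) * exp (- (\<mu> - (N\<^sub>F \<zeta> + \<omega>\<^sub>A / \<zeta>)) * r))) has_integral
      C\<^sub>S * (Gamma \<delta>\<^sub>Y / (\<mu> - (N\<^sub>F \<zeta> + \<omega>\<^sub>A / \<zeta>)) powr \<delta>\<^sub>Y)) {0<..}"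
    by (rule has_integral_mult_right[OF has_integral_Gamma_scaled[OF delta_Y(1) l]])
  moreover have "C\<^sub>S * (r powr (\<delta>\<^sub>Y - 1) * exp (- (\<mu> - (N\<^sub>F \<zeta> + \<omega>\<^sub>A / \<zeta>)) * r)) = kerF r * exp (- \<mu> * r)" for r
  proof -
    have "exp (- (\<mu> - (N\<^sub>F \<zeta> + \<omega>\<^sub>A / \<zeta>)) * r) = exp ((N\<^sub>F \<zeta> + \<omega>\<^sub>A / \<zeta>) * r) * exp (- \<mu> * r)"
      by (simp add: exp_add[symmetric] algebra_simps)
    then show ?thesis by (simp add: kerF_def)
  qed
  ultimately show ?thesis by simp
qed

section \<open>The Lyapunov-Perron operator on weighted path spaces\<close>

text \<open>
  The state space \<open>Zs\<close> of the paths, and the space \<open>Ws\<close> of the values of the nonlinearity,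
  weighted by the Lipschitz constants of its components.
\<close>

abbreviation (input) "Zs \<equiv> prod_ns (X 1) (prod_ns Y1F Y1S)"
abbreviation (input) "Ws \<equiv> max_ns L\<^sub>f (X \<gamma>\<^sub>X) 1 (max_ns L\<^sub>g YdF (L\<^sub>g * \<zeta> powr (\<delta>\<^sub>Y - 1)) Y1S)"
abbreviation (input) "scZ \<equiv> prod_scale sX (prod_scale sY sY)"

text \<open>
  The integral part of the Lyapunov-Perron operator, as a linear operator on the forcing \<open>w\<close>. The
  sign in the last component is due to the orientation of \<open>{t..0}\<close>.
\<close>

definition LP :: "(real \<Rightarrow> 'x \<times> 'y \<times> 'y) \<Rightarrow> real \<Rightarrow> 'x \<times> 'y \<times> 'y" where
  "LP w t = ((1 / \<epsilon>) *\<^sub>R integral {..t} (\<lambda>s. TA ((t - s) / \<epsilon>) (fst (w s))),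
     integral {..t} (\<lambda>s. TB (t - s) (fst (snd (w s)))),
     - integral {t..0} (\<lambda>s. GB \<zeta> (t - s) (snd (snd (w s)))))"

lemma weight_S: "L\<^sub>g * \<zeta> powr (\<delta>\<^sub>Y - 1) > 0" using Lip_pos zeta by simp

lemma banach_Z: "banach_space_on scZ Zs"
  by (intro banach_prod_ns X1.banach_space_on_axioms Y1F.banach_space_on_axioms Y1S.banach_space_on_axioms)

lemma normed_W: "normed_space_on scZ Ws"
  by (intro normed_max_ns Xg.normed_space_on_axioms YdF.normed_space_on_axioms Y1S.normed_space_on_axioms)
    (use Lip_pos weight_S in auto)

lemma W_components:
  assumes w: "continuous_path Ws {..0} w"
  shows "continuous_path (X \<gamma>\<^sub>X) {..0} (\<lambda>s. fst (w s))" "continuous_path YdF {..0} (\<lambda>s. fst (snd (w s)))"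
    "continuous_path Y1S {..0} (\<lambda>s. snd (snd (w s)))"
proof -
  have n: "normed_space_on (prod_scale sY sY) (max_ns L\<^sub>g YdF (L\<^sub>g * \<zeta> powr (\<delta>\<^sub>Y - 1)) Y1S)"
    by (intro normed_max_ns YdF.normed_space_on_axioms Y1S.normed_space_on_axioms) (use Lip_pos weight_S in auto)
  note 1 = continuous_path_max_ns[OF Xg.normed_space_on_axioms n Lip_pos(1) zero_less_one w]
  show "continuous_path (X \<gamma>\<^sub>X) {..0} (\<lambda>s. fst (w s))" by (rule 1(1))
  show "continuous_path YdF {..0} (\<lambda>s. fst (snd (w s)))" "continuous_path Y1S {..0} (\<lambda>s. snd (snd (w s)))"
    using continuous_path_max_ns[OF YdF.normed_space_on_axioms Y1S.normed_space_on_axioms Lip_pos(2) weight_S 1(2)] by auto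
qed

lemma W_bounds:
  assumes "nrm Ws z \<le> c * e"
  shows "nrm (X \<gamma>\<^sub>X) (fst z) \<le> L\<^sub>f * c * e" "nrm YdF (fst (snd z)) \<le> L\<^sub>g * c * e"
    "nrm Y1S (snd (snd z)) \<le> L\<^sub>g * \<zeta> powr (\<delta>\<^sub>Y - 1) * c * e"
  using assms Lip_pos weight_S by (cases z; simp add: pos_divide_le_eq mult_ac)+

context
  fixes \<mu> c :: real and w
  assumes \<mu>: "admissible \<mu>" and w: "continuous_path Ws {..0} w"
    and wb: "\<And>s. s \<le> 0 \<Longrightarrow> nrm Ws (w s) \<le> c * exp (\<mu> * s)"
begin

lemmas w_bounds = W_bounds[OF wb]

lemma
  shows convX_integrable: "t \<le> 0 \<Longrightarrow> (\<lambda>s. TA ((t - s) / \<epsilon>) (fst (w s))) integrable_on {..t}"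
    and convX_in: "t \<le> 0 \<Longrightarrow> integral {..t} (\<lambda>s. TA ((t - s) / \<epsilon>) (fst (w s))) \<in> carr (X 1)"
    and convX_bound: "t \<le> 0 \<Longrightarrow> nrm (X 1) (integral {..t} (\<lambda>s. TA ((t - s) / \<epsilon>) (fst (w s))))
      \<le> L\<^sub>f * c * (\<epsilon> * (C\<^sub>A * Gamma \<gamma>\<^sub>X / (\<epsilon> * (\<mu> - \<omega>\<^sub>A / \<epsilon>)) powr \<gamma>\<^sub>X)) * exp (\<mu> * t)"
    and convX_path: "continuous_path (X 1) {..0} (\<lambda>t. integral {..t} (\<lambda>s. TA ((t - s) / \<epsilon>) (fst (w s))))"
  by (rule convX.convolution[OF refl W_components(1)[OF w] w_bounds(1) kerX_integral[OF \<mu>]]; assumption)+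

lemma
  shows convF_integrable: "t \<le> 0 \<Longrightarrow> (\<lambda>s. TB (t - s) (fst (snd (w s)))) integrable_on {..t}"
    and convF_in: "t \<le> 0 \<Longrightarrow> integral {..t} (\<lambda>s. TB (t - s) (fst (snd (w s)))) \<in> carr Y1F"
    and convF_bound: "t \<le> 0 \<Longrightarrow> nrm Y1F (integral {..t} (\<lambda>s. TB (t - s) (fst (snd (w s)))))
      \<le> L\<^sub>g * c * (C\<^sub>S * Gamma \<delta>\<^sub>Y / (\<mu> - (N\<^sub>F \<zeta> + \<omega>\<^sub>A / \<zeta>)) powr \<delta>\<^sub>Y) * exp (\<mu> * t)"
    and convF_path: "continuous_path Y1F {..0} (\<lambda>t. integral {..t} (\<lambda>s. TB (t - s) (fst (snd (w s)))))"
  by (rule convF.convolution[OF refl W_components(2)[OF w] w_bounds(2) kerF_integral[OF \<mu>]]; assumption)+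

lemma slow_rate: "- (N\<^sub>S \<zeta> + \<omega>\<^sub>A / \<zeta>) + \<mu> < 0" using \<mu> by (simp add: admissible_def)

lemma
  shows convS_integrable: "t \<le> 0 \<Longrightarrow> (\<lambda>s. GB \<zeta> (t - s) (snd (snd (w s)))) integrable_on {t..0}"
    and convS_in: "t \<le> 0 \<Longrightarrow> integral {t..0} (\<lambda>s. GB \<zeta> (t - s) (snd (snd (w s)))) \<in> carr Y1S"
    and convS_bound: "t \<le> 0 \<Longrightarrow> nrm Y1S (integral {t..0} (\<lambda>s. GB \<zeta> (t - s) (snd (snd (w s)))))
      \<le> L\<^sub>g * \<zeta> powr (\<delta>\<^sub>Y - 1) * c * (M\<^sub>S / - (- (N\<^sub>S \<zeta> + \<omega>\<^sub>A / \<zeta>) + \<mu>)) * exp (\<mu> * t)"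
    and convS_path: "continuous_path Y1S {..0} (\<lambda>t. integral {t..0} (\<lambda>s. GB \<zeta> (t - s) (snd (snd (w s)))))"
  by (rule convS.backward_convolution[OF refl kerS_def slow_rate W_components(3)[OF w] w_bounds(3), unfolded minus_diff_eq]; assumption)+

lemma LP_path: "continuous_path Zs {..0} (LP w)"
  unfolding continuous_path_prod_ns[OF X1.normed_space_on_axioms
      normed_prod_ns[OF Y1F.normed_space_on_axioms Y1S.normed_space_on_axioms]]
    continuous_path_prod_ns[OF Y1F.normed_space_on_axioms Y1S.normed_space_on_axioms] LP_def fst_conv snd_conv
proof (intro conjI)
  show "continuous_path (X 1) {..0} (\<lambda>t. (1 / \<epsilon>) *\<^sub>R integral {..t} (\<lambda>s. TA ((t - s) / \<epsilon>) (fst (w s))))"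
    by (rule X1.continuous_path_scaleR[OF convX_path])
  show "continuous_path Y1F {..0} (\<lambda>t. integral {..t} (\<lambda>s. TB (t - s) (fst (snd (w s)))))" by (rule convF_path)
  show "continuous_path Y1S {..0} (\<lambda>t. - integral {t..0} (\<lambda>s. GB \<zeta> (t - s) (snd (snd (w s)))))"
    using Y1S.continuous_path_scaleR[OF convS_path, of "-1"] by simp
qed

lemma LP_bound:
  assumes t: "t \<le> 0"
  shows "nrm Zs (LP w t) \<le> rate \<mu> * c * exp (\<mu> * t)"
proof -
  let ?X = "integral {..t} (\<lambda>s. TA ((t - s) / \<epsilon>) (fst (w s)))"
  let ?F = "integral {..t} (\<lambda>s. TB (t - s) (fst (snd (w s))))"
  let ?S = "integral {t..0} (\<lambda>s. GB \<zeta> (t - s) (snd (snd (w s))))"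
  have "nrm (X 1) ((1 / \<epsilon>) *\<^sub>R ?X) = 1 / \<epsilon> * nrm (X 1) ?X"
    using X1.nrm_scaleR[OF convX_in[OF t], of "1 / \<epsilon>"] eps_pos by simp
  also have "\<dots> \<le> 1 / \<epsilon> * (L\<^sub>f * c * (\<epsilon> * (C\<^sub>A * Gamma \<gamma>\<^sub>X / (\<epsilon> * (\<mu> - \<omega>\<^sub>A / \<epsilon>)) powr \<gamma>\<^sub>X)) * exp (\<mu> * t))"
    using convX_bound[OF t] eps_pos by (intro mult_left_mono) auto
  also have "\<dots> = L\<^sub>f * (C\<^sub>A * Gamma \<gamma>\<^sub>X / (\<epsilon> * (\<mu> - \<omega>\<^sub>A / \<epsilon>)) powr \<gamma>\<^sub>X) * c * exp (\<mu> * t)"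
    using eps_pos by simp
  finally have 1: "nrm (X 1) ((1 / \<epsilon>) *\<^sub>R ?X) \<le> L\<^sub>f * (C\<^sub>A * Gamma \<gamma>\<^sub>X / (\<epsilon> * (\<mu> - \<omega>\<^sub>A / \<epsilon>)) powr \<gamma>\<^sub>X) * c * exp (\<mu> * t)" .
  have 2: "nrm (Y 1) ?F \<le> L\<^sub>g * (C\<^sub>S * Gamma \<delta>\<^sub>Y / (\<mu> - (N\<^sub>F \<zeta> + \<omega>\<^sub>A / \<zeta>)) powr \<delta>\<^sub>Y) * c * exp (\<mu> * t)"
    using convF_bound[OF t] by (simp add: mult_ac)
  have sign: "- (- (N\<^sub>S \<zeta> + \<omega>\<^sub>A / \<zeta>) + \<mu>) = N\<^sub>S \<zeta> + \<omega>\<^sub>A / \<zeta> - \<mu>" by simp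
  have 3: "nrm (Y 1) (- ?S) \<le> L\<^sub>g * \<zeta> powr (\<delta>\<^sub>Y - 1) * (M\<^sub>S / (N\<^sub>S \<zeta> + \<omega>\<^sub>A / \<zeta> - \<mu>)) * c * exp (\<mu> * t)"
    using convS_bound[OF t] Y1S.nrm_minus[OF convS_in[OF t]] unfolding sign by (simp add: mult_ac)
  show ?thesis using 1 2 3 by (simp add: LP_def rate_def distrib_right)
qed

end

lemma LP_add:
  assumes w: "continuous_path Ws {..0} w" "\<And>s. s \<le> 0 \<Longrightarrow> nrm Ws (w s) \<le> c * exp (\<mu> * s)"
    and w': "continuous_path Ws {..0} w'" "\<And>s. s \<le> 0 \<Longrightarrow> nrm Ws (w' s) \<le> c' * exp (\<mu> * s)"
    and \<mu>: "admissible \<mu>" and t: "t \<le> 0"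
  shows "LP (\<lambda>s. w s + w' s) t = LP w t + LP w' t"
proof -
  note i = convX_integrable[OF \<mu> w t] convF_integrable[OF \<mu> w t] convS_integrable[OF \<mu> w t]
  note i' = convX_integrable[OF \<mu> w' t] convF_integrable[OF \<mu> w' t] convS_integrable[OF \<mu> w' t]
  note v = Xg.continuous_pathD[OF W_components(1)[OF w(1)]] YdF.continuous_pathD[OF W_components(2)[OF w(1)]]
    Y1S.continuous_pathD[OF W_components(3)[OF w(1)]]
  note v' = Xg.continuous_pathD[OF W_components(1)[OF w'(1)]] YdF.continuous_pathD[OF W_components(2)[OF w'(1)]]
    Y1S.continuous_pathD[OF W_components(3)[OF w'(1)]]
  have "integral {..t} (\<lambda>s. TA ((t - s) / \<epsilon>) (fst (w s + w' s)))
      = integral {..t} (\<lambda>s. TA ((t - s) / \<epsilon>) (fst (w s)) + TA ((t - s) / \<epsilon>) (fst (w' s)))"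
    using t eps_pos Xg_X0 v(1) v'(1) by (intro integral_cong) (auto intro!: TA.T_add)
  moreover have "integral {..t} (\<lambda>s. TB (t - s) (fst (snd (w s + w' s))))
      = integral {..t} (\<lambda>s. TB (t - s) (fst (snd (w s))) + TB (t - s) (fst (snd (w' s))))"
    using t Yd_Y0 v(2) v'(2) by (intro integral_cong) (auto intro!: TB.T_add)
  moreover have "integral {t..0} (\<lambda>s. GB \<zeta> (t - s) (snd (snd (w s + w' s))))
      = integral {t..0} (\<lambda>s. GB \<zeta> (t - s) (snd (snd (w s))) + GB \<zeta> (t - s) (snd (snd (w' s))))"
    using v(3) v'(3) by (intro integral_cong) (auto intro!: GB_add)
  ultimately show ?thesis
    unfolding LP_def using integral_add[OF i(1) i'(1)] integral_add[OF i(2) i'(2)] integral_add[OF i(3) i'(3)]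
    by (simp add: scaleR_add_right)
qed

lemma LP_scale:
  assumes w: "continuous_path Ws {..0} w" "\<And>s. s \<le> 0 \<Longrightarrow> nrm Ws (w s) \<le> c * exp (\<mu> * s)"
    and \<mu>: "admissible \<mu>" and t: "t \<le> 0"
  shows "LP (\<lambda>s. scZ a (w s)) t = scZ a (LP w t)"
proof -
  note i = convX_integrable[OF \<mu> w t] convF_integrable[OF \<mu> w t] convS_integrable[OF \<mu> w t]
  note v = Xg.continuous_pathD[OF W_components(1)[OF w(1)]] YdF.continuous_pathD[OF W_components(2)[OF w(1)]]
    Y1S.continuous_pathD[OF W_components(3)[OF w(1)]]
  have pr: "fst (scZ a z) = sX a (fst z)" "fst (snd (scZ a z)) = sY a (fst (snd z))" "snd (snd (scZ a z)) = sY a (snd (snd z))" for z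
    by (cases z; simp add: prod_scale_def)+
  have "integral {..t} (\<lambda>s. TA ((t - s) / \<epsilon>) (fst (scZ a (w s))))
      = integral {..t} (\<lambda>s. sX a (TA ((t - s) / \<epsilon>) (fst (w s))))"
    unfolding pr using t eps_pos Xg_X0 v(1) by (intro integral_cong) (auto intro!: TA.T_scale)
  also have "\<dots> = sX a (integral {..t} (\<lambda>s. TA ((t - s) / \<epsilon>) (fst (w s))))"
    using integral_linear[OF i(1) bounded_linear_sX] by (simp add: comp_def)
  finally have 1: "integral {..t} (\<lambda>s. TA ((t - s) / \<epsilon>) (fst (scZ a (w s)))) = sX a (integral {..t} (\<lambda>s. TA ((t - s) / \<epsilon>) (fst (w s))))" .
  have "integral {..t} (\<lambda>s. TB (t - s) (fst (snd (scZ a (w s)))))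
      = integral {..t} (\<lambda>s. sY a (TB (t - s) (fst (snd (w s)))))"
    unfolding pr using t Yd_Y0 v(2) by (intro integral_cong) (auto intro!: TB.T_scale)
  also have "\<dots> = sY a (integral {..t} (\<lambda>s. TB (t - s) (fst (snd (w s)))))"
    using integral_linear[OF i(2) bounded_linear_sY] by (simp add: comp_def)
  finally have 2: "integral {..t} (\<lambda>s. TB (t - s) (fst (snd (scZ a (w s))))) = sY a (integral {..t} (\<lambda>s. TB (t - s) (fst (snd (w s)))))" .
  have "integral {t..0} (\<lambda>s. GB \<zeta> (t - s) (snd (snd (scZ a (w s)))))
      = integral {t..0} (\<lambda>s. sY a (GB \<zeta> (t - s) (snd (snd (w s)))))"
    unfolding pr using v(3) by (intro integral_cong) (auto intro!: GB_scale)
  also have "\<dots> = sY a (integral {t..0} (\<lambda>s. GB \<zeta> (t - s) (snd (snd (w s)))))"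
    using integral_linear[OF i(3) bounded_linear_sY] by (simp add: comp_def)
  finally have 3: "integral {t..0} (\<lambda>s. GB \<zeta> (t - s) (snd (snd (scZ a (w s))))) = sY a (integral {t..0} (\<lambda>s. GB \<zeta> (t - s) (snd (snd (w s)))))" .
  have "scZ a (x, y, z) = (sX a x, sY a y, sY a z)" for x y z by (simp add: prod_scale_def)
  then show ?thesis
    unfolding LP_def 1 2 3
    by (simp add: linear_scale[OF bounded_linear.linear[OF bounded_linear_sX]] linear_neg[OF bounded_linear.linear[OF bounded_linear_sY]])
qed

lemma LP_cong:
  assumes "\<And>s. s \<le> 0 \<Longrightarrow> w s = w' s" and t: "t \<le> 0"
  shows "LP w t = LP w' t"
  unfolding LP_def using assms by (auto intro!: arg_cong[where f = "(*\<^sub>R) (1 / \<epsilon>)"] integral_cong)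

text \<open>The solution of the equation with zero nonlinearity.\<close>

definition free_path :: "'y \<Rightarrow> real \<Rightarrow> 'x \<times> 'y \<times> 'y" where "free_path v t = (0, 0, GB \<zeta> t v)"

lemma free_path_continuous:
  assumes v: "v \<in> carr Y1S"
  shows "continuous_path Zs {..0} (free_path v)"
proof -
  have "continuous_path Y1S {..0} (\<lambda>t. GB \<zeta> (- (- t)) v)"
    by (rule Y1S.continuous_path_compose[OF GB.orbit1[OF v]]) (auto intro!: continuous_intros)
  then show ?thesis
    unfolding continuous_path_prod_ns[OF X1.normed_space_on_axioms
      normed_prod_ns[OF Y1F.normed_space_on_axioms Y1S.normed_space_on_axioms]]
    continuous_path_prod_ns[OF Y1F.normed_space_on_axioms Y1S.normed_space_on_axioms] free_path_def fst_conv snd_conv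
    using X1.continuous_path_const[OF X1.zero_in] Y1F.continuous_path_const[OF Y1F.zero_in] by simp
qed

lemma free_path_bound:
  assumes v: "v \<in> carr Y1S" and t: "t \<le> 0"
  shows "nrm Zs (free_path v t) \<le> M\<^sub>S * nrm Y1S v * exp (\<eta> * t)"
proof -
  have "nrm (Y 1) (GB \<zeta> t v) \<le> M\<^sub>S * exp (- (N\<^sub>S \<zeta> + \<omega>\<^sub>A / \<zeta>) * (- t)) * nrm (Y 1) v"
    using slow_bound[OF zeta, of "- t"] t v by (simp add: opbound_def)
  also have "\<dots> \<le> M\<^sub>S * exp (\<eta> * t) * nrm (Y 1) v"
  proof -
    have "- (N\<^sub>S \<zeta> + \<omega>\<^sub>A / \<zeta>) * (- t) = (N\<^sub>S \<zeta> + \<omega>\<^sub>A / \<zeta>) * t" by (rule minus_mult_minus)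
    also have "\<dots> \<le> \<eta> * t"
      using admissible_eta t by (intro mult_right_mono_neg) (auto simp: admissible_def)
    finally have "exp (- (N\<^sub>S \<zeta> + \<omega>\<^sub>A / \<zeta>) * (- t)) \<le> exp (\<eta> * t)" by (simp only: exp_le_cancel_iff)
    then show ?thesis using dichotomy_const(2) Y1S.nrm_nonneg[OF v]
      by (intro mult_right_mono mult_left_mono) auto
  qed
  finally show ?thesis by (simp add: free_path_def mult_ac)
qed

section \<open>The nonlinearity\<close>

text \<open>The arguments \<open>(x, y\<^sub>F + y\<^sub>S)\<close> at which \<open>f\<close> and \<open>g\<close> are evaluated.\<close>

definition slow_sum :: "'x \<times> 'y \<times> 'y \<Rightarrow> 'x \<times> 'y" where "slow_sum z = (fst z, fst (snd z) + snd (snd z))"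

text \<open>The nonlinearity, with \<open>g\<close> split into its fast and its slow part.\<close>

definition nonlin :: "'x \<times> 'y \<times> 'y \<Rightarrow> 'x \<times> 'y \<times> 'y" where
  "nonlin z = (case_prod f (slow_sum z), PF (case_prod g (slow_sum z)), PS (case_prod g (slow_sum z)))"

lemma nonlin_eq: "nonlin (x, a, b) = (f x (a + b), PF (g x (a + b)), PS (g x (a + b)))"
  by (simp add: nonlin_def slow_sum_def)

lemma slow_sum_linear: "linear_between scZ (prod_scale sX sY) (carr Zs) (carr (prod_ns (X 1) (Y 1))) slow_sum"
  unfolding linear_between_def slow_sum_def
  by (auto simp: prod_scale_def module.scale_right_distrib[OF Y0.module_sc] algebra_simps)

lemma slow_sum_bound: "opbound Zs (prod_ns (X 1) (Y 1)) slow_sum 1"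
  unfolding opbound_def slow_sum_def
proof (clarsimp)
  fix a b assume "a \<in> YF \<zeta>" "a \<in> carr (Y 1)" "b \<in> YS \<zeta>" "b \<in> carr (Y 1)"
  then show "nrm (Y 1) (a + b) \<le> nrm (Y 1) a + nrm (Y 1) b" by (intro Y1.nrm_triangle)
qed

lemma nonlin_0: "nonlin 0 = 0"
proof -
  have "PF 0 = 0" "PS 0 = 0" using split.P_diff[of 0 0] split.Q_diff[of 0 0] by simp_all
  then show ?thesis by (simp add: nonlin_def slow_sum_def fg_zero zero_prod_def)
qed

lemma nonlin_Lipschitz:
  assumes fast: "\<And>x1 x2 a1 a2 b1 b2.
      x1 \<in> carr (X 1) \<Longrightarrow> x2 \<in> carr (X 1) \<Longrightarrow>
      a1 \<in> YF \<zeta> \<inter> carr (Y 1) \<Longrightarrow> a2 \<in> YF \<zeta> \<inter> carr (Y 1) \<Longrightarrow>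
      b1 \<in> YS \<zeta> \<inter> carr (Y 1) \<Longrightarrow> b2 \<in> YS \<zeta> \<inter> carr (Y 1) \<Longrightarrow>
      nrm (Y \<delta>\<^sub>Y) (PF (g x1 (a1 + b1) - g x2 (a2 + b2)))
        \<le> L\<^sub>g * (nrm (X 1) (x1 - x2) + nrm (Y 1) (a1 - a2) + nrm (Y 1) (b1 - b2))"
    and z: "z \<in> carr Zs" "z' \<in> carr Zs"
  shows "nrm Ws (nonlin z - nonlin z') \<le> nrm Zs (z - z')"
proof -
  obtain x a b x' a' b' where zz: "z = (x, a, b)" "z' = (x', a', b')" by (metis prod.exhaust)
  have m: "x \<in> carr (X 1)" "x' \<in> carr (X 1)" "a \<in> YF \<zeta> \<inter> carr (Y 1)" "a' \<in> YF \<zeta> \<inter> carr (Y 1)"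
    "b \<in> YS \<zeta> \<inter> carr (Y 1)" "b' \<in> YS \<zeta> \<inter> carr (Y 1)" using z zz by auto
  have s: "a + b \<in> carr (Y 1)" "a' + b' \<in> carr (Y 1)" using m by auto
  let ?n = "nrm (X 1) (x - x') + nrm (Y 1) (a - a') + nrm (Y 1) (b - b')"
  have g0: "g x (a + b) \<in> carr (Y 0)" "g x' (a' + b') \<in> carr (Y 0)" using fg_range m s Yd_Y0 by auto
  have "nrm (X \<gamma>\<^sub>X) (f x (a + b) - f x' (a' + b')) \<le> L\<^sub>f * (nrm (X 1) (x - x') + nrm (Y 1) ((a + b) - (a' + b')))"
    by (rule f_Lip) (use m s in auto)
  also have "\<dots> \<le> L\<^sub>f * ?n"
  proof (rule mult_left_mono)
    have eq: "(a + b) - (a' + b') = (a - a') + (b - b')" by simp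
    have "nrm (Y 1) ((a - a') + (b - b')) \<le> nrm (Y 1) (a - a') + nrm (Y 1) (b - b')"
      using m by (intro Y1.nrm_triangle) auto
    then show "nrm (X 1) (x - x') + nrm (Y 1) ((a + b) - (a' + b')) \<le> ?n" unfolding eq by simp
  qed (use Lip_pos in simp)
  finally have 1: "nrm (X \<gamma>\<^sub>X) (f x (a + b) - f x' (a' + b')) / L\<^sub>f \<le> ?n" using Lip_pos by (simp add: pos_divide_le_eq mult.commute)
  have 2: "nrm (Y \<delta>\<^sub>Y) (PF (g x (a + b)) - PF (g x' (a' + b'))) / L\<^sub>g \<le> ?n"
    using fast[OF m] split.P_diff[OF g0] Lip_pos by (simp add: pos_divide_le_eq mult.commute)
  have "nrm (Y 1) (PS (g x (a + b) - g x' (a' + b'))) \<le> L\<^sub>g * \<zeta> powr (\<delta>\<^sub>Y - 1) * ?n"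
    using g_slow_Lip[OF zeta m] by simp
  then have 3: "nrm (Y 1) (PS (g x (a + b)) - PS (g x' (a' + b'))) / (L\<^sub>g * \<zeta> powr (\<delta>\<^sub>Y - 1)) \<le> ?n"
    unfolding split.Q_diff[OF g0] using weight_S by (simp only: pos_divide_le_eq mult.commute)
  show ?thesis using 1 2 3 unfolding zz nonlin_eq by simp
qed

text \<open>
  \<open>PF\<close> and \<open>PS\<close> are bounded linear operators between the respective spaces, so the derivative is
  obtained from those of \<open>f\<close> and \<open>g\<close> by composition.
\<close>

lemma nonlin_C1:
  assumes F: "C1_bounded_ns (prod_scale sX sY) sX (prod_ns (X 1) (Y 1)) (X \<gamma>\<^sub>X) (\<lambda>(x, y). f x y) L\<^sub>f"
    and G: "C1_bounded_ns (prod_scale sX sY) sY (prod_ns (X 1) (Y 1)) (Y \<delta>\<^sub>Y) (\<lambda>(x, y). g x y) L\<^sub>g"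
  shows "\<exists>D. C1_ns scZ scZ Zs Ws nonlin D"
proof -
  obtain DF where DF: "C1_ns (prod_scale sX sY) sX (prod_ns (X 1) (Y 1)) (X \<gamma>\<^sub>X) (case_prod f) DF"
    using F unfolding C1_bounded_ns_def C1_ns_def by blast
  obtain DG where DG: "C1_ns (prod_scale sX sY) sY (prod_ns (X 1) (Y 1)) (Y \<delta>\<^sub>Y) (case_prod g) DG"
    using G unfolding C1_bounded_ns_def C1_ns_def by blast
  interpret Zs: banach_space_on scZ Zs by (rule banach_Z)
  have XY: "normed_space_on (prod_scale sX sY) (prod_ns (X 1) (Y 1))"
    by (rule normed_prod_ns[OF X1.normed_space_on_axioms Y1.normed_space_on_axioms])
  obtain cF where cF: "cF \<ge> 0" "opbound (Y \<delta>\<^sub>Y) YdF PF cF" using PF_bounded by blast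
  obtain cS where cS: "cS \<ge> 0" "opbound (Y \<delta>\<^sub>Y) Y1S PS cS" using PS_smoothing by blast
  have lF: "linear_between sY sY (carr (Y \<delta>\<^sub>Y)) (carr YdF) PF"
    unfolding linear_between_def using split.P_add split.P_scale Yd_Y0 cF(2) by (auto simp: opbound_def subset_iff)
  have lS: "linear_between sY sY (carr (Y \<delta>\<^sub>Y)) (carr Y1S) PS"
    unfolding linear_between_def using split.Q_add split.Q_scale Yd_Y0 cS(2) by (auto simp: opbound_def subset_iff)
  note cl = C1_ns_compose_linear[OF XY Zs.normed_space_on_axioms]
  have idX: "linear_between sX sX (carr (X \<gamma>\<^sub>X)) (carr (X \<gamma>\<^sub>X)) (\<lambda>x. x)" "opbound (X \<gamma>\<^sub>X) (X \<gamma>\<^sub>X) (\<lambda>x. x) 1"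
    by (auto simp: linear_between_def opbound_def)
  have "C1_ns scZ sX Zs (X \<gamma>\<^sub>X) (\<lambda>z. case_prod f (slow_sum z)) (\<lambda>z h. DF (slow_sum z) (slow_sum h))"
    by (rule cl[OF Xg.normed_space_on_axioms Xg.normed_space_on_axioms DF slow_sum_linear slow_sum_bound _ idX]) auto
  moreover have "C1_ns scZ sY Zs YdF (\<lambda>z. PF (case_prod g (slow_sum z))) (\<lambda>z h. PF (DG (slow_sum z) (slow_sum h)))"
    by (rule cl[OF Yd.normed_space_on_axioms YdF.normed_space_on_axioms DG slow_sum_linear slow_sum_bound _ lF cF(2,1)]) simp
  moreover have "C1_ns scZ sY Zs Y1S (\<lambda>z. PS (case_prod g (slow_sum z))) (\<lambda>z h. PS (DG (slow_sum z) (slow_sum h)))"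
    by (rule cl[OF Yd.normed_space_on_axioms Y1S.normed_space_on_axioms DG slow_sum_linear slow_sum_bound _ lS cS(2,1)]) simp
  ultimately have "C1_ns scZ scZ Zs Ws nonlin
      (\<lambda>z h. (DF (slow_sum z) (slow_sum h), PF (DG (slow_sum z) (slow_sum h)), PS (DG (slow_sum z) (slow_sum h))))"
    unfolding nonlin_def[abs_def]
    by (intro C1_ns_pair Zs.normed_space_on_axioms normed_max_ns Xg.normed_space_on_axioms YdF.normed_space_on_axioms
        Y1S.normed_space_on_axioms Lip_pos weight_S zero_less_one)
  then show ?thesis by blast
qed

end

section \<open>The slow manifold\<close>

context slow_manifold_setting begin

text \<open>
  The space \<open>C_eta\<close> and the fixed point equation in terms of paths in the product space \<open>Zs\<close>.
\<close>

lemma C_eta_iff: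
  "(u, vF, vS) \<in> C_eta (X 1) (Y 1) (YF \<zeta>) (YS \<zeta>) \<eta> \<longleftrightarrow>
    continuous_path Zs {..0} (\<lambda>t. (u t, vF t, vS t)) \<and>
    (\<exists>c. \<forall>t\<le>0. nrm Zs (u t, vF t, vS t) \<le> c * exp (\<eta> * t))"
proof -
  have "bdd_above ((\<lambda>t. exp (- \<eta> * t) * n t) ` {..0}) \<longleftrightarrow> (\<exists>c. \<forall>t\<le>0. n t \<le> c * exp (\<eta> * t))" for n :: "real \<Rightarrow> real"
  proof -
    have "exp (- \<eta> * t) * n t \<le> c \<longleftrightarrow> n t \<le> c * exp (\<eta> * t)" for t c
      by (simp add: exp_minus inverse_eq_divide pos_divide_le_eq)
    then show ?thesis by (auto simp: bdd_above_def)
  qed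
  note b = this[of "\<lambda>t. nrm (X 1) (u t) + nrm (Y 1) (vF t) + nrm (Y 1) (vS t)"]
  show ?thesis
    unfolding C_eta_def mem_Collect_eq prod.case b
    unfolding continuous_path_prod_ns[OF X1.normed_space_on_axioms
      normed_prod_ns[OF Y1F.normed_space_on_axioms Y1S.normed_space_on_axioms]]
    continuous_path_prod_ns[OF Y1F.normed_space_on_axioms Y1S.normed_space_on_axioms] fst_conv snd_conv
    by (simp add: add.assoc)
qed

lemma lp_fixed_point_iff:
  "lp_fixed_point TA TB (GB \<zeta>) f g (YF \<zeta>) (YS \<zeta>) \<epsilon> v (u, vF, vS) \<longleftrightarrow>
    (\<forall>t\<le>0. (u t, vF t, vS t) = free_path v t + LP (\<lambda>s. nonlin (u s, vF s, vS s)) t)"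
  unfolding lp_fixed_point_def lyapunov_perron_def free_path_def LP_def nonlin_eq by auto

text \<open>
  The slow map is the value at \<open>0\<close> of the solution, followed by the bounded linear map \<open>R\<close> that
  drops the slow component and weakens the norm of the fast component from \<open>Y 1\<close> to \<open>Y \<delta>\<^sub>Y\<close>. The
  solution is differentiable already in the norm of \<open>X 1\<close> and \<open>Y 1\<close>.
\<close>

theorem slow_map_differentiable:
  assumes fast: "\<And>x1 x2 a1 a2 b1 b2.
      x1 \<in> carr (X 1) \<Longrightarrow> x2 \<in> carr (X 1) \<Longrightarrow>
      a1 \<in> YF \<zeta> \<inter> carr (Y 1) \<Longrightarrow> a2 \<in> YF \<zeta> \<inter> carr (Y 1) \<Longrightarrow>
      b1 \<in> YS \<zeta> \<inter> carr (Y 1) \<Longrightarrow> b2 \<in> YS \<zeta> \<inter> carr (Y 1) \<Longrightarrow>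
      nrm (Y \<delta>\<^sub>Y) (PF (g x1 (a1 + b1) - g x2 (a2 + b2)))
        \<le> L\<^sub>g * (nrm (X 1) (x1 - x2) + nrm (Y 1) (a1 - a2) + nrm (Y 1) (b1 - b2))"
    and F: "C1_bounded_ns (prod_scale sX sY) sX (prod_ns (X 1) (Y 1)) (X \<gamma>\<^sub>X) (\<lambda>(x, y). f x y) L\<^sub>f"
    and G: "C1_bounded_ns (prod_scale sX sY) sY (prod_ns (X 1) (Y 1)) (Y \<delta>\<^sub>Y) (\<lambda>(x, y). g x y) L\<^sub>g"
  shows "frechet_differentiable_ns sY (prod_scale sX sY) Y1S
      (prod_ns (X 1) (NSpace (YF \<zeta> \<inter> carr (Y 1)) (nrm (Y \<delta>\<^sub>Y))))
      (slow_map (X 1) (Y 1) TA TB (GB \<zeta>) f g (YF \<zeta>) (YS \<zeta>) \<epsilon> \<eta>)"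
proof -
  obtain D where D: "C1_ns scZ scZ Zs Ws nonlin D" using nonlin_C1[OF F G] by blast
  \<comment> \<open>one contraction constant for both weights\<close>
  define q where "q = max (rate \<eta>\<^sub>1) (rate \<eta>)"
  interpret Zs: banach_space_on scZ Zs by (rule banach_Z)
  interpret Ws: normed_space_on scZ Ws by (rule normed_W)
  have adm: "admissible \<mu>" if "\<mu> \<in> {\<eta>\<^sub>1, \<eta>}" for \<mu> using that eta1(2) admissible_eta by auto
  interpret LP: lyapunov_perron_equation scZ Zs scZ Ws sY Y1S LP free_path nonlin D \<eta> \<eta>\<^sub>1 q M\<^sub>S
  proof
    show "0 \<le> q" "q < 1" using rate_nonneg[OF admissible_eta] rate_eta eta1(3) by (auto simp: q_def)
    show "\<eta>\<^sub>1 < \<eta>" by (rule eta1(1))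
    show "0 \<le> M\<^sub>S" using dichotomy_const(2) by simp
    show "continuous_path Zs {..0} (LP w)"
      if "\<mu> \<in> {\<eta>\<^sub>1, \<eta>}" "continuous_path Ws {..0} w" "\<And>s. s \<le> 0 \<Longrightarrow> nrm Ws (w s) \<le> c * exp (\<mu> * s)" for \<mu> w c
      by (rule LP_path[OF adm[OF that(1)] that(2,3)])
    show "nrm Zs (LP w t) \<le> q * c * exp (\<mu> * t)"
      if \<mu>: "\<mu> \<in> {\<eta>\<^sub>1, \<eta>}" and w: "continuous_path Ws {..0} w" "\<And>s. s \<le> 0 \<Longrightarrow> nrm Ws (w s) \<le> c * exp (\<mu> * s)"
        and t: "t \<le> 0" for \<mu> w c t
    proof -
      have "0 \<le> nrm Ws (w 0)" using Ws.continuous_pathD[OF w(1)] Ws.nrm_nonneg by simp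
      then have c: "0 \<le> c" using w(2)[of 0] by simp
      have "nrm Zs (LP w t) \<le> rate \<mu> * c * exp (\<mu> * t)" by (rule LP_bound[OF adm[OF \<mu>] w t])
      also have "\<dots> \<le> q * c * exp (\<mu> * t)" using c \<mu> by (intro mult_right_mono) (auto simp: q_def)
      finally show ?thesis .
    qed
    show "LP (\<lambda>s. w s + w' s) t = LP w t + LP w' t"
      if "continuous_path Ws {..0} w" "continuous_path Ws {..0} w'"
        "\<And>s. s \<le> 0 \<Longrightarrow> nrm Ws (w s) \<le> c * exp (\<eta>\<^sub>1 * s)" "\<And>s. s \<le> 0 \<Longrightarrow> nrm Ws (w' s) \<le> c' * exp (\<eta>\<^sub>1 * s)" "t \<le> 0" for w w' c c' t
      by (rule LP_add[OF that(1,3,2,4) eta1(2) that(5)])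
    show "LP (\<lambda>s. scZ a (w s)) t = scZ a (LP w t)"
      if "continuous_path Ws {..0} w" "\<And>s. s \<le> 0 \<Longrightarrow> nrm Ws (w s) \<le> c * exp (\<eta>\<^sub>1 * s)" "t \<le> 0" for w c a t
      by (rule LP_scale[OF that(1,2) eta1(2) that(3)])
    show "LP w t = LP w' t" if "\<And>s. s \<le> 0 \<Longrightarrow> w s = w' s" "t \<le> 0" for w w' t by (rule LP_cong[OF that])
    show "continuous_path Zs {..0} (free_path v)" if "v \<in> carr Y1S" for v by (rule free_path_continuous[OF that])
    show "nrm Zs (free_path v t) \<le> M\<^sub>S * nrm Y1S v * exp (\<eta> * t)" if "v \<in> carr Y1S" "t \<le> 0" for v t
      by (rule free_path_bound[OF that])
    show "free_path (v + v') t = free_path v t + free_path v' t" if "v \<in> carr Y1S" "v' \<in> carr Y1S" for v v' t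
      using that GB_add by (simp add: free_path_def)
    show "free_path (sY a v) t = scZ a (free_path v t)" if "v \<in> carr Y1S" for a v t
    proof -
      have "sX a 0 = 0" "sY a 0 = 0" using module.scale_zero_right[OF X0.module_sc] module.scale_zero_right[OF Y0.module_sc] by auto
      then show ?thesis using that GB_scale by (simp add: free_path_def prod_scale_def)
    qed
    show "nonlin 0 = 0" by (rule nonlin_0)
    show "nrm Ws (nonlin z - nonlin z') \<le> nrm Zs (z - z')" if "z \<in> carr Zs" "z' \<in> carr Zs" for z z'
      by (rule nonlin_Lipschitz[OF fast that])
    show "nonlin z \<in> carr Ws" if "z \<in> carr Zs" for z
      using D that unfolding C1_ns_def by blast
    show "frechet_deriv_ns scZ scZ Zs Ws nonlin z (D z)" if "z \<in> carr Zs" for z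
      using D that unfolding C1_ns_def by blast
    show "\<exists>d>0. \<forall>z'\<in>carr Zs. nrm Zs (z' - z) < d \<longrightarrow> opbound Zs Ws (\<lambda>h. D z' h - D z h) e"
      if "z \<in> carr Zs" "e > 0" for z e
      using D that unfolding C1_ns_def by blast
  qed
  let ?solves = "\<lambda>v \<phi>. LP.solves (\<lambda>s. nonlin) (free_path v) \<phi>"
  have fixed_point_iff: "(u, vF, vS) \<in> C_eta (X 1) (Y 1) (YF \<zeta>) (YS \<zeta>) \<eta> \<and>
      lp_fixed_point TA TB (GB \<zeta>) f g (YF \<zeta>) (YS \<zeta>) \<epsilon> v (u, vF, vS) \<longleftrightarrow> ?solves v (\<lambda>t. (u t, vF t, vS t))" for u vF vS v
    unfolding C_eta_iff lp_fixed_point_iff LP.solves_def by blast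
  obtain \<phi> where \<phi>: "\<And>v. v \<in> carr Y1S \<Longrightarrow> ?solves v (\<phi> v)" using LP.fixed_point_exists by metis
  define R where "R z = (fst z, fst (snd z))" for z :: "'x \<times> 'y \<times> 'y"
  define h where "h = slow_map (X 1) (Y 1) TA TB (GB \<zeta>) f g (YF \<zeta>) (YS \<zeta>) \<epsilon> \<eta>"
  have h_eq: "h v = R (\<phi> v 0)" if v: "v \<in> carr Y1S" for v
    unfolding h_def slow_map_def
  proof (rule the_equality)
    let ?u = "\<lambda>t. fst (\<phi> v t)" and ?F = "\<lambda>t. fst (snd (\<phi> v t))" and ?S = "\<lambda>t. snd (snd (\<phi> v t))"
    have "?solves v (\<lambda>t. (?u t, ?F t, ?S t))" using \<phi>[OF v] by simp
    then show "\<exists>u vF vS. (u, vF, vS) \<in> C_eta (X 1) (Y 1) (YF \<zeta>) (YS \<zeta>) \<eta> \<and>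
        lp_fixed_point TA TB (GB \<zeta>) f g (YF \<zeta>) (YS \<zeta>) \<epsilon> v (u, vF, vS) \<and> R (\<phi> v 0) = (u 0, vF 0)"
      unfolding fixed_point_iff[symmetric] R_def by blast
    fix p assume "\<exists>u vF vS. (u, vF, vS) \<in> C_eta (X 1) (Y 1) (YF \<zeta>) (YS \<zeta>) \<eta> \<and>
        lp_fixed_point TA TB (GB \<zeta>) f g (YF \<zeta>) (YS \<zeta>) \<epsilon> v (u, vF, vS) \<and> p = (u 0, vF 0)"
    then obtain u vF vS where s: "?solves v (\<lambda>t. (u t, vF t, vS t))" and p: "p = (u 0, vF 0)"
      using fixed_point_iff by blast
    have "(u 0, vF 0, vS 0) = \<phi> v 0"
      using LP.solves_unique[OF LP.nemytskii_G s \<phi>[OF v] order_refl] by simp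
    then show "p = R (\<phi> v 0)" unfolding R_def p by (metis fst_conv snd_conv)
  qed
  define Target where "Target = prod_ns (X 1) (NSpace (YF \<zeta> \<inter> carr (Y 1)) (nrm (Y \<delta>\<^sub>Y)))"
  have V: "normed_space_on sY (NSpace (YF \<zeta> \<inter> carr (Y 1)) (nrm (Y \<delta>\<^sub>Y)))"
  proof (rule normed_space_on.intro)
    obtain c where c: "\<And>y. y \<in> carr (Y 1) \<Longrightarrow> y \<in> carr (Y \<delta>\<^sub>Y)" using Y1_Yd_bound by blast
    show "module.subspace sY (carr (NSpace (YF \<zeta> \<inter> carr (Y 1)) (nrm (Y \<delta>\<^sub>Y))))" using Y1F.carr_subspace by simp
  qed (use Y1_Yd_bound Y0.scalars Y0.scale_of_real Yd.nrm_nonneg Yd.nrm_eq_0 Yd.nrm_triangle Yd.nrm_scale in auto)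
  have T: "normed_space_on (prod_scale sX sY) Target"
    unfolding Target_def by (rule normed_prod_ns[OF X1.normed_space_on_axioms V])
  obtain b where b: "b > 0" "\<And>y. y \<in> carr (Y 1) \<Longrightarrow> nrm (Y \<delta>\<^sub>Y) y \<le> b * nrm (Y 1) y" using Y1_Yd_bound by blast
  have R_lin: "linear_between scZ (prod_scale sX sY) (carr Zs) (carr Target) R"
    unfolding linear_between_def R_def Target_def by (auto simp: prod_scale_def)
  have R_bound: "opbound Zs Target R (1 + b)"
    unfolding opbound_def
  proof
    fix z assume z: "z \<in> carr Zs"
    obtain x y y' where zz: "z = (x, y, y')" by (metis prod.exhaust)
    have m: "x \<in> carr (X 1)" "y \<in> carr Y1F" "y' \<in> carr Y1S" using z zz by auto
    have n: "0 \<le> nrm (X 1) x" "0 \<le> nrm (Y 1) y" "0 \<le> nrm (Y 1) y'" "nrm (Y \<delta>\<^sub>Y) y \<le> b * nrm (Y 1) y"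
      using X1.nrm_nonneg[OF m(1)] Y1F.nrm_nonneg[OF m(2)] Y1S.nrm_nonneg[OF m(3)] b(2) m by auto
    have "nrm (X 1) x + nrm (Y \<delta>\<^sub>Y) y \<le> (1 + b) * (nrm (X 1) x + (nrm (Y 1) y + nrm (Y 1) y'))"
      using n mult_nonneg_nonneg[OF less_imp_le[OF b(1)] n(1)] mult_nonneg_nonneg[OF less_imp_le[OF b(1)] n(3)]
      unfolding distrib_left distrib_right mult_1 by linarith
    then show "R z \<in> carr Target \<and> nrm Target (R z) \<le> (1 + b) * nrm Zs z"
      using m unfolding zz R_def Target_def by simp
  qed
  have \<phi>0: "\<phi> v 0 \<in> carr Zs" if "v \<in> carr Y1S" for v
    using \<phi>[OF that] Zs.continuous_pathD by (fastforce simp: LP.solves_def)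
  have idU: "linear_between sY sY (carr Y1S) (carr Y1S) (\<lambda>x. x)" "opbound Y1S Y1S (\<lambda>x. x) 1"
    by (auto simp: linear_between_def opbound_def)
  have "\<exists>Dh. frechet_deriv_ns sY (prod_scale sX sY) Y1S Target h v Dh" if v: "v \<in> carr Y1S" for v
  proof -
    obtain D\<^sub>\<phi> where D\<^sub>\<phi>: "frechet_deriv_ns sY scZ Y1S Zs (\<lambda>v. \<phi> v 0) v D\<^sub>\<phi>"
      using LP.frechet_differentiable[OF _ v, of "\<lambda>v. \<phi> v 0"] \<phi> by blast
    have fr: "frechet_deriv_ns sY (prod_scale sX sY) Y1S Target (\<lambda>v. R (\<phi> v 0)) v (\<lambda>k. R (D\<^sub>\<phi> k))"
      by (rule frechet_deriv_compose_linear[OF Y1S.normed_space_on_axioms Y1S.normed_space_on_axioms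
            Zs.normed_space_on_axioms T \<phi>0 idU(1) idU(2) _ R_lin R_bound _ v D\<^sub>\<phi>]) (use b(1) in auto)
    have "frechet_deriv_ns sY (prod_scale sX sY) Y1S Target h v (\<lambda>k. R (D\<^sub>\<phi> k))"
    proof -
      have "h (v + k) - h v = R (\<phi> (v + k) 0) - R (\<phi> v 0)" if "k \<in> carr Y1S" for k
        by (simp only: h_eq[OF v] h_eq[OF Y1S.add_in[OF v that]])
      then show ?thesis using fr unfolding frechet_deriv_ns_def by metis
    qed
    then show ?thesis by blast
  qed
  moreover have "h v \<in> carr Target" if "v \<in> carr Y1S" for v
    using bspec[OF R_bound[unfolded opbound_def] \<phi>0[OF that]] by (simp only: h_eq[OF that])
  ultimately show ?thesis
    unfolding frechet_differentiable_ns_def h_def[symmetric] Target_def[symmetric] by blast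
qed

end

theorem proposition5p4:
  fixes sX :: "'k::{real_normed_field,banach} \<Rightarrow> 'x::banach \<Rightarrow> 'x"
    and sY :: "'k \<Rightarrow> 'y::banach \<Rightarrow> 'y"
    and X :: "real \<Rightarrow> 'x nspace" and Y :: "real \<Rightarrow> 'y nspace"
    and f :: "'x \<Rightarrow> 'y \<Rightarrow> 'x" and g :: "'x \<Rightarrow> 'y \<Rightarrow> 'y"
  assumes setting: "slow_manifold_setting sX sY X Y A TA B TB f g
      \<gamma>\<^sub>X \<delta>\<^sub>X \<delta>\<^sub>Y L\<^sub>f L\<^sub>g M\<^sub>A M\<^sub>B C\<^sub>A C\<^sub>B \<omega>\<^sub>A \<omega>\<^sub>B \<omega>\<^sub>f \<epsilon> \<zeta>\<^sub>0 YF YS GB N\<^sub>F N\<^sub>S C\<^sub>S M\<^sub>S \<zeta>"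
    and g_fast_Lip: "\<And>x1 x2 a1 a2 b1 b2.
      x1 \<in> carr (X 1) \<Longrightarrow> x2 \<in> carr (X 1) \<Longrightarrow>
      a1 \<in> YF \<zeta> \<inter> carr (Y 1) \<Longrightarrow> a2 \<in> YF \<zeta> \<inter> carr (Y 1) \<Longrightarrow>
      b1 \<in> YS \<zeta> \<inter> carr (Y 1) \<Longrightarrow> b2 \<in> YS \<zeta> \<inter> carr (Y 1) \<Longrightarrow>
      nrm (Y \<delta>\<^sub>Y) (proj_along (YF \<zeta>) (YS \<zeta>) (g x1 (a1 + b1) - g x2 (a2 + b2)))
        \<le> L\<^sub>g * (nrm (X 1) (x1 - x2) + nrm (Y 1) (a1 - a2) + nrm (Y 1) (b1 - b2))"
    and f_C1: "C1_bounded_ns (prod_scale sX sY) sX (prod_ns (X 1) (Y 1)) (X \<gamma>\<^sub>X)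
      (\<lambda>(x, y). f x y) L\<^sub>f"
    and g_C1: "C1_bounded_ns (prod_scale sX sY) sY (prod_ns (X 1) (Y 1)) (Y \<delta>\<^sub>Y)
      (\<lambda>(x, y). g x y) L\<^sub>g"
  shows "frechet_differentiable_ns sY (prod_scale sX sY)
      (sub_ns (Y 1) (YS \<zeta>))
      (prod_ns (X 1) (NSpace (YF \<zeta> \<inter> carr (Y 1)) (nrm (Y \<delta>\<^sub>Y))))
      (slow_map (X 1) (Y 1) TA TB (GB \<zeta>) f g (YF \<zeta>) (YS \<zeta>) \<epsilon>
        (eta \<omega>\<^sub>A (N\<^sub>F \<zeta>) (N\<^sub>S \<zeta>) \<zeta>))"
  by (rule slow_manifold_setting.slow_map_differentiable[OF setting g_fast_Lip f_C1 g_C1])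

end
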